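(* Let $t$ be a positive integer. Then as $n\to\infty$, the random variable $N^{\mathcal{DD}}_{t,2n}$ is asymptotically normally distributed with mean \[ \mu_{t,2n}=\frac{2\sqrt{3n}}{\pi}+\frac{3}{\pi^2}-\frac t2+\frac{\delta_{2|t}}{4}+O\left(n^{-\frac12}\right) \] and variance \[ \sigma^2_{t,2n}=\frac{2(\pi^2-6)}{\pi^3}\sqrt{3n}-\frac{36}{\pi^4}+\frac{3}{\pi^2}-\frac14-\frac{\delta_{2|t}}{8}+O\left(n^{-\frac12}\right). \]
   Context: $\delta_{2|t}$ is $1$ if $t$ is even and $0$ if $t$ is odd. $N^{\mathcal{DD}}_{t,2n}$ is the random variable taking the value $n_t(\lambda\lambda)$ when $\lambda\lambda$ is chosen uniformly at random from the (finite) set of doubled distinct partitions of $2n$. "Asymptotically normally distributed with mean $\mu_{t,2n}$ and variance $\sigma_{t,2n}^2$" means: the mean and variance of $N^{\mathcal{DD}}_{t,2n}$ satisfy the stated asymptotic expansions as $n\to\infty$, and $(N^{\mathcal{DD}}_{t,2n}-\mu_{t,2n})/\sigma_{t,2n}$ converges in distribution to the standard normal distribution. A partition is a finite weakly decreasing sequence of positive integers; $|\lambda|$ is the sum of its parts. The hook of a box in a Young diagram consists of the box itself and all boxes to its right in the same row or below it in the same column; a $t$-hook is a hook with exactly $t$ boxes; $n_t(\lambda)$ denotes the number of $t$-hooks of $\lambda$. A strict partition is a partition into distinct parts. For a strict partition $\lambda=(\lambda_1>\dots>\lambda_\ell)$, the doubled distinct partition $\lambda\lambda$ is obtained from the shifted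 Young diagram of $\lambda$ (row $i$ moved right by $i-1$ boxes) by adding $\lambda_i$ boxes to the $(i-1)$-st column for each $i$; equivalently, $\lambda\lambda$ is the partition of $2|\lambda|$ with Frobenius symbol $\begin{pmatrix}\lambda_1&\cdots&\lambda_\ell\\ \lambda_1-1&\cdots&\lambda_\ell-1\end{pmatrix}$ (the Frobenius symbol of $\mu$ with Durfee square of side $s$ has top row $\mu_i-i$ and bottom row $\mu'_i-i$, $1\le i\le s$, where $\mu'$ is the conjugate partition). E.g. $\lambda=(5,4,1)$ gives $\lambda\lambda=(6,6,4,2,2)$. $\mathcal{DD}$ is the set of all doubled distinct partitions. *)

theory Defs
  imports "HOL-Probability.Probability"
begin

definition is_partition :: "nat list \<Rightarrow> bool" where
  "is_partition \<mu> \<longleftrightarrow> sorted_wrt (\<ge>) \<mu> \<and> (\<forall>k\<in>set \<mu>. 0 < k)"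

definition is_strict_partition :: "nat list \<Rightarrow> bool" where
  "is_strict_partition \<mu> \<longleftrightarrow> is_partition \<mu> \<and> distinct \<mu>"

text \<open>Boxes are pairs (row, column), both counted from 0.\<close>

definition young_diagram :: "nat list \<Rightarrow> (nat \<times> nat) set" where
  "young_diagram \<mu> = {(i, j). i < length \<mu> \<and> j < \<mu> ! i}"

definition hook :: "nat list \<Rightarrow> nat \<times> nat \<Rightarrow> (nat \<times> nat) set" where
  "hook \<mu> b = {(i, j) \<in> young_diagram \<mu>. (i = fst b \<and> j \<ge> snd b) \<or> (j = snd b \<and> i \<ge> fst b)}"

definition n_hooks :: "nat \<Rightarrow> nat list \<Rightarrow> nat" where
  "n_hooks t \<mu> = card {b \<in> young_diagram \<mu>. card (hook \<mu> b) = t}"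

text \<open>
  The shifted diagram is placed in the columns 1, 2, \<dots>, so that column 0 is initially empty:
  row \<open>i\<close> (from 0) occupies the columns \<open>i + 1, \<dots>, i + \<nu>\<^sub>i\<close>.  Column \<open>i\<close> then already has
  boxes in exactly the rows \<open>0, \<dots>, i - 1\<close>, so the \<open>\<nu>\<^sub>i\<close> boxes added below them lie in the
  rows \<open>i, \<dots>, i + \<nu>\<^sub>i - 1\<close>.
\<close>

definition shifted_diagram :: "nat list \<Rightarrow> (nat \<times> nat) set" where
  "shifted_diagram \<nu> = {(i, j). i < length \<nu> \<and> i + 1 \<le> j \<and> j \<le> i + \<nu> ! i}"

definition added_boxes :: "nat list \<Rightarrow> (nat \<times> nat) set" where
  "added_boxes \<nu> = {(r, i). i < length \<nu> \<and> i \<le> r \<and> r < i + \<nu> ! i}"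

definition is_doubling :: "nat list \<Rightarrow> nat list \<Rightarrow> bool" where
  "is_doubling \<nu> \<mu> \<longleftrightarrow>
     is_partition \<mu> \<and> young_diagram \<mu> = shifted_diagram \<nu> \<union> added_boxes \<nu>"

definition doubled_distinct :: "nat list set" where
  "doubled_distinct = {\<mu>. \<exists>\<nu>. is_strict_partition \<nu> \<and> is_doubling \<nu> \<mu>}"

definition doubled_distinct_of :: "nat \<Rightarrow> nat list set" where
  "doubled_distinct_of m = {\<mu> \<in> doubled_distinct. sum_list \<mu> = m}"

definition DD_pmf :: "nat \<Rightarrow> nat list pmf" where
  "DD_pmf n = pmf_of_set (doubled_distinct_of (2 * n))"

definition N_DD :: "nat \<Rightarrow> nat list \<Rightarrow> real" where
  "N_DD t \<mu> = real (n_hooks t \<mu>)"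

definition mean_DD :: "nat \<Rightarrow> nat \<Rightarrow> real" where
  "mean_DD t n = measure_pmf.expectation (DD_pmf n) (N_DD t)"

definition var_DD :: "nat \<Rightarrow> nat \<Rightarrow> real" where
  "var_DD t n = measure_pmf.variance (DD_pmf n) (N_DD t)"

definition delta_even :: "nat \<Rightarrow> real" where
  "delta_even t = (if even t then 1 else 0)"

lemma is_doubling_example: "is_doubling [5, 4, 1] [6, 6, 4, 2, 2]"
proof -
  have "(i, j) \<in> young_diagram [6, 6, 4, 2, 2] \<longleftrightarrow>
        (i, j) \<in> shifted_diagram [5, 4, 1] \<union> added_boxes [5, 4, 1]" for i j
    by (auto simp: young_diagram_def shifted_diagram_def added_boxes_def less_Suc_eq
        numeral_eq_Suc)
  then show ?thesis
    by (auto simp: is_doubling_def is_partition_def)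
qed

text \<open>The set of doubled distinct partitions of \<open>2 * n\<close> is finite and nonempty, as
  \<^const>\<open>pmf_of_set\<close> requires.\<close>

lemma finite_doubled_distinct_of: "finite (doubled_distinct_of m)"
proof (rule finite_subset)
  show "doubled_distinct_of m \<subseteq> {\<mu>. set \<mu> \<subseteq> {..m} \<and> length \<mu> \<le> m}"
  proof safe
    fix \<mu> k assume "\<mu> \<in> doubled_distinct_of m"
    then have p: "\<forall>k\<in>set \<mu>. 0 < k" and s: "sum_list \<mu> = m"
      by (auto simp: doubled_distinct_of_def doubled_distinct_def is_doubling_def is_partition_def)
    show "k \<le> m" if "k \<in> set \<mu>"
      using that s member_le_sum_list by blast
    have "length xs \<le> sum_list xs" if "\<forall>k\<in>set xs. 0 < k" for xs :: "nat list"
      using that by (induction xs) auto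
    then show "length \<mu> \<le> m" using p s by blast
  qed
  show "finite {\<mu>. set \<mu> \<subseteq> {..m} \<and> length \<mu> \<le> m}"
    by (rule finite_lists_length_le) simp
qed

lemma doubled_distinct_of_nonempty: "doubled_distinct_of (2 * n) \<noteq> {}"
proof (cases n)
  case 0
  have "is_strict_partition [] \<and> is_doubling [] []"
    by (simp add: is_strict_partition_def is_partition_def is_doubling_def young_diagram_def
        shifted_diagram_def added_boxes_def)
  then show ?thesis
    using 0 unfolding doubled_distinct_of_def doubled_distinct_def by fastforce
next
  case (Suc k)
  let ?\<mu> = "(n + 1) # replicate k 1"
  have 1: "is_strict_partition [n]"
    using Suc by (simp add: is_strict_partition_def is_partition_def)
  have "sorted_wrt (\<ge>) (replicate k (1::nat))"
    by (induction k) auto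
  then have p: "is_partition ?\<mu>"
    by (auto simp: is_partition_def)
  have "(i, j) \<in> young_diagram ?\<mu> \<longleftrightarrow> (i, j) \<in> shifted_diagram [n] \<union> added_boxes [n]" for i j
    using Suc
    by (cases i) (auto simp: young_diagram_def shifted_diagram_def added_boxes_def)
  then have "is_doubling [n] ?\<mu>"
    using p by (auto simp: is_doubling_def)
  moreover have "sum_list ?\<mu> = 2 * n"
    using Suc by (simp add: sum_list_replicate)
  ultimately show ?thesis
    using 1 unfolding doubled_distinct_of_def doubled_distinct_def by blast
qed

end

theory Submission
  imports Defs "HOL-Complex_Analysis.Complex_Analysis" "HOL-Real_Asymp.Real_Asymp"
begin

text \<open>Let \<open>S\<close> be the set of parts of a strict partition. The number of \<open>t\<close>-hooks of its double is a sum
  of contributions of the residue classes modulo \<open>t\<close>, paired up as \<open>b\<close> and \<open>t - b\<close>, so the generating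
  function of \<open>x ^ n\<^sub>t * q ^ |S|\<close> is a product over these pairs. Each factor is built from the solution
  \<open>f\<close> of \<open>f w = (1 + w) * f (w * Q) + z * w * Q * f (w * Q\<^sup>2)\<close> with \<open>z = x\<^sup>2 - 1\<close> and \<open>Q = q ^ t\<close>, and a Jacobi
  type identity evaluates the factors of the pairs \<open>b \<noteq> t - b\<close> as infinite products; for the remaining classes the
  ratio \<open>f w / f (w * Q)\<close> is close to the fixed point \<open>1 + x\<close> of its recursion.

  With \<open>x = exp u\<close> and \<open>q = exp (- s)\<close>, the products give the main term \<open>exp (a u / s + l u) / sqrt 2\<close> as
  \<open>s\<close> tends to \<open>0\<close> in a sector, uniformly for small complex \<open>u\<close>, and away from it the generating function
  is exponentially smaller. The saddle point method then shows that the moment generating function behaves like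
  \<open>exp (sqrt n * 2 * sqrt (a u) + l u + ln (a u) / 4)\<close> up to a factor \<open>1 + O(1 / sqrt n)\<close> and one that does not depend on
  \<open>u\<close>. As the error is holomorphic in \<open>u\<close>, Cauchy's estimates give the mean and the variance, and Levy's
  continuity theorem the limit law.\<close>

section \<open>A q-series with a second order q-difference equation\<close>

text \<open>For z other than 0 the series \<open>qf\<close> is not evaluated as a product; only the
  bilinear combination \<open>qG\<close> of its values at w and Q / w is. This settles the pairs of
  residue classes, but not the classes equal to their own negative. For those, w = Q or w * w = Q,
  and \<open>qG\<close> degenerates to the square of one value of \<open>qf\<close> times a factor
  that depends only on the ratio of consecutive values. Hence the square of \<open>hookF\<close> is
  estimated first and its sign is chosen afterwards. Every estimate has to hold for complex u in a
  fixed disc with relative error O(1 / sqrt n), because derivatives in u are taken of the error. The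
  saddle point therefore moves off the real axis, and the Gaussian approximation has to be one order
  better than a crude bound gives; the gain comes from the cubic term being odd. Most constants are
  crude. Only one balance is delicate: leaving the dominant singularity saves 1 / 88 in the
  exponent, and the disc for u is so small that the perturbation by z spends at most half of
  it.\<close>

definition qcoeff :: "complex \<Rightarrow> complex \<Rightarrow> nat \<Rightarrow> complex" where
  "qcoeff z Q k = (\<Prod>j<k. (1 + z * Q ^ Suc j) / (1 - Q ^ Suc j)) * Q ^ (\<Sum>i<k. i)"

text \<open>In basic hypergeometric notation this is \<open>1phi1(- z * Q; 0; Q, - w)\<close>.
  Comparing coefficients in the q-difference equation gives \<open>c (k + 1) * (1 - Q ^ (k + 1)) = c
  k * Q ^ k * (1 + z * Q ^ (k + 1))\<close>, and \<open>qcoeff\<close> is the solution with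
  \<open>c 0 = 1\<close>. The quadratic power of Q makes the series entire in w.\<close>

definition qf :: "complex \<Rightarrow> complex \<Rightarrow> complex \<Rightarrow> complex" where
  "qf z Q w = (\<Sum>k. qcoeff z Q k * w ^ k)"

text \<open>A partial theta series. It majorizes \<open>qf\<close>, because the product inside
  \<open>qcoeff\<close> is bounded.\<close>

definition ptheta :: "real \<Rightarrow> real \<Rightarrow> real" where
  "ptheta p Y = (\<Sum>k. p ^ (\<Sum>i<k. i) * Y ^ k)"

lemma summable_ptheta:
  fixes p Y :: real
  assumes "0 \<le> p" "p < 1"
  shows "summable (\<lambda>k. p ^ (\<Sum>i<k. i) * Y ^ k)"
proof -
  have "(\<lambda>k. p ^ k * \<bar>Y\<bar>) \<longlonglongrightarrow> 0 * \<bar>Y\<bar>"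
    by (intro tendsto_intros LIMSEQ_power_zero) (use assms in auto)
  then have "eventually (\<lambda>k. p ^ k * \<bar>Y\<bar> < 1/2) sequentially"
    by (rule order_tendstoD) simp
  then obtain N where N: "\<And>k. k \<ge> N \<Longrightarrow> p ^ k * \<bar>Y\<bar> < 1/2"
    by (auto simp: eventually_sequentially)
  show ?thesis
  proof (rule summable_ratio_test[of "1/2" N])
    fix k assume "k \<ge> N"
    then have "(p ^ k * \<bar>Y\<bar>) * (p ^ (\<Sum>i<k. i) * \<bar>Y\<bar> ^ k) \<le> 1/2 * (p ^ (\<Sum>i<k. i) * \<bar>Y\<bar> ^ k)"
      using N[of k] assms by (intro mult_right_mono) auto
    then show "norm (p ^ (\<Sum>i<Suc k. i) * Y ^ Suc k) \<le> 1/2 * norm (p ^ (\<Sum>i<k. i) * Y ^ k)"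
      using assms by (simp add: abs_mult power_add power_abs mult_ac)
  qed simp
qed

lemma ptheta_nonneg: "0 \<le> p \<Longrightarrow> p < 1 \<Longrightarrow> 0 \<le> Y \<Longrightarrow> 0 \<le> ptheta p Y"
  unfolding ptheta_def by (intro suminf_nonneg summable_ptheta) auto

lemma ptheta_mono:
  assumes "0 \<le> p" "p < 1" "0 \<le> Y" "Y \<le> Z"
  shows "ptheta p Y \<le> ptheta p Z"
  unfolding ptheta_def using assms
  by (intro suminf_le summable_ptheta mult_left_mono power_mono) auto

lemma ptheta_rec:
  assumes "0 \<le> p" "p < 1"
  shows "ptheta p Y = 1 + Y * ptheta p (Y * p)"
proof -
  have "ptheta p Y = p ^ (\<Sum>i<0. i) * Y ^ 0 + (\<Sum>k. p ^ (\<Sum>i<Suc k. i) * Y ^ Suc k)"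
    unfolding ptheta_def using summable_ptheta[OF assms, of Y]
    by (subst suminf_split_head) auto
  also have "(\<Sum>k. p ^ (\<Sum>i<Suc k. i) * Y ^ Suc k) = (\<Sum>k. Y * (p ^ (\<Sum>i<k. i) * (Y * p) ^ k))"
    by (intro suminf_cong) (simp add: power_add power_mult_distrib mult_ac)
  also have "\<dots> = Y * ptheta p (Y * p)"
    unfolding ptheta_def by (intro suminf_mult summable_ptheta assms)
  finally show ?thesis by simp
qed

lemma qcoeff_0: "qcoeff z Q 0 = 1"
  by (simp add: qcoeff_def)

lemma qcoeff_Suc:
  "qcoeff z Q (Suc k) = qcoeff z Q k * Q ^ k * ((1 + z * Q ^ Suc k) / (1 - Q ^ Suc k))"
  by (simp add: qcoeff_def power_add mult_ac)

text \<open>The j-th factor differs from 1 by a multiple of \<open>p ^ Suc j\<close>, so it is at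
  most the exponential of a geometric term and the product stays bounded.\<close>

lemma qcoeff_bound:
  assumes "norm Q < 1"
  obtains C where "C > 0" "\<And>k. norm (qcoeff z Q k) \<le> C * norm Q ^ (\<Sum>i<k. i)"
proof -
  define p where "p = norm Q"
  have p: "0 \<le> p" "p < 1" using assms by (auto simp: p_def)
  define a where "a = (norm z + 1) / (1 - p)"
  have a: "a \<ge> 0" using p by (simp add: a_def)
  have factor: "norm ((1 + z * Q ^ Suc j) / (1 - Q ^ Suc j)) \<le> exp (a * p ^ Suc j)" for j
  proof -
    have pj: "p ^ Suc j \<le> p" "p ^ Suc j \<ge> 0" 
      using p power_decreasing[of 1 "Suc j" p] by auto
    have d: "norm (1 - Q ^ Suc j) \<ge> 1 - p ^ Suc j"
      using norm_triangle_ineq2[of 1 "Q ^ Suc j"] by (simp add: p_def norm_mult norm_power)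
    have "norm (1 + z * Q ^ Suc j) \<le> 1 + norm z * p ^ Suc j"
      using norm_triangle_ineq[of 1 "z * Q ^ Suc j"] by (simp add: p_def norm_mult norm_power)
    then have "norm ((1 + z * Q ^ Suc j) / (1 - Q ^ Suc j)) \<le> (1 + norm z * p ^ Suc j) / (1 - p ^ Suc j)"
      unfolding norm_divide using d pj p by (intro frac_le) auto
    also have "\<dots> = 1 + (norm z + 1) * p ^ Suc j / (1 - p ^ Suc j)"
      using pj p by (simp add: field_simps)
    also have "(norm z + 1) * p ^ Suc j / (1 - p ^ Suc j) \<le> (norm z + 1) * p ^ Suc j / (1 - p)"
      using pj p by (intro divide_left_mono mult_nonneg_nonneg mult_pos_pos) auto
    also have "1 + (norm z + 1) * p ^ Suc j / (1 - p) = 1 + a * p ^ Suc j"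
      by (simp add: a_def)
    also have "\<dots> \<le> exp (a * p ^ Suc j)"
      by (rule exp_ge_add_one_self)
    finally show ?thesis by simp
  qed
  define C where "C = exp (a * (\<Sum>j. p ^ j))"
  have sm: "summable (\<lambda>j. p ^ j)" using p by (intro summable_geometric) auto
  have "norm (qcoeff z Q k) \<le> C * norm Q ^ (\<Sum>i<k. i)" for k
  proof -
    have "norm (\<Prod>j<k. (1 + z * Q ^ Suc j) / (1 - Q ^ Suc j)) \<le> (\<Prod>j<k. exp (a * p ^ Suc j))"
      unfolding prod_norm[symmetric] by (intro prod_mono conjI norm_ge_zero factor)
    also have "\<dots> = exp (a * (\<Sum>j<k. p ^ Suc j))"
      by (simp add: exp_sum sum_distrib_left)
    also have "(\<Sum>j<k. p ^ Suc j) \<le> (\<Sum>j<k. p ^ j)"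
      using p by (intro sum_mono power_decreasing) auto
    then have "exp (a * (\<Sum>j<k. p ^ Suc j)) \<le> exp (a * (\<Sum>j<k. p ^ j))"
      using a by (simp add: mult_left_mono)
    also have "\<dots> \<le> C"
      unfolding C_def using a p sm by (auto intro!: mult_left_mono sum_le_suminf)
    finally show ?thesis
      by (auto simp: qcoeff_def norm_mult norm_power intro!: mult_right_mono)
  qed
  moreover have "C > 0" by (simp add: C_def)
  ultimately show ?thesis using that by blast
qed

lemma summable_qf:
  assumes "norm Q < 1"
  shows "summable (\<lambda>k. norm (qcoeff z Q k * w ^ k))" "summable (\<lambda>k. qcoeff z Q k * w ^ k)"
proof -
  obtain C where C: "C > 0" "\<And>k. norm (qcoeff z Q k) \<le> C * norm Q ^ (\<Sum>i<k. i)"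
    using qcoeff_bound[OF assms] by blast
  show *: "summable (\<lambda>k. norm (qcoeff z Q k * w ^ k))"
  proof (rule summable_comparison_test')
    show "summable (\<lambda>k. C * (norm Q ^ (\<Sum>i<k. i) * norm w ^ k))"
      using assms by (intro summable_mult summable_ptheta) auto
    show "norm (norm (qcoeff z Q k * w ^ k)) \<le> C * (norm Q ^ (\<Sum>i<k. i) * norm w ^ k)" for k
      using mult_right_mono[OF C(2)[of k], of "norm w ^ k"] by (simp add: norm_mult norm_power)
  qed
  show "summable (\<lambda>k. qcoeff z Q k * w ^ k)"
    using * by (rule summable_norm_cancel)
qed

text \<open>The second bound comes from dropping the term k = 0; its factor \<open>norm w\<close>
  controls \<open>qf\<close> near w = 0.\<close>

lemma qf_norm_bounds:
  assumes "norm Q < 1"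
  obtains C where "C > 0" "\<And>w. norm (qf z Q w) \<le> C * ptheta (norm Q) (norm w)"
    "\<And>w. norm (qf z Q w - 1) \<le> C * norm w * ptheta (norm Q) (norm w * norm Q)"
proof -
  define p where "p = norm Q"
  have p: "0 \<le> p" "p < 1" using assms by (auto simp: p_def)
  obtain C where C: "C > 0" "\<And>k. norm (qcoeff z Q k) \<le> C * p ^ (\<Sum>i<k. i)"
    using qcoeff_bound[OF assms] p_def by metis
  have tm: "norm (qcoeff z Q k * w ^ k) \<le> C * (p ^ (\<Sum>i<k. i) * norm w ^ k)" for k w
    using mult_right_mono[OF C(2)[of k], of "norm w ^ k"] by (simp add: norm_mult norm_power)
  have 1: "norm (qf z Q w) \<le> C * ptheta p (norm w)" for w
  proof -
    have "norm (qf z Q w) \<le> (\<Sum>k. norm (qcoeff z Q k * w ^ k))"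
      unfolding qf_def by (intro summable_norm summable_qf assms)
    also have "\<dots> \<le> (\<Sum>k. C * (p ^ (\<Sum>i<k. i) * norm w ^ k))"
      by (intro suminf_le tm summable_qf assms summable_mult summable_ptheta p)
    also have "\<dots> = C * ptheta p (norm w)"
      unfolding ptheta_def by (intro suminf_mult summable_ptheta p)
    finally show ?thesis .
  qed
  have 2: "norm (qf z Q w - 1) \<le> C * norm w * ptheta p (norm w * p)" for w
  proof -
    have "qf z Q w = qcoeff z Q 0 * w ^ 0 + (\<Sum>k. qcoeff z Q (Suc k) * w ^ Suc k)"
      unfolding qf_def using summable_qf(2)[OF assms, of z w] by (subst suminf_split_head) auto
    then have "norm (qf z Q w - 1) = norm (\<Sum>k. qcoeff z Q (Suc k) * w ^ Suc k)"
      by (simp add: qcoeff_0)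
    also have "\<dots> \<le> (\<Sum>k. norm (qcoeff z Q (Suc k) * w ^ Suc k))"
      using summable_Suc_iff[of "\<lambda>k. norm (qcoeff z Q k * w ^ k)"] summable_qf(1)[OF assms, of z w] 
      by (intro summable_norm) auto
    also have "\<dots> \<le> (\<Sum>k. C * norm w * (p ^ (\<Sum>i<k. i) * (norm w * p) ^ k))"
    proof (intro suminf_le)
      show "norm (qcoeff z Q (Suc k) * w ^ Suc k) \<le> C * norm w * (p ^ (\<Sum>i<k. i) * (norm w * p) ^ k)" for k
        using tm[of "Suc k" w] by (simp add: power_add power_mult_distrib mult_ac)
      show "summable (\<lambda>k. norm (qcoeff z Q (Suc k) * w ^ Suc k))"
        using summable_Suc_iff[of "\<lambda>k. norm (qcoeff z Q k * w ^ k)"] summable_qf(1)[OF assms, of z w] by auto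
      show "summable (\<lambda>k. C * norm w * (p ^ (\<Sum>i<k. i) * (norm w * p) ^ k))"
        by (intro summable_mult summable_ptheta p)
    qed
    also have "\<dots> = C * norm w * ptheta p (norm w * p)"
      unfolding ptheta_def by (intro suminf_mult summable_ptheta p)
    finally show ?thesis .
  qed
  show ?thesis using that[OF C(1)] 1 2 by (simp add: p_def)
qed

lemma qf_rec:
  assumes "norm Q < 1"
  shows "qf z Q w = (1 + w) * qf z Q (w * Q) + z * w * Q * qf z Q (w * Q\<^sup>2)"
proof -
  have nz: "1 - Q ^ Suc k \<noteq> 0" for k
  proof
    assume "1 - Q ^ Suc k = 0"
    then have "norm Q ^ Suc k = 1" by (metis eq_iff_diff_eq_0 norm_one norm_power)
    moreover have "norm Q ^ Suc k \<le> norm Q ^ 1" using assms by (intro power_decreasing) auto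
    then have "norm Q ^ Suc k < 1" using assms by simp
    ultimately show False by simp
  qed
  have coef: "qcoeff z Q (Suc k) = qcoeff z Q (Suc k) * Q ^ Suc k + qcoeff z Q k * Q ^ k
                + z * Q * (qcoeff z Q k * Q ^ (2 * k))" for k
  proof -
    have "qcoeff z Q (Suc k) * (1 - Q ^ Suc k) = qcoeff z Q k * Q ^ k * (1 + z * Q ^ Suc k)"
      using nz[of k] unfolding qcoeff_Suc by (simp del: power_Suc add: field_simps)
    moreover have "Q ^ (2 * k) = Q ^ k * Q ^ k" by (simp add: mult_2 power_add)
    ultimately show ?thesis by (simp add: algebra_simps)
  qed
  have s: "(\<lambda>k. qcoeff z Q k * v ^ k) sums qf z Q v" for v
    unfolding qf_def by (intro summable_sums summable_qf assms)
  have s': "(\<lambda>k. qcoeff z Q (Suc k) * v ^ Suc k) sums (qf z Q v - 1)" for v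
    using s[of v] by (subst sums_Suc_iff) (simp add: qcoeff_0)
  have "(\<lambda>k. qcoeff z Q (Suc k) * (w * Q) ^ Suc k + w * (qcoeff z Q k * (w * Q) ^ k)
               + z * w * Q * (qcoeff z Q k * (w * Q\<^sup>2) ^ k)) sums
        ((qf z Q (w * Q) - 1) + w * qf z Q (w * Q) + z * w * Q * qf z Q (w * Q\<^sup>2))"
    by (intro sums_add sums_mult s s')
  also have "(\<lambda>k. qcoeff z Q (Suc k) * (w * Q) ^ Suc k + w * (qcoeff z Q k * (w * Q) ^ k)
               + z * w * Q * (qcoeff z Q k * (w * Q\<^sup>2) ^ k)) = (\<lambda>k. qcoeff z Q (Suc k) * w ^ Suc k)"
  proof
    fix k
    have "(Q\<^sup>2) ^ k = Q ^ (2 * k)" by (simp add: power_mult)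
    then show "qcoeff z Q (Suc k) * (w * Q) ^ Suc k + w * (qcoeff z Q k * (w * Q) ^ k)
               + z * w * Q * (qcoeff z Q k * (w * Q\<^sup>2) ^ k) = qcoeff z Q (Suc k) * w ^ Suc k"
      by (subst (2) coef) (simp add: power_mult_distrib algebra_simps)
  qed
  finally have "qf z Q w - 1 = (qf z Q (w * Q) - 1) + w * qf z Q (w * Q) + z * w * Q * qf z Q (w * Q\<^sup>2)"
    using s'[of w] by (metis sums_unique2)
  then show ?thesis by (simp add: algebra_simps)
qed

text \<open>The boundary condition for every iteration along \<open>w * Q ^ N\<close>.\<close>

lemma qf_tendsto_1:
  assumes "norm Q < 1" "v \<longlonglongrightarrow> 0"
  shows "(\<lambda>N. qf z Q (v N)) \<longlonglongrightarrow> 1"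
proof -
  define p where "p = norm Q"
  have p: "0 \<le> p" "p < 1" using assms by (auto simp: p_def)
  obtain C where C: "C > 0" "\<And>w. norm (qf z Q w - 1) \<le> C * norm w * ptheta p (norm w * p)"
    using qf_norm_bounds[OF assms(1)] p_def by metis
  have "eventually (\<lambda>N. norm (v N) < 1) sequentially"
    using assms(2) tendsto_norm_zero order_tendstoD(2) zero_less_one by metis
  then have "eventually (\<lambda>N. norm (qf z Q (v N) - 1) \<le> C * norm (v N) * ptheta p p) sequentially"
  proof eventually_elim
    case (elim N)
    have "ptheta p (norm (v N) * p) \<le> ptheta p p"
      using elim p by (intro ptheta_mono) (auto intro: mult_left_le_one_le)
    then have "C * norm (v N) * ptheta p (norm (v N) * p) \<le> C * norm (v N) * ptheta p p"
      using C(1) by (intro mult_left_mono) auto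
    then show ?case using C(2)[of "v N"] by linarith
  qed
  moreover have "(\<lambda>N. C * norm (v N) * ptheta p p) \<longlonglongrightarrow> C * 0 * ptheta p p"
    using assms(2) by (intro tendsto_intros tendsto_norm_zero)
  ultimately have "(\<lambda>N. qf z Q (v N) - 1) \<longlonglongrightarrow> 0"
    by (auto intro: Lim_null_comparison)
  then show ?thesis by (simp add: LIM_zero_iff)
qed

lemma tendsto_mult_power_0:
  fixes Q :: complex
  assumes "norm Q < 1"
  shows "(\<lambda>N. w * Q ^ N) \<longlonglongrightarrow> 0"
  using tendsto_mult_left[OF LIMSEQ_power_zero[OF assms], of w] by simp

text \<open>At z = 0 the equation has first order, and iterating it produces Euler's product of the
  factors \<open>1 + w * Q ^ j\<close>.\<close>

lemma qf0_prod:
  assumes "norm Q < 1"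
  shows "qf 0 Q w = (\<Prod>j<N. 1 + w * Q ^ j) * qf 0 Q (w * Q ^ N)"
proof (induction N)
  case (Suc N)
  have "qf 0 Q (w * Q ^ N) = (1 + w * Q ^ N) * qf 0 Q (w * Q ^ Suc N)"
    using qf_rec[OF assms, of 0 "w * Q ^ N"] by (simp add: mult_ac)
  then show ?case by (subst Suc.IH) (simp add: mult_ac)
qed simp

lemma qf0_tendsto:
  assumes "norm Q < 1"
  shows "(\<lambda>N. \<Prod>j<N. 1 + w * Q ^ j) \<longlonglongrightarrow> qf 0 Q w"
proof -
  have lim: "(\<lambda>N. qf 0 Q (w * Q ^ N)) \<longlonglongrightarrow> 1"
    by (intro qf_tendsto_1 assms tendsto_mult_power_0)
  then have "(\<lambda>N. qf 0 Q w / qf 0 Q (w * Q ^ N)) \<longlonglongrightarrow> qf 0 Q w / 1"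
    by (intro tendsto_intros) auto
  moreover have "eventually (\<lambda>N. qf 0 Q (w * Q ^ N) \<noteq> 0) sequentially"
    using lim by (rule tendsto_imp_eventually_ne) simp
  then have "eventually (\<lambda>N. qf 0 Q w / qf 0 Q (w * Q ^ N) = (\<Prod>j<N. 1 + w * Q ^ j)) sequentially"
  proof eventually_elim
    case (elim N)
    then show ?case using qf0_prod[OF assms, of w N] by simp
  qed
  ultimately show ?thesis by (simp add: tendsto_cong)
qed

text \<open>The limit contribution of the classes b and t - b: for w = \<open>q ^ b\<close> the
  partner has variable Q / w, and the summand with z is the excess weight when both smallest members
  are present, where w * (Q / w) leaves the single factor Q.\<close>

definition qG :: "complex \<Rightarrow> complex \<Rightarrow> complex \<Rightarrow> complex" where
  "qG z Q w = qf z Q w * qf z Q (Q / w) + z * Q * qf z Q (w * Q) * qf z Q (Q\<^sup>2 / w)"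

text \<open>Expand the value at w on the left and the value at 1 / w on the right by the recursion;
  both sides become the same form in the values at \<open>w * Q\<close>,
  \<open>w * Q\<^sup>2\<close>, \<open>Q / w\<close> and \<open>Q\<^sup>2 / w\<close>. This is the
  quasi-periodicity of a theta function, with a multiplier independent of z.\<close>

lemma qG_shift:
  assumes "norm Q < 1" "Q \<noteq> 0" "w \<noteq> 0"
  shows "qG z Q w = w * qG z Q (w * Q)"
proof -
  have 1: "qf z Q w = (1 + w) * qf z Q (w * Q) + z * w * Q * qf z Q (w * Q\<^sup>2)"
    by (rule qf_rec[OF assms(1)])
  have 2: "qf z Q (1 / w) = (1 + 1 / w) * qf z Q (Q / w) + z * (1 / w) * Q * qf z Q (Q\<^sup>2 / w)"
    using qf_rec[OF assms(1), of z "1 / w"] by simp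
  have e: "Q / (w * Q) = 1 / w" "Q\<^sup>2 / (w * Q) = Q / w" "w * Q * Q = w * Q\<^sup>2"
    using assms by (auto simp: field_simps power2_eq_square)
  have "w * qG z Q (w * Q) = w * (qf z Q (w * Q) * qf z Q (1 / w)) + w * z * Q * qf z Q (w * Q\<^sup>2) * qf z Q (Q / w)"
    unfolding qG_def e by (simp only: algebra_simps)
  also have "w * (qf z Q (w * Q) * qf z Q (1 / w)) = 
       qf z Q (w * Q) * ((w + 1) * qf z Q (Q / w) + z * Q * qf z Q (Q\<^sup>2 / w))"
    unfolding 2 using assms by (simp add: field_simps)
  also have "\<dots> + w * z * Q * qf z Q (w * Q\<^sup>2) * qf z Q (Q / w) = qG z Q w"
    unfolding qG_def 1 by (simp add: algebra_simps)
  finally show ?thesis ..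
qed

lemma qG_shifts:
  assumes "norm Q < 1" "Q \<noteq> 0" "w \<noteq> 0"
  shows "qG z Q w = w ^ N * Q ^ (\<Sum>i<N. i) * qG z Q (w * Q ^ N)"
proof (induction N)
  case (Suc N)
  have "qG z Q (w * Q ^ N) = (w * Q ^ N) * qG z Q (w * Q ^ Suc N)"
    using qG_shift[OF assms(1,2), of "w * Q ^ N" z] assms by (simp add: mult_ac)
  then show ?case by (subst Suc.IH) (simp add: power_add mult_ac)
qed simp

text \<open>The coefficients at \<open>z\<close> are those at \<open>0\<close> times partial products converging to
  \<open>qf 0 Q (z * Q)\<close> exponentially fast.\<close>

lemma qf_minus_limit_bound:
  assumes "norm Q < 1"
  obtains C where "C > 0"
    "\<And>w. norm (qf z Q w - qf 0 Q (z * Q) * qf 0 Q w) \<le> C * ptheta (norm Q) (norm w * norm Q)"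
proof -
  define p where "p = norm Q"
  have p: "0 \<le> p" "p < 1" using assms by (auto simp: p_def)
  define P where "P = qf 0 Q (z * Q)"
  obtain C0 where C0: "C0 > 0" "\<And>w. norm (qf 0 Q w - 1) \<le> C0 * norm w * ptheta p (norm w * p)"
    using qf_norm_bounds[OF assms(1)] p_def by metis
  obtain C1 where C1: "C1 > 0" "\<And>k. norm (qcoeff z Q k) \<le> C1 * p ^ (\<Sum>i<k. i)"
    using qcoeff_bound[OF assms] p_def by metis
  \<comment> \<open>The summand 1 keeps C positive even for z = 0.\<close>
  define C where "C = C1 * C0 * norm z * ptheta p (norm z) + 1"
  have P: "P = (\<Prod>j<k. 1 + z * Q ^ Suc j) * qf 0 Q (z * Q ^ Suc k)" for k
    unfolding P_def by (subst qf0_prod[OF assms, of _ k]) (simp add: mult_ac)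
  have coef: "P * qcoeff 0 Q k = qcoeff z Q k * qf 0 Q (z * Q ^ Suc k)" for k
    unfolding P[of k] by (simp add: qcoeff_def prod_dividef)
  have th: "ptheta p (norm z) \<ge> 0" using p by (intro ptheta_nonneg) auto
  have Cpos: "C > 0" using C0 C1 th unfolding C_def by (intro add_nonneg_pos mult_nonneg_nonneg) auto
  have tb: "norm (qcoeff z Q k * w ^ k - P * (qcoeff 0 Q k * w ^ k)) \<le> C * (p ^ (\<Sum>i<k. i) * (norm w * p) ^ k)" for k w
  proof -
    have pk: "p ^ Suc k \<le> p ^ k" "0 \<le> p ^ k" "0 \<le> p ^ Suc k" 
      using p by (auto intro: mult_left_le_one_le)
    have pk1: "p ^ Suc k * p \<le> 1" using p power_le_one[of p "Suc (Suc k)"] by (simp add: mult_ac)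
    have "norm (qf 0 Q (z * Q ^ Suc k) - 1) \<le> C0 * norm (z * Q ^ Suc k) * ptheta p (norm (z * Q ^ Suc k) * p)"
      by (rule C0)
    also have "\<dots> \<le> C0 * (norm z * p ^ k) * ptheta p (norm z)"
    proof (intro mult_mono ptheta_mono)
      show "norm (z * Q ^ Suc k) * p \<le> norm z"
        using mult_left_mono[OF pk1, of "norm z"] by (simp add: norm_mult norm_power p_def mult_ac)
      show "norm (z * Q ^ Suc k) \<le> norm z * p ^ k"
        using mult_left_mono[OF pk(1), of "norm z"] by (simp add: norm_mult norm_power p_def mult_ac)
    qed (use p C0 in \<open>auto intro!: ptheta_nonneg\<close>)
    finally have d: "norm (1 - qf 0 Q (z * Q ^ Suc k)) \<le> C0 * (norm z * p ^ k) * ptheta p (norm z)"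
      by (simp add: norm_minus_commute)
    have "qcoeff z Q k * w ^ k - P * (qcoeff 0 Q k * w ^ k) = qcoeff z Q k * w ^ k * (1 - qf 0 Q (z * Q ^ Suc k))"
      using coef[of k] by (simp add: algebra_simps)
    then have "norm (qcoeff z Q k * w ^ k - P * (qcoeff 0 Q k * w ^ k)) = norm (qcoeff z Q k) * norm w ^ k * norm (1 - qf 0 Q (z * Q ^ Suc k))"
      by (simp add: norm_mult norm_power)
    also have "\<dots> \<le> (C1 * p ^ (\<Sum>i<k. i)) * norm w ^ k * (C0 * (norm z * p ^ k) * ptheta p (norm z))"
      using C1 p by (intro mult_mono C1 d) auto
    also have "\<dots> = (C - 1) * (p ^ (\<Sum>i<k. i) * (norm w * p) ^ k)"
      by (simp add: C_def power_mult_distrib mult_ac)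
    also have "\<dots> \<le> C * (p ^ (\<Sum>i<k. i) * (norm w * p) ^ k)"
      using p by (intro mult_right_mono) auto
    finally show ?thesis .
  qed
  have "norm (qf z Q w - P * qf 0 Q w) \<le> C * ptheta p (norm w * p)" for w
  proof -
    have "(\<lambda>k. qcoeff z Q k * w ^ k - P * (qcoeff 0 Q k * w ^ k)) sums (qf z Q w - P * qf 0 Q w)"
      unfolding qf_def by (intro sums_diff sums_mult summable_sums summable_qf assms)
    then have "norm (qf z Q w - P * qf 0 Q w) = norm (\<Sum>k. qcoeff z Q k * w ^ k - P * (qcoeff 0 Q k * w ^ k))"
      by (simp add: sums_iff)
    also have "\<dots> \<le> (\<Sum>k. C * (p ^ (\<Sum>i<k. i) * (norm w * p) ^ k))"
      by (intro norm_suminf_le tb summable_mult summable_ptheta p)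
    also have "\<dots> = C * ptheta p (norm w * p)"
      unfolding ptheta_def by (intro suminf_mult summable_ptheta p)
    finally show ?thesis .
  qed
  then show ?thesis using that[OF Cpos] by (simp add: p_def P_def)
qed

text \<open>\<open>T N\<close> is the modulus of the multiplier collected in
  \<open>qG_shifts\<close>; it has to beat the growth of \<open>qf\<close> at the large arguments Q
  / (w * \<open>Q ^ N\<close>). By \<open>ptheta_rec\<close> the product of both grows by just one
  term \<open>T (Suc N)\<close> per step, and these are terms of the convergent series
  \<open>ptheta p b\<close>. One more factor p in the argument gains the vanishing factor
  \<open>p ^ N\<close>.\<close>

lemma ptheta_scaled_bounds:
  assumes p: "0 < p" "p < 1" and b: "b > 0"
  defines "T \<equiv> \<lambda>N::nat. p ^ (\<Sum>i<N. i) * b ^ N"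
  shows "T N * ptheta p (p / (b * p ^ N)) \<le> ptheta p (p / b) + ptheta p b"
    and "T N * ptheta p (p\<^sup>2 / (b * p ^ N)) \<le> b * p ^ N / p * (ptheta p (p / b) + ptheta p b)"
proof -
  have T0: "T N \<ge> 0" for N using p b by (simp add: T_def)
  have eq: "T N * ptheta p (p / (b * p ^ N)) = ptheta p (p / b) + (\<Sum>k<N. T (Suc k))" for N
  proof (induction N)
    case (Suc N)
    have "ptheta p (p / (b * p ^ Suc N)) = 1 + p / (b * p ^ Suc N) * ptheta p (p / (b * p ^ Suc N) * p)"
      using p by (intro ptheta_rec) auto
    also have "p / (b * p ^ Suc N) * p = p / (b * p ^ N)" using p by simp
    finally have "T (Suc N) * ptheta p (p / (b * p ^ Suc N)) = 
        T (Suc N) + (T (Suc N) * (p / (b * p ^ Suc N))) * ptheta p (p / (b * p ^ N))"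
      by (simp add: algebra_simps)
    also have "T (Suc N) * (p / (b * p ^ Suc N)) = T N"
      using p b by (simp add: T_def power_add)
    finally show ?case using Suc.IH by simp
  qed (simp add: T_def)
  have "(\<Sum>k<N. T (Suc k)) \<le> (\<Sum>k<Suc N. T k)" for N
    using T0 by (subst sum.lessThan_Suc_shift) auto
  moreover have "(\<Sum>k<Suc N. T k) \<le> ptheta p b" for N
    unfolding ptheta_def T_def using p b by (intro sum_le_suminf summable_ptheta) auto
  ultimately have "(\<Sum>k<N. T (Suc k)) \<le> ptheta p b" for N
    by (meson order_trans)
  then show 1: "T N * ptheta p (p / (b * p ^ N)) \<le> ptheta p (p / b) + ptheta p b" for N
    unfolding eq by simp
  have "ptheta p (p / (b * p ^ N)) = 1 + p / (b * p ^ N) * ptheta p (p / (b * p ^ N) * p)"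
    using p by (intro ptheta_rec) auto
  moreover have "p / (b * p ^ N) * p = p\<^sup>2 / (b * p ^ N)" by (simp add: power2_eq_square)
  ultimately have "p / (b * p ^ N) * ptheta p (p\<^sup>2 / (b * p ^ N)) \<le> ptheta p (p / (b * p ^ N))"
    by (metis add.commute le_add_same_cancel1 zero_le_one)
  then have "ptheta p (p\<^sup>2 / (b * p ^ N)) \<le> b * p ^ N / p * ptheta p (p / (b * p ^ N))"
    using p b by (simp add: field_simps)
  then have "T N * ptheta p (p\<^sup>2 / (b * p ^ N)) \<le> T N * (b * p ^ N / p * ptheta p (p / (b * p ^ N)))"
    by (intro mult_left_mono T0)
  also have "\<dots> = b * p ^ N / p * (T N * ptheta p (p / (b * p ^ N)))" by simp
  also have "\<dots> \<le> b * p ^ N / p * (ptheta p (p / b) + ptheta p b)"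
    using p b by (intro mult_left_mono 1) auto
  finally show "T N * ptheta p (p\<^sup>2 / (b * p ^ N)) \<le> b * p ^ N / p * (ptheta p (p / b) + ptheta p b)" .
qed

text \<open>Both sides satisfy the same first order equation under \<open>w \<mapsto> w * Q\<close>; iterating it
  towards \<open>0\<close> shows that the ratio does not depend on \<open>w\<close> and identifies it.\<close>

theorem qG_product:
  assumes Q: "norm Q < 1" "Q \<noteq> 0" and w: "w \<noteq> 0"
  shows "qG z Q w = qf 0 Q (z * Q) * qf 0 Q w * qf 0 Q (Q / w)"
proof -
  define p b P where "p = norm Q" and "b = norm w" and "P = qf 0 Q (z * Q)"
  have p: "0 < p" "p < 1" and b: "b > 0" using assms by (auto simp: p_def b_def)
  obtain C0 where C0: "C0 > 0" "\<And>w. norm (qf 0 Q w) \<le> C0 * ptheta p (norm w)"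
    using qf_norm_bounds[OF Q(1), of 0] p_def by metis
  obtain C1 where C1: "C1 > 0" "\<And>w. norm (qf z Q w) \<le> C1 * ptheta p (norm w)"
    using qf_norm_bounds[OF Q(1), of z] p_def by metis
  obtain C2 where C2: "C2 > 0" "\<And>w. norm (qf z Q w - P * qf 0 Q w) \<le> C2 * ptheta p (norm w * p)"
    using qf_minus_limit_bound[OF Q(1), of z] p_def P_def by metis
  define D where "D = ptheta p (p / b) + ptheta p b"
  define Y where "Y = (\<lambda>N. Q / (w * Q ^ N))"
  define S where "S = (\<lambda>N. w ^ N * Q ^ (\<Sum>i<N. i))"
  have nY: "norm (Y N) = p / (b * p ^ N)" for N
    by (simp add: Y_def p_def b_def norm_divide norm_mult norm_power)
  have nS: "norm (S N) = p ^ (\<Sum>i<N. i) * b ^ N" for N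
    by (simp add: S_def p_def b_def norm_mult norm_power)
  have b1: "norm (S N) * ptheta p (norm (Y N)) \<le> D" for N
    unfolding nS nY D_def by (rule ptheta_scaled_bounds(1)[OF p b])
  have b2: "norm (S N) * ptheta p (norm (Y N) * p) \<le> b * p ^ N / p * D" for N
    unfolding nS nY D_def using ptheta_scaled_bounds(2)[OF p b, of N] by (simp add: power2_eq_square)
  have D0: "D \<ge> 0" unfolding D_def using p b by (intro add_nonneg_nonneg ptheta_nonneg) auto
  \<comment> \<open>\<open>S N\<close> tends to 0 while \<open>Y N\<close> escapes to infinity. The
    first and the third summand gain \<open>p ^ N\<close> from \<open>b2\<close>; the second pairs
    the merely bounded \<open>S N * qf 0 Q (Y N)\<close> with a difference that tends to 1 -
    1.\<close>
  have diff: "qG z Q w - P * (qf 0 Q w * qf 0 Q (Q / w)) =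
     S N * (qf z Q (Y N) - P * qf 0 Q (Y N)) * qf z Q (w * Q ^ N)
     + S N * qf 0 Q (Y N) * (P * (qf z Q (w * Q ^ N) - qf 0 Q (w * Q ^ N)))
     + S N * qf z Q (Y N * Q) * (z * Q * qf z Q (w * Q ^ Suc N))" for N
  proof -
    have a: "Q\<^sup>2 / (w * Q ^ N) = Y N * Q" "w * Q ^ N * Q = w * Q ^ Suc N" "Q / (w * Q ^ N) = Y N"
      by (simp_all add: Y_def power2_eq_square mult_ac)
    have "qG z Q w = S N * (qf z Q (w * Q ^ N) * qf z Q (Y N) + z * Q * qf z Q (w * Q ^ Suc N) * qf z Q (Y N * Q))"
      using qG_shifts[OF Q w, of z N] unfolding qG_def a by (simp add: S_def)
    moreover have "qf 0 Q w * qf 0 Q (Q / w) = S N * (qf 0 Q (w * Q ^ N) * qf 0 Q (Y N))"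
      using qG_shifts[OF Q w, of 0 N] unfolding qG_def a by (simp add: S_def)
    ultimately show ?thesis by (simp add: algebra_simps)
  qed
  have pN: "(\<lambda>N. b * p ^ N / p * D) \<longlonglongrightarrow> b * 0 / p * D"
    using p by (intro tendsto_intros LIMSEQ_power_zero) auto
  have t1: "(\<lambda>N. S N * (qf z Q (Y N) - P * qf 0 Q (Y N))) \<longlonglongrightarrow> 0"
  proof (rule Lim_null_comparison)
    show "\<forall>\<^sub>F N in sequentially. norm (S N * (qf z Q (Y N) - P * qf 0 Q (Y N))) \<le> C2 * (b * p ^ N / p * D)"
    proof (intro always_eventually allI)
      fix N
      have "norm (S N * (qf z Q (Y N) - P * qf 0 Q (Y N))) \<le> norm (S N) * (C2 * ptheta p (norm (Y N) * p))"
        unfolding norm_mult by (intro mult_left_mono C2) auto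
      also have "\<dots> = C2 * (norm (S N) * ptheta p (norm (Y N) * p))" by simp
      also have "\<dots> \<le> C2 * (b * p ^ N / p * D)"
        using C2(1) by (intro mult_left_mono b2) auto
      finally show "norm (S N * (qf z Q (Y N) - P * qf 0 Q (Y N))) \<le> C2 * (b * p ^ N / p * D)" .
    qed
    show "(\<lambda>N. C2 * (b * p ^ N / p * D)) \<longlonglongrightarrow> 0"
      using tendsto_mult_left[OF pN, of C2] by simp
  qed
  have t2: "(\<lambda>N. S N * qf z Q (Y N * Q)) \<longlonglongrightarrow> 0"
  proof (rule Lim_null_comparison)
    show "\<forall>\<^sub>F N in sequentially. norm (S N * qf z Q (Y N * Q)) \<le> C1 * (b * p ^ N / p * D)"
    proof (intro always_eventually allI)
      fix N
      have "norm (S N * qf z Q (Y N * Q)) \<le> norm (S N) * (C1 * ptheta p (norm (Y N * Q)))"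
        unfolding norm_mult[of "S N"] by (intro mult_left_mono C1) auto
      also have "\<dots> = C1 * (norm (S N) * ptheta p (norm (Y N) * p))" by (simp add: norm_mult p_def)
      also have "\<dots> \<le> C1 * (b * p ^ N / p * D)"
        using C1(1) by (intro mult_left_mono b2) auto
      finally show "norm (S N * qf z Q (Y N * Q)) \<le> C1 * (b * p ^ N / p * D)" .
    qed
    show "(\<lambda>N. C1 * (b * p ^ N / p * D)) \<longlonglongrightarrow> 0"
      using tendsto_mult_left[OF pN, of C1] by simp
  qed
  have f1: "(\<lambda>N. qf y Q (w * Q ^ N)) \<longlonglongrightarrow> 1" for y
    by (intro qf_tendsto_1 Q tendsto_mult_power_0)
  have f2: "(\<lambda>N. qf z Q (w * Q ^ Suc N)) \<longlonglongrightarrow> 1"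
    using f1 by (rule LIMSEQ_Suc)
  have t3: "(\<lambda>N. S N * qf 0 Q (Y N) * (P * (qf z Q (w * Q ^ N) - qf 0 Q (w * Q ^ N)))) \<longlonglongrightarrow> 0"
  proof (rule Lim_null_comparison)
    show "\<forall>\<^sub>F N in sequentially. norm (S N * qf 0 Q (Y N) * (P * (qf z Q (w * Q ^ N) - qf 0 Q (w * Q ^ N))))
             \<le> C0 * D * norm (P * (qf z Q (w * Q ^ N) - qf 0 Q (w * Q ^ N)))"
    proof (intro always_eventually allI)
      fix N
      have "norm (S N * qf 0 Q (Y N)) \<le> norm (S N) * (C0 * ptheta p (norm (Y N)))"
        unfolding norm_mult by (intro mult_left_mono C0) auto
      also have "\<dots> = C0 * (norm (S N) * ptheta p (norm (Y N)))" by simp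
      also have "\<dots> \<le> C0 * D"
        using C0(1) by (intro mult_left_mono b1) auto
      finally show "norm (S N * qf 0 Q (Y N) * (P * (qf z Q (w * Q ^ N) - qf 0 Q (w * Q ^ N))))
             \<le> C0 * D * norm (P * (qf z Q (w * Q ^ N) - qf 0 Q (w * Q ^ N)))"
        unfolding norm_mult[of "S N * qf 0 Q (Y N)"] by (intro mult_right_mono) auto
    qed
    have "(\<lambda>N. C0 * D * norm (P * (qf z Q (w * Q ^ N) - qf 0 Q (w * Q ^ N)))) \<longlonglongrightarrow> C0 * D * norm (P * (1 - 1))"
      by (intro tendsto_intros f1)
    then show "(\<lambda>N. C0 * D * norm (P * (qf z Q (w * Q ^ N) - qf 0 Q (w * Q ^ N)))) \<longlonglongrightarrow> 0" by simp
  qed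
  have "(\<lambda>N. S N * (qf z Q (Y N) - P * qf 0 Q (Y N)) * qf z Q (w * Q ^ N)
     + S N * qf 0 Q (Y N) * (P * (qf z Q (w * Q ^ N) - qf 0 Q (w * Q ^ N)))
     + S N * qf z Q (Y N * Q) * (z * Q * qf z Q (w * Q ^ Suc N))) \<longlonglongrightarrow> 0 * 1 + 0 + 0 * (z * Q * 1)"
    by (intro tendsto_intros t1 t2 t3 f1 f2)
  then have "(\<lambda>N::nat. qG z Q w - P * (qf 0 Q w * qf 0 Q (Q / w))) \<longlonglongrightarrow> 0"
    unfolding diff[symmetric] by simp
  then show ?thesis by (simp add: LIMSEQ_const_iff P_def mult_ac)
qed

section \<open>Generating functions of hook statistics of strict partitions\<close>

text \<open>For the set \<open>S\<close> of parts of a strict partition this is the number of \<open>t\<close>-hooks of its double.\<close>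

definition hookN :: "nat \<Rightarrow> nat set \<Rightarrow> nat" where
  "hookN t S = 2 * card {i. 1 \<le> i \<and> i \<notin> S \<and> i + t \<in> S} + (if t \<in> S then 1 else 0)
     + card {a \<in> S. a < t \<and> t - a \<in> S}"

text \<open>If the elements of \<open>S\<close> in one residue class are written as \<open>b + t * k\<close>, then the pairs
  \<open>i \<notin> S\<close>, \<open>i + t \<in> S\<close> in this class are the ascents of the set of these \<open>k\<close>.\<close>

definition asc :: "nat set \<Rightarrow> nat" where
  "asc T = card {k. k \<notin> T \<and> Suc k \<in> T}"

definition wsum :: "complex \<Rightarrow> complex \<Rightarrow> nat \<Rightarrow> nat set \<Rightarrow> complex" where
  "wsum x q t A = (\<Sum>S\<in>Pow A. x ^ hookN t S * q ^ \<Sum>S)"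

definition phi :: "complex \<Rightarrow> complex \<Rightarrow> nat \<Rightarrow> complex \<Rightarrow> complex" where
  "phi x Q M w = (\<Sum>T\<in>Pow {..<M}. x ^ (2 * asc T) * w ^ card T * Q ^ \<Sum>T)"

text \<open>Membership of 0 is the state of the recursion: it decides whether a shift creates an
  ascent, and it decides the two terms of \<open>hookN\<close> that are not ascents.\<close>

definition phi1 :: "complex \<Rightarrow> complex \<Rightarrow> nat \<Rightarrow> complex \<Rightarrow> complex" where
  "phi1 x Q M w = (\<Sum>T\<in>Pow {..<M}. if 0 \<in> T then x ^ (2 * asc T) * w ^ card T * Q ^ \<Sum>T else 0)"

text \<open>Excludes each way in which an element of A and one of B could interact in
  \<open>hookN\<close>: equality, distance t in either direction, and sum t.\<close>

definition separated :: "nat \<Rightarrow> nat set \<Rightarrow> nat set \<Rightarrow> bool" where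
  "separated t A B \<longleftrightarrow> (\<forall>a\<in>A. \<forall>b\<in>B. a \<noteq> b \<and> a \<noteq> b + t \<and> b \<noteq> a + t \<and> a + b \<noteq> t)"

lemma finite_shift: "finite (S::nat set) \<Longrightarrow> finite {i. P i \<and> i + t \<in> S}"
  by (rule finite_subset[of _ "(\<lambda>a. a - t) ` S"]) (auto intro!: image_eqI[of _ _ "_ + t"])

lemma hookN_union:
  assumes "finite S" "finite T" "separated t S T"
  shows "hookN t (S \<union> T) = hookN t S + hookN t T"
proof -
  have fin: "finite {i. 1 \<le> i \<and> i \<notin> A \<and> i + t \<in> B}" if "finite B" for A B
    using finite_shift[OF that, of "\<lambda>i. 1 \<le> i \<and> i \<notin> A" t] by simp
  have sep: "a \<noteq> b" "a \<noteq> b + t" "b \<noteq> a + t" "a + b \<noteq> t" if "a \<in> S" "b \<in> T" for a b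
    using assms(3) that unfolding separated_def by blast+
  have "{i. 1 \<le> i \<and> i \<notin> S \<union> T \<and> i + t \<in> S \<union> T} = {i. 1 \<le> i \<and> i \<notin> S \<and> i + t \<in> S} \<union> {i. 1 \<le> i \<and> i \<notin> T \<and> i + t \<in> T}"
    using sep by blast
  moreover have "card ({i. 1 \<le> i \<and> i \<notin> S \<and> i + t \<in> S} \<union> {i. 1 \<le> i \<and> i \<notin> T \<and> i + t \<in> T}) =
      card {i. 1 \<le> i \<and> i \<notin> S \<and> i + t \<in> S} + card {i. 1 \<le> i \<and> i \<notin> T \<and> i + t \<in> T}"
    using sep by (intro card_Un_disjoint fin assms) blast
  moreover have "{a \<in> S \<union> T. a < t \<and> t - a \<in> S \<union> T} = {a \<in> S. a < t \<and> t - a \<in> S} \<union> {a \<in> T. a < t \<and> t - a \<in> T}"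
  proof -
    have "\<not> (a \<in> S \<and> t - a \<in> T)" "\<not> (a \<in> T \<and> t - a \<in> S)" if "a < t" for a
      using that sep(4)[of a "t - a"] sep(4)[of "t - a" a] by auto
    then show ?thesis by blast
  qed
  moreover have "card ({a \<in> S. a < t \<and> t - a \<in> S} \<union> {a \<in> T. a < t \<and> t - a \<in> T}) =
     card {a \<in> S. a < t \<and> t - a \<in> S} + card {a \<in> T. a < t \<and> t - a \<in> T}"
    using sep assms by (intro card_Un_disjoint) auto
  moreover have "\<not> (t \<in> S \<and> t \<in> T)" using sep by blast
  ultimately show ?thesis by (auto simp: hookN_def)
qed

lemma sum_Pow_union:
  assumes "A \<inter> B = {}"
  shows "(\<Sum>S\<in>Pow (A \<union> B). f S) = (\<Sum>S\<in>Pow A. \<Sum>T\<in>Pow B. f (S \<union> T))"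
proof -
  have "(\<Sum>S\<in>Pow (A \<union> B). f S) = (\<Sum>(S, T)\<in>Pow A \<times> Pow B. f (S \<union> T))"
  proof (rule sum.reindex_bij_witness[of _ "\<lambda>(S, T). S \<union> T" "\<lambda>S. (S \<inter> A, S \<inter> B)"])
    fix S assume "S \<in> Pow (A \<union> B)"
    then have "S \<inter> A \<union> S \<inter> B = S" by blast
    then show "(case (S \<inter> A, S \<inter> B) of (S, T) \<Rightarrow> S \<union> T) = S"
      "(case (S \<inter> A, S \<inter> B) of (S, T) \<Rightarrow> f (S \<union> T)) = f S" by simp_all
  qed (use assms in auto)
  then show ?thesis by (simp add: sum.cartesian_product)
qed

lemma separated_disjoint: "separated t A B \<Longrightarrow> A \<inter> B = {}"
  unfolding separated_def by blast

lemma separated_subset: "separated t A B \<Longrightarrow> S \<subseteq> A \<Longrightarrow> T \<subseteq> B \<Longrightarrow> separated t S T"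
  unfolding separated_def by blast

lemma wsum_union:
  assumes "finite A" "finite B" "separated t A B"
  shows "wsum x q t (A \<union> B) = wsum x q t A * wsum x q t B"
proof -
  have "wsum x q t (A \<union> B) = (\<Sum>S\<in>Pow A. \<Sum>T\<in>Pow B. x ^ hookN t (S \<union> T) * q ^ \<Sum>(S \<union> T))"
    unfolding wsum_def by (rule sum_Pow_union[OF separated_disjoint[OF assms(3)]])
  also have "\<dots> = (\<Sum>S\<in>Pow A. \<Sum>T\<in>Pow B. (x ^ hookN t S * q ^ \<Sum>S) * (x ^ hookN t T * q ^ \<Sum>T))"
  proof (intro sum.cong refl)
    fix S T assume ST: "S \<in> Pow A" "T \<in> Pow B"
    then have fin: "finite S" "finite T" using assms by (auto intro: finite_subset)
    have sep: "separated t S T" using separated_subset[OF assms(3)] ST by auto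
    have "\<Sum>(S \<union> T) = \<Sum>S + \<Sum>T"
      by (rule sum.union_disjoint[OF fin separated_disjoint[OF sep]])
    then show "x ^ hookN t (S \<union> T) * q ^ \<Sum>(S \<union> T) = (x ^ hookN t S * q ^ \<Sum>S) * (x ^ hookN t T * q ^ \<Sum>T)"
      by (simp add: hookN_union[OF fin sep] power_add)
  qed
  also have "\<dots> = wsum x q t A * wsum x q t B"
    by (simp add: wsum_def sum_product)
  finally show ?thesis .
qed

lemma wsum_empty: "wsum x q t {} = 1"
  by (simp add: wsum_def hookN_def)

lemma wsum_UN:
  assumes "finite I" "\<And>i. i \<in> I \<Longrightarrow> finite (C i)"
    "\<And>i j. i \<in> I \<Longrightarrow> j \<in> I \<Longrightarrow> i \<noteq> j \<Longrightarrow> separated t (C i) (C j)"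
  shows "wsum x q t (\<Union>i\<in>I. C i) = (\<Prod>i\<in>I. wsum x q t (C i))"
  using assms
proof (induction I rule: finite_induct)
  case (insert i I)
  have "separated t (C i) (\<Union>j\<in>I. C j)"
  proof -
    have "separated t (C i) (C j)" if "j \<in> I" for j
      using insert that by (metis insertCI)
    then show ?thesis unfolding separated_def by blast
  qed
  then have "wsum x q t (C i \<union> (\<Union>j\<in>I. C j)) = wsum x q t (C i) * wsum x q t (\<Union>j\<in>I. C j)"
    using insert by (intro wsum_union) auto
  then show ?case using insert by simp
qed (simp add: wsum_empty)

section \<open>A single residue class: the recursion for ascent weights\<close>

lemma Pow_lessThan_Suc_shift:
  "Pow {..<Suc M} = (`) Suc ` Pow {..<M} \<union> (\<lambda>T. insert 0 (Suc ` T)) ` Pow {..<M}"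
proof (intro equalityI subsetI)
  fix S assume S: "S \<in> Pow {..<Suc M}"
  define T where "T = {k. Suc k \<in> S}"
  have T: "T \<in> Pow {..<M}" using S by (auto simp: T_def)
  have "S = (if 0 \<in> S then insert 0 (Suc ` T) else Suc ` T)"
  proof (rule set_eqI)
    show "x \<in> S \<longleftrightarrow> x \<in> (if 0 \<in> S then insert 0 (Suc ` T) else Suc ` T)" for x
      by (cases x) (auto simp: T_def)
  qed
  then have SE: "S = (if 0 \<in> S then insert 0 (Suc ` T) else Suc ` T)" .
  show "S \<in> (`) Suc ` Pow {..<M} \<union> (\<lambda>T. insert 0 (Suc ` T)) ` Pow {..<M}"
  proof (cases "0 \<in> S")
    case True
    with SE have "S = insert 0 (Suc ` T)" by (simp only: if_True)
    then show ?thesis using T by (intro UnI2 image_eqI[of _ _ T])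
  next
    case False
    with SE have "S = Suc ` T" by (simp only: if_False)
    then show ?thesis using T by (intro UnI1 image_eqI[of _ _ T])
  qed
next
  fix S assume "S \<in> (`) Suc ` Pow {..<M} \<union> (\<lambda>T. insert 0 (Suc ` T)) ` Pow {..<M}"
  then obtain T where "T \<subseteq> {..<M}" "S = Suc ` T \<or> S = insert 0 (Suc ` T)" by blast
  then show "S \<in> Pow {..<Suc M}" by (auto simp: subset_iff)
qed

lemma sum_Pow_lessThan_Suc_shift:
  "(\<Sum>S\<in>Pow {..<Suc M}. f S) = (\<Sum>T\<in>Pow {..<M}. f (Suc ` T) + f (insert 0 (Suc ` T)))"
proof -
  have i1: "inj_on ((`) Suc) (Pow {..<M})" by (simp add: inj_on_def inj_image_eq_iff)
  have i2: "inj_on (\<lambda>T. insert 0 (Suc ` T)) (Pow {..<M})"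
    by (auto simp: inj_on_def insert_ident inj_image_eq_iff)
  have "(\<Sum>S\<in>Pow {..<Suc M}. f S) = (\<Sum>S\<in>(`) Suc ` Pow {..<M}. f S) + (\<Sum>S\<in>(\<lambda>T. insert 0 (Suc ` T)) ` Pow {..<M}. f S)"
    unfolding Pow_lessThan_Suc_shift by (intro sum.union_disjoint) auto
  then show ?thesis
    by (simp add: sum.reindex[OF i1] sum.reindex[OF i2] sum.distrib o_def)
qed

lemma asc_Suc_image:
  assumes "finite T"
  shows "asc (Suc ` T) = asc T + (if 0 \<in> T then 1 else 0)"
    and "asc (insert 0 (Suc ` T)) = asc T"
proof -
  have fin: "finite {k. k \<notin> T \<and> Suc k \<in> T}"
    using finite_shift[OF assms, of "\<lambda>k. k \<notin> T" 1] by simp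
  have e: "{k. k \<notin> Suc ` T \<and> Suc k \<in> Suc ` T} = (if 0 \<in> T then {0} else {}) \<union> Suc ` {k. k \<notin> T \<and> Suc k \<in> T}"
  proof (rule set_eqI)
    show "x \<in> {k. k \<notin> Suc ` T \<and> Suc k \<in> Suc ` T} \<longleftrightarrow> x \<in> (if 0 \<in> T then {0} else {}) \<union> Suc ` {k. k \<notin> T \<and> Suc k \<in> T}" for x
      by (cases x) auto
  qed
  have "card (Suc ` {k. k \<notin> T \<and> Suc k \<in> T}) = asc T"
    unfolding asc_def by (rule card_image) simp
  then show "asc (Suc ` T) = asc T + (if 0 \<in> T then 1 else 0)"
    unfolding asc_def[of "Suc ` T"] e using fin by (subst card_Un_disjoint) auto
  have e: "{k. k \<notin> insert 0 (Suc ` T) \<and> Suc k \<in> insert 0 (Suc ` T)} = Suc ` {k. k \<notin> T \<and> Suc k \<in> T}"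
  proof (rule set_eqI)
    show "x \<in> {k. k \<notin> insert 0 (Suc ` T) \<and> Suc k \<in> insert 0 (Suc ` T)} \<longleftrightarrow> x \<in> Suc ` {k. k \<notin> T \<and> Suc k \<in> T}" for x
      by (cases x) auto
  qed
  show "asc (insert 0 (Suc ` T)) = asc T"
    unfolding asc_def[of "insert 0 (Suc ` T)"] e asc_def by (rule card_image) simp
qed

lemma phi_0: "phi x Q 0 w = 1" "phi1 x Q 0 w = 0"
  by (simp_all add: phi_def phi1_def asc_def)

text \<open>Splitting off 0 shifts the rest by one, which replaces w by w * Q. A new ascent appears
  exactly if 0 is absent and 1 present; its weight \<open>x\<^sup>2\<close> in place of 1 is the
  excess multiplying \<open>phi1\<close>.\<close>

lemma phi_Suc:
  "phi x Q (Suc M) w = (1 + w) * phi x Q M (w * Q) + (x\<^sup>2 - 1) * phi1 x Q M (w * Q)"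
  "phi1 x Q (Suc M) w = w * phi x Q M (w * Q)"
proof -
  have fin: "finite T" if "T \<in> Pow {..<M}" for T using that by (auto intro: finite_subset)
  have sums: "\<Sum>(Suc ` T) = \<Sum>T + card T" for T
    by (simp add: sum.reindex sum_Suc)
  have a: "x ^ (2 * asc (Suc ` T)) * w ^ card (Suc ` T) * Q ^ \<Sum>(Suc ` T) =
     x ^ (2 * asc T) * (w * Q) ^ card T * Q ^ \<Sum>T +
       (x\<^sup>2 - 1) * (if 0 \<in> T then x ^ (2 * asc T) * (w * Q) ^ card T * Q ^ \<Sum>T else 0)" if "T \<in> Pow {..<M}" for T
  proof -
    have "x ^ (2 * asc (Suc ` T)) = x ^ (2 * asc T) * (if 0 \<in> T then x\<^sup>2 else 1)"
      unfolding asc_Suc_image(1)[OF fin[OF that]] by (simp add: power_add distrib_left)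
    moreover have "card (Suc ` T) = card T" by (simp add: card_image)
    moreover have "Q ^ \<Sum>(Suc ` T) = Q ^ \<Sum>T * Q ^ card T" unfolding sums by (simp add: power_add)
    ultimately show ?thesis by (simp add: power_mult_distrib left_diff_distrib)
  qed
  have b: "x ^ (2 * asc (insert 0 (Suc ` T))) * w ^ card (insert 0 (Suc ` T)) * Q ^ \<Sum>(insert 0 (Suc ` T)) =
     w * (x ^ (2 * asc T) * (w * Q) ^ card T * Q ^ \<Sum>T)" if "T \<in> Pow {..<M}" for T
  proof -
    have "card (insert 0 (Suc ` T)) = Suc (card T)" using fin[OF that] by (simp add: card_image)
    moreover have "Q ^ \<Sum>(insert 0 (Suc ` T)) = Q ^ \<Sum>T * Q ^ card T"
      using fin[OF that] by (simp add: sums power_add)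
    ultimately show ?thesis
      unfolding asc_Suc_image(2)[OF fin[OF that]] by (simp add: power_mult_distrib)
  qed
  show "phi x Q (Suc M) w = (1 + w) * phi x Q M (w * Q) + (x\<^sup>2 - 1) * phi1 x Q M (w * Q)"
  proof -
    let ?g = "\<lambda>T. x ^ (2 * asc T) * (w * Q) ^ card T * Q ^ \<Sum>T"
    have "phi x Q (Suc M) w = (\<Sum>T\<in>Pow {..<M}. ?g T + (x\<^sup>2 - 1) * (if 0 \<in> T then ?g T else 0) + w * ?g T)"
      unfolding phi_def sum_Pow_lessThan_Suc_shift by (intro sum.cong refl) (simp only: a b)
    also have "\<dots> = phi x Q M (w * Q) + (x\<^sup>2 - 1) * phi1 x Q M (w * Q) + w * phi x Q M (w * Q)"
      unfolding phi_def phi1_def sum.distrib sum_distrib_left ..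
    finally show ?thesis by (simp add: distrib_right)
  qed
  show "phi1 x Q (Suc M) w = w * phi x Q M (w * Q)"
  proof -
    let ?g = "\<lambda>T. x ^ (2 * asc T) * (w * Q) ^ card T * Q ^ \<Sum>T"
    have "phi1 x Q (Suc M) w = (\<Sum>T\<in>Pow {..<M}. w * ?g T)"
    proof -
      have "(if 0 \<in> Suc ` T then x ^ (2 * asc (Suc ` T)) * w ^ card (Suc ` T) * Q ^ \<Sum>(Suc ` T) else 0) +
        (if 0 \<in> insert 0 (Suc ` T) then x ^ (2 * asc (insert 0 (Suc ` T))) * w ^ card (insert 0 (Suc ` T)) * Q ^ \<Sum>(insert 0 (Suc ` T)) else 0)
         = w * ?g T" if T: "T \<in> Pow {..<M}" for T
      proof -
        have "0 \<notin> Suc ` T" "0 \<in> insert 0 (Suc ` T)" by auto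
        then show ?thesis by (simp only: if_True if_False b[OF T] add_0)
      qed
      then show ?thesis unfolding phi1_def sum_Pow_lessThan_Suc_shift by (rule sum.cong[OF refl])
    qed
    then show ?thesis by (simp add: phi_def sum_distrib_left)
  qed
qed

lemma phi_rec:
  "phi x Q (Suc (Suc M)) w = (1 + w) * phi x Q (Suc M) (w * Q) + (x\<^sup>2 - 1) * w * Q * phi x Q M (w * Q\<^sup>2)"
  by (subst phi_Suc(1), subst phi_Suc(2)) (simp add: power2_eq_square mult_ac)

text \<open>Truncated and full series obey the same recursion, the truncation shrinking by one with
  each factor Q. The errors are compared along \<open>w * Q ^ j\<close>: a step costs a factor
  \<open>exp (c * p ^ j)\<close>, the product of these is bounded, and at the end the polynomials
  \<open>1 + w * Q ^ m\<close> and 1 meet values of \<open>qf\<close> close to 1.\<close>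

lemma phi_tendsto:
  assumes Q: "norm Q < 1"
  shows "(\<lambda>M. phi x Q M w) \<longlonglongrightarrow> qf (x\<^sup>2 - 1) Q w"
proof -
  define z where "z = x\<^sup>2 - 1"
  define p where "p = norm Q"
  have p: "0 \<le> p" "p < 1" using Q by (auto simp: p_def)
  define c where "c = (1 + norm z) * norm w"
  have c0: "c \<ge> 0" by (simp add: c_def)
  define d where "d = (\<lambda>M j. norm (qf z Q (w * Q ^ j) - phi x Q (M - j) (w * Q ^ j)))"
  \<comment> \<open>Two consecutive errors, since the recursion has order two.\<close>
  define a where "a = (\<lambda>M j. max (d M j) (d M (Suc j)))"
  have step: "a M j \<le> exp (c * p ^ j) * a M (Suc j)" if "j + 2 \<le> M" for M j
  proof -
    let ?v = "w * Q ^ j"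
    obtain m where m: "M = j + 2 + m" using \<open>j + 2 \<le> M\<close> le_Suc_ex by blast
    have e: "w * Q ^ Suc j = ?v * Q" "w * Q ^ Suc (Suc j) = ?v * Q\<^sup>2" 
      by (simp_all add: power2_eq_square mult_ac)
    have nv: "norm ?v = norm w * p ^ j" by (simp add: norm_mult norm_power p_def)
    have "qf z Q ?v - phi x Q (Suc (Suc m)) ?v = (1 + ?v) * (qf z Q (?v * Q) - phi x Q (Suc m) (?v * Q))
       + z * ?v * Q * (qf z Q (?v * Q\<^sup>2) - phi x Q m (?v * Q\<^sup>2))"
      unfolding qf_rec[OF Q, of z ?v] phi_rec z_def[symmetric] by (simp add: algebra_simps)
    then have "d M j = norm ((1 + ?v) * (qf z Q (?v * Q) - phi x Q (Suc m) (?v * Q))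
       + z * ?v * Q * (qf z Q (?v * Q\<^sup>2) - phi x Q m (?v * Q\<^sup>2)))"
      unfolding d_def m by (simp add: add.commute)
    also have "\<dots> \<le> norm (1 + ?v) * d M (Suc j) + norm (z * ?v * Q) * d M (Suc (Suc j))"
      unfolding d_def m e by (intro norm_triangle_le add_mono) (simp_all add: norm_mult)
    also have "\<dots> \<le> (1 + norm ?v) * a M (Suc j) + (norm z * norm ?v) * a M (Suc j)"
    proof (intro add_mono mult_mono)
      show "norm (1 + ?v) \<le> 1 + norm ?v" using norm_triangle_ineq[of 1 ?v] by simp
      show "norm (z * ?v * Q) \<le> norm z * norm ?v"
        unfolding norm_mult[of "z * ?v"] norm_mult[of z ?v] using Q by (intro mult_left_le) auto
    qed (auto simp: a_def d_def)
    also have "\<dots> = (1 + c * p ^ j) * a M (Suc j)" unfolding nv c_def by (simp add: algebra_simps)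
    also have "\<dots> \<le> exp (c * p ^ j) * a M (Suc j)"
      by (intro mult_right_mono exp_ge_add_one_self) (auto simp: a_def d_def le_max_iff_disj)
    finally have 1: "d M j \<le> exp (c * p ^ j) * a M (Suc j)" .
    have "d M (Suc j) \<le> a M (Suc j)" by (simp add: a_def)
    also have "a M (Suc j) = 1 * a M (Suc j)" by simp
    also have "\<dots> \<le> exp (c * p ^ j) * a M (Suc j)"
      using c0 p by (intro mult_right_mono) (auto simp: a_def d_def le_max_iff_disj)
    finally show ?thesis using 1 by (simp add: a_def)
  qed
  have it: "a M 0 \<le> exp (c * (\<Sum>i<j. p ^ i)) * a M j" if "j + 1 \<le> M" for M j
    using that
  proof (induction j)
    case (Suc j)
    have "a M 0 \<le> exp (c * (\<Sum>i<j. p ^ i)) * a M j" using Suc by simp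
    also have "\<dots> \<le> exp (c * (\<Sum>i<j. p ^ i)) * (exp (c * p ^ j) * a M (Suc j))"
      using Suc by (intro mult_left_mono step) auto
    finally show ?case by (simp add: exp_add algebra_simps)
  qed simp
  have lim: "(\<lambda>m. qf z Q (w * Q ^ m)) \<longlonglongrightarrow> 1"
    by (intro qf_tendsto_1 Q tendsto_mult_power_0)
  have bound: "norm (qf z Q w - phi x Q (Suc m) w) \<le> exp (c * (1 / (1 - p))) *
     (norm (qf z Q (w * Q ^ m) - 1 - w * Q ^ m) + norm (qf z Q (w * Q ^ Suc m) - 1))" for m
  proof -
    have sg: "(\<lambda>i. p ^ i) sums (1 / (1 - p))" using p by (intro geometric_sums) auto
    have "(\<Sum>i<m. p ^ i) \<le> 1 / (1 - p)"
      using p sum_le_suminf[OF sums_summable[OF sg], of "{..<m}"] sg by (simp add: sums_iff)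
    then have E: "exp (c * (\<Sum>i<m. p ^ i)) \<le> exp (c * (1 / (1 - p)))" using c0 
      by (simp add: mult_left_mono del: times_divide_eq_right mult_1_right)
    have "norm (qf z Q w - phi x Q (Suc m) w) \<le> a (Suc m) 0" by (simp add: a_def d_def)
    also have "\<dots> \<le> exp (c * (\<Sum>i<m. p ^ i)) * a (Suc m) m" by (intro it) simp
    also have "\<dots> \<le> exp (c * (1 / (1 - p))) * a (Suc m) m"
      using E by (intro mult_right_mono) (auto simp: a_def d_def le_max_iff_disj)
    also have "a (Suc m) m = max (norm (qf z Q (w * Q ^ m) - 1 - w * Q ^ m)) (norm (qf z Q (w * Q ^ Suc m) - 1))"
      by (simp add: a_def d_def phi_0 phi_Suc diff_diff_eq)
    also have "\<dots> \<le> norm (qf z Q (w * Q ^ m) - 1 - w * Q ^ m) + norm (qf z Q (w * Q ^ Suc m) - 1)" by simp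
    finally show ?thesis by (simp add: mult_left_mono)
  qed
  have "(\<lambda>m. exp (c * (1 / (1 - p))) *
     (norm (qf z Q (w * Q ^ m) - 1 - w * Q ^ m) + norm (qf z Q (w * Q ^ Suc m) - 1))) \<longlonglongrightarrow>
     exp (c * (1 / (1 - p))) * (norm ((1::complex) - 1 - 0) + norm ((1::complex) - 1))"
    by (intro tendsto_intros lim LIMSEQ_Suc[OF lim] tendsto_mult_power_0 Q)
  then have "(\<lambda>m. exp (c * (1 / (1 - p))) *
     (norm (qf z Q (w * Q ^ m) - 1 - w * Q ^ m) + norm (qf z Q (w * Q ^ Suc m) - 1))) \<longlonglongrightarrow> 0"
    by simp
  then have "(\<lambda>m. qf z Q w - phi x Q (Suc m) w) \<longlonglongrightarrow> 0"
    by (rule Lim_null_comparison[rotated]) (intro always_eventually allI bound)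
  then have "(\<lambda>m. qf z Q w - (qf z Q w - phi x Q (Suc m) w)) \<longlonglongrightarrow> qf z Q w - 0"
    by (intro tendsto_diff tendsto_const)
  then have "(\<lambda>m. phi x Q (Suc m) w) \<longlonglongrightarrow> qf z Q w" by simp
  then show ?thesis unfolding z_def by (rule LIMSEQ_imp_Suc)
qed

lemma phi1_tendsto:
  assumes Q: "norm Q < 1"
  shows "(\<lambda>M. phi1 x Q M w) \<longlonglongrightarrow> w * qf (x\<^sup>2 - 1) Q (w * Q)"
proof (rule LIMSEQ_imp_Suc)
  show "(\<lambda>M. phi1 x Q (Suc M) w) \<longlonglongrightarrow> w * qf (x\<^sup>2 - 1) Q (w * Q)"
    unfolding phi_Suc(2) by (intro tendsto_intros phi_tendsto Q)
qed

section \<open>Arithmetic progressions modulo t and their hook weights\<close>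

definition chain :: "nat \<Rightarrow> nat \<Rightarrow> nat set \<Rightarrow> nat set" where
  "chain t b T = (\<lambda>k. b + t * k) ` T"

lemma inj_chain: "t > 0 \<Longrightarrow> inj_on (\<lambda>k. b + t * k) (A :: nat set)"
  by (auto simp: inj_on_def)

lemma mem_chain_residue_unique:
  assumes "1 \<le> b" "b \<le> t" "1 \<le> b'" "b' \<le> t" "b + t * k = b' + t * (k'::nat)"
  shows "b = b' \<and> k = k'"
proof -
  have "k = k'"
  proof (rule ccontr)
    assume "k \<noteq> k'"
    then consider "k + 1 \<le> k'" | "k' + 1 \<le> k" by linarith
    then show False
    proof cases
      case 1
      then have "t * (k + 1) \<le> t * k'" by (rule mult_le_mono2)
      then show False using assms by simp
    next
      case 2
      then have "t * (k' + 1) \<le> t * k" by (rule mult_le_mono2)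
      then show False using assms by simp
    qed
  qed
  then show ?thesis using assms by simp
qed

lemma card_shift_chain:
  assumes "1 \<le> b" "b \<le> t"
  shows "card {i. 1 \<le> i \<and> i \<notin> chain t b T \<and> i + t \<in> chain t b T} = asc T"
proof -
  have t: "t > 0" using assms by simp
  have "{i. 1 \<le> i \<and> i \<notin> chain t b T \<and> i + t \<in> chain t b T} = (\<lambda>k. b + t * k) ` {k. k \<notin> T \<and> Suc k \<in> T}"
  proof (intro equalityI subsetI)
    fix i assume "i \<in> {i. 1 \<le> i \<and> i \<notin> chain t b T \<and> i + t \<in> chain t b T}"
    then obtain k where k: "1 \<le> i" "i \<notin> chain t b T" "k \<in> T" "i + t = b + t * k"
      by (auto simp: chain_def)
    show "i \<in> (\<lambda>k. b + t * k) ` {k. k \<notin> T \<and> Suc k \<in> T}"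
    proof (cases k)
      case 0
      then show ?thesis using k assms by simp
    next
      case (Suc j)
      then have "i = b + t * j" using k by simp
      then show ?thesis using k Suc by (auto simp: chain_def)
    qed
  next
    fix i assume "i \<in> (\<lambda>k. b + t * k) ` {k. k \<notin> T \<and> Suc k \<in> T}"
    then obtain k where k: "k \<notin> T" "Suc k \<in> T" "i = b + t * k" by auto
    have "i + t = b + t * Suc k" using k by simp
    then have "i + t \<in> chain t b T" using k unfolding chain_def by blast
    moreover have "i \<notin> chain t b T" using k t by (auto simp: chain_def)
    ultimately show "i \<in> {i. 1 \<le> i \<and> i \<notin> chain t b T \<and> i + t \<in> chain t b T}"
      using k assms by simp
  qed
  then show ?thesis using card_image[OF inj_chain[OF t]] by (simp add: asc_def)
qed

lemma mem_chain_small: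
  assumes "1 \<le> b" "b \<le> t" "1 \<le> a" "a \<le> t"
  shows "a \<in> chain t b T \<longleftrightarrow> a = b \<and> 0 \<in> T"
proof
  assume "a \<in> chain t b T"
  then obtain k where k: "k \<in> T" "a = b + t * k" by (auto simp: chain_def)
  then show "a = b \<and> 0 \<in> T" using mem_chain_residue_unique[of a t b 0 k] assms by auto
qed (auto simp: chain_def)

text \<open>The extra 1 is t itself if b = t; if 2 * b = t it is a = t - a = b, which the last term
  of \<open>hookN\<close> counts once.\<close>

lemma hookN_chain:
  assumes "1 \<le> b" "b \<le> t"
  shows "hookN t (chain t b T) = 2 * asc T + (if 0 \<in> T \<and> (b = t \<or> 2 * b = t) then 1 else 0)"
proof -
  have 1: "t \<in> chain t b T \<longleftrightarrow> t = b \<and> 0 \<in> T" using assms by (intro mem_chain_small) auto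
  have pos: "0 \<notin> chain t b T" using assms by (auto simp: chain_def)
  have "{a \<in> chain t b T. a < t \<and> t - a \<in> chain t b T} = (if 0 \<in> T \<and> 2 * b = t then {b} else {})"
  proof -
    have "a \<in> chain t b T \<and> a < t \<and> t - a \<in> chain t b T \<longleftrightarrow> 0 \<in> T \<and> 2 * b = t \<and> a = b" for a
    proof (cases "1 \<le> a \<and> a < t")
      case True
      then have a: "1 \<le> a" "a \<le> t" "1 \<le> t - a" "t - a \<le> t" by auto
      have 2: "a \<in> chain t b T \<longleftrightarrow> a = b \<and> 0 \<in> T" "t - a \<in> chain t b T \<longleftrightarrow> t - a = b \<and> 0 \<in> T"
        using mem_chain_small[OF assms a(1,2)] mem_chain_small[OF assms a(3,4)] by auto
      show ?thesis unfolding 2 using True by auto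
    next
      case False
      then show ?thesis using assms pos by (cases "a = 0") auto
    qed
    then show ?thesis by auto
  qed
  then show ?thesis using assms unfolding hookN_def card_shift_chain[OF assms] 1 by auto
qed

text \<open>The extra 2 counts both a = b and a = t - b, each being the complement of the
  other.\<close>

lemma hookN_chain_pair:
  assumes "1 \<le> b" "2 * b < t" "finite T" "finite T'"
  shows "hookN t (chain t b T \<union> chain t (t - b) T') = 2 * asc T + 2 * asc T' + (if 0 \<in> T \<and> 0 \<in> T' then 2 else 0)"
proof -
  let ?A = "chain t b T" and ?B = "chain t (t - b) T'"
  have b: "1 \<le> b" "b \<le> t" "1 \<le> t - b" "t - b \<le> t" "b \<noteq> t - b" "b \<noteq> t" "t - b \<noteq> t" using assms by auto
  have fin: "finite ?A" "finite ?B" using assms by (auto simp: chain_def)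
  have dj: "x \<noteq> y" "x \<noteq> y + t" "y \<noteq> x + t" if xy: "x \<in> ?A" "y \<in> ?B" for x y
  proof -
    obtain k k' where k: "x = b + t * k" "y = t - b + t * k'" using xy by (auto simp: chain_def)
    show "x \<noteq> y" using mem_chain_residue_unique[OF b(1-4), of k k'] b(5) k by auto
    show "x \<noteq> y + t" using mem_chain_residue_unique[OF b(1-4), of k "Suc k'"] b(5) k by auto
    show "y \<noteq> x + t" using mem_chain_residue_unique[OF b(1-4), of "Suc k" k'] b(5) k by auto
  qed
  have e: "{i. 1 \<le> i \<and> i \<notin> ?A \<union> ?B \<and> i + t \<in> ?A \<union> ?B} = {i. 1 \<le> i \<and> i \<notin> ?A \<and> i + t \<in> ?A} \<union> {i. 1 \<le> i \<and> i \<notin> ?B \<and> i + t \<in> ?B}"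
    using dj by blast
  have f: "finite {i. 1 \<le> i \<and> i \<notin> B \<and> i + t \<in> B}" if "finite B" for B
    using finite_shift[OF that, of "\<lambda>i. 1 \<le> i \<and> i \<notin> B" t] by simp
  have "card ({i. 1 \<le> i \<and> i \<notin> ?A \<and> i + t \<in> ?A} \<union> {i. 1 \<le> i \<and> i \<notin> ?B \<and> i + t \<in> ?B}) =
      card {i. 1 \<le> i \<and> i \<notin> ?A \<and> i + t \<in> ?A} + card {i. 1 \<le> i \<and> i \<notin> ?B \<and> i + t \<in> ?B}"
    using dj by (intro card_Un_disjoint f fin) blast
  then have 1: "card {i. 1 \<le> i \<and> i \<notin> ?A \<union> ?B \<and> i + t \<in> ?A \<union> ?B} = asc T + asc T'"
    unfolding e using card_shift_chain[OF b(1,2)] card_shift_chain[OF b(3,4)] by simp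
  have 2: "t \<notin> ?A \<union> ?B" using mem_chain_small[OF b(1,2)] mem_chain_small[OF b(3,4)] b by auto
  have "a \<in> ?A \<union> ?B \<and> a < t \<and> t - a \<in> ?A \<union> ?B \<longleftrightarrow> (0 \<in> T \<and> 0 \<in> T' \<and> (a = b \<or> a = t - b))" for a
  proof (cases "1 \<le> a \<and> a < t")
    case True
    then have a: "1 \<le> a" "a \<le> t" "1 \<le> t - a" "t - a \<le> t" by auto
    have "a \<in> ?A \<union> ?B \<longleftrightarrow> a = b \<and> 0 \<in> T \<or> a = t - b \<and> 0 \<in> T'"
      unfolding Un_iff mem_chain_small[OF b(1,2) a(1,2)] mem_chain_small[OF b(3,4) a(1,2)] ..
    moreover have "t - a \<in> ?A \<union> ?B \<longleftrightarrow> t - a = b \<and> 0 \<in> T \<or> t - a = t - b \<and> 0 \<in> T'"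
      unfolding Un_iff mem_chain_small[OF b(1,2) a(3,4)] mem_chain_small[OF b(3,4) a(3,4)] ..
    moreover have "t - a = b \<longleftrightarrow> a = t - b" "t - a = t - b \<longleftrightarrow> a = b" "a < t" using True b by auto
    ultimately show ?thesis using b(5) by metis
  next
    case False
    have "0 \<notin> ?A \<union> ?B" using b by (auto simp: chain_def)
    then show ?thesis using False b by (cases "a = 0") auto
  qed
  then have "{a \<in> ?A \<union> ?B. a < t \<and> t - a \<in> ?A \<union> ?B} = (if 0 \<in> T \<and> 0 \<in> T' then {b, t - b} else {})"
    by auto
  then have 3: "card {a \<in> ?A \<union> ?B. a < t \<and> t - a \<in> ?A \<union> ?B} = (if 0 \<in> T \<and> 0 \<in> T' then 2 else 0)"
    using b by simp
  show ?thesis unfolding hookN_def 1 3 using 2 by simp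
qed

lemma Pow_chain: "Pow (chain t b A) = chain t b ` Pow A"
  unfolding chain_def by (auto simp: subset_image_iff)

lemma inj_on_chain: "t > 0 \<Longrightarrow> inj_on (chain t b) (Pow A)"
  unfolding chain_def using inj_chain[of t b UNIV] by (auto simp: inj_on_def inj_image_eq_iff)

lemma sum_chain: "t > 0 \<Longrightarrow> \<Sum>(chain t b T) = b * card T + t * \<Sum>T"
  unfolding chain_def by (simp add: sum.reindex[OF inj_chain] sum.distrib sum_distrib_left)

lemma wsum_chain:
  assumes "1 \<le> b" "b \<le> t" "b = t \<or> 2 * b = t"
  shows "wsum x q t (chain t b {..<M}) = phi x (q ^ t) M (q ^ b) + (x - 1) * phi1 x (q ^ t) M (q ^ b)"
proof -
  have t: "t > 0" using assms by simp
  have "wsum x q t (chain t b {..<M}) = (\<Sum>T\<in>Pow {..<M}. x ^ hookN t (chain t b T) * q ^ \<Sum>(chain t b T))"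
    unfolding wsum_def Pow_chain by (simp add: sum.reindex[OF inj_on_chain[OF t]])
  also have "\<dots> = phi x (q ^ t) M (q ^ b) + (x - 1) * phi1 x (q ^ t) M (q ^ b)"
    unfolding phi_def phi1_def sum_distrib_left sum.distrib[symmetric]
    by (intro sum.cong refl) (use assms in \<open>auto simp: hookN_chain sum_chain[OF t] power_add power_mult algebra_simps\<close>)
  finally show ?thesis .
qed

lemma wsum_chain_pair:
  assumes "1 \<le> b" "2 * b < t"
  shows "wsum x q t (chain t b {..<M} \<union> chain t (t - b) {..<M}) =
    phi x (q ^ t) M (q ^ b) * phi x (q ^ t) M (q ^ (t - b)) +
    (x\<^sup>2 - 1) * phi1 x (q ^ t) M (q ^ b) * phi1 x (q ^ t) M (q ^ (t - b))"
proof -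
  have t: "t > 0" using assms by simp
  let ?W = "\<lambda>b T. x ^ (2 * asc T) * (q ^ b) ^ card T * (q ^ t) ^ \<Sum>T"
  have dj: "chain t b A \<inter> chain t (t - b) B = {}" for A B
  proof (rule ccontr)
    assume "\<not> ?thesis"
    then obtain k k' where "b + t * k = t - b + t * k'" by (auto simp: chain_def)
    then show False using mem_chain_residue_unique[of b t "t - b" k k'] assms by auto
  qed
  have "wsum x q t (chain t b {..<M} \<union> chain t (t - b) {..<M}) = 
     (\<Sum>T\<in>Pow {..<M}. \<Sum>T'\<in>Pow {..<M}. x ^ hookN t (chain t b T \<union> chain t (t - b) T') * q ^ \<Sum>(chain t b T \<union> chain t (t - b) T'))"
    unfolding wsum_def by (simp add: sum_Pow_union[OF dj] Pow_chain sum.reindex[OF inj_on_chain[OF t]])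
  also have "\<dots> = (\<Sum>T\<in>Pow {..<M}. \<Sum>T'\<in>Pow {..<M}. ?W b T * ?W (t - b) T' + 
      (x\<^sup>2 - 1) * ((if 0 \<in> T then ?W b T else 0) * (if 0 \<in> T' then ?W (t - b) T' else 0)))"
  proof (intro sum.cong refl)
    fix T T' assume "T \<in> Pow {..<M}" "T' \<in> Pow {..<M}"
    then have fin: "finite T" "finite T'" by (auto intro: finite_subset)
    then have "\<Sum>(chain t b T \<union> chain t (t - b) T') = \<Sum>(chain t b T) + \<Sum>(chain t (t - b) T')"
      by (intro sum.union_disjoint dj) (auto simp: chain_def)
    then have "q ^ \<Sum>(chain t b T \<union> chain t (t - b) T') = (q ^ b) ^ card T * (q ^ t) ^ \<Sum>T * ((q ^ (t - b)) ^ card T' * (q ^ t) ^ \<Sum>T')"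
      by (simp add: sum_chain[OF t] power_add power_mult)
    then show "x ^ hookN t (chain t b T \<union> chain t (t - b) T') * q ^ \<Sum>(chain t b T \<union> chain t (t - b) T') =
       ?W b T * ?W (t - b) T' + (x\<^sup>2 - 1) * ((if 0 \<in> T then ?W b T else 0) * (if 0 \<in> T' then ?W (t - b) T' else 0))"
      by (simp add: hookN_chain_pair[OF assms fin] power_add algebra_simps)
  qed
  also have "\<dots> = phi x (q ^ t) M (q ^ b) * phi x (q ^ t) M (q ^ (t - b)) +
    (x\<^sup>2 - 1) * (phi1 x (q ^ t) M (q ^ b) * phi1 x (q ^ t) M (q ^ (t - b)))"
  proof -
    have "(\<Sum>T\<in>A. \<Sum>T'\<in>A. c * h T T') = c * (\<Sum>T\<in>A. \<Sum>T'\<in>A. h T T')" for A c and h :: "nat set \<Rightarrow> nat set \<Rightarrow> complex"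
      by (simp only: sum_distrib_left)
    then show ?thesis unfolding phi_def phi1_def sum.distrib by (simp only: sum_product)
  qed
  finally show ?thesis by (simp add: mult.assoc)
qed

text \<open>The limit contribution of a class fixed by b -> t - b. Its smallest member carries one
  more factor x, written as 1 + (x - 1) on the sets that contain it.\<close>

definition self_class :: "complex \<Rightarrow> complex \<Rightarrow> complex \<Rightarrow> complex" where
  "self_class x Q w = qf (x\<^sup>2 - 1) Q w + (x - 1) * (w * qf (x\<^sup>2 - 1) Q (w * Q))"

text \<open>The factors belong to the residue class \<open>0\<close>, the class \<open>t div 2\<close> and the pairs of classes
  \<open>b\<close>, \<open>t - b\<close>.\<close>

definition hookF :: "nat \<Rightarrow> complex \<Rightarrow> complex \<Rightarrow> complex" where
  "hookF t x q = self_class x (q ^ t) (q ^ t) * (if even t then self_class x (q ^ t) (q ^ (t div 2)) else 1)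
     * (\<Prod>b\<in>{1..(t - 1) div 2}. qG (x\<^sup>2 - 1) (q ^ t) (q ^ b))"

text \<open>Index 0 stands for the multiples of t, whose smallest member is t because 0 is no part.
  For even t and i = t div 2 the two chains coincide.\<close>

definition residue_class :: "nat \<Rightarrow> nat \<Rightarrow> nat \<Rightarrow> nat set" where
  "residue_class t M i = (if i = 0 then chain t t {..<M} else chain t i {..<M} \<union> chain t (t - i) {..<M})"

lemma residue_class_dvd:
  assumes "a \<in> residue_class t M i" "i \<le> t"
  shows "int t dvd int a - int i \<or> int t dvd int a + int i"
proof (cases "i = 0")
  case True
  then obtain k where "a = t + t * k" using assms by (auto simp: residue_class_def chain_def)
  then have "int a = int t * (1 + int k)" by (simp add: algebra_simps)
  then show ?thesis using True by simp
next
  case False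
  then consider k where "a = i + t * k" | k where "a = t - i + t * k"
    using assms by (auto simp: residue_class_def chain_def)
  then show ?thesis
  proof cases
    case 1
    then have "int a - int i = int t * int k" by simp
    then show ?thesis by simp
  next
    case 2
    then have "int a + int i = int t * (1 + int k)" using assms(2) by (simp add: of_nat_diff algebra_simps)
    then show ?thesis by simp
  qed
qed

text \<open>Members of the two classes are congruent to plus or minus i and plus or minus j. Any
  interaction would make i congruent to j or to -j modulo t, impossible for different indices
  between 0 and t div 2.\<close>

lemma residue_class_separated:
  assumes "i \<le> t div 2" "j \<le> t div 2" "i \<noteq> j" "t > 0"
  shows "separated t (residue_class t M i) (residue_class t M j)"
  unfolding separated_def
proof (intro ballI)
  fix a b assume a: "a \<in> residue_class t M i" and b: "b \<in> residue_class t M j"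
  have da: "int t dvd int a - int i \<or> int t dvd int a + int i"
    using a assms by (intro residue_class_dvd[of a t M]) auto
  have db: "int t dvd int b - int j \<or> int t dvd int b + int j"
    using b assms by (intro residue_class_dvd[of b t M]) auto
  have no: "\<not> int t dvd int i - int j" "\<not> int t dvd int i + int j"
  proof -
    have small: "\<not> int t dvd m" if "m \<noteq> 0" "\<bar>m\<bar> < int t" for m
      using that zdvd_not_zless[of "\<bar>m\<bar>" "int t"] by auto
    show "\<not> int t dvd int i - int j" using assms by (intro small) linarith+
    show "\<not> int t dvd int i + int j" using assms by (intro small) linarith+
  qed
  have no': "\<not> int t dvd int j - int i" using no(1) by (metis dvd_minus_iff minus_diff_eq)
  have key: False if d: "int t dvd int a - int b \<or> int t dvd int a + int b"
  proof -
    obtain e where e: "e = 1 \<or> e = -1" "int t dvd int a + e * int i" using da by force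
    obtain f where f: "f = 1 \<or> f = -1" "int t dvd int b + f * int j" using db by force
    obtain g where g: "g = 1 \<or> g = -1" "int t dvd int a + g * int b" using d by force
    have "int t dvd (int a + g * int b) - (int a + e * int i) - g * (int b + f * int j)"
      by (intro dvd_diff dvd_mult g f e)
    also have "(int a + g * int b) - (int a + e * int i) - g * (int b + f * int j) = - (e * int i) - g * f * int j"
      by (simp add: algebra_simps)
    finally have "int t dvd - (e * int i) - g * f * int j" .
    then have "int t dvd e * int i + g * f * int j" by (metis dvd_minus_iff minus_diff_eq diff_minus_eq_add uminus_add_conv_diff minus_add_distrib add.commute)
    then have "int t dvd e * (e * int i + g * f * int j)" by (rule dvd_mult)
    moreover have "e * e = 1" "e * g * f = 1 \<or> e * g * f = -1" using e f g by auto
    ultimately have "int t dvd int i + int j \<or> int t dvd int i - int j"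
      by (auto simp: distrib_left mult.assoc[symmetric])
    then show False using no by simp
  qed
  have 1: "int t dvd int a - int b" if "a = b" using that by simp
  have 2: "int t dvd int a - int b" if "a = b + t" using that by simp
  have 3: "int t dvd int a - int b" if "b = a + t" using that by simp
  have 4: "int t dvd int a + int b" if "a + b = t" using that by (metis dvd_refl of_nat_add)
  show "a \<noteq> b \<and> a \<noteq> b + t \<and> b \<noteq> a + t \<and> a + b \<noteq> t"
    using key 1 2 3 4 by blast
qed

lemma residue_class_cover:
  assumes "t > 0"
  shows "{1..t * M} = (\<Union>i\<in>{0..t div 2}. residue_class t M i)"
proof (intro equalityI subsetI)
  fix a assume a: "a \<in> {1..t * M}"
  define b k where "b = (a - 1) mod t + 1" and "k = (a - 1) div t"
  have ab: "a = b + t * k" using a unfolding b_def k_def by (simp add: algebra_simps)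
  have b: "1 \<le> b" "b \<le> t" using assms by (auto simp: b_def Suc_leI)
  have "k < M" using a unfolding k_def by (simp add: div_less_iff_less_mult[OF assms] mult.commute) linarith
  then have mem: "a \<in> chain t b {..<M}" using ab by (auto simp: chain_def)
  consider "b = t" | "b \<le> t div 2" "b \<noteq> t" | "b < t" "t - b \<le> t div 2" using b by linarith
  then show "a \<in> (\<Union>i\<in>{0..t div 2}. residue_class t M i)"
  proof cases
    case 1
    then show ?thesis using mem by (intro UN_I[of 0]) (auto simp: residue_class_def)
  next
    case 2
    then show ?thesis using mem b by (intro UN_I[of b]) (auto simp: residue_class_def)
  next
    case 3
    then show ?thesis using mem b by (intro UN_I[of "t - b"]) (auto simp: residue_class_def)
  qed
next
  have ch: "x \<in> {1..t * M}" if xb: "x \<in> chain t b {..<M}" "1 \<le> b" "b \<le> t" for x b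
  proof -
    obtain k where k: "k < M" "x = b + t * k" using xb by (auto simp: chain_def)
    have "t * (k + 1) \<le> t * M" using k by (intro mult_le_mono2) auto
    then show ?thesis using k xb by auto
  qed
  fix a assume "a \<in> (\<Union>i\<in>{0..t div 2}. residue_class t M i)"
  then obtain i where i: "i \<le> t div 2" "a \<in> residue_class t M i" by auto
  show "a \<in> {1..t * M}"
  proof (cases "i = 0")
    case True
    then show ?thesis using i assms ch[of a t] by (auto simp: residue_class_def)
  next
    case False
    have "i \<le> t" "t - i \<ge> 1" "t - i \<le> t" using i assms False by linarith+
    then show ?thesis using i False ch[of a i] ch[of a "t - i"] by (auto simp: residue_class_def)
  qed
qed

lemma pair_tendsto:
  assumes Q: "norm Q < 1" "w * w' = Q" "w \<noteq> 0"
  shows "(\<lambda>M. phi x Q M w * phi x Q M w' + (x\<^sup>2 - 1) * phi1 x Q M w * phi1 x Q M w') \<longlonglongrightarrow> qG (x\<^sup>2 - 1) Q w"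
proof -
  have "(\<lambda>M. phi x Q M w * phi x Q M w' + (x\<^sup>2 - 1) * phi1 x Q M w * phi1 x Q M w') \<longlonglongrightarrow>
     qf (x\<^sup>2 - 1) Q w * qf (x\<^sup>2 - 1) Q w' + (x\<^sup>2 - 1) * (w * qf (x\<^sup>2 - 1) Q (w * Q)) * (w' * qf (x\<^sup>2 - 1) Q (w' * Q))"
    by (intro tendsto_intros phi_tendsto phi1_tendsto Q)
  also have "w' = Q / w" "w' * Q = Q\<^sup>2 / w" using Q by (auto simp: field_simps power2_eq_square)
  then have "qf (x\<^sup>2 - 1) Q w * qf (x\<^sup>2 - 1) Q w' + (x\<^sup>2 - 1) * (w * qf (x\<^sup>2 - 1) Q (w * Q)) * (w' * qf (x\<^sup>2 - 1) Q (w' * Q)) = qG (x\<^sup>2 - 1) Q w"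
    using Q by (simp add: qG_def mult_ac)
  finally show ?thesis .
qed

lemma self_class_tendsto:
  assumes Q: "norm Q < 1"
  shows "(\<lambda>M. phi x Q M w + (x - 1) * phi1 x Q M w) \<longlonglongrightarrow> self_class x Q w"
  unfolding self_class_def by (intro tendsto_intros phi_tendsto phi1_tendsto Q)

lemma wsum_tendsto_hookF:
  assumes t: "t > 0" and q: "q \<noteq> 0" "norm q < 1"
  shows "(\<lambda>M. wsum x q t {1..t * M}) \<longlonglongrightarrow> hookF t x q"
proof -
  have Q: "norm (q ^ t) < 1"
    using q t by (simp add: norm_power power_less_one_iff)
  define h where "h = (\<lambda>M i. wsum x q t (residue_class t M i))"
  have fin: "finite (residue_class t M i)" for M i by (simp add: residue_class_def chain_def)
  have "wsum x q t {1..t * M} = (\<Prod>i\<in>{0..t div 2}. h M i)" for M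
    unfolding residue_class_cover[OF t] h_def using t
    by (intro wsum_UN fin residue_class_separated) auto
  also have "(\<Prod>i\<in>{0..t div 2}. h M i) = h M 0 * (if even t then h M (t div 2) else 1) * (\<Prod>b\<in>{1..(t - 1) div 2}. h M b)" for M
  proof (cases "even t")
    case True
    then have "{0..t div 2} = insert 0 (insert (t div 2) {1..(t - 1) div 2})" "0 \<notin> insert (t div 2) {1..(t - 1) div 2}" "t div 2 \<notin> {1..(t - 1) div 2}"
      using t by (auto elim!: evenE)
    then show ?thesis using True by simp
  next
    case False
    then have "{0..t div 2} = insert 0 {1..(t - 1) div 2}" "0 \<notin> {1..(t - 1) div 2}"
      by (auto elim!: oddE)
    then show ?thesis using False by simp
  qed
  finally have eq: "wsum x q t {1..t * M} = h M 0 * (if even t then h M (t div 2) else 1) * (\<Prod>b\<in>{1..(t - 1) div 2}. h M b)" for M .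
  have 0: "(\<lambda>M. h M 0) \<longlonglongrightarrow> self_class x (q ^ t) (q ^ t)"
    unfolding h_def residue_class_def using t self_class_tendsto[OF Q, of x "q ^ t"] by (simp add: wsum_chain)
  have half: "(\<lambda>M. h M (t div 2)) \<longlonglongrightarrow> self_class x (q ^ t) (q ^ (t div 2))" if "even t"
  proof -
    have "t div 2 \<noteq> 0" "t - t div 2 = t div 2" "1 \<le> t div 2" "t div 2 \<le> t" "2 * (t div 2) = t"
      using that t by (auto elim!: evenE)
    then show ?thesis
      unfolding h_def residue_class_def using self_class_tendsto[OF Q, of x "q ^ (t div 2)"] by (simp add: wsum_chain)
  qed
  have pair: "(\<lambda>M. h M b) \<longlonglongrightarrow> qG (x\<^sup>2 - 1) (q ^ t) (q ^ b)" if "b \<in> {1..(t - 1) div 2}" for b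
  proof -
    have b: "1 \<le> b" "2 * b < t" using that by auto
    have "q ^ b * q ^ (t - b) = q ^ t" using b by (simp flip: power_add)
    then have "(\<lambda>M. phi x (q ^ t) M (q ^ b) * phi x (q ^ t) M (q ^ (t - b)) + (x\<^sup>2 - 1) * phi1 x (q ^ t) M (q ^ b) * phi1 x (q ^ t) M (q ^ (t - b))) \<longlonglongrightarrow> qG (x\<^sup>2 - 1) (q ^ t) (q ^ b)"
      using Q q by (intro pair_tendsto) auto
    then show ?thesis
      unfolding h_def residue_class_def using b by (simp add: wsum_chain_pair)
  qed
  have "(\<lambda>M. h M 0 * (if even t then h M (t div 2) else 1) * (\<Prod>b\<in>{1..(t - 1) div 2}. h M b)) \<longlonglongrightarrow> hookF t x q"
    unfolding hookF_def using half by (intro tendsto_mult tendsto_prod pair 0) auto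
  then show ?thesis unfolding eq .
qed

section \<open>From finite truncations to power series in q\<close>

definition strict_sets :: "nat \<Rightarrow> nat set set" where
  "strict_sets n = {S. finite S \<and> 0 \<notin> S \<and> \<Sum>S = n}"

definition hookpoly :: "nat \<Rightarrow> nat \<Rightarrow> 'a \<Rightarrow> 'a :: comm_semiring_1" where
  "hookpoly t n x = (\<Sum>S\<in>strict_sets n. x ^ hookN t S)"

lemma strict_sets_subset: "strict_sets n \<subseteq> Pow {1..n}"
proof
  fix S assume "S \<in> strict_sets n"
  then have S: "finite S" "0 \<notin> S" "\<Sum>S = n" by (auto simp: strict_sets_def)
  have "a \<in> {1..n}" if "a \<in> S" for a
  proof -
    have "a \<le> \<Sum>S" using S(1) that by (intro member_le_sum) auto
    then show ?thesis using S that by (cases "a = 0") auto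
  qed
  then show "S \<in> Pow {1..n}" by blast
qed

lemma finite_strict_sets: "finite (strict_sets n)"
  using strict_sets_subset by (rule finite_subset) simp

lemma sum_strict_sets_lessThan:
  fixes g :: "nat set \<Rightarrow> 'a :: comm_monoid_add"
  shows "(\<Sum>n<N. \<Sum>S\<in>strict_sets n. g S) = (\<Sum>S\<in>(\<Union>n\<in>{..<N}. strict_sets n). g S)"
  by (rule sum.UNION_disjoint[symmetric]) (auto simp: finite_strict_sets, auto simp: strict_sets_def)

text \<open>Exhausting the finite sets of positive integers by their sum or by their largest element
  gives interleaved families, and with nonnegative weights the partial sums interleave too.\<close>

lemma hookpoly_partial_le:
  fixes X r :: real
  assumes "t > 0" "X \<ge> 0" "r \<ge> 0"
  defines "W \<equiv> \<lambda>M. \<Sum>S\<in>Pow {1..t * M}. X ^ hookN t S * r ^ \<Sum>S"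
  shows "(\<Sum>n<M. hookpoly t n X * r ^ n) \<le> W M"
    and "W M \<le> (\<Sum>n<Suc (t * M * (t * M)). hookpoly t n X * r ^ n)"
proof -
  define g where "g = (\<lambda>S. X ^ hookN t S * r ^ \<Sum>S)"
  have g0: "g S \<ge> 0" for S using assms by (simp add: g_def)
  have eq: "(\<Sum>n<N. hookpoly t n X * r ^ n) = (\<Sum>S\<in>(\<Union>n\<in>{..<N}. strict_sets n). g S)" for N
    unfolding sum_strict_sets_lessThan[symmetric] hookpoly_def sum_distrib_right g_def
    by (intro sum.cong refl) (auto simp: strict_sets_def)
  show "(\<Sum>n<M. hookpoly t n X * r ^ n) \<le> W M"
    unfolding eq W_def g_def[symmetric]
  proof (intro sum_mono2 g0)
    have "strict_sets n \<subseteq> Pow {1..t * M}" if "n < M" for n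
    proof -
      have "n \<le> t * M" using that assms(1) by (cases t) auto
      then have "{1..n} \<subseteq> {1..t * M}" by auto
      then show ?thesis using strict_sets_subset[of n] by blast
    qed
    then show "(\<Union>n\<in>{..<M}. strict_sets n) \<subseteq> Pow {1..t * M}" by blast
  qed simp
  show "W M \<le> (\<Sum>n<Suc (t * M * (t * M)). hookpoly t n X * r ^ n)"
    unfolding eq W_def g_def[symmetric]
  proof (intro sum_mono2 g0)
    show "finite (\<Union>n\<in>{..<Suc (t * M * (t * M))}. strict_sets n)" by (auto simp: finite_strict_sets)
    show "Pow {1..t * M} \<subseteq> (\<Union>n\<in>{..<Suc (t * M * (t * M))}. strict_sets n)"
    proof
      fix S assume S: "S \<in> Pow {1..t * M}"
      then have fin: "finite S" by (auto intro: finite_subset)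
      have "\<Sum>S \<le> (\<Sum>a\<in>S. t * M)" using S by (intro sum_mono) auto
      also have "\<dots> = card S * (t * M)" by simp
      also have "\<dots> \<le> t * M * (t * M)" using S card_mono[of "{1..t * M}" S] by (intro mult_le_mono1) auto
      finally show "S \<in> (\<Union>n\<in>{..<Suc (t * M * (t * M))}. strict_sets n)"
        using S fin by (intro UN_I[of "\<Sum>S"]) (auto simp: strict_sets_def)
    qed
  qed
qed

lemma hookpoly_nonneg: "X \<ge> 0 \<Longrightarrow> hookpoly t n (X :: real) \<ge> 0"
  unfolding hookpoly_def by (intro sum_nonneg) auto

text \<open>Boundedness of the partial sums is borrowed from the convergence of \<open>wsum\<close>
  to \<open>hookF\<close> at the real point; the sandwich then makes both exhaustions converge to
  the same value.\<close>

lemma hookpoly_real_sums: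
  fixes X r :: real
  assumes t: "t > 0" and X: "X \<ge> 0" and r: "0 < r" "r < 1"
  defines "W \<equiv> \<lambda>M. \<Sum>S\<in>Pow {1..t * M}. X ^ hookN t S * r ^ \<Sum>S"
  shows "summable (\<lambda>n. hookpoly t n X * r ^ n)" "W \<longlonglongrightarrow> (\<Sum>n. hookpoly t n X * r ^ n)"
proof -
  define P where "P = (\<lambda>N. \<Sum>n<N. hookpoly t n X * r ^ n)"
  have le: "P M \<le> W M" "W M \<le> P (Suc (t * M * (t * M)))" for M
    using hookpoly_partial_le[OF t X, of r M] r unfolding P_def W_def by auto
  have a0: "hookpoly t n X * r ^ n \<ge> 0" for n using X r by (simp add: hookpoly_nonneg)
  have W: "of_real (W M) = wsum (of_real X) (of_real r) t {1..t * M}" for M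
    by (simp add: W_def wsum_def)
  have "(\<lambda>M. wsum (of_real X) (of_real r) t {1..t * M}) \<longlonglongrightarrow> hookF t (of_real X) (of_real r)"
    using t r by (intro wsum_tendsto_hookF) auto
  then have "Bseq (\<lambda>M. complex_of_real (W M))" unfolding W by (intro convergent_imp_Bseq convergentI)
  then obtain K where K: "\<And>M. norm (complex_of_real (W M)) \<le> K" by (auto simp: Bseq_def)
  have "P M \<le> K" for M using le(1)[of M] K[of M] by simp
  then show sm: "summable (\<lambda>n. hookpoly t n X * r ^ n)"
    unfolding P_def using a0 by (intro summableI_nonneg_bounded[of _ K]) auto
  have up: "W M \<le> (\<Sum>n. hookpoly t n X * r ^ n)" for M
    using le(2)[of M] sum_le_suminf[OF sm, of "{..<Suc (t * M * (t * M))}"] a0 unfolding P_def by force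
  show "W \<longlonglongrightarrow> (\<Sum>n. hookpoly t n X * r ^ n)"
  proof (rule tendsto_sandwich[of P _ _ "\<lambda>_. \<Sum>n. hookpoly t n X * r ^ n"])
    show "P \<longlonglongrightarrow> (\<Sum>n. hookpoly t n X * r ^ n)" unfolding P_def by (rule summable_LIMSEQ[OF sm])
  qed (use le up in auto)
qed

lemma norm_hookpoly_le:
  assumes "norm x \<le> X"
  shows "norm (hookpoly t n x :: complex) \<le> hookpoly t n X"
  unfolding hookpoly_def using assms
  by (intro sum_norm_le) (auto simp: norm_power intro!: power_mono)

text \<open>The two complex exhaustions differ by a sum over the sets missed by one of them, which
  is dominated by the same difference at \<open>norm x\<close> and \<open>norm q\<close>; that
  difference tends to 0 by the real case.\<close>

theorem hookpoly_sums_hookF: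
  assumes t: "t > 0" and q: "q \<noteq> 0" "norm q < 1"
  shows "(\<lambda>n. hookpoly t n x * q ^ n) sums hookF t x q"
proof -
  define X r where "X = norm x" and "r = norm q"
  have X: "X \<ge> 0" and r: "0 < r" "r < 1" using q by (auto simp: X_def r_def)
  define W where "W = (\<lambda>M. \<Sum>S\<in>Pow {1..t * M}. X ^ hookN t S * r ^ \<Sum>S)"
  define P where "P = (\<lambda>N. \<Sum>n<N. hookpoly t n X * r ^ n)"
  define U where "U = (\<lambda>M. \<Union>n\<in>{..<M}. strict_sets n)"
  have sub: "U M \<subseteq> Pow {1..t * M}" for M
  proof -
    have "strict_sets n \<subseteq> Pow {1..t * M}" if "n < M" for n
    proof -
      have "n \<le> t * M" using that t by (cases t) auto
      then have "{1..n} \<subseteq> {1..t * M}" by auto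
      then show ?thesis using strict_sets_subset[of n] by blast
    qed
    then show ?thesis unfolding U_def by blast
  qed
  have eqr: "P M = (\<Sum>S\<in>U M. X ^ hookN t S * r ^ \<Sum>S)" for M
    unfolding P_def U_def sum_strict_sets_lessThan[symmetric] hookpoly_def sum_distrib_right
    by (intro sum.cong refl) (auto simp: strict_sets_def)
  have eqc: "(\<Sum>n<M. hookpoly t n x * q ^ n) = (\<Sum>S\<in>U M. x ^ hookN t S * q ^ \<Sum>S)" for M
    unfolding U_def sum_strict_sets_lessThan[symmetric] hookpoly_def sum_distrib_right
    by (intro sum.cong refl) (auto simp: strict_sets_def)
  have bound: "norm (wsum x q t {1..t * M} - (\<Sum>n<M. hookpoly t n x * q ^ n)) \<le> W M - P M" for M
  proof -
    have "wsum x q t {1..t * M} - (\<Sum>n<M. hookpoly t n x * q ^ n) = (\<Sum>S\<in>Pow {1..t * M} - U M. x ^ hookN t S * q ^ \<Sum>S)"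
      unfolding wsum_def eqc using sub by (subst sum_diff) auto
    also have "norm \<dots> \<le> (\<Sum>S\<in>Pow {1..t * M} - U M. X ^ hookN t S * r ^ \<Sum>S)"
      by (intro sum_norm_le) (simp add: norm_mult norm_power X_def r_def)
    also have "\<dots> = W M - P M"
      unfolding W_def eqr using sub by (subst sum_diff) auto
    finally show ?thesis .
  qed
  have "(\<lambda>M. W M - P M) \<longlonglongrightarrow> (\<Sum>n. hookpoly t n X * r ^ n) - (\<Sum>n. hookpoly t n X * r ^ n)"
    unfolding P_def W_def using hookpoly_real_sums[OF t X r] by (intro tendsto_diff summable_LIMSEQ) auto
  then have "(\<lambda>M. W M - P M) \<longlonglongrightarrow> 0" by simp
  then have 0: "(\<lambda>M. wsum x q t {1..t * M} - (\<Sum>n<M. hookpoly t n x * q ^ n)) \<longlonglongrightarrow> 0"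
    by (rule Lim_null_comparison[rotated]) (intro always_eventually allI bound)
  have "(\<lambda>M. wsum x q t {1..t * M} - (wsum x q t {1..t * M} - (\<Sum>n<M. hookpoly t n x * q ^ n))) \<longlonglongrightarrow> hookF t x q - 0"
    by (intro tendsto_diff 0 wsum_tendsto_hookF t q)
  then show ?thesis unfolding sums_def by simp
qed

text \<open>Serves the connectedness argument in \<open>hookF_major\<close>. The M-test uses the
  nonnegative series at the radius X.\<close>

lemma continuous_on_hookF:
  assumes t: "t > 0" and q: "q \<noteq> 0" "norm q < 1"
  shows "continuous_on (cball 0 X) (\<lambda>x. hookF t x q)"
proof (cases "X \<ge> 0")
  case True
  have "uniform_limit (cball 0 X) (\<lambda>N x. \<Sum>n<N. hookpoly t n x * q ^ n) (\<lambda>x. \<Sum>n. hookpoly t n x * q ^ n) sequentially"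
  proof (rule Weierstrass_m_test)
    show "summable (\<lambda>n. hookpoly t n X * norm q ^ n)"
      using q by (intro hookpoly_real_sums t True) auto
    show "norm (hookpoly t n x * q ^ n) \<le> hookpoly t n X * norm q ^ n" if "x \<in> cball 0 X" for n x
      using that norm_hookpoly_le[of x X] by (auto simp: norm_mult norm_power intro!: mult_right_mono)
  qed
  moreover have "continuous_on (cball 0 X) (\<lambda>x. \<Sum>n<N. hookpoly t n x * q ^ n)" for N
    unfolding hookpoly_def by (intro continuous_intros)
  ultimately have "continuous_on (cball 0 X) (\<lambda>x. \<Sum>n. hookpoly t n x * q ^ n)"
    by (intro uniform_limit_theorem[rotated]) auto
  then show ?thesis using hookpoly_sums_hookF[OF t q] by (simp add: sums_iff)
next
  case False
  then show ?thesis by simp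
qed

section \<open>The products at a cusp\<close>

text \<open>This is minus the dilogarithm at -y. The term n = 0 vanishes because division by 0
  yields 0.\<close>

definition altdilog :: "complex \<Rightarrow> complex" where
  "altdilog y = (\<Sum>n. (-1) ^ Suc n / of_nat n ^ 2 * y ^ n)"

lemma summable_altdilog_coeffs: "summable (\<lambda>n. norm ((-1) ^ Suc n / of_nat n ^ 2 :: complex))"
proof -
  have "summable (\<lambda>n. 1 / real n ^ 2)"
    using inverse_power_summable[of 2, where 'a = real] by (simp add: inverse_eq_divide)
  then show ?thesis by (simp add: norm_divide norm_power norm_mult)
qed

lemma continuous_on_altdilog: "continuous_on (cball 0 1) altdilog"
proof -
  have "uniform_limit (cball 0 1) (\<lambda>n y. \<Sum>i<n. (-1) ^ Suc i / of_nat i ^ 2 * y ^ i) 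
          (\<lambda>y. \<Sum>i. (-1) ^ Suc i / of_nat i ^ 2 * y ^ i :: complex) sequentially"
  proof (rule Weierstrass_m_test[OF _ summable_altdilog_coeffs])
    fix n and y :: complex assume "y \<in> cball 0 1"
    then have "norm y ^ n \<le> 1" by (intro power_le_one) auto
    then show "norm ((-1) ^ Suc n / of_nat n ^ 2 * y ^ n) \<le> norm ((-1) ^ Suc n / of_nat n ^ 2 :: complex)"
      unfolding norm_mult norm_power by (rule mult_left_le) simp
  qed
  then have "continuous_on (cball 0 1) (\<lambda>y. \<Sum>i. (-1) ^ Suc i / of_nat i ^ 2 * y ^ i :: complex)"
    by (rule uniform_limit_theorem[rotated])
      (simp, intro always_eventually allI continuous_on_sum continuous_on_mult continuous_on_power continuous_on_const continuous_on_id)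
  then show ?thesis by (simp add: altdilog_def[abs_def])
qed

lemma altdilog_0 [simp]: "altdilog 0 = 0"
proof -
  have "altdilog 0 = (\<Sum>n. (0::complex))"
    unfolding altdilog_def by (intro suminf_cong) (auto simp: power_0_left)
  then show ?thesis by simp
qed

lemma has_field_derivative_altdilog:
  assumes "norm y < 1" "y \<noteq> 0"
  shows "(altdilog has_field_derivative (Ln (1 + y) / y)) (at y)"
proof -
  define c where "c = (\<lambda>n. (-1) ^ Suc n / of_nat n ^ 2 :: complex)"
  have "summable (\<lambda>n. c n * 1 ^ n)"
    using summable_norm_cancel[OF summable_altdilog_coeffs] by (simp add: c_def)
  moreover have "altdilog = (\<lambda>y. \<Sum>n. c n * y ^ n)"
    by (simp add: altdilog_def c_def fun_eq_iff)
  ultimately have D: "(altdilog has_field_derivative (\<Sum>n. diffs c n * y ^ n)) (at y)"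
    using assms termdiffs_strong[of c 1 y] by simp
  have "(\<lambda>n. (-1) ^ Suc (Suc n) / of_nat (Suc n) * y ^ Suc n) sums (Ln (1 + y) - (-1) ^ Suc 0 / of_nat 0 * y ^ 0)"
    using Ln_series[OF assms(1)] by (subst sums_Suc_iff) simp
  then have "(\<lambda>n. (1 / y) * ((-1) ^ Suc (Suc n) / of_nat (Suc n) * y ^ Suc n)) sums ((1 / y) * Ln (1 + y))"
    by (intro sums_mult) simp
  moreover have "(1 / y) * ((-1) ^ Suc (Suc n) / of_nat (Suc n) * y ^ Suc n) = diffs c n * y ^ n" for n
  proof -
    have "of_nat (Suc n) \<noteq> (0::complex)" by (rule of_nat_neq_0)
    then have "diffs c n = (-1) ^ Suc (Suc n) / of_nat (Suc n)"
      unfolding diffs_def c_def power2_eq_square by (simp del: of_nat_Suc)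
    then show ?thesis using assms(2) by simp
  qed
  ultimately have "(\<lambda>n. diffs c n * y ^ n) sums (Ln (1 + y) / y)" by simp
  then show ?thesis using D by (simp add: sums_iff)
qed

lemma altdilog_1: "altdilog 1 = of_real (pi\<^sup>2 / 12)"
proof -
  define a where "a = (\<lambda>n::nat. 1 / (real n + 1)\<^sup>2)"
  have a: "a sums (pi\<^sup>2 / 6)"
    using inverse_squares_sums by (simp add: a_def add_ac)
  \<comment> \<open>Index n carries the denominator \<open>(n + 1)\<^sup>2\<close>, so odd indices
    belong to even numbers: they make up a quarter of the sum, to be subtracted twice.\<close>
  define g where "g = (\<lambda>m::nat. 2 * m + 1)"
  have g: "strict_mono g" by (auto simp: g_def strict_mono_def)
  have "(\<lambda>m. (1/4) * a m) sums ((1/4) * (pi\<^sup>2 / 6))"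
    by (intro sums_mult a)
  also have "(\<lambda>m. (1/4) * a m) = (\<lambda>m. (if odd (g m) then a (g m) else 0))"
    by (auto simp: a_def g_def power2_eq_square field_simps fun_eq_iff)
  finally have "(\<lambda>n. if odd n then a n else 0) sums ((1/4) * (pi\<^sup>2 / 6))"
    by (subst (asm) sums_mono_reindex[OF g, of "\<lambda>n. if odd n then a n else 0"]) 
      (auto simp: g_def elim!: oddE)
  then have "(\<lambda>n. a n - 2 * (if odd n then a n else 0)) sums (pi\<^sup>2 / 6 - 2 * ((1/4) * (pi\<^sup>2 / 6)))"
    by (intro sums_diff a sums_mult)
  also have "(\<lambda>n. a n - 2 * (if odd n then a n else 0)) = (\<lambda>n. (-1) ^ Suc (Suc n) / real (Suc n) ^ 2 * 1 ^ Suc n)"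
    by (auto simp: a_def fun_eq_iff add_ac)
  finally have "(\<lambda>n. (-1) ^ Suc n / real n ^ 2 * 1 ^ n) sums (pi\<^sup>2 / 12)"
    by (subst (asm) sums_Suc_iff) simp
  then have "(\<lambda>n. of_real ((-1) ^ Suc n / real n ^ 2 * 1 ^ n) :: complex) sums of_real (pi\<^sup>2 / 12)"
    by (rule sums_of_real)
  then show ?thesis by (simp add: altdilog_def sums_iff)
qed

text \<open>The major arc in the variable s with q = exp (- s). Its half-angle pi / 4 keeps
  \<open>norm s\<close> comparable to \<open>Re s\<close>; the complement is left to
  \<open>hookF_minor\<close>.\<close>

definition sector :: "complex set" where
  "sector = {s. 0 < Re s \<and> \<bar>Im s\<bar> \<le> Re s}"

lemma sector_scale: "s \<in> sector \<Longrightarrow> c > 0 \<Longrightarrow> of_real c * s \<in> sector"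
  by (auto simp: sector_def abs_mult)

lemma norm_le_Re_sector: "s \<in> sector \<Longrightarrow> norm s \<le> 3 / 2 * Re s"
proof -
  assume s: "s \<in> sector"
  then have "(Im s)\<^sup>2 \<le> (Re s)\<^sup>2" by (subst abs_le_square_iff[symmetric]) (auto simp: sector_def)
  then have "(norm s)\<^sup>2 \<le> 2 * (Re s)\<^sup>2" by (simp add: cmod_power2)
  also have "\<dots> \<le> (3 / 2 * Re s)\<^sup>2" by (simp add: power2_eq_square)
  finally show ?thesis using s by (auto simp: sector_def intro: power2_le_imp_le)
qed

text \<open>The zeros of 1 + exp (- v) lie on the imaginary axis, away from the sector: for a small
  imaginary part the cosine is nonnegative, otherwise the real part is at least 1 and exp (- v) is
  small.\<close>

lemma norm_1_plus_exp_sector: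
  assumes "0 \<le> Re v" "\<bar>Im v\<bar> \<le> Re v"
  shows "norm (1 + exp (- v)) \<ge> 1 / 2"
proof (cases "\<bar>Im v\<bar> \<le> pi / 2")
  case True
  then have "cos (Im v) \<ge> 0" by (intro cos_ge_zero) auto
  then have "Re (1 + exp (- v)) \<ge> 1" by (simp add: Re_exp)
  then show ?thesis using complex_Re_le_cmod[of "1 + exp (- v)"] by linarith
next
  case False
  then have "Re v \<ge> 1" using assms pi_gt3 by linarith
  then have "exp (- Re v) \<le> exp (-1)" by simp
  moreover have "exp (1::real) \<ge> 2" using exp_ge_add_one_self[of 1] by simp
  then have "exp (-1::real) \<le> 1 / 2" by (simp add: exp_minus field_simps)
  ultimately have "exp (- Re v) \<le> 1 / 2" by linarith
  then show ?thesis using norm_triangle_ineq2[of 1 "- exp (- v)"] by simp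
qed

text \<open>The error of the trapezoidal rule on one step, for the integrand \<open>Ln (1 + z * exp (- x))\<close>,
  whose primitive is a dilogarithm.\<close>

lemma altdilog_step:
  fixes s z :: complex and n :: nat
  assumes s: "s \<in> sector" and z: "z = 1 \<or> norm z \<le> 1 / 2" "z \<noteq> 0"
  defines "y \<equiv> \<lambda>k::nat. z * exp (- s) ^ k"
  shows "norm (altdilog (y (Suc n)) - altdilog (y n) + s / 2 * (Ln (1 + y n) + Ln (1 + y (Suc n))))
          \<le> 2 * norm s ^ 3 * exp (- Re s) ^ n"
proof -
  have s': "Re s > 0" "\<bar>Im s\<bar> \<le> Re s" using s by (auto simp: sector_def)
  define Y where "Y = (\<lambda>V::complex. z * exp (- (of_nat n + V) * s))"
  have Y0: "Y 0 = y n" and Y1: "Y 1 = y (Suc n)"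
    by (simp_all add: Y_def y_def exp_of_nat_mult[symmetric] algebra_simps exp_add)
  have Yne: "Y V \<noteq> 0" for V using z by (simp add: Y_def)
  have z1: "norm z \<le> 1" using z by auto
  have nY: "norm (Y (of_real v)) \<le> exp (- Re s) ^ n" "norm (Y (of_real v)) \<le> exp (- v * Re s)" if "0 \<le> v" for v
  proof -
    have "norm (Y (of_real v)) = norm z * exp (- (n + v) * Re s)"
      by (simp add: Y_def norm_mult)
    also have "\<dots> \<le> exp (- (n + v) * Re s)" using z1 by (simp add: mult_left_le_one_le)
    finally have *: "norm (Y (of_real v)) \<le> exp (- (n + v) * Re s)" .
    also have "- (n + v) * Re s \<le> real n * (- Re s)" using that s' by (simp add: algebra_simps)
    then have "exp (- (n + v) * Re s) \<le> exp (real n * (- Re s))" by simp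
    also have "\<dots> = exp (- Re s) ^ n" by (rule exp_of_nat_mult)
    finally show "norm (Y (of_real v)) \<le> exp (- Re s) ^ n" .
    have "- (n + v) * Re s \<le> - v * Re s" using s' by (simp add: algebra_simps)
    then show "norm (Y (of_real v)) \<le> exp (- v * Re s)" using * by (meson exp_le_cancel_iff order_trans)
  qed
  have nY1: "norm (Y (of_real v)) \<le> 1" if "0 \<le> v" for v
  proof -
    have "exp (- v * Re s) \<le> 1" using that s' by simp
    then show ?thesis using nY(2)[OF that] by linarith
  qed
  have half: "norm (1 + Y (of_real v)) \<ge> 1 / 2" if "0 \<le> v" for v
    using z(1)
  proof
    assume z1: "z = 1"
    have "norm (1 + exp (- (of_real (real n + v) * s))) \<ge> 1 / 2"
      using that s' by (intro norm_1_plus_exp_sector) (auto simp: abs_mult mult_left_mono)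
    moreover have "- (of_real (real n + v) * s) = - (of_nat n + of_real v) * s" by (simp add: algebra_simps)
    ultimately show ?thesis using z1 unfolding Y_def by simp
  next
    assume z2: "norm z \<le> 1 / 2"
    have "norm (Y (of_real v)) = norm z * exp (- (n + v) * Re s)"
      by (simp add: Y_def norm_mult)
    also have "\<dots> \<le> norm z"
    proof (rule mult_left_le)
      have "(n + v) * Re s \<ge> 0" using that s' by (intro mult_nonneg_nonneg) auto
      then show "exp (- (n + v) * Re s) \<le> 1" by (simp add: algebra_simps)
    qed simp
    finally show ?thesis using z2 norm_triangle_ineq2[of 1 "- Y (of_real v)"] by simp
  qed
  \<comment> \<open>Keeps the principal logarithm holomorphic along the step. As Y lies in the
    closed unit disc, only Y = -1 could fail, and \<open>half\<close> excludes it.\<close>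
  have RePos: "Re (1 + Y (of_real v)) > 0" if "0 \<le> v" for v
  proof (rule ccontr)
    let ?w = "Y (of_real v)"
    assume "\<not> Re (1 + ?w) > 0"
    then have "Re ?w \<le> -1" by simp
    moreover have "(Re ?w)\<^sup>2 + (Im ?w)\<^sup>2 \<le> 1" 
      using nY1[OF that] by (metis cmod_power2 norm_ge_zero power_le_one)
    moreover have "\<bar>Re ?w\<bar> \<le> 1" using abs_Re_le_cmod[of ?w] nY1[OF that] by linarith
    ultimately have "Re ?w = -1" "(Re ?w)\<^sup>2 + (Im ?w)\<^sup>2 \<le> 1" by linarith+
    then have "Im ?w = 0" by simp
    then have "1 + ?w = 0" using \<open>Re ?w = -1\<close> by (simp add: complex_eq_iff)
    then show False using half[OF that] by simp
  qed
  then have nonpos: "1 + Y (of_real v) \<notin> \<real>\<^sub>\<le>\<^sub>0" if "0 \<le> v" for v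
    using that by (auto simp: complex_nonpos_Reals_iff not_le)
  have ne: "1 + Y (of_real v) \<noteq> 0" if "0 \<le> v" for v
    using half[OF that] by auto
  \<comment> \<open>\<open>e\<close> is the trapezoidal error after the fraction V of the step, and
    e' = s / 2 * k. The derivative of \<open>k\<close> is V * s^2 * Y / (1 + Y)^2, of order s^2, so
    two mean value bounds yield the cube of s.\<close>
  define k where "k = (\<lambda>V. - Ln (1 + Y V) + Ln (1 + Y 0) - V * s * (Y V / (1 + Y V)))"
  define e where "e = (\<lambda>V. altdilog (Y V) - altdilog (Y 0) + V * s / 2 * (Ln (1 + Y 0) + Ln (1 + Y V)))"
  have dY: "(Y has_field_derivative (- s * Y V)) (at V within A)" for V A
    unfolding Y_def by (auto intro!: derivative_eq_intros)
  have dk: "(k has_field_derivative (of_real v * s\<^sup>2 * Y (of_real v) / (1 + Y (of_real v))\<^sup>2)) (at (of_real v) within A)" if "0 \<le> v" for v A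
  proof -
    define W where "W = Y (of_real v)"
    have W: "1 + W \<noteq> 0" "1 + W \<notin> \<real>\<^sub>\<le>\<^sub>0" using ne[OF that] nonpos[OF that] by (auto simp: W_def)
    have "((\<lambda>V. Y V / (1 + Y V)) has_field_derivative (((- s * W) * (1 + W) - W * (- s * W)) / ((1 + W) * (1 + W)))) (at (of_real v) within A)"
      using W unfolding W_def by (auto intro!: derivative_eq_intros dY)
    also have "((- s * W) * (1 + W) - W * (- s * W)) / ((1 + W) * (1 + W)) = - s * W / (1 + W)\<^sup>2"
      by (simp add: power2_eq_square algebra_simps)
    finally have D2: "((\<lambda>V. Y V / (1 + Y V)) has_field_derivative (- s * W / (1 + W)\<^sup>2)) (at (of_real v) within A)" .
    have D1: "((\<lambda>V. Ln (1 + Y V)) has_field_derivative (- s * (W / (1 + W)))) (at (of_real v) within A)"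
      using W unfolding W_def by (auto intro!: derivative_eq_intros dY simp: field_simps)
    have "(k has_field_derivative (- (- s * (W / (1 + W))) + 0 - (s * (W / (1 + W)) + (- s * W / (1 + W)\<^sup>2) * (of_real v * s)))) (at (of_real v) within A)"
      unfolding k_def
      by (rule derivative_eq_intros D1 D2 refl | simp add: W_def)+
    then show ?thesis unfolding W_def[symmetric] by (rule DERIV_cong) (simp add: power2_eq_square)
  qed
  have kb: "norm (k (of_real v)) \<le> 4 * norm s ^ 2 * exp (- Re s) ^ n" if v: "0 \<le> v" "v \<le> 1" for v
  proof (cases "v = 0")
    case True then show ?thesis by (simp add: k_def)
  next
    case False
    let ?M = "4 * norm s ^ 2 * exp (- Re s) ^ n"
    have "norm (k (of_real v) - k (of_real 0)) \<le> ?M * v - ?M * 0"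
    proof (rule differentiable_bound_general[where f = "\<lambda>x. k (of_real x)" and \<phi> = "\<lambda>x. ?M * x" 
          and f' = "\<lambda>v. of_real v * s\<^sup>2 * Y (of_real v) / (1 + Y (of_real v))\<^sup>2" and \<phi>' = "\<lambda>x. ?M"])
      show "0 < v" using v False by simp
      have "continuous_on {0..v} (k \<circ> of_real)"
      proof (rule continuous_on_compose)
        show "continuous_on (of_real ` {0..v}) k"
          by (rule DERIV_continuous_on) (auto intro: dk)
      qed (intro continuous_intros)
      then show "continuous_on {0..v} (\<lambda>x. k (of_real x))" by (simp add: o_def)
      show "continuous_on {0..v} (\<lambda>x. ?M * x)" by (intro continuous_intros)
      show "((\<lambda>x. ?M * x) has_vector_derivative ?M) (at x)" for x
        by (auto intro!: derivative_eq_intros)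
    next
      fix x assume x: "0 < x" "x < v"
      show "((\<lambda>x. k (of_real x)) has_vector_derivative of_real x * s\<^sup>2 * Y (of_real x) / (1 + Y (of_real x))\<^sup>2) (at x)"
        by (rule has_vector_derivative_real_field) (use x in \<open>auto intro: dk\<close>)
      have "norm (of_real x * s\<^sup>2 * Y (of_real x) / (1 + Y (of_real x))\<^sup>2)
             \<le> (1 * norm s ^ 2 * exp (- Re s) ^ n) / (1/2)\<^sup>2"
        unfolding norm_divide norm_mult norm_power
        using x v nY(1)[of x] half[of x] by (intro frac_le mult_mono power_mono mult_nonneg_nonneg) auto
      then show "norm (of_real x * s\<^sup>2 * Y (of_real x) / (1 + Y (of_real x))\<^sup>2) \<le> ?M"
        by (simp add: power2_eq_square)
    qed
    also have "\<dots> \<le> ?M" using v by (simp add: mult_left_le)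
    finally show ?thesis by (simp add: k_def)
  qed
  have de: "(e has_field_derivative (s / 2 * k (of_real v))) (at (of_real v))" if "0 < v" for v
  proof -
    have "norm (Y (of_real v)) < 1"
    proof -
      have "exp (- v * Re s) < 1" using that s' by simp
      then show ?thesis using nY(2)[of v] that by linarith
    qed
    then have dL: "((\<lambda>V. altdilog (Y V)) has_field_derivative (Ln (1 + Y (of_real v)) / Y (of_real v) * (- s * Y (of_real v)))) (at (of_real v))"
      using Yne by (intro DERIV_chain2[OF has_field_derivative_altdilog] dY) auto
    show ?thesis
    proof -
      define W where "W = Y (of_real v)"
      define R where "R = W / (1 + W)"
      have W: "1 + W \<noteq> 0" "1 + W \<notin> \<real>\<^sub>\<le>\<^sub>0" "W \<noteq> 0" using ne[of v] nonpos[of v] that Yne by (auto simp: W_def)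
      have D1: "((\<lambda>V. Ln (1 + Y V)) has_field_derivative (- s * R)) (at (of_real v))"
        using W unfolding W_def R_def by (auto intro!: derivative_eq_intros dY simp: field_simps)
      have D2: "((\<lambda>V. V * s / 2) has_field_derivative (s / 2)) (at (of_real v))"
        by (auto intro!: derivative_eq_intros)
      have D3: "((\<lambda>V. Ln (1 + Y 0) + Ln (1 + Y V)) has_field_derivative (0 + (- s * R))) (at (of_real v))"
        by (intro DERIV_add DERIV_const D1)
      have "(e has_field_derivative (Ln (1 + W) / W * (- s * W) - 0 + (s / 2 * (Ln (1 + Y 0) + Ln (1 + W)) + (0 + (- s * R)) * (of_real v * s / 2)))) (at (of_real v))"
        unfolding e_def W_def using DERIV_add[OF DERIV_diff[OF dL DERIV_const] DERIV_mult[OF D2 D3]] by simp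
      moreover have "Ln (1 + W) / W * (- s * W) = - s * Ln (1 + W)" using W(3) by simp
      ultimately have "(e has_field_derivative (- s * Ln (1 + W) - 0 + (s / 2 * (Ln (1 + Y 0) + Ln (1 + W)) + (0 + (- s * R)) * (of_real v * s / 2)))) (at (of_real v))"
        by simp
      moreover have kv: "k (of_real v) = - Ln (1 + W) + Ln (1 + Y 0) - of_real v * s * R"
        by (simp add: k_def W_def R_def)
      ultimately show ?thesis
        unfolding kv by (elim DERIV_cong) (simp add: field_simps)
    qed
  qed
  have "norm (e (of_real 1) - e (of_real 0)) \<le> (2 * norm s ^ 3 * exp (- Re s) ^ n) * 1 - (2 * norm s ^ 3 * exp (- Re s) ^ n) * 0"
  proof (rule differentiable_bound_general[where f = "\<lambda>x. e (of_real x)" and \<phi> = "\<lambda>x. (2 * norm s ^ 3 * exp (- Re s) ^ n) * x" 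
          and f' = "\<lambda>v. s / 2 * k (of_real v)" and \<phi>' = "\<lambda>x. (2 * norm s ^ 3 * exp (- Re s) ^ n)"])
    have cY: "continuous_on {0..1} (\<lambda>x. Y (of_real x))"
      unfolding Y_def by (intro continuous_intros)
    have "continuous_on {0..1} (\<lambda>x. altdilog (Y (of_real x)))"
      by (rule continuous_on_compose2[OF continuous_on_altdilog cY]) (use nY1 in auto)
    then show "continuous_on {0..1} (\<lambda>x. e (of_real x))"
      unfolding e_def by (intro continuous_intros cY) (use nonpos in auto)
    show "continuous_on {0..1} (\<lambda>x. (2 * norm s ^ 3 * exp (- Re s) ^ n) * x)" by (intro continuous_intros)
    show "((\<lambda>x. (2 * norm s ^ 3 * exp (- Re s) ^ n) * x) has_vector_derivative (2 * norm s ^ 3 * exp (- Re s) ^ n)) (at x)" for x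
      by (auto intro!: derivative_eq_intros)
  next
    fix x :: real assume x: "0 < x" "x < 1"
    show "((\<lambda>x. e (of_real x)) has_vector_derivative s / 2 * k (of_real x)) (at x)"
      by (rule has_vector_derivative_real_field, rule de) (use x in auto)
    have "norm (s / 2 * k (of_real x)) \<le> norm s / 2 * (4 * norm s ^ 2 * exp (- Re s) ^ n)"
      unfolding norm_mult norm_divide using kb[of x] x by (intro mult_mono) auto
    then show "norm (s / 2 * k (of_real x)) \<le> 2 * norm s ^ 3 * exp (- Re s) ^ n"
      by (simp add: power2_eq_square power3_eq_cube)
  qed simp
  then show ?thesis by (simp add: e_def Y0 Y1)
qed

text \<open>Summing \<open>altdilog_step\<close> over n telescopes the dilogarithms. The product
  starts at z * exp (- s), so the trapezoidal rule leaves the half term at its start point z. The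
  errors sum to order |s|^3 / Re s, hence |s|^2 in the sector, and are then divided by s. The case z
  = 1 serves \<open>qf 0 q q\<close>, the small z serve \<open>qf 0 Q (z * Q)\<close>.\<close>

lemma qf0_exp_asymptotics:
  assumes s: "s \<in> sector" "norm s \<le> 1" and z: "z = 1 \<or> norm z \<le> 1 / 2" 
  shows "\<exists>e. norm e \<le> 6 * norm s \<and>
    qf 0 (exp (- s)) (z * exp (- s)) = exp (altdilog z / s - Ln (1 + z) / 2 + e)"
proof (cases "z = 0")
  case True
  have "qf 0 (exp (-s)) 0 = 1"
    by (simp add: qf_def powser_zero qcoeff_0)
  then show ?thesis using True by (intro exI[of _ 0]) auto
next
  case False
  define y where "y = (\<lambda>k::nat. z * exp (- s) ^ k)"
  define e where "e = (\<lambda>n. altdilog (y (Suc n)) - altdilog (y n) + s / 2 * (Ln (1 + y n) + Ln (1 + y (Suc n))))"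
  have s': "Re s > 0" "s \<noteq> 0" using s by (auto simp: sector_def)
  have s1: "Re s \<le> 1" using s complex_Re_le_cmod[of s] by linarith
  have Q: "norm (exp (- s)) < 1" using s' by simp
  have eb: "norm (e n) \<le> 2 * norm s ^ 3 * exp (- Re s) ^ n" for n
    unfolding e_def y_def using altdilog_step[OF s(1) z False] by simp
  have geo: "(\<lambda>n. 2 * norm s ^ 3 * exp (- Re s) ^ n) sums (2 * norm s ^ 3 * (1 / (1 - exp (- Re s))))"
    using s' by (intro sums_mult geometric_sums) auto
  have se: "summable e"
    by (rule summable_comparison_test'[OF sums_summable[OF geo]]) (use eb in auto)
  have "norm (suminf e) \<le> 2 * norm s ^ 3 * (1 / (1 - exp (- Re s)))"
    using norm_suminf_le[OF eb sums_summable[OF geo]] geo by (simp add: sums_iff)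
  also have "\<dots> \<le> 2 * norm s ^ 3 * (2 / Re s)"
  proof -
    have "1 + Re s / 1 \<le> exp (Re s)" using exp_ge_add_one_self[of "Re s"] by simp
    then have "exp (- Re s) \<le> 1 / (1 + Re s)" using s' by (simp add: exp_minus field_simps)
    also have "\<dots> \<le> 1 - Re s / 2" using s' s1 by (simp add: field_simps mult_le_one power2_eq_square)
    finally have "Re s / 2 \<le> 1 - exp (- Re s)" by simp
    then have "1 / (1 - exp (- Re s)) \<le> 1 / (Re s / 2)" using s' by (intro frac_le) auto
    then show ?thesis by (intro mult_left_mono) auto
  qed
  also have "\<dots> \<le> 2 * norm s ^ 3 * (2 / (norm s / (3/2)))"
    using s' norm_le_Re_sector[OF s(1)] by (intro mult_left_mono divide_left_mono mult_pos_pos) auto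
  also have "\<dots> = 6 * norm s ^ 2" using s' by (simp add: power2_eq_square power3_eq_cube)
  finally have sb: "norm (suminf e) \<le> 6 * norm s ^ 2" .
  have part: "(\<Sum>n<N. Ln (1 + y (Suc n))) = 
       ((\<Sum>n<N. e n) - altdilog (y N) + altdilog z) / s - Ln (1 + z) / 2 + Ln (1 + y N) / 2" for N
  proof (induction N)
    case (Suc N)
    have "altdilog (y (Suc N)) = e N + altdilog (y N) - s / 2 * (Ln (1 + y N) + Ln (1 + y (Suc N)))"
      by (simp add: e_def)
    then show ?case using s' unfolding sum.lessThan_Suc Suc.IH by (simp add: field_simps)
  qed (use s' in \<open>simp add: y_def\<close>)
  have y0: "y \<longlonglongrightarrow> 0"
    unfolding y_def by (intro tendsto_mult_power_0 Q)
  have L1: "(\<lambda>N. altdilog (y N)) \<longlonglongrightarrow> altdilog 0"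
  proof (rule continuous_on_tendsto_compose[OF continuous_on_altdilog y0])
    show "\<forall>\<^sub>F n in sequentially. y n \<in> cball 0 1"
      using order_tendstoD(2)[OF tendsto_norm_zero[OF y0], of 1] by (auto elim: eventually_mono)
  qed simp
  have L2: "(\<lambda>N. Ln (1 + y N)) \<longlonglongrightarrow> Ln (1 + 0)"
    by (intro tendsto_intros y0) auto
  have "(\<lambda>N. ((\<Sum>n<N. e n) - altdilog (y N) + altdilog z) / s - Ln (1 + z) / 2 + Ln (1 + y N) / 2) \<longlonglongrightarrow> 
       (suminf e - altdilog 0 + altdilog z) / s - Ln (1 + z) / 2 + Ln (1 + 0) / 2"
    by (intro tendsto_add tendsto_diff tendsto_divide tendsto_const L1 L2 summable_LIMSEQ se) (use s' in auto)
  then have "(\<lambda>N. exp (\<Sum>n<N. Ln (1 + y (Suc n)))) \<longlonglongrightarrow> exp (altdilog z / s - Ln (1 + z) / 2 + suminf e / s)"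
    unfolding part by (intro tendsto_exp) (simp add: add_divide_distrib algebra_simps)
  moreover have ne: "1 + y (Suc n) \<noteq> 0" for n
  proof
    assume "1 + y (Suc n) = 0"
    then have "norm (y (Suc n)) = 1" by (metis add_eq_0_iff norm_minus_cancel norm_one)
    moreover have "norm (y (Suc n)) \<le> 1 * norm (exp (- s)) ^ Suc n"
      unfolding y_def norm_mult norm_power using z by (intro mult_right_mono) auto
    moreover have "norm (exp (- s)) ^ Suc n < 1" using Q by (intro power_Suc_less_one) auto
    ultimately show False by simp
  qed
  then have "exp (\<Sum>n<N. Ln (1 + y (Suc n))) = (\<Prod>j<N. 1 + z * exp (- s) * exp (- s) ^ j)" for N
    by (simp add: exp_sum y_def mult_ac)
  ultimately have "(\<lambda>N. \<Prod>j<N. 1 + z * exp (- s) * exp (- s) ^ j) \<longlonglongrightarrow> exp (altdilog z / s - Ln (1 + z) / 2 + suminf e / s)"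
    by simp
  then have "qf 0 (exp (- s)) (z * exp (- s)) = exp (altdilog z / s - Ln (1 + z) / 2 + suminf e / s)"
    using qf0_tendsto[OF Q] LIMSEQ_unique by blast
  moreover have "norm (suminf e / s) \<le> 6 * norm s"
    using sb s' by (simp add: norm_divide divide_le_eq power2_eq_square mult_ac)
  ultimately show ?thesis by blast
qed

section \<open>Asymptotics near the dominant singularity\<close>

lemma norm_exp_minus_1_le:
  fixes v :: complex
  assumes "norm v \<le> 1"
  shows "norm (exp v - 1) \<le> 3 * norm v"
proof -
  have "norm (exp v - exp 0) \<le> 3 * norm (v - 0)"
  proof (rule field_differentiable_bound[of "cball 0 1"])
    show "(exp has_field_derivative exp w) (at w within cball 0 1)" for w :: complex
      by (auto intro!: derivative_eq_intros)
    fix w :: complex assume "w \<in> cball 0 1"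
    then have "Re w \<le> 1" using complex_Re_le_cmod[of w] by auto
    then have "exp (Re w) \<le> exp 1" by simp
    then have "exp (Re w) \<le> 3" using exp_le by linarith
    then show "norm (exp w) \<le> 3" by simp
  qed (use assms in auto)
  then show ?thesis by simp
qed

lemma norm_affine_le:
  fixes p c a b :: complex
  shows "norm (p + c * (a + b)) \<le> norm p + norm c * (norm a + norm b)"
proof -
  have "norm (p + c * (a + b)) \<le> norm p + norm (c * (a + b))" by (rule norm_triangle_ineq)
  also have "norm (c * (a + b)) \<le> norm c * (norm a + norm b)"
    unfolding norm_mult by (intro mult_left_mono norm_triangle_ineq) auto
  finally show ?thesis by simp
qed

text \<open>Conditions under which the continued fraction for the ratio \<open>r\<close> of
  consecutive values is a contraction: once |r| >= 1 / 4, the term with z is at most 4 / 32 = 1 / 8,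
  and its Lipschitz factor in r is at most 4 * 4 / 32 = 1 / 2.\<close>

locale ratio_setup =
  fixes z Q w :: complex
  assumes Q: "norm Q < 1" and z: "norm z \<le> 1 / 32"
    and half: "\<And>j. norm (1 + w * Q ^ j) \<ge> 1 / 2" and w1: "norm w \<le> 1"
begin

definition f :: "nat \<Rightarrow> complex" where "f j = qf z Q (w * Q ^ j)"

definition r :: "nat \<Rightarrow> complex" where "r j = f j / f (Suc j)"

lemma f_rec: "f j = (1 + w * Q ^ j) * f (Suc j) + z * (w * Q ^ j) * Q * f (Suc (Suc j))"
  using qf_rec[OF Q, of z "w * Q ^ j"] by (simp add: f_def power2_eq_square mult_ac)

lemma f_tendsto: "f \<longlonglongrightarrow> 1"
  unfolding f_def by (intro qf_tendsto_1 Q tendsto_mult_power_0)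

lemma wj: "norm (w * Q ^ j) \<le> 1"
proof -
  have "norm Q ^ j \<le> 1" using Q by (intro power_le_one) auto
  then show ?thesis using w1 by (simp add: norm_mult norm_power mult_le_one)
qed

lemma r_tendsto: "r \<longlonglongrightarrow> 1"
  unfolding r_def using tendsto_divide[OF f_tendsto LIMSEQ_Suc[OF f_tendsto]] by simp

text \<open>Downward induction from a large index, where the ratio is near 1. Going down, |1 + w *
  \<open>Q ^ j\<close>| >= 1 / 2 loses at most 1 / 8, so the bound 1 / 4 reproduces itself.\<close>

lemma f_nonzero_r_ge: "f (Suc j) \<noteq> 0 \<and> f j \<noteq> 0 \<and> norm (r j) \<ge> 1 / 4"
proof -
  have "eventually (\<lambda>j. f j \<noteq> 0) sequentially"
    using f_tendsto by (rule tendsto_imp_eventually_ne) simp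
  moreover have "eventually (\<lambda>j. norm (r j) > 1 / 4) sequentially"
    using tendsto_norm[OF r_tendsto] by (rule order_tendstoD) simp
  ultimately obtain N where N: "\<And>j. j \<ge> N \<Longrightarrow> f j \<noteq> 0" "\<And>j. j \<ge> N \<Longrightarrow> norm (r j) > 1 / 4"
    by (auto simp: eventually_sequentially) (metis nat_le_linear order_trans)
  have "N \<ge> j \<Longrightarrow> ?thesis" 
  proof (induction j rule: inc_induct)
    case base
    then show ?case using N[of N] N(1)[of "Suc N"] by force
  next
    case (step n)
    then have IH: "f (Suc (Suc n)) \<noteq> 0" "f (Suc n) \<noteq> 0" "norm (r (Suc n)) \<ge> 1 / 4" by auto
    have rn: "r n = (1 + w * Q ^ n) + z * (w * Q ^ n) * Q / r (Suc n)"
      unfolding r_def using IH by (subst f_rec) (simp add: field_simps)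
    have "norm (z * (w * Q ^ n) * Q / r (Suc n)) \<le> (1 / 32 * 1 * 1) / (1 / 4)"
      unfolding norm_divide norm_mult[of "z * (w * Q ^ n)"] norm_mult[of z]
      using IH z wj[of n] Q by (intro frac_le mult_mono) auto
    then have "norm (z * (w * Q ^ n) * Q / r (Suc n)) \<le> 1 / 8" by simp
    then have "norm (r n) \<ge> 1 / 2 - 1 / 8"
      unfolding rn using half[of n] norm_diff_ineq[of "1 + w * Q ^ n" "z * (w * Q ^ n) * Q / r (Suc n)"] by linarith
    then have "norm (r n) \<ge> 1 / 4" by linarith
    moreover from this have "f n \<noteq> 0" by (auto simp: r_def)
    ultimately show ?case using IH by auto
  qed
  then show ?thesis using N(1)[of j] N(1)[of "Suc j"] N(2)[of j] by (cases "j \<le> N") force+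
qed

lemma r_rec: "r j = (1 + w * Q ^ j) + z * (w * Q ^ j) * Q / r (Suc j)"
  unfolding r_def using f_nonzero_r_ge[of j] f_nonzero_r_ge[of "Suc j"]
  by (subst f_rec) (simp add: field_simps)

lemma r_nz: "r j \<noteq> 0" and r_ge: "norm (r j) \<ge> 1 / 4"
  using f_nonzero_r_ge[of j] by auto

lemma inverse_r_le: "norm (1 / r j) \<le> 4"
  using r_ge[of j] r_nz[of j] by (simp add: norm_divide field_simps)

text \<open>The constants are 9 / 8 = 1 + 4 / 32 and 1 / 2 = 16 / 32, from |z| <= 1 / 32 and |1 / r|
  <= 4.\<close>

lemma r_diff_step: "norm (r j - r (Suc j)) \<le> 9 / 8 * norm (1 - Q) + 1 / 2 * norm (r (Suc j) - r (Suc (Suc j)))"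
proof -
  define a b where "a = w * Q ^ j" and "b = w * Q ^ Suc j"
  define R S where "R = r (Suc j)" and "S = r (Suc (Suc j))"
  have nz: "R \<noteq> 0" "S \<noteq> 0" using r_nz by (auto simp: R_def S_def)
  have le: "norm (1 / R) \<le> 4" "norm (1 / S) \<le> 4" unfolding R_def S_def by (rule inverse_r_le)+
  have ab: "norm (a - b) \<le> norm (1 - Q)" "norm b \<le> 1"
  proof -
    have "a - b = a * (1 - Q)" by (simp add: a_def b_def algebra_simps)
    then have "norm (a - b) = norm a * norm (1 - Q)" by (simp add: norm_mult)
    also have "\<dots> \<le> 1 * norm (1 - Q)" using wj[of j] by (intro mult_right_mono) (auto simp: a_def)
    finally show "norm (a - b) \<le> norm (1 - Q)" by simp
    show "norm b \<le> 1" unfolding b_def by (rule wj)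
  qed
  have "r j - r (Suc j) = (1 + a + z * a * Q / R) - (1 + b + z * b * Q / S)"
    using r_rec[of j] r_rec[of "Suc j"] by (simp add: a_def b_def R_def S_def)
  also have "\<dots> = (a - b) + z * Q * ((a - b) * (1 / R) + b * (S - R) * (1 / R) * (1 / S))"
    using nz by (simp add: field_simps)
  finally have "norm (r j - r (Suc j)) \<le> norm (a - b) + norm (z * Q) * (norm ((a - b) * (1 / R)) + norm (b * (S - R) * (1 / R) * (1 / S)))"
    using norm_affine_le by simp
  then have "norm (r j - r (Suc j)) \<le> norm (a - b) + norm (z * Q) * (norm (a - b) * norm (1 / R) + norm b * norm (S - R) * norm (1 / R) * norm (1 / S))"
    by (simp only: norm_mult)
  also have "\<dots> \<le> norm (1 - Q) + 1 / 32 * (norm (1 - Q) * 4 + 1 * norm (S - R) * 4 * 4)"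
  proof (intro add_mono mult_mono ab le)
    have "norm (z * Q) \<le> 1 / 32 * 1" unfolding norm_mult using z Q by (intro mult_mono) auto
    then show "norm (z * Q) \<le> 1 / 32" by simp
  qed (auto intro!: add_nonneg_nonneg mult_nonneg_nonneg)
  finally have "norm (r j - r (Suc j)) \<le> 9 / 8 * norm (1 - Q) + 1 / 2 * norm (S - R)"
    by argo
  then show ?thesis by (simp add: R_def S_def norm_minus_commute)
qed

lemma r_diff: "norm (r 0 - r 1) \<le> 3 * norm (1 - Q)"
proof -
  define d where "d = (\<lambda>j. norm (r j - r (Suc j)))"
  have st: "d j \<le> 9 / 8 * norm (1 - Q) + 1 / 2 * d (Suc j)" for j
    using r_diff_step[of j] by (simp add: d_def)
  have it0: "d 0 \<le> 9 / 4 * norm (1 - Q) - 9 / 4 * norm (1 - Q) * (1 / 2) ^ N + (1 / 2) ^ N * d N" for N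
  proof (induction N)
    case (Suc N)
    have "(1 / 2) ^ N * d N \<le> (1 / 2) ^ N * (9 / 8 * norm (1 - Q) + 1 / 2 * d (Suc N))"
      by (intro mult_left_mono st) auto
    also have "\<dots> = 9 / 8 * norm (1 - Q) * (1 / 2) ^ N + (1 / 2) ^ Suc N * d (Suc N)"
      by (simp add: algebra_simps)
    finally show ?case using Suc by simp
  qed simp
  have it: "d 0 \<le> 9 / 4 * norm (1 - Q) + (1 / 2) ^ N * d N" for N
  proof -
    have "0 \<le> 9 / 4 * norm (1 - Q) * (1 / 2) ^ N" by (intro mult_nonneg_nonneg) auto
    then show ?thesis using it0[of N] by linarith
  qed
  have "d \<longlonglongrightarrow> norm (1 - 1 :: complex)"
    unfolding d_def by (intro tendsto_intros r_tendsto LIMSEQ_Suc[OF r_tendsto])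
  then have "(\<lambda>N. 9 / 4 * norm (1 - Q) + (1 / 2) ^ N * d N) \<longlonglongrightarrow> 9 / 4 * norm (1 - Q) + 0 * norm (1 - 1 :: complex)"
    by (intro tendsto_intros LIMSEQ_power_zero) auto
  then have "d 0 \<le> 9 / 4 * norm (1 - Q) + 0 * norm (1 - 1 :: complex)"
    by (rule LIMSEQ_le_const) (use it in auto)
  also have "\<dots> \<le> 3 * norm (1 - Q)" by (simp add: mult_right_mono)
  finally show ?thesis by (simp add: d_def)
qed

text \<open>With consecutive ratios nearly equal and w, Q near 1, the ratio R almost solves R = 2 +
  z / R, that is (R - 1)^2 = 1 + z = x^2. Then R * (R - 2 - z / R) factors as (R - (1 + x)) * (R -
  (1 - x)), and R is near 2, so the second factor is bounded away from 0.\<close>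

lemma r0_approx:
  assumes x: "z = x\<^sup>2 - 1" "norm (x - 1) \<le> 1 / 8" and d: "norm (1 - w) \<le> 1 / 2"
  shows "norm (r 0 - (1 + x)) \<le> 6 * (norm (1 - w) + norm (1 - Q))"
proof -
  let ?d = "norm (1 - w) + norm (1 - Q)"
  define R S where "R = r 0" and "S = r 1"
  have nz: "R \<noteq> 0" "S \<noteq> 0" using r_nz by (auto simp: R_def S_def)
  have le: "norm (1 / R) \<le> 4" "norm (1 / S) \<le> 4" unfolding R_def S_def by (rule inverse_r_le)+
  have R: "R = 1 + w + z * w * Q * (1 / S)" using r_rec[of 0] by (simp add: R_def S_def)
  have small: "norm (z * w * Q * (1 / S)) \<le> 1 / 8"
  proof -
    have "norm (z * w * Q * (1 / S)) \<le> 1 / 32 * 1 * 1 * 4"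
      unfolding norm_mult[of _ "1 / S"] norm_mult[of _ Q] norm_mult[of z]
      using z w1 Q by (intro mult_mono le) auto
    then show ?thesis by simp
  qed
  have R2: "norm (R - 2) \<le> norm (1 - w) + 1 / 8"
  proof -
    have "R - 2 = (w - 1) + z * w * Q * (1 / S)" by (subst R) simp
    then have "norm (R - 2) \<le> norm (w - 1) + norm (z * w * Q * (1 / S))" by (metis norm_triangle_ineq)
    then show ?thesis using small by (simp add: norm_minus_commute)
  qed
  then have R3: "norm R \<le> 3" using d norm_triangle_ineq[of "R - 2" 2] by simp
  have RS: "norm (R - S) \<le> 3 * norm (1 - Q)" using r_diff by (simp add: R_def S_def)
  have wQ: "norm (w * Q - 1) \<le> ?d"
  proof -
    have "w * Q - 1 = (w - 1) - w * (1 - Q)" by (simp add: algebra_simps)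
    then have "norm (w * Q - 1) \<le> norm (w - 1) + norm w * norm (1 - Q)" by (metis norm_mult norm_triangle_ineq4)
    also have "\<dots> \<le> norm (w - 1) + 1 * norm (1 - Q)" using w1 by (intro add_left_mono mult_right_mono) auto
    finally show ?thesis by (simp add: norm_minus_commute)
  qed
  have key: "norm (R - 2 - z * (1 / R)) \<le> 2 * ?d"
  proof -
    have "R - 2 - z * (1 / R) = (w - 1) + z * (w * Q * (R - S) * (1 / R) * (1 / S) + (w * Q - 1) * (1 / R))"
    proof -
      have "R - 2 - z * (1 / R) = (w - 1) + z * (w * Q * (1 / S) - 1 / R)"
        by (subst (1) R) (simp add: algebra_simps)
      also have "w * Q * (1 / S) - 1 / R = w * Q * (R - S) * (1 / R) * (1 / S) + (w * Q - 1) * (1 / R)"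
        using nz by (simp add: field_simps)
      finally show ?thesis .
    qed
    also have "norm \<dots> \<le> norm (w - 1) + norm z * (norm (w * Q * (R - S) * (1 / R) * (1 / S)) + norm ((w * Q - 1) * (1 / R)))"
      by (rule norm_affine_le)
    also have "\<dots> = norm (w - 1) + norm z * (norm (w * Q) * norm (R - S) * norm (1 / R) * norm (1 / S) + norm (w * Q - 1) * norm (1 / R))"
      by (simp only: norm_mult)
    also have "\<dots> \<le> norm (w - 1) + 1 / 32 * (1 * (3 * norm (1 - Q)) * 4 * 4 + ?d * 4)"
      using wj[of 1] by (intro add_mono order_refl mult_mono z RS le wQ) (auto intro!: add_nonneg_nonneg mult_nonneg_nonneg)
    also have "\<dots> \<le> 2 * ?d"
      using norm_ge_zero[of "1 - w"] norm_ge_zero[of "1 - Q"] unfolding norm_minus_commute[of w 1] by argo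
    finally show ?thesis .
  qed
  have "(R - (1 + x)) * (R - 1 + x) = R * (R - 2 - z * (1 / R))"
    using nz by (simp add: x(1) power2_eq_square algebra_simps)
  then have "norm (R - (1 + x)) * norm (R - 1 + x) = norm R * norm (R - 2 - z * (1 / R))"
    by (metis norm_mult)
  also have "\<dots> \<le> 3 * (2 * ?d)" by (intro mult_mono R3 key) auto
  finally have prod: "norm (R - (1 + x)) * norm (R - 1 + x) \<le> 6 * ?d" by simp
  have "norm (R - 1 + x) \<ge> 1"
  proof -
    have "2 = (R - 1 + x) - ((R - 2) + (x - 1))" by simp
    then have "norm (2::complex) \<le> norm (R - 1 + x) + norm ((R - 2) + (x - 1))" by (metis norm_triangle_ineq4)
    also have "norm ((R - 2) + (x - 1)) \<le> norm (R - 2) + norm (x - 1)" by (rule norm_triangle_ineq)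
    finally show ?thesis using R2 d x(2) by simp
  qed
  then have "norm (R - (1 + x)) * 1 \<le> norm (R - (1 + x)) * norm (R - 1 + x)" by (intro mult_left_mono) auto
  then show ?thesis using prod by (simp add: R_def)
qed

lemma r0_quotient:
  assumes x: "z = x\<^sup>2 - 1" "norm (x - 1) \<le> 1 / 8" and d: "norm (1 - w) \<le> 1 / 2"
    and v: "norm (v - 1) \<le> norm (1 - w) + norm (1 - Q)"
  shows "norm (v / r 0 - 1 / (1 + x)) \<le> 36 * (norm (1 - w) + norm (1 - Q))"
proof -
  let ?d = "norm (1 - w) + norm (1 - Q)"
  define N where "N = (v - 1) * (1 + x) - (r 0 - (1 + x))"
  have x1: "norm (1 + x) \<ge> 15 / 8" "norm (1 + x) \<le> 17 / 8"
    using x(2) norm_triangle_ineq4[of "1 + x" "x - 1"] norm_triangle_ineq[of 2 "x - 1"] by auto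
  have xnz: "1 + x \<noteq> 0" using x1 by auto
  have ix: "norm (1 / (1 + x)) \<le> 1" using x1 xnz by (auto simp: norm_divide field_simps)
  have "norm N \<le> norm ((v - 1) * (1 + x)) + norm (r 0 - (1 + x))" unfolding N_def by (rule norm_triangle_ineq4)
  moreover have "norm ((v - 1) * (1 + x)) \<le> ?d * (17 / 8)" unfolding norm_mult using v x1 by (intro mult_mono) auto
  ultimately have N: "norm N \<le> 9 * ?d" using r0_approx[OF x d] norm_ge_zero[of "1 - w"] norm_ge_zero[of "1 - Q"] by argo
  have "v / r 0 - 1 / (1 + x) = N * (1 / r 0) * (1 / (1 + x))"
    using r_nz[of 0] xnz by (simp add: N_def field_simps)
  then have "norm (v / r 0 - 1 / (1 + x)) = norm N * norm (1 / r 0) * norm (1 / (1 + x))" by (simp only: norm_mult)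
  also have "\<dots> \<le> (9 * ?d) * 4 * 1" by (intro mult_mono N inverse_r_le ix) auto
  finally show ?thesis by simp
qed

lemma self_class_eq: "z = x\<^sup>2 - 1 \<Longrightarrow> self_class x Q w = f 0 * (1 + (x - 1) * w / r 0)"
proof -
  assume "z = x\<^sup>2 - 1"
  then have "self_class x Q w = f 0 + (x - 1) * (w * f 1)" unfolding f_def by (simp add: self_class_def)
  moreover have "f 1 = f 0 / r 0" using f_nonzero_r_ge[of 0] by (simp add: r_def)
  ultimately show ?thesis by (simp add: distrib_left mult_ac)
qed

end

lemma square_quotient_lipschitz:
  fixes A A0 B B0 :: complex
  assumes "norm (A - A0) \<le> e" "norm (B - B0) \<le> e" "norm A \<le> 2" "norm A0 \<le> 2" "norm B \<ge> 1 / 2" "norm B0 \<ge> 1 / 2"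
  shows "norm (A\<^sup>2 / B - A0\<^sup>2 / B0) \<le> 24 * e"
proof -
  have nz: "B \<noteq> 0" "B0 \<noteq> 0" using assms by auto
  have e: "e \<ge> 0" using assms(1) norm_ge_zero order_trans by blast
  have i: "norm (1 / B) \<le> 2" "norm (1 / B0) \<le> 2" using assms nz by (auto simp: norm_divide field_simps)
  have "A\<^sup>2 / B - A0\<^sup>2 / B0 = (A - A0) * (A + A0) * (1 / B) + A0 * A0 * (B0 - B) * (1 / B) * (1 / B0)"
    using nz by (simp add: field_simps power2_eq_square)
  also have "norm \<dots> \<le> norm ((A - A0) * (A + A0) * (1 / B)) + norm (A0 * A0 * (B0 - B) * (1 / B) * (1 / B0))"
    by (rule norm_triangle_ineq)
  also have "\<dots> \<le> e * 4 * 2 + 2 * 2 * e * 2 * 2"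
    unfolding norm_mult using assms i e norm_triangle_ineq[of A A0]
    by (intro add_mono mult_mono) (auto simp: norm_minus_commute)
  finally show ?thesis by simp
qed

text \<open>\<open>qG\<close> at w = Q contains the value at 1, which the recursion reduces to
  values at Q and Q^2; so \<open>qG\<close> becomes 2 * (f 0)^2 * (1 + z * Q / R). The product
  formula thus gives (f 0)^2 up to the ratio R alone. In the limit A is 2 * x / (1 + x) and B is
  x.\<close>

lemma (in ratio_setup) self_class_zero:
  assumes x: "z = x\<^sup>2 - 1" "norm (x - 1) \<le> 1 / 8" and d: "norm (1 - w) \<le> 1 / 2" and wQ: "w = Q" "Q \<noteq> 0"
  obtains H where "(self_class x Q w)\<^sup>2 = qf 0 Q (z * Q) * (qf 0 Q w)\<^sup>2 * H"
    "norm (H - 4 * x / (1 + x)\<^sup>2) \<le> 240 * (norm (1 - w) + norm (1 - Q))"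
proof -
  let ?d = "norm (1 - w) + norm (1 - Q)"
  define R where "R = r 0"
  define A B where "A = 1 + (x - 1) * w / R" and "B = 1 + z * Q / R"
  have R: "norm (R - (1 + x)) \<le> 6 * ?d" using r0_approx[OF x d] by (simp add: R_def)
  have nz: "R \<noteq> 0" "norm (1 / R) \<le> 4" using r_nz inverse_r_le by (auto simp: R_def)
  have x1: "norm (1 + x) \<ge> 15 / 8" "norm (1 + x) \<le> 17 / 8"
    using x(2) norm_triangle_ineq4[of "1 + x" "x - 1"] norm_triangle_ineq[of 2 "x - 1"] by auto
  have xnz: "1 + x \<noteq> 0" using x1 by auto
  have ix: "norm (1 / (1 + x)) \<le> 1" using x1 xnz by (auto simp: norm_divide field_simps)
  have x0: "norm x \<ge> 7 / 8" using x(2) norm_triangle_ineq4[of x "x - 1"] by auto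
  have quot: "norm (v / R - 1 / (1 + x)) \<le> 36 * ?d" if "norm (v - 1) \<le> ?d" for v
    unfolding R_def using r0_quotient[OF x d that] .
  have E1: "f 0 * f 0 * (2 * B) = qf 0 Q (z * Q) * (qf 0 Q w * (2 * qf 0 Q w))"
  proof -
    have "qG z Q Q = qf 0 Q (z * Q) * qf 0 Q Q * qf 0 Q (Q / Q)" by (rule qG_product) (use Q wQ in auto)
    also have "qf 0 Q (Q / Q) = 2 * qf 0 Q Q" using qf_rec[OF Q, of 0 1] wQ by simp
    finally have 1: "qG z Q Q = qf 0 Q (z * Q) * (qf 0 Q w * (2 * qf 0 Q w))" using wQ by simp
    have "qf z Q (Q / Q) = 2 * f 0 + z * Q * f 1"
      using qf_rec[OF Q, of z 1] wQ(2) unfolding f_def by (simp add: wQ(1) power2_eq_square)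
    moreover have "Q\<^sup>2 / Q = Q" "qf z Q Q = f 0" "qf z Q (Q * Q) = f 1"
      using wQ(2) unfolding f_def by (simp_all add: wQ(1) power2_eq_square)
    ultimately have "qG z Q Q = f 0 * (2 * f 0 + z * Q * f 1) + z * Q * f 1 * f 0"
      unfolding qG_def by simp
    also have "f 1 = f 0 / R" using f_nonzero_r_ge[of 0] by (simp add: r_def R_def)
    finally have "qG z Q Q = f 0 * f 0 * (2 * B)" by (simp add: B_def algebra_simps)
    then show ?thesis using 1 by simp
  qed
  have wd: "norm (w - 1) \<le> ?d" "norm (Q - 1) \<le> ?d" by (simp_all add: norm_minus_commute)
  have A0: "2 * x / (1 + x) = 1 + (x - 1) * (1 / (1 + x))" using xnz by (simp add: field_simps)
  have B0: "x = 1 + z * (1 / (1 + x))"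
  proof -
    have "z = (x - 1) * (1 + x)" by (simp add: x(1) power2_eq_square algebra_simps)
    then show ?thesis using xnz by simp
  qed
  have "norm (A - 2 * x / (1 + x)) \<le> 1 / 8 * (36 * ?d)"
  proof -
    have "A - 2 * x / (1 + x) = (x - 1) * (w / R - 1 / (1 + x))" unfolding A0 A_def by (simp add: algebra_simps)
    then show ?thesis using quot[OF wd(1)] x(2) by (simp only: norm_mult) (intro mult_mono, auto)
  qed
  then have AA: "norm (A - 2 * x / (1 + x)) \<le> 10 * ?d"
    using norm_ge_zero[of "1 - w"] norm_ge_zero[of "1 - Q"] by argo
  have "norm (B - x) \<le> 1 / 32 * (36 * ?d)"
  proof -
    have "B - x = z * (Q / R - 1 / (1 + x))" by (subst B0) (simp add: B_def algebra_simps)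
    then show ?thesis using quot[OF wd(2)] z by (simp only: norm_mult) (intro mult_mono, auto)
  qed
  then have BB: "norm (B - x) \<le> 10 * ?d"
    using norm_ge_zero[of "1 - w"] norm_ge_zero[of "1 - Q"] by argo
  have nA: "norm A \<le> 2"
  proof -
    have "norm ((x - 1) * w * (1 / R)) \<le> 1 / 8 * 1 * 4"
      unfolding norm_mult using x(2) w1 nz by (intro mult_mono) auto
    then show ?thesis unfolding A_def using norm_triangle_ineq[of 1 "(x - 1) * w / R"] by simp
  qed
  have nA0: "norm (2 * x / (1 + x)) \<le> 2"
  proof -
    have "norm ((x - 1) * (1 / (1 + x))) \<le> 1 / 8 * 1" unfolding norm_mult using x(2) ix by (intro mult_mono) auto
    then show ?thesis unfolding A0 using norm_triangle_ineq[of 1 "(x - 1) * (1 / (1 + x))"] by simp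
  qed
  have nB: "norm B \<ge> 1 / 2"
  proof -
    have "norm (z * Q * (1 / R)) \<le> 1 / 32 * 1 * 4"
      unfolding norm_mult using z Q nz by (intro mult_mono) auto
    then show ?thesis unfolding B_def using norm_diff_ineq[of 1 "z * Q / R"] by simp
  qed
  have "norm (A\<^sup>2 / B - (2 * x / (1 + x))\<^sup>2 / x) \<le> 24 * (10 * ?d)"
    using x0 by (intro square_quotient_lipschitz AA BB nA nA0 nB) auto
  moreover have "(2 * x / (1 + x))\<^sup>2 / x = 4 * x / (1 + x)\<^sup>2"
    using x0 by (auto simp: power_divide power2_eq_square)
  moreover have "(self_class x Q w)\<^sup>2 = qf 0 Q (z * Q) * (qf 0 Q w)\<^sup>2 * (A\<^sup>2 / B)"
  proof -
    have "B \<noteq> 0" using nB by auto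
    have "(self_class x Q w)\<^sup>2 = f 0 * f 0 * A\<^sup>2"
      unfolding self_class_eq[OF x(1)] A_def R_def by (simp add: power_mult_distrib power2_eq_square)
    also have "f 0 * f 0 = qf 0 Q (z * Q) * (qf 0 Q w)\<^sup>2 / B"
      using E1 \<open>B \<noteq> 0\<close> by (simp add: power2_eq_square field_simps)
    finally show ?thesis by simp
  qed
  ultimately show ?thesis using that[of "A\<^sup>2 / B"] by simp
qed

text \<open>Now Q / w = w, and \<open>qG\<close> becomes (f 0)^2 * (1 + z * Q / R^2). Here A and B
  have the same limit 2 * x / (1 + x), so A^2 / B tends to it as well.\<close>

lemma (in ratio_setup) self_class_half:
  assumes x: "z = x\<^sup>2 - 1" "norm (x - 1) \<le> 1 / 8" and d: "norm (1 - w) \<le> 1 / 2" and wQ: "w * w = Q" "Q \<noteq> 0"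
  obtains H where "(self_class x Q w)\<^sup>2 = qf 0 Q (z * Q) * (qf 0 Q w)\<^sup>2 * H"
    "norm (H - 2 * x / (1 + x)) \<le> 240 * (norm (1 - w) + norm (1 - Q))"
proof -
  let ?d = "norm (1 - w) + norm (1 - Q)"
  define R where "R = r 0"
  define A B where "A = 1 + (x - 1) * w / R" and "B = 1 + z * Q / R\<^sup>2"
  have R: "norm (R - (1 + x)) \<le> 6 * ?d" using r0_approx[OF x d] by (simp add: R_def)
  have nz: "R \<noteq> 0" "norm (1 / R) \<le> 4" using r_nz inverse_r_le by (auto simp: R_def)
  have x1: "norm (1 + x) \<ge> 15 / 8" "norm (1 + x) \<le> 17 / 8"
    using x(2) norm_triangle_ineq4[of "1 + x" "x - 1"] norm_triangle_ineq[of 2 "x - 1"] by auto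
  have xnz: "1 + x \<noteq> 0" using x1 by auto
  have ix: "norm (1 / (1 + x)) \<le> 1" using x1 xnz by (auto simp: norm_divide field_simps)
  have x0: "norm x \<ge> 7 / 8" using x(2) norm_triangle_ineq4[of x "x - 1"] by auto
  have quot: "norm (v / R - 1 / (1 + x)) \<le> 36 * ?d" if "norm (v - 1) \<le> ?d" for v
    unfolding R_def using r0_quotient[OF x d that] .
  have E1: "f 0 * f 0 * B = qf 0 Q (z * Q) * (qf 0 Q w * qf 0 Q w)"
  proof -
    have w0: "w \<noteq> 0" "Q / w = w" "Q\<^sup>2 / w = w * Q" using wQ by (auto simp: field_simps power2_eq_square)
    have "qG z Q w = qf 0 Q (z * Q) * qf 0 Q w * qf 0 Q (Q / w)" by (rule qG_product) (use Q wQ w0 in auto)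
    then have 1: "qG z Q w = qf 0 Q (z * Q) * (qf 0 Q w * qf 0 Q w)" using w0 by simp
    have "qG z Q w = f 0 * f 0 + z * Q * f 1 * f 1"
      unfolding qG_def w0 by (simp add: f_def)
    also have "f 1 = f 0 / R" using f_nonzero_r_ge[of 0] by (simp add: r_def R_def)
    finally have "qG z Q w = f 0 * f 0 * B" by (simp add: B_def algebra_simps power2_eq_square)
    then show ?thesis using 1 by simp
  qed
  have wd: "norm (w - 1) \<le> ?d" "norm (Q - 1) \<le> ?d" "norm (1 - 1 :: complex) \<le> ?d" by (simp_all add: norm_minus_commute)
  have A0: "2 * x / (1 + x) = 1 + (x - 1) * (1 / (1 + x))" using xnz by (simp add: field_simps)
  have B0: "2 * x / (1 + x) = 1 + z * (1 / (1 + x)) * (1 / (1 + x))"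
  proof -
    have "z = (x - 1) * (1 + x)" by (simp add: x(1) power2_eq_square algebra_simps)
    then show ?thesis using xnz A0 by simp
  qed
  have "norm (A - 2 * x / (1 + x)) \<le> 1 / 8 * (36 * ?d)"
  proof -
    have "A - 2 * x / (1 + x) = (x - 1) * (w / R - 1 / (1 + x))" unfolding A0 A_def by (simp add: algebra_simps)
    then show ?thesis using quot[OF wd(1)] x(2) by (simp only: norm_mult) (intro mult_mono, auto)
  qed
  then have AA: "norm (A - 2 * x / (1 + x)) \<le> 10 * ?d"
    using norm_ge_zero[of "1 - w"] norm_ge_zero[of "1 - Q"] by argo
  have "norm (B - 2 * x / (1 + x)) \<le> 1 / 32 * (36 * ?d * 4 + 1 * (36 * ?d))"
  proof -
    have "B - 2 * x / (1 + x) = z * ((Q / R - 1 / (1 + x)) * (1 / R) + 1 / (1 + x) * (1 / R - 1 / (1 + x)))"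
      unfolding B0 by (simp add: B_def algebra_simps power2_eq_square)
    also have "norm \<dots> \<le> 1 / 32 * (36 * ?d * 4 + 1 * (36 * ?d))"
      unfolding norm_mult[of z]
    proof (intro mult_mono z order_trans[OF norm_triangle_ineq])
      show "norm ((Q / R - 1 / (1 + x)) * (1 / R)) + norm (1 / (1 + x) * (1 / R - 1 / (1 + x))) \<le> 36 * ?d * 4 + 1 * (36 * ?d)"
        unfolding norm_mult using quot[OF wd(2)] quot[OF wd(3)] nz ix by (intro add_mono mult_mono) auto
    qed auto
    finally show ?thesis .
  qed
  then have BB: "norm (B - 2 * x / (1 + x)) \<le> 10 * ?d"
    using norm_ge_zero[of "1 - w"] norm_ge_zero[of "1 - Q"] by argo
  have nA: "norm A \<le> 2"
  proof -
    have "norm ((x - 1) * w * (1 / R)) \<le> 1 / 8 * 1 * 4"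
      unfolding norm_mult using x(2) w1 nz by (intro mult_mono) auto
    then show ?thesis unfolding A_def using norm_triangle_ineq[of 1 "(x - 1) * w / R"] by simp
  qed
  have small: "norm ((x - 1) * (1 / (1 + x))) \<le> 1 / 8 * 1" unfolding norm_mult using x(2) ix by (intro mult_mono) auto
  have nA0: "norm (2 * x / (1 + x)) \<le> 2" "norm (2 * x / (1 + x)) \<ge> 1 / 2"
    unfolding A0 using small norm_triangle_ineq[of 1 "(x - 1) * (1 / (1 + x))"] norm_diff_ineq[of 1 "(x - 1) * (1 / (1 + x))"] by simp_all
  have nB: "norm B \<ge> 1 / 2"
  proof -
    have "norm (z * Q * (1 / R) * (1 / R)) \<le> 1 / 32 * 1 * 4 * 4"
      unfolding norm_mult using z Q nz by (intro mult_mono) auto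
    then show ?thesis unfolding B_def using norm_diff_ineq[of 1 "z * Q / R\<^sup>2"] by (simp add: power2_eq_square)
  qed
  have sq: "c\<^sup>2 / c = c" for c :: complex
    by (cases "c = 0") (auto simp: power2_eq_square)
  have "norm (A\<^sup>2 / B - (2 * x / (1 + x))\<^sup>2 / (2 * x / (1 + x))) \<le> 24 * (10 * ?d)"
    by (intro square_quotient_lipschitz AA BB nA nA0 nB)
  then have "norm (A\<^sup>2 / B - 2 * x / (1 + x)) \<le> 240 * ?d"
    unfolding sq by simp
  moreover have "(self_class x Q w)\<^sup>2 = qf 0 Q (z * Q) * (qf 0 Q w)\<^sup>2 * (A\<^sup>2 / B)"
  proof -
    have "B \<noteq> 0" using nB by auto
    have "(self_class x Q w)\<^sup>2 = f 0 * f 0 * A\<^sup>2"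
      unfolding self_class_eq[OF x(1)] A_def R_def by (simp add: power_mult_distrib power2_eq_square)
    also have "f 0 * f 0 = qf 0 Q (z * Q) * (qf 0 Q w)\<^sup>2 / B"
      using E1 \<open>B \<noteq> 0\<close> by (simp add: power2_eq_square field_simps)
    finally show ?thesis by simp
  qed
  ultimately show ?thesis using that[of "A\<^sup>2 / B"] by blast
qed

section \<open>The residue classes put together\<close>

lemma prod_pairs:
  fixes g :: "nat \<Rightarrow> 'a :: comm_monoid_mult"
  assumes "t > 0"
  shows "(\<Prod>b\<in>{1..t}. g b) = g t * (if even t then g (t div 2) else 1) * (\<Prod>b\<in>{1..(t - 1) div 2}. g b * g (t - b))"
proof -
  define m where "m = (t - 1) div 2"
  have inj: "inj_on (\<lambda>b. t - b) {1..m}" by (auto simp: inj_on_def m_def)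
  have cover: "{1..t} = insert t ((if even t then {t div 2} else {}) \<union> ({1..m} \<union> (\<lambda>b. t - b) ` {1..m}))"
  proof (intro equalityI subsetI)
    fix a assume a: "a \<in> {1..t}"
    then consider "a = t" | "2 * a = t" | "1 \<le> a" "a \<le> m" | "1 \<le> t - a" "t - a \<le> m" "a < t"
      by (fastforce simp: m_def)
    then show "a \<in> insert t ((if even t then {t div 2} else {}) \<union> ({1..m} \<union> (\<lambda>b. t - b) ` {1..m}))"
    proof cases
      case 4
      then have "a = t - (t - a)" by simp
      then have "a \<in> (\<lambda>b. t - b) ` {1..m}" using 4 by (intro image_eqI[of _ _ "t - a"]) auto
      then show ?thesis by blast
    qed auto
  qed (use assms in \<open>auto simp: m_def split: if_splits elim!: evenE\<close>)
  have d1: "{1..m} \<inter> (\<lambda>b. t - b) ` {1..m} = {}" by (auto simp: m_def)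
  define U where "U = {1..m} \<union> (\<lambda>b. t - b) ` {1..m}"
  have U: "finite U" "t \<notin> U" "t div 2 \<notin> U \<or> odd t"
    using assms by (auto simp: m_def U_def elim!: evenE)
  have PU: "(\<Prod>b\<in>U. g b) = (\<Prod>b\<in>{1..m}. g b * g (t - b))"
  proof -
    have "(\<Prod>b\<in>U. g b) = (\<Prod>b\<in>{1..m}. g b) * (\<Prod>b\<in>(\<lambda>b. t - b) ` {1..m}. g b)"
      unfolding U_def by (intro prod.union_disjoint d1) auto
    also have "(\<Prod>b\<in>(\<lambda>b. t - b) ` {1..m}. g b) = (\<Prod>b\<in>{1..m}. g (t - b))"
      by (subst prod.reindex[OF inj]) (simp add: o_def)
    finally show ?thesis by (simp only: prod.distrib)
  qed
  have "(\<Prod>b\<in>{1..t}. g b) = g t * ((if even t then g (t div 2) else 1) * (\<Prod>b\<in>U. g b))"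
    unfolding cover U_def[symmetric] using U assms by (cases "even t") auto
  then show ?thesis by (simp only: PU m_def mult.assoc)
qed

text \<open>Each exponent k >= 1 is b + t * j for exactly one b in 1..t; on partial products, one
  value of j is a block of t consecutive factors.\<close>

lemma qf0_regroup:
  assumes q: "norm q < 1" and t: "t > 0"
  shows "(\<Prod>b\<in>{1..t}. qf 0 (q ^ t) (q ^ b)) = qf 0 q q"
proof -
  have Q: "norm (q ^ t) < 1" using q t by (simp add: norm_power power_less_one_iff)
  have fin: "(\<Prod>b\<in>{1..t}. \<Prod>j<N. 1 + q ^ b * (q ^ t) ^ j) = (\<Prod>k<t * N. 1 + q * q ^ k)" for N
  proof (induction N)
    case (Suc N)
    have "(\<Prod>k<t * Suc N. 1 + q * q ^ k) = (\<Prod>k<t * N. 1 + q * q ^ k) * (\<Prod>k\<in>{t * N..<t * N + t}. 1 + q * q ^ k)"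
    proof -
      have "{..<t * Suc N} = {..<t * N} \<union> {t * N..<t * N + t}" by auto
      then show ?thesis by (simp add: prod.union_disjoint ivl_disj_int)
    qed
    also have "(\<Prod>k\<in>{t * N..<t * N + t}. 1 + q * q ^ k) = (\<Prod>b\<in>{1..t}. 1 + q ^ b * (q ^ t) ^ N)"
      by (rule prod.reindex_bij_witness[of _ "\<lambda>b. t * N + b - 1" "\<lambda>k. k + 1 - t * N"])
        (use t in \<open>auto simp flip: power_mult power_add power_Suc intro!: arg_cong[where f = "\<lambda>n. q ^ n"]\<close>)
    finally have "(\<Prod>k<t * Suc N. 1 + q * q ^ k) = (\<Prod>k<t * N. 1 + q * q ^ k) * (\<Prod>b\<in>{1..t}. 1 + q ^ b * (q ^ t) ^ N)" .
    moreover have "(\<Prod>b\<in>{1..t}. \<Prod>j<Suc N. 1 + q ^ b * (q ^ t) ^ j) =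
        (\<Prod>b\<in>{1..t}. \<Prod>j<N. 1 + q ^ b * (q ^ t) ^ j) * (\<Prod>b\<in>{1..t}. 1 + q ^ b * (q ^ t) ^ N)"
      by (simp add: prod.distrib)
    ultimately show ?case by (simp only: Suc.IH)
  qed simp
  have "(\<lambda>N. \<Prod>b\<in>{1..t}. \<Prod>j<N. 1 + q ^ b * (q ^ t) ^ j) \<longlonglongrightarrow> (\<Prod>b\<in>{1..t}. qf 0 (q ^ t) (q ^ b))"
    by (intro tendsto_prod qf0_tendsto Q)
  moreover have "strict_mono (\<lambda>N. t * N)" using t by (auto simp: strict_mono_def)
  then have "(\<lambda>N. \<Prod>k<t * N. 1 + q * q ^ k) \<longlonglongrightarrow> qf 0 q q"
    using LIMSEQ_subseq_LIMSEQ[OF qf0_tendsto[OF q, of q]] by (simp add: o_def)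
  ultimately show ?thesis unfolding fin using LIMSEQ_unique by blast
qed

lemma exp_power_sector:
  assumes "s \<in> sector" "k + t * j > 0"
  shows "exp (- s) ^ k * (exp (- s) ^ t) ^ j = exp (- (of_real (real (k + t * j)) * s))"
    "of_real (real (k + t * j)) * s \<in> sector"
proof -
  have "exp (- s) ^ k * (exp (- s) ^ t) ^ j = exp (- s) ^ (k + t * j)"
    by (simp add: power_add power_mult)
  also have "\<dots> = exp (of_nat (k + t * j) * (- s))" by (rule exp_of_nat_mult[symmetric])
  finally show "exp (- s) ^ k * (exp (- s) ^ t) ^ j = exp (- (of_real (real (k + t * j)) * s))" by simp
  show "of_real (real (k + t * j)) * s \<in> sector"
    using assms by (intro sector_scale) (simp_all only: of_nat_0_less_iff)
qed

lemma norm_exp_sector_less: "s \<in> sector \<Longrightarrow> norm (exp (- s)) < 1"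
  by (simp add: sector_def)

lemma ratio_setup_exp:
  assumes s: "s \<in> sector" and z: "norm z \<le> 1 / 32" and t: "t > 0" and k: "k > 0"
  shows "ratio_setup z (exp (- s) ^ t) (exp (- s) ^ k)"
proof
  have lt: "norm (exp (- s)) < 1" using s by (rule norm_exp_sector_less)
  show "norm (exp (- s) ^ t) < 1" using lt t by (simp only: norm_power power_less_one_iff norm_ge_zero)
  show "norm (exp (- s) ^ k) \<le> 1" unfolding norm_power using lt by (intro power_le_one) auto
  show "1 / 2 \<le> norm (1 + exp (- s) ^ k * (exp (- s) ^ t) ^ j)" for j
    using exp_power_sector[OF s, of k t j] k norm_1_plus_exp_sector[of "of_real (real (k + t * j)) * s"]
    by (auto simp: sector_def)
qed (rule z)

lemma one_minus_exp_power_le: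
  fixes s :: complex
  assumes "real k * norm s \<le> 1"
  shows "norm (1 - exp (- s) ^ k) \<le> 3 * (real k * norm s)"
proof -
  have "exp (- s) ^ k = exp (of_nat k * (- s))" by (rule exp_of_nat_mult[symmetric])
  then have "norm (1 - exp (- s) ^ k) = norm (exp (of_nat k * (- s)) - 1)" by (simp only: norm_minus_commute)
  also have "\<dots> \<le> 3 * norm (of_nat k * (- s))" using assms by (intro norm_exp_minus_1_le) (simp add: norm_mult)
  finally show ?thesis by (simp add: norm_mult)
qed

lemma norm_prod_minus_1_le:
  fixes A B :: complex
  assumes "norm (A - 1) \<le> \<alpha>" "\<alpha> \<le> 1" "norm (B - 1) \<le> \<beta>"
  shows "norm (A * B - 1) \<le> \<alpha> + 2 * \<beta>"
proof -
  have "norm A \<le> 2" using norm_triangle_ineq[of "A - 1" 1] assms by simp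
  then have "norm (A * (B - 1)) \<le> 2 * \<beta>" unfolding norm_mult using assms by (intro mult_mono) auto
  then show ?thesis using norm_triangle_ineq[of "A * (B - 1)" "A - 1"] assms by (simp add: algebra_simps)
qed

text \<open>The exponent of the main term at \<open>q = exp (- s)\<close> is \<open>afun u / s + lfun t u\<close>.\<close>

definition afun :: "complex \<Rightarrow> complex" where
  "afun u = of_real (pi\<^sup>2 / 12) + altdilog (exp (2 * u) - 1) / 2"

definition lfun :: "nat \<Rightarrow> complex \<Rightarrow> complex" where
  "lfun t u = of_real ((1 - real t + delta_even t) / 2) * u - of_real (1 + delta_even t / 2) * Ln ((1 + exp u) / 2)"

text \<open>The radius 1 / 200 gives |z| <= 3 * 2 / 200 <= 1 / 32, the hypothesis of
  \<open>ratio_setup\<close>.\<close>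

lemma exp_near_0_bounds:
  fixes u :: complex
  assumes u: "norm u \<le> 1 / 200"
  shows "norm (exp u - 1) \<le> 1 / 8" "norm (exp (2 * u) - 1) \<le> 1 / 32" "exp (2 * u) - 1 = (exp u)\<^sup>2 - 1"
    "norm (exp u) \<ge> 7 / 8" "norm (1 + exp u) \<ge> 15 / 8" "norm (1 + exp u) \<le> 17 / 8"
proof -
  have 1: "norm (exp u - 1) \<le> 3 * norm u" using u by (intro norm_exp_minus_1_le) simp
  then show "norm (exp u - 1) \<le> 1 / 8" using u by simp
  have "norm (exp (2 * u) - 1) \<le> 3 * norm (2 * u)" using u by (intro norm_exp_minus_1_le) (simp add: norm_mult)
  then show "norm (exp (2 * u) - 1) \<le> 1 / 32" using u by (simp add: norm_mult)
  show "exp (2 * u) - 1 = (exp u)\<^sup>2 - 1" by (simp add: exp_double)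
  show "norm (exp u) \<ge> 7 / 8" "norm (1 + exp u) \<ge> 15 / 8" "norm (1 + exp u) \<le> 17 / 8"
    using 1 u norm_triangle_ineq4[of "exp u" "exp u - 1"] norm_triangle_ineq4[of "1 + exp u" "exp u - 1"] 
      norm_triangle_ineq[of 2 "exp u - 1"] by auto
qed

text \<open>The origin of \<open>lfun\<close>: exp (- t * u) comes from the t half terms Ln (1 + z)
  / 2 = u of the factor \<open>qf 0 Q (z * Q)\<close> in \<open>hookF_squared\<close>; the other two
  factors are the limits found in \<open>self_class_zero\<close> and
  \<open>self_class_half\<close>.\<close>

lemma exp_2_lfun:
  assumes "1 + exp u \<noteq> 0"
  shows "exp (2 * lfun t u) = exp (- of_nat t * u) * (4 * exp u / (1 + exp u)\<^sup>2) * (if even t then 2 * exp u / (1 + exp u) else 1)"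
proof -
  define L where "L = Ln ((1 + exp u) / 2)"
  have L: "exp L = (1 + exp u) / 2" unfolding L_def using assms by (intro exp_Ln) auto
  show ?thesis
  proof (cases "even t")
    case True
    then have "2 * lfun t u = - of_nat t * u + u + u - L - L - L"
      by (simp add: lfun_def delta_even_def L_def field_simps)
    then have "exp (2 * lfun t u) = exp (- of_nat t * u) * exp u * exp u / exp L / exp L / exp L"
      by (simp only: exp_diff exp_add)
    then show ?thesis using True assms by (simp add: L power2_eq_square field_simps)
  next
    case False
    then have "2 * lfun t u = - of_nat t * u + u - L - L"
      by (simp add: lfun_def delta_even_def L_def field_simps)
    then have "exp (2 * lfun t u) = exp (- of_nat t * u) * exp u / exp L / exp L"
      by (simp only: exp_diff exp_add)
    then show ?thesis using False assms by (simp add: L power2_eq_square field_simps)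
  qed
qed

text \<open>The factor 1 / sqrt 2 is the half term Ln 2 / 2 of the product at z = 1.\<close>

definition major :: "nat \<Rightarrow> complex \<Rightarrow> complex \<Rightarrow> complex" where
  "major t u s = exp (afun u / s + lfun t u) / of_real (sqrt 2)"

text \<open>Squares are taken because the self-paired classes are known only up to squaring. The
  factor \<open>qf 0 Q (z * Q)\<close> occurs twice per squared pair and once per squared
  self-paired class, t times in all; the remaining products regroup to
  \<open>qf 0 q q\<close>.\<close>

lemma hookF_squared:
  assumes s: "s \<in> sector" and t: "t > 0" and u: "norm u \<le> 1 / 200" and ts: "real t * norm s \<le> 1 / 6"
  obtains H0 Hh where
    "(hookF t (exp u) (exp (- s)))\<^sup>2 = (qf 0 (exp (- s) ^ t) ((exp (2 * u) - 1) * exp (- s) ^ t)) ^ t * (qf 0 (exp (- s)) (exp (- s)))\<^sup>2 * (H0 * Hh)"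
    "norm (H0 / (4 * exp u / (1 + exp u)\<^sup>2) - 1) \<le> 2880 * (real t * norm s)"
    "norm (Hh / (if even t then 2 * exp u / (1 + exp u) else 1) - 1) \<le> 2880 * (real t * norm s)"
proof -
  define q Q x z where "q = exp (- s)" and "Q = q ^ t" and "x = exp u" and "z = exp (2 * u) - 1"
  note n1 = exp_near_0_bounds[OF u, folded x_def, folded z_def]
  have z: "z = x\<^sup>2 - 1" "norm z \<le> 1 / 32" using n1 by auto
  have q: "q \<noteq> 0" "norm q < 1" using norm_exp_sector_less[OF s] by (auto simp: q_def)
  have Q: "Q \<noteq> 0" "norm Q < 1" using q t by (auto simp: Q_def norm_power power_less_one_iff)
  have one: "norm (1 - q ^ k) \<le> 3 * (real k * norm s)" if "k \<le> t" for k
  proof -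
    have "real k * norm s \<le> real t * norm s" using that by (intro mult_right_mono) auto
    then show ?thesis unfolding q_def using ts by (intro one_minus_exp_power_le) linarith
  qed
  have Q1: "norm (1 - Q) \<le> 3 * (real t * norm s)" unfolding Q_def by (rule one) simp
  have Qh: "norm (1 - Q) \<le> 1 / 2" using Q1 ts by linarith
  have xne: "x \<noteq> 0" "1 + x \<noteq> 0" using n1 by auto
  interpret R0: ratio_setup z Q Q
    unfolding Q_def q_def by (rule ratio_setup_exp[OF s z(2) t t])
  obtain H0 where H0: "(self_class x Q Q)\<^sup>2 = qf 0 Q (z * Q) * (qf 0 Q Q)\<^sup>2 * H0"
    "norm (H0 - 4 * x / (1 + x)\<^sup>2) \<le> 240 * (norm (1 - Q) + norm (1 - Q))"
    using R0.self_class_zero[OF z(1) n1(1) Qh refl Q(1)] by blast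
  have h0: "norm (4 * x / (1 + x)\<^sup>2) \<ge> 1 / 2"
  proof -
    have "norm ((1 + x)\<^sup>2) \<le> (17 / 8)\<^sup>2" unfolding norm_power using n1 by (intro power_mono) auto
    also have "(17 / 8)\<^sup>2 \<le> (7::real)" by (simp add: power2_eq_square)
    finally have "norm ((1 + x)\<^sup>2) \<le> 7" .
    then have "norm (4 * x) / norm ((1 + x)\<^sup>2) \<ge> (4 * (7 / 8)) / 7"
      using n1 xne by (intro frac_le) (auto simp: norm_mult)
    then show ?thesis by (simp add: norm_divide)
  qed
  have hh: "norm (2 * x / (1 + x)) \<ge> 1 / 2"
  proof -
    have "norm (2 * x) / norm (1 + x) \<ge> (2 * (7 / 8)) / (17 / 8)"
      using n1 xne by (intro frac_le) (auto simp: norm_mult)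
    then show ?thesis by (simp add: norm_divide)
  qed
  have rel: "norm (H / h - 1) \<le> 2 * e" if "norm (H - h) \<le> e" "norm h \<ge> 1 / 2" for H h :: complex and e
  proof -
    have hn: "h \<noteq> 0" using that by auto
    have "e \<ge> 0" using that(1) norm_ge_zero order_trans by blast
    have "H / h - 1 = (H - h) / h" using hn by (simp add: field_simps)
    then have "norm (H / h - 1) = norm (H - h) / norm h" by (simp add: norm_divide)
    also have "\<dots> \<le> e / (1 / 2)" using that \<open>e \<ge> 0\<close> by (intro frac_le) auto
    finally show ?thesis by simp
  qed
  have "norm (H0 / (4 * x / (1 + x)\<^sup>2) - 1) \<le> 2 * (240 * (norm (1 - Q) + norm (1 - Q)))"
    by (rule rel[OF H0(2) h0])
  \<comment> \<open>2880 = 2 * 240 * (3 + 3), from |1 - Q| <= 3 * t * |s|.\<close>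
  then have b0: "norm (H0 / (4 * x / (1 + x)\<^sup>2) - 1) \<le> 2880 * (real t * norm s)" using Q1 by argo
  obtain Hh where Hh: "(if even t then (self_class x Q (q ^ (t div 2)))\<^sup>2 else 1) = 
      (if even t then qf 0 Q (z * Q) * (qf 0 Q (q ^ (t div 2)))\<^sup>2 else 1) * Hh"
    "norm (Hh / (if even t then 2 * x / (1 + x) else 1) - 1) \<le> 2880 * (real t * norm s)"
  proof (cases "even t")
    case True
    define w where "w = q ^ (t div 2)"
    have t2: "t div 2 > 0" "t div 2 \<le> t" using t True by (auto elim!: evenE)
    interpret Rh: ratio_setup z Q w
      unfolding Q_def q_def w_def by (rule ratio_setup_exp[OF s z(2) t t2(1)])
    have wQ: "w * w = Q" unfolding w_def Q_def power_add[symmetric] using True by (auto elim!: evenE simp: mult_2)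
    have w1: "norm (1 - w) \<le> 3 * (real (t div 2) * norm s)" unfolding w_def by (rule one[OF t2(2)])
    also have "\<dots> \<le> 3 * (real t * norm s)" by (intro mult_left_mono mult_right_mono) auto
    finally have w1: "norm (1 - w) \<le> 3 * (real t * norm s)" .
    have wh: "norm (1 - w) \<le> 1 / 2" using w1 ts by linarith
    obtain H where H: "(self_class x Q w)\<^sup>2 = qf 0 Q (z * Q) * (qf 0 Q w)\<^sup>2 * H"
      "norm (H - 2 * x / (1 + x)) \<le> 240 * (norm (1 - w) + norm (1 - Q))"
      using Rh.self_class_half[OF z(1) n1(1) wh wQ Q(1)] by blast
    have "norm (H / (2 * x / (1 + x)) - 1) \<le> 2 * (240 * (norm (1 - w) + norm (1 - Q)))"
      by (rule rel[OF H(2) hh])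
    then have "norm (H / (2 * x / (1 + x)) - 1) \<le> 2880 * (real t * norm s)" using Q1 w1 by argo
    then show ?thesis using True H(1) that[of H] by (simp add: w_def)
  next
    case False
    then show ?thesis using that[of 1] by simp
  qed
  define P where "P = qf 0 Q (z * Q)"
  define E where "E = (\<lambda>b. qf 0 Q (q ^ b))"
  define m where "m = (t - 1) div 2"
  have pair: "qG (x\<^sup>2 - 1) Q (q ^ b) = P * (E b * E (t - b))" if "b \<in> {1..m}" for b
  proof -
    have "b \<le> t" using that by (auto simp: m_def)
    then have "q ^ b * q ^ (t - b) = Q" unfolding Q_def power_add[symmetric] by simp
    then have "Q / q ^ b = q ^ (t - b)" using q by (simp add: field_simps)
    moreover have "qG z Q (q ^ b) = P * qf 0 Q (q ^ b) * qf 0 Q (Q / q ^ b)"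
      unfolding P_def using Q q by (intro qG_product) auto
    ultimately show ?thesis by (simp add: E_def z(1)[symmetric])
  qed
  have a1: "(self_class x Q Q)\<^sup>2 = P * (E t)\<^sup>2 * H0"
    using H0(1) by (simp add: P_def E_def Q_def)
  have a2: "(if even t then (self_class x Q (q ^ (t div 2)))\<^sup>2 else 1) = (if even t then P * (E (t div 2))\<^sup>2 else 1) * Hh"
    unfolding P_def E_def by (rule Hh(1))
  have "(hookF t x q)\<^sup>2 = (self_class x Q Q)\<^sup>2 * (if even t then (self_class x Q (q ^ (t div 2)))\<^sup>2 else 1)
     * (\<Prod>b\<in>{1..m}. qG (x\<^sup>2 - 1) Q (q ^ b))\<^sup>2"
    by (simp add: hookF_def Q_def m_def power_mult_distrib)
  also have "(\<Prod>b\<in>{1..m}. qG (x\<^sup>2 - 1) Q (q ^ b)) = P ^ m * (\<Prod>b\<in>{1..m}. E b * E (t - b))"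
    using pair by (simp add: prod.distrib)
  finally have F2: "(hookF t x q)\<^sup>2 = (P * (E t)\<^sup>2 * H0) * ((if even t then P * (E (t div 2))\<^sup>2 else 1) * Hh) * (P ^ m * (\<Prod>b\<in>{1..m}. E b * E (t - b)))\<^sup>2"
    unfolding a1 a2 .
  also have "\<dots> = P ^ t * ((E t * (if even t then E (t div 2) else 1) * (\<Prod>b\<in>{1..m}. E b * E (t - b)))\<^sup>2) * (H0 * Hh)"
  proof -
    have "P ^ t = P * (if even t then P else 1) * (P ^ m)\<^sup>2"
    proof (cases "even t")
      case True
      then obtain b where "t = 2 * b" by (elim evenE)
      then have "t = Suc (Suc (m * 2))" using t by (cases b) (auto simp: m_def)
      then show ?thesis using True by (simp add: power_mult[symmetric])
    next
      case False
      then have "t = Suc (m * 2)" by (auto simp: m_def elim!: oddE)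
      then show ?thesis using False by (simp add: power_mult[symmetric])
    qed
    then show ?thesis by (simp add: power2_eq_square)
  qed
  also have "E t * (if even t then E (t div 2) else 1) * (\<Prod>b\<in>{1..m}. E b * E (t - b)) = qf 0 q q"
    using qf0_regroup[OF q(2) t] prod_pairs[OF t, of E] by (simp add: E_def Q_def m_def)
  finally have F: "(hookF t x q)\<^sup>2 = P ^ t * (qf 0 q q)\<^sup>2 * (H0 * Hh)" .
  show ?thesis
    by (rule that[OF F[unfolded P_def Q_def q_def x_def z_def] b0[unfolded x_def] Hh(2)[unfolded x_def]])
qed

text \<open>The errors of the two products add up to an exponent of at most 18 * t^2 * |s|, hence 54
  after exponentiation; the class factors add 2 * (2880 + 2 * 2880). The sum 17334 is rounded up to
  20000, and the restriction on s keeps the total at most 1 / 2.\<close>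

lemma hookF_squared_asymptotics:
  assumes s: "s \<in> sector" and t: "t > 0" and u: "norm u \<le> 1 / 200" and small: "40000 * (real t)\<^sup>2 * norm s \<le> 1"
  shows "norm ((hookF t (exp u) (exp (- s)) / major t u s)\<^sup>2 - 1) \<le> 20000 * (real t)\<^sup>2 * norm s"
proof -
  define x z where "x = exp u" and "z = exp (2 * u) - 1"
  note n1 = exp_near_0_bounds[OF u, folded x_def, folded z_def]
  have xne: "x \<noteq> 0" "1 + x \<noteq> 0" using n1 by auto
  define T where "T = real t"
  have T: "T \<ge> 1" "T \<le> T\<^sup>2" using t by (auto simp: T_def power2_eq_square)
  have ns: "norm s \<ge> 0" by simp
  have Ts: "T * norm s \<le> T\<^sup>2 * norm s" "norm s \<le> T\<^sup>2 * norm s" using T by (auto intro!: mult_right_mono mult_left_mono)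
      (metis mult_1 mult_right_mono norm_ge_zero order_trans)
  have ts: "real t * norm s \<le> 1 / 6" "norm s \<le> 1" "T * norm s \<le> 1" using Ts small unfolding T_def by linarith+
  obtain H0 Hh where H:
    "(hookF t x (exp (- s)))\<^sup>2 = (qf 0 (exp (- s) ^ t) (z * exp (- s) ^ t)) ^ t * (qf 0 (exp (- s)) (exp (- s)))\<^sup>2 * (H0 * Hh)"
    "norm (H0 / (4 * x / (1 + x)\<^sup>2) - 1) \<le> 2880 * (T * norm s)"
    "norm (Hh / (if even t then 2 * x / (1 + x) else 1) - 1) \<le> 2880 * (T * norm s)"
    using hookF_squared[OF s t u ts(1)] unfolding x_def z_def T_def by blast
  define h0 hh where "h0 = 4 * x / (1 + x)\<^sup>2" and "hh = (if even t then 2 * x / (1 + x) else 1)"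
  have hne: "h0 \<noteq> 0" "hh \<noteq> 0" using xne by (auto simp: h0_def hh_def)
  have sne: "s \<noteq> 0" using s by (auto simp: sector_def)
  obtain e1 where e1: "norm e1 \<le> 6 * norm s" "qf 0 (exp (- s)) (exp (- s)) = exp (of_real (pi\<^sup>2 / 12) / s - Ln 2 / 2 + e1)"
    using qf0_exp_asymptotics[OF s ts(2), of 1] by (auto simp: altdilog_1)
  define S where "S = of_real T * s"
  have S: "S \<in> sector" "norm S \<le> 1" using sector_scale[OF s, of T] T ts by (auto simp: S_def norm_mult)
  have eS: "exp (- s) ^ t = exp (- S)" unfolding S_def T_def using exp_of_nat_mult[of t "- s"] by simp
  obtain e2 where e2: "norm e2 \<le> 6 * norm S" "qf 0 (exp (- S)) (z * exp (- S)) = exp (altdilog z / S - Ln (1 + z) / 2 + e2)"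
    using qf0_exp_asymptotics[OF S, of z] n1 by auto
  have Lnz: "Ln (1 + z) = 2 * u"
  proof -
    have "\<bar>Im (2 * u)\<bar> \<le> norm (2 * u)" by (rule abs_Im_le_cmod)
    then have "\<bar>Im (2 * u)\<bar> < pi" using u pi_gt3 by (simp add: norm_mult)
    then show ?thesis by (simp add: z_def Ln_exp)
  qed
  define e where "e = 2 * e1 + of_real T * e2"
  have en: "norm e \<le> 18 * (T\<^sup>2 * norm s)"
  proof -
    have "norm e \<le> 2 * norm e1 + T * norm e2" unfolding e_def using T
      by (intro order_trans[OF norm_triangle_ineq]) (simp add: norm_mult)
    also have "T * norm e2 \<le> T * (6 * (T * norm s))" using e2(1) T by (intro mult_left_mono) (auto simp: S_def norm_mult)
    also have "\<dots> = 6 * (T\<^sup>2 * norm s)" by (simp add: power2_eq_square)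
    finally show ?thesis using e1(1) Ts by linarith
  qed
  have small': "40000 * (T\<^sup>2 * norm s) \<le> 1" using small by (simp add: T_def mult.assoc)
  have ee: "norm (exp e - 1) \<le> 54 * (T\<^sup>2 * norm s)"
    using norm_exp_minus_1_le[of e] en small' by linarith
  have af: "afun u = of_real (pi\<^sup>2 / 12) + altdilog z / 2" by (simp add: afun_def z_def)
  define A where "A = exp (afun u / s + lfun t u)"
  have F2: "(hookF t x (exp (- s)))\<^sup>2 = A\<^sup>2 / 2 * (exp e * ((H0 / h0) * (Hh / hh)))"
  proof -
    have "(qf 0 (exp (- S)) (z * exp (- S))) ^ t * (qf 0 (exp (- s)) (exp (- s)))\<^sup>2 = 
       exp (of_nat t * (altdilog z / S - Ln (1 + z) / 2 + e2)) * exp (2 * (of_real (pi\<^sup>2 / 12) / s - Ln 2 / 2 + e1))"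
      unfolding e1(2) e2(2) exp_of_nat_mult exp_double ..
    also have "\<dots> = exp (2 * (afun u / s) - of_nat t * u - Ln 2 + e)"
      unfolding exp_add[symmetric]
    proof (rule arg_cong[where f = exp])
      have "of_nat t * (altdilog z / S) = altdilog z / s" using T sne by (simp add: S_def T_def)
      then show "of_nat t * (altdilog z / S - Ln (1 + z) / 2 + e2) + 2 * (of_real (pi\<^sup>2 / 12) / s - Ln 2 / 2 + e1) =
          2 * (afun u / s) - of_nat t * u - Ln 2 + e"
        unfolding af by (simp add: Lnz e_def T_def algebra_simps add_divide_distrib)
    qed
    also have "\<dots> = exp (2 * (afun u / s)) * exp (- of_nat t * u) / 2 * exp e"
      by (simp add: exp_add exp_diff exp_minus field_simps)
    finally have P1: "(qf 0 (exp (- S)) (z * exp (- S))) ^ t * (qf 0 (exp (- s)) (exp (- s)))\<^sup>2 =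
       exp (2 * (afun u / s)) * exp (- of_nat t * u) / 2 * exp e" .
    have 1: "(hookF t x (exp (- s)))\<^sup>2 = exp (2 * (afun u / s)) * exp (- of_nat t * u) / 2 * exp e * (H0 * Hh)"
      unfolding H(1) eS P1 by (rule refl)
    have "A\<^sup>2 = exp (2 * (afun u / s)) * exp (2 * lfun t u)"
      unfolding A_def exp_double[symmetric] exp_add[symmetric] by (simp add: algebra_simps)
    also have "exp (2 * lfun t u) = exp (- of_nat t * u) * h0 * hh"
      using exp_2_lfun[of u t] xne unfolding h0_def hh_def x_def by simp
    finally have "A\<^sup>2 = exp (2 * (afun u / s)) * (exp (- of_nat t * u) * h0 * hh)" .
    then show ?thesis unfolding 1 using hne by (simp add: field_simps)
  qed
  have "(of_real (sqrt 2) :: complex)\<^sup>2 = 2" by (metis of_real_numeral of_real_power real_sqrt_pow2 zero_le_numeral)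
  then have eqn: "(hookF t x (exp (- s)) / major t u s)\<^sup>2 = exp e * ((H0 / h0) * (Hh / hh))"
    unfolding power_divide F2 major_def A_def[symmetric] by (simp add: A_def)
  have N: "norm (exp e * ((H0 / h0) * (Hh / hh)) - 1) \<le> 54 * (T\<^sup>2 * norm s) + 2 * (2880 * (T * norm s) + 2 * (2880 * (T * norm s)))"
  proof (intro norm_prod_minus_1_le ee)
    show "2880 * (T * norm s) \<le> 1" "54 * (T\<^sup>2 * norm s) \<le> 1" using Ts small' by linarith+
  qed (use H(2,3) in \<open>simp_all add: h0_def hh_def\<close>)
  then have "norm (exp e * ((H0 / h0) * (Hh / hh)) - 1) \<le> 20000 * (T\<^sup>2 * norm s)"
  proof -
    have "a \<le> 54 * X + 2 * (2880 * Y + 2 * (2880 * Y)) \<Longrightarrow> Y \<le> X \<Longrightarrow> 0 \<le> X \<Longrightarrow> a \<le> 20000 * X" for a X Y :: real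
      by argo
    from this[OF _ Ts(1)] show ?thesis using N Ts(2) ns by (meson order_trans)
  qed
  then show ?thesis unfolding eqn[symmetric] x_def T_def by (simp only: mult.assoc)
qed

text \<open>The sign of the square root is constant in \<open>u\<close> by connectedness and is fixed at \<open>u = 0\<close>,
  where the generating function is \<open>qf 0 q q\<close>.\<close>

theorem hookF_major:
  assumes s: "s \<in> sector" and t: "t > 0" and u: "norm u \<le> 1 / 200" and small: "40000 * (real t)\<^sup>2 * norm s \<le> 1"
  shows "norm (hookF t (exp u) (exp (- s)) / major t u s - 1) \<le> 20000 * (real t)\<^sup>2 * norm s"
proof -
  define q where "q = exp (- s)"
  have q: "q \<noteq> 0" "norm q < 1" using norm_exp_sector_less[OF s] by (auto simp: q_def)
  have sne: "s \<noteq> 0" using s by (auto simp: sector_def)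
  define g where "g = (\<lambda>u. hookF t (exp u) q / major t u s)"
  define U where "U = cball (0::complex) (1 / 200)"
  have sq: "norm ((g v)\<^sup>2 - 1) \<le> 20000 * (real t)\<^sup>2 * norm s" if "v \<in> U" for v
    unfolding g_def q_def using that by (intro hookF_squared_asymptotics s t small) (auto simp: U_def)
  have sq2: "norm ((g v)\<^sup>2 - 1) \<le> 1 / 2" if "v \<in> U" for v
    using sq[OF that] small by simp
  \<comment> \<open>A purely imaginary g has a nonpositive square, at distance at least 1 from
    1.\<close>
  have nr: "Re (g v) \<noteq> 0" if "v \<in> U" for v
  proof
    assume "Re (g v) = 0"
    then have "Re ((g v)\<^sup>2 - 1) \<le> -1" by (simp add: power2_eq_square)
    then show False using sq2[OF that] abs_Re_le_cmod[of "(g v)\<^sup>2 - 1"] by linarith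
  qed
  have near: "norm v \<le> 1 / 200" if "v \<in> U" for v using that by (simp add: U_def)
  have cont: "continuous_on U g"
  proof -
    have "continuous_on U (\<lambda>v. hookF t (exp v) q)"
    proof (rule continuous_on_compose2[OF continuous_on_hookF[OF t q, of 2]])
      show "continuous_on U exp" by (intro continuous_intros)
      have "norm (exp v) \<le> 2" if "v \<in> U" for v :: complex
        using exp_near_0_bounds(6)[OF near[OF that]] norm_triangle_ineq4[of "1 + exp v" 1] 
          exp_near_0_bounds(1)[OF near[OF that]] norm_triangle_ineq[of 1 "exp v - 1"] by simp
      then show "exp ` U \<subseteq> cball 0 2" by auto
    qed
    moreover have "continuous_on U (\<lambda>v. altdilog (exp (2 * v) - 1))"
    proof (rule continuous_on_compose2[OF continuous_on_altdilog])
      show "continuous_on U (\<lambda>v. exp (2 * v) - 1)" by (intro continuous_intros)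
      have "norm (exp (2 * v) - 1) \<le> 1" if "v \<in> U" for v :: complex
        using exp_near_0_bounds(2)[OF near[OF that]] by simp
      then show "(\<lambda>v. exp (2 * v) - 1) ` U \<subseteq> cball 0 1" by auto
    qed
    moreover have "(1 + exp v) / 2 \<notin> \<real>\<^sub>\<le>\<^sub>0" if "v \<in> U" for v :: complex
    proof -
      have "\<bar>Re (exp v - 1)\<bar> \<le> 1 / 8" using exp_near_0_bounds(1)[OF near[OF that]] abs_Re_le_cmod order_trans by blast
      then have "\<bar>Re (exp v) - 1\<bar> \<le> 1 / 8" by simp
      then have "Re (exp v) > 0" by linarith
      then have "Re ((1 + exp v) / 2) > 0" by simp
      then show ?thesis by (auto simp: complex_nonpos_Reals_iff)
    qed
    ultimately show ?thesis
      unfolding g_def major_def afun_def lfun_def using sne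
      by (intro continuous_intros) auto
  qed
  have pos: "Re (g v) > 0" if "v \<in> U" for v
  proof (rule ccontr)
    assume "\<not> Re (g v) > 0"
    then have neg: "Re (g v) < 0" using nr[OF that] by linarith
    have "hookF t 1 q = qf 0 q q"
    proof -
      have Q: "norm (q ^ t) < 1" "q ^ t \<noteq> 0" using q t by (auto simp: norm_power power_less_one_iff)
      have "qG 0 (q ^ t) (q ^ b) = qf 0 (q ^ t) (q ^ b) * qf 0 (q ^ t) (q ^ (t - b))" if "b \<in> {1..(t - 1) div 2}" for b
      proof -
        have "b \<le> t" using that by auto
        then have "q ^ t / q ^ b = q ^ (t - b)" using q by (simp add: power_diff)
        then show ?thesis by (simp add: qG_def)
      qed
      then have "hookF t 1 q = qf 0 (q ^ t) (q ^ t) * (if even t then qf 0 (q ^ t) (q ^ (t div 2)) else 1) *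
          (\<Prod>b\<in>{1..(t - 1) div 2}. qf 0 (q ^ t) (q ^ b) * qf 0 (q ^ t) (q ^ (t - b)))"
        by (simp add: hookF_def self_class_def)
      also have "\<dots> = qf 0 q q"
        using qf0_regroup[OF q(2) t] prod_pairs[OF t, of "\<lambda>b. qf 0 (q ^ t) (q ^ b)"] by simp
      finally show ?thesis .
    qed
    moreover have "norm s \<le> 1 / 40000"
    proof -
      have "(real t)\<^sup>2 \<ge> 1" using t by simp
      then have "1 * norm s \<le> (real t)\<^sup>2 * norm s" by (intro mult_right_mono) auto
      then show ?thesis using small by (simp add: mult.assoc)
    qed
    then obtain e where e: "norm e \<le> 6 * norm s" "qf 0 q q = exp (of_real (pi\<^sup>2 / 12) / s - Ln 2 / 2 + e)"
      using qf0_exp_asymptotics[OF s, of 1] by (auto simp: altdilog_1 q_def)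
    moreover have "major t 0 s = exp (of_real (pi\<^sup>2 / 12) / s - Ln 2 / 2)"
    proof -
      have "exp (Ln 2 / 2 :: complex) = of_real (exp (ln 2 / 2))"
        by (simp add: exp_of_real[symmetric] Ln_of_real[of 2, simplified])
      also have "exp (ln 2 / 2) = sqrt (2::real)"
      proof -
        have "(exp (ln 2 / 2))\<^sup>2 = (2::real)" by (simp add: exp_double[symmetric])
        then show ?thesis by (metis exp_ge_zero real_sqrt_unique)
      qed
      finally show ?thesis by (simp add: major_def afun_def lfun_def exp_diff)
    qed
    ultimately have g0: "g 0 = exp e" by (simp add: g_def exp_add)
    have "norm (exp e - 1) \<le> 1 / 2"
      using norm_exp_minus_1_le[of e] e(1) \<open>norm s \<le> 1 / 40000\<close> by linarith
    then have g0: "Re (g 0) > 0" using abs_Re_le_cmod[of "exp e - 1"] unfolding g0 by simp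
    have "connected ((\<lambda>v. Re (g v)) ` U)"
      unfolding U_def[symmetric] by (intro connected_continuous_image continuous_intros cont) (simp add: U_def)
    moreover have "Re (g v) \<in> (\<lambda>v. Re (g v)) ` U" "Re (g 0) \<in> (\<lambda>v. Re (g v)) ` U" using that by (auto simp: U_def)
    ultimately have "0 \<in> (\<lambda>v. Re (g v)) ` U" 
      using neg g0 unfolding connected_iff_interval by (meson less_imp_le)
    then show False using nr by force
  qed
  have uU: "u \<in> U" using u by (simp add: U_def)
  \<comment> \<open>With the sign known, |g + 1| >= 1, so |g - 1| is at most |g^2 - 1|.\<close>
  have "1 \<le> Re (g u + 1)" using pos[OF uU] by simp
  also have "\<dots> \<le> norm (g u + 1)" by (rule complex_Re_le_cmod)
  finally have "norm (g u - 1) * 1 \<le> norm (g u - 1) * norm (g u + 1)" by (intro mult_left_mono) auto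
  also have "\<dots> = norm ((g u)\<^sup>2 - 1)" by (simp add: norm_mult[symmetric] power2_eq_square algebra_simps)
  finally show ?thesis using sq[OF uU] by (simp add: g_def q_def)
qed

section \<open>Bounds away from the dominant singularity\<close>

text \<open>With d = |v| - Re v one has |1 + v|^2 = (1 + |v|)^2 - 2 * d. Since (1 + |v|)^2 <= 4,
  this is a relative loss of at least d / 2, and the square root halves the exponent.\<close>

lemma norm_1_plus_le_exp:
  fixes v :: complex
  assumes "norm v \<le> 1"
  shows "norm (1 + v) \<le> (1 + norm v) * exp (- (norm v - Re v) / 4)"
proof -
  define d where "d = norm v - Re v"
  have d: "0 \<le> d" "d \<le> 2" using complex_Re_le_cmod[of v] abs_Re_le_cmod[of v] assms by (auto simp: d_def)
  have "(norm (1 + v))\<^sup>2 = 1 + 2 * Re v + (norm v)\<^sup>2"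
    unfolding cmod_power2 by (simp add: power2_eq_square algebra_simps)
  also have "\<dots> = (1 + norm v)\<^sup>2 - 2 * d" by (simp add: d_def power2_eq_square algebra_simps)
  also have "\<dots> \<le> (1 + norm v)\<^sup>2 - (1 + norm v)\<^sup>2 * (d / 2)"
  proof -
    have "(1 + norm v)\<^sup>2 \<le> 2\<^sup>2" using assms by (intro power_mono) auto
    then have "(1 + norm v)\<^sup>2 * (d / 2) \<le> 4 * (d / 2)" using d by (intro mult_right_mono) auto
    then show ?thesis by simp
  qed
  also have "\<dots> = (1 + norm v)\<^sup>2 * (1 - d / 2)" by (simp add: algebra_simps)
  also have "\<dots> \<le> (1 + norm v)\<^sup>2 * exp (- d / 2)"
    using exp_ge_add_one_self[of "- d / 2"] by (intro mult_left_mono) auto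
  also have "\<dots> = ((1 + norm v) * exp (- d / 4))\<^sup>2"
    by (simp add: power_mult_distrib exp_double[symmetric])
  finally show ?thesis unfolding d_def by (rule power2_le_imp_le) (auto intro!: mult_nonneg_nonneg)
qed

text \<open>The recursion in norms along \<open>w * Q ^ j\<close>: each factor 1 + v j loses as in
  \<open>norm_1_plus_le_exp\<close>, and the term with z costs at most exp (4 * |z| * |v j|). The
  exponents are geometric series, with sums |w| / (1 - |Q|) and Re (w / (1 - Q)); without the loss
  there remains the product at the moduli.\<close>

lemma qf_norm_le_exp:
  fixes z Q w :: complex
  assumes Q: "norm Q < 1" and w: "norm w \<le> 1"
  defines "B \<equiv> norm (qf 0 (of_real (norm Q)) (of_real (norm w))) *
    exp (- (norm w / (1 - norm Q) - Re (w / (1 - Q))) / 4 + 4 * norm z * (norm w / (1 - norm Q)))"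
  shows "norm (qf z Q w) \<le> B" "norm (qf z Q (w * Q)) \<le> 2 * B"
proof -
  define f where "f = (\<lambda>j. norm (qf z Q (w * Q ^ j)))"
  define v where "v = (\<lambda>j. w * Q ^ j)"
  \<comment> \<open>\<open>K j\<close> may fall below 1 but not below 1 / 2, which the weight 1 / 2
    of the older value absorbs.\<close>
  define E where "E = (\<lambda>j. max (f j) (f (Suc j) / 2))"
  define K where "K = (\<lambda>j. (1 + norm (v j)) * exp (- (norm (v j) - Re (v j)) / 4) * exp (4 * norm z * norm (v j)))"
  have E0: "E j \<ge> 0" for j by (simp add: E_def f_def le_max_iff_disj)
  have nv: "norm (v j) \<le> 1" for j
  proof -
    have "norm Q ^ j \<le> 1" using Q by (intro power_le_one) auto
    then show ?thesis using w by (simp add: v_def norm_mult norm_power mult_le_one)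
  qed
  have e1: "exp (- (norm (v j) - Re (v j)) / 4) \<ge> 1 / 2" for j
  proof -
    have "- (norm (v j) - Re (v j)) / 4 \<ge> - 1 / 2" using nv[of j] abs_Re_le_cmod[of "v j"] by simp
    then show ?thesis using exp_ge_add_one_self[of "- (norm (v j) - Re (v j)) / 4"] by linarith
  qed
  have step: "E j \<le> K j * E (Suc j)" for j
  proof -
    define P where "P = (1 + norm (v j)) * exp (- (norm (v j) - Re (v j)) / 4)"
    have P: "P \<ge> 1 / 2" unfolding P_def using mult_mono[OF _ e1[of j], of 1 "1 + norm (v j)"] by auto
    have "qf z Q (v j) = (1 + v j) * qf z Q (v (Suc j)) + z * v j * Q * qf z Q (v (Suc (Suc j)))"
      using qf_rec[OF Q, of z "v j"] by (simp add: v_def power2_eq_square mult_ac)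
    then have "f j \<le> norm ((1 + v j) * qf z Q (v (Suc j))) + norm (z * v j * Q * qf z Q (v (Suc (Suc j))))"
      unfolding f_def v_def by (metis norm_triangle_ineq)
    also have "\<dots> = norm (1 + v j) * f (Suc j) + norm z * norm (v j) * norm Q * f (Suc (Suc j))"
      by (simp add: norm_mult f_def v_def)
    also have "\<dots> \<le> P * E (Suc j) + norm z * norm (v j) * 1 * (2 * E (Suc j))"
    proof (intro add_mono mult_mono)
      show "norm (1 + v j) \<le> P" unfolding P_def by (rule norm_1_plus_le_exp[OF nv])
      show "f (Suc j) \<le> E (Suc j)" "f (Suc (Suc j)) \<le> 2 * E (Suc j)" by (auto simp: E_def)
    qed (use P Q E0 in \<open>auto simp: f_def\<close>)
    also have "\<dots> \<le> P * E (Suc j) + P * (4 * norm z * norm (v j)) * E (Suc j)"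
    proof -
      have "1 / 2 * (4 * norm z * norm (v j)) \<le> P * (4 * norm z * norm (v j))" using P by (intro mult_right_mono) auto
      then have "1 / 2 * (4 * norm z * norm (v j)) * E (Suc j) \<le> P * (4 * norm z * norm (v j)) * E (Suc j)"
        by (rule mult_right_mono[OF _ E0])
      then show ?thesis by simp
    qed
    also have "\<dots> = P * (1 + 4 * norm z * norm (v j)) * E (Suc j)" by (simp add: algebra_simps)
    also have "\<dots> \<le> P * exp (4 * norm z * norm (v j)) * E (Suc j)"
      using P by (intro mult_right_mono mult_left_mono E0 exp_ge_add_one_self) auto
    finally have 1: "f j \<le> K j * E (Suc j)" by (simp add: K_def P_def)
    have "1 / 2 * 1 \<le> P * exp (4 * norm z * norm (v j))" using P by (intro mult_mono) auto
    then have "1 / 2 * E (Suc j) \<le> K j * E (Suc j)" unfolding K_def P_def by (intro mult_right_mono E0) auto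
    then have "f (Suc j) / 2 \<le> K j * E (Suc j)" using E_def by (simp add: E_def)
    then show ?thesis using 1 unfolding E_def[of] by (simp add: E_def)
  qed
  have K0: "K j \<ge> 0" for j by (simp add: K_def)
  have it: "E 0 \<le> (\<Prod>j<N. K j) * E N" for N
  proof (induction N)
    case (Suc N)
    have "E 0 \<le> (\<Prod>j<N. K j) * E N" by (rule Suc.IH)
    also have "\<dots> \<le> (\<Prod>j<N. K j) * (K N * E (Suc N))" by (intro mult_left_mono step prod_nonneg K0)
    finally show ?case by (simp add: mult_ac)
  qed simp
  have geo: "(\<lambda>N. \<Sum>j<N. norm (v j)) \<longlonglongrightarrow> norm w / (1 - norm Q)" 
    using sums_mult[OF geometric_sums[of "norm Q"], of "norm w"] Q unfolding sums_def by (simp add: v_def norm_mult norm_power)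
  have "(\<lambda>j. v j) sums (w * (1 / (1 - Q)))" unfolding v_def by (intro sums_mult geometric_sums Q)
  then have "(\<lambda>j. Re (v j)) sums Re (w / (1 - Q))" using sums_Re by fastforce
  then have geoR: "(\<lambda>N. \<Sum>j<N. Re (v j)) \<longlonglongrightarrow> Re (w / (1 - Q))" by (simp add: sums_def)
  have prodK: "(\<Prod>j<N. K j) = norm (\<Prod>j<N. 1 + of_real (norm w) * (of_real (norm Q) :: complex) ^ j) *
      exp (- ((\<Sum>j<N. norm (v j)) - (\<Sum>j<N. Re (v j))) / 4 + 4 * norm z * (\<Sum>j<N. norm (v j)))" for N
  proof -
    have "norm (\<Prod>j<N. 1 + of_real (norm w) * (of_real (norm Q) :: complex) ^ j) = (\<Prod>j<N. 1 + norm (v j))"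
      unfolding prod_norm[symmetric]
    proof (intro prod.cong refl)
      fix j
      have "1 + of_real (norm w) * (of_real (norm Q) :: complex) ^ j = of_real (1 + norm (v j))"
        by (simp add: v_def norm_mult norm_power)
      then show "norm (1 + of_real (norm w) * (of_real (norm Q) :: complex) ^ j) = 1 + norm (v j)"
        by (simp only: norm_of_real) simp
    qed
    moreover have "(\<Prod>j<N. K j) = (\<Prod>j<N. 1 + norm (v j)) * exp (\<Sum>j<N. - (norm (v j) - Re (v j)) / 4 + 4 * norm z * norm (v j))"
      unfolding K_def by (simp add: prod.distrib exp_sum exp_add mult.assoc)
    moreover have "(\<Sum>j<N. - (norm (v j) - Re (v j)) / 4 + 4 * norm z * norm (v j)) = 
       - ((\<Sum>j<N. norm (v j)) - (\<Sum>j<N. Re (v j))) / 4 + 4 * norm z * (\<Sum>j<N. norm (v j))"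
      by (simp add: sum.distrib sum_subtractf sum_distrib_left sum_divide_distrib diff_divide_distrib)
    ultimately show ?thesis by simp
  qed
  have f1: "f \<longlonglongrightarrow> norm (1::complex)" unfolding f_def by (intro tendsto_norm qf_tendsto_1 Q tendsto_mult_power_0)
  have "E \<longlonglongrightarrow> max (norm (1::complex)) (norm (1::complex) / 2)"
    unfolding E_def by (intro tendsto_max tendsto_divide f1 LIMSEQ_Suc[OF f1] tendsto_const) auto
  then have E1: "E \<longlonglongrightarrow> 1" by simp
  have "(\<lambda>N. (\<Prod>j<N. K j) * E N) \<longlonglongrightarrow> B * 1"
    unfolding prodK B_def using Q
    by (intro tendsto_mult tendsto_norm qf0_tendsto tendsto_exp tendsto_add tendsto_divide tendsto_minus tendsto_diff geo geoR tendsto_const E1) auto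
  then have "E 0 \<le> B * 1" by (rule LIMSEQ_le_const) (use it in auto)
  then show "norm (qf z Q w) \<le> B" "norm (qf z Q (w * Q)) \<le> 2 * B" by (auto simp: E_def f_def)
qed

lemma qf0_norm_le_exp:
  assumes Q: "norm Q < 1"
  shows "norm (qf 0 Q w) \<le> exp (norm w / (1 - norm Q))"
proof -
  have "norm (\<Prod>j<N. 1 + w * Q ^ j) \<le> exp (norm w / (1 - norm Q))" for N
  proof -
    have "norm (\<Prod>j<N. 1 + w * Q ^ j) \<le> (\<Prod>j<N. exp (norm w * norm Q ^ j))"
      unfolding prod_norm[symmetric]
    proof (intro prod_mono conjI norm_ge_zero)
      fix j
      have "norm (1 + w * Q ^ j) \<le> 1 + norm w * norm Q ^ j"
        using norm_triangle_ineq[of 1 "w * Q ^ j"] by (simp add: norm_mult norm_power)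
      also have "\<dots> \<le> exp (norm w * norm Q ^ j)" by (rule exp_ge_add_one_self)
      finally show "norm (1 + w * Q ^ j) \<le> exp (norm w * norm Q ^ j)" .
    qed
    also have "\<dots> = exp (norm w * (\<Sum>j<N. norm Q ^ j))" by (simp add: exp_sum sum_distrib_left)
    also have "(\<Sum>j<N. norm Q ^ j) \<le> 1 / (1 - norm Q)"
      using sum_le_suminf[OF summable_geometric[of "norm Q"], of "{..<N}"] suminf_geometric[of "norm Q"] Q by simp
    then have "exp (norm w * (\<Sum>j<N. norm Q ^ j)) \<le> exp (norm w * (1 / (1 - norm Q)))"
      by (simp only: exp_le_cancel_iff) (intro mult_left_mono, auto)
    finally show ?thesis by simp
  qed
  then show ?thesis using LIMSEQ_le_const2[OF tendsto_norm[OF qf0_tendsto[OF Q, of w]]] by blast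
qed

text \<open>The losses of the classes add up to that of the full series, since the sum of y^b / (1 -
  y^t) over b = 1..t is y / (1 - y). In t + 8, the self-paired classes use 4 each and every pair
  uses 1 for \<open>qf 0 Q (z * Q)\<close>. The factor 4 allows 2 per self-paired class; for odd t a
  harmless bound replaces the missing one.\<close>

lemma hookF_norm_le:
  assumes q: "q \<noteq> 0" "norm q < 1" and t: "t > 0" and x: "norm (x - 1) \<le> 1 / 2"
  shows "norm (hookF t x q) \<le> 4 * norm (qf 0 (of_real (norm q)) (of_real (norm q))) *
    exp (- (norm q / (1 - norm q) - Re (q / (1 - q))) / 4 + real (t + 8) * (norm (x\<^sup>2 - 1) / (1 - norm q)))"
proof -
  define z Q p where "z = x\<^sup>2 - 1" and "Q = q ^ t" and "p = norm q"
  have p: "0 < p" "p < 1" using q by (auto simp: p_def)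
  have Q: "norm Q < 1" "Q \<noteq> 0" "norm Q = p ^ t" using q t by (auto simp: Q_def p_def norm_power power_less_one_iff)
  have pt: "p ^ t \<le> p" "p ^ t < 1" using p t Q power_decreasing[of 1 t p] by auto
  define A where "A = (\<lambda>b. norm (qf 0 (of_real p ^ t) (of_real p ^ b)))"
  define D where "D = (\<lambda>b. p ^ b / (1 - p ^ t) - Re (q ^ b / (1 - Q)))"
  define Z where "Z = norm z / (1 - p)"
  have Z: "Z \<ge> 0" using p by (simp add: Z_def)
  have zb: "norm z * (p ^ b / (1 - p ^ t)) \<le> Z" for b
  proof -
    have "p ^ b \<le> 1" using p by (intro power_le_one) auto
    then have "p ^ b / (1 - p ^ t) \<le> 1 / (1 - p)" using p pt by (intro frac_le) auto
    then have "norm z * (p ^ b / (1 - p ^ t)) \<le> norm z * (1 / (1 - p))" by (intro mult_left_mono) auto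
    then show ?thesis by (simp add: Z_def)
  qed
  have B: "norm (qf 0 (of_real (norm Q)) (of_real (norm (q ^ b)))) *
      exp (- (norm (q ^ b) / (1 - norm Q) - Re (q ^ b / (1 - Q))) / 4 + 4 * norm y * (norm (q ^ b) / (1 - norm Q))) =
      A b * exp (- D b / 4 + 4 * (norm y * (p ^ b / (1 - p ^ t))))" for b y
    by (simp add: A_def D_def Q(3) norm_power p_def[symmetric])
  have qb: "norm (q ^ b) \<le> 1" for b unfolding norm_power using q by (intro power_le_one) auto
  note qfb = qf_norm_le_exp[OF Q(1) qb, unfolded B]
  have self: "norm (self_class x Q (q ^ b)) \<le> 2 * (A b * exp (- D b / 4 + 4 * Z))" for b
  proof -
    let ?B = "A b * exp (- D b / 4 + 4 * (norm z * (p ^ b / (1 - p ^ t))))"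
    have "norm (self_class x Q (q ^ b)) \<le> norm (qf z Q (q ^ b)) + norm ((x - 1) * (q ^ b * qf z Q (q ^ b * Q)))"
      unfolding self_class_def z_def by (rule norm_triangle_ineq)
    also have "\<dots> \<le> ?B + 1 / 2 * (1 * (2 * ?B))"
      unfolding norm_mult[of "x - 1"] norm_mult[of "q ^ b"]
      by (intro add_mono mult_mono qfb x qb) (auto intro!: mult_nonneg_nonneg)
    also have "\<dots> = 2 * ?B" by simp
    also have "\<dots> \<le> 2 * (A b * exp (- D b / 4 + 4 * Z))"
      using zb[of b] by (intro mult_left_mono) (auto simp: A_def)
    finally show ?thesis .
  qed
  have E: "norm (qf 0 Q (q ^ b)) \<le> A b * exp (- D b / 4)" for b
    using qfb(1)[of 0 b] by simp
  have P: "norm (qf 0 Q (z * Q)) \<le> exp Z"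
  proof -
    have "norm (z * Q) / (1 - norm Q) = norm z * (p ^ t / (1 - p ^ t))" by (simp add: norm_mult Q(3))
    then show ?thesis using qf0_norm_le_exp[OF Q(1), of "z * Q"] zb[of t] by (metis exp_le_cancel_iff order_trans)
  qed
  define m where "m = (t - 1) div 2"
  define a where "a = (\<lambda>b. A b * exp (- D b / 4))"
  have a0: "a b \<ge> 0" for b by (simp add: a_def A_def)
  have ea: "A b * exp (- D b / 4 + 4 * Z) = a b * exp (4 * Z)" for b unfolding a_def exp_add by simp
  have pair: "norm (qG z Q (q ^ b)) \<le> exp Z * (a b * a (t - b))" if "b \<in> {1..m}" for b
  proof -
    have "b \<le> t" using that by (auto simp: m_def)
    then have "q ^ b * q ^ (t - b) = Q" unfolding Q_def power_add[symmetric] by simp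
    then have "Q / q ^ b = q ^ (t - b)" using q by (simp add: field_simps)
    then have "qG z Q (q ^ b) = qf 0 Q (z * Q) * (qf 0 Q (q ^ b) * qf 0 Q (q ^ (t - b)))"
      using qG_product[OF Q(1,2), of "q ^ b" z] q by simp
    then have "norm (qG z Q (q ^ b)) = norm (qf 0 Q (z * Q)) * (norm (qf 0 Q (q ^ b)) * norm (qf 0 Q (q ^ (t - b))))"
      by (simp add: norm_mult)
    also have "\<dots> \<le> exp Z * (a b * a (t - b))"
      unfolding a_def by (intro mult_mono P E) (auto simp: A_def intro!: mult_nonneg_nonneg)
    finally show ?thesis .
  qed
  have "norm (hookF t x q) = norm (self_class x Q (q ^ t)) * (if even t then norm (self_class x Q (q ^ (t div 2))) else 1) * (\<Prod>b\<in>{1..m}. norm (qG z Q (q ^ b)))"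
    by (simp add: hookF_def Q_def z_def m_def norm_mult prod_norm)
  also have "\<dots> \<le> (2 * (a t * exp (4 * Z))) * (if even t then 2 * (a (t div 2) * exp (4 * Z)) else 2 * exp (4 * Z)) * (\<Prod>b\<in>{1..m}. exp Z * (a b * a (t - b)))"
  proof (intro mult_mono prod_mono)
    show "norm (self_class x Q (q ^ t)) \<le> 2 * (a t * exp (4 * Z))" using self[of t] unfolding ea .
    have "1 * 1 \<le> 2 * exp (4 * Z)" using Z by (intro mult_mono) auto
    then show "(if even t then norm (self_class x Q (q ^ (t div 2))) else 1) \<le> (if even t then 2 * (a (t div 2) * exp (4 * Z)) else 2 * exp (4 * Z))"
      using self[of "t div 2"] unfolding ea by simp
  qed (use pair a0 in \<open>auto intro!: mult_nonneg_nonneg prod_nonneg\<close>)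
  also have "\<dots> = 4 * (exp (8 * Z) * exp Z ^ m) * (a t * (if even t then a (t div 2) else 1) * (\<Prod>b\<in>{1..m}. a b * a (t - b)))"
    by (simp add: prod.distrib exp_add[symmetric])
  also have "a t * (if even t then a (t div 2) else 1) * (\<Prod>b\<in>{1..m}. a b * a (t - b)) = (\<Prod>b\<in>{1..t}. a b)"
    using prod_pairs[OF t, of a] by (simp add: m_def)
  also have "(\<Prod>b\<in>{1..t}. a b) = norm (qf 0 (of_real p) (of_real p)) * exp (- (\<Sum>b\<in>{1..t}. D b) / 4)"
  proof -
    have "(\<Prod>b\<in>{1..t}. A b) = norm (\<Prod>b\<in>{1..t}. qf 0 (of_real p ^ t) (of_real p ^ b))" by (simp add: A_def prod_norm)
    also have "(\<Prod>b\<in>{1..t}. qf 0 (of_real p ^ t) (of_real p ^ b)) = qf 0 (of_real p) (of_real p)"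
      using p t by (intro qf0_regroup) auto
    finally show ?thesis by (simp add: a_def prod.distrib exp_sum[symmetric] sum_divide_distrib sum_negf)
  qed
  also have "(\<Sum>b\<in>{1..t}. D b) = p / (1 - p) - Re (q / (1 - q))"
  proof -
    have geom: "(\<Sum>b\<in>{1..t}. y ^ b / (1 - y ^ t)) = y / (1 - y)" if "y \<noteq> 1" "y ^ t \<noteq> 1" for y :: "'a :: field"
    proof -
      have "(\<Sum>b\<in>{1..t}. y ^ b) = (\<Sum>b<t. y * y ^ b)"
        by (rule sum.reindex_bij_witness[of _ Suc "\<lambda>b. b - 1"]) (auto simp flip: power_Suc)
      also have "\<dots> = y * ((1 - y ^ t) / (1 - y))" using that by (simp add: sum_distrib_left[symmetric] sum_gp_strict)
      finally show ?thesis using that by (simp add: sum_divide_distrib[symmetric])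
    qed
    have "q \<noteq> 1" "Q \<noteq> 1" using q Q by auto
    then have "(\<Sum>b\<in>{1..t}. Re (q ^ b / (1 - Q))) = Re (q / (1 - q))"
      unfolding Re_sum[symmetric] using geom[of q] by (simp add: Q_def)
    moreover have "(\<Sum>b\<in>{1..t}. p ^ b / (1 - p ^ t)) = p / (1 - p)" using p pt by (intro geom) auto
    ultimately show ?thesis by (simp add: D_def sum_subtractf)
  qed
  also have "4 * (exp (8 * Z) * exp Z ^ m) * (norm (qf 0 (of_real p) (of_real p)) * exp (- (p / (1 - p) - Re (q / (1 - q))) / 4)) \<le> 
      4 * exp (real (t + 8) * Z) * (norm (qf 0 (of_real p) (of_real p)) * exp (- (p / (1 - p) - Re (q / (1 - q))) / 4))"
  proof -
    have "exp (8 * Z) * exp Z ^ m = exp ((8 + real m) * Z)"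
      by (simp add: exp_of_nat_mult[symmetric] exp_add[symmetric] algebra_simps)
    also have "\<dots> \<le> exp (real (t + 8) * Z)" using Z by (auto simp: m_def intro!: mult_right_mono)
    finally show ?thesis by (intro mult_right_mono mult_left_mono) (auto intro!: mult_nonneg_nonneg)
  qed
  finally show ?thesis by (simp add: p_def z_def Z_def exp_add mult_ac)
qed

lemma one_minus_cos_ge:
  fixes \<sigma> :: real
  assumes "0 \<le> \<sigma>" "\<sigma> \<le> 1"
  shows "1 - cos \<sigma> \<ge> \<sigma>\<^sup>2 / 4"
proof -
  define h where "h = (\<lambda>x::real. 1 - cos x - x\<^sup>2 / 4)"
  have s: "sin x \<ge> x / 2" if "0 \<le> x" "x \<le> 1" for x :: real
  proof -
    have "(\<lambda>x. sin x - x / 2) 0 \<le> (\<lambda>x. sin x - x / 2) x"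
    proof (rule DERIV_nonneg_imp_nondecreasing[OF that(1)])
      fix y :: real assume y: "0 \<le> y" "y \<le> x"
      have "cos y \<ge> cos (pi / 3)" using y that pi_gt3 by (intro cos_monotone_0_pi_le) auto
      then have "cos y - 1 / 2 \<ge> 0" by (simp add: cos_60)
      moreover have "((\<lambda>x. sin x - x / 2) has_real_derivative (cos y - 1 / 2)) (at y)"
        by (auto intro!: derivative_eq_intros)
      ultimately show "\<exists>D. ((\<lambda>x. sin x - x / 2) has_real_derivative D) (at y) \<and> 0 \<le> D" by blast
    qed
    then show ?thesis by simp
  qed
  have "h 0 \<le> h \<sigma>"
  proof (rule DERIV_nonneg_imp_nondecreasing[OF assms(1)])
    fix y :: real assume y: "0 \<le> y" "y \<le> \<sigma>"
    have "(h has_real_derivative (sin y - y / 2)) (at y)"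
      unfolding h_def by (auto intro!: derivative_eq_intros)
    moreover have "sin y - y / 2 \<ge> 0" using s[of y] y assms by simp
    ultimately show "\<exists>D. (h has_real_derivative D) (at y) \<and> 0 \<le> D" by blast
  qed
  then show ?thesis by (simp add: h_def)
qed

text \<open>Outside the sector |1 - q| >= 11 / 10 * (1 - |q|), so the loss is at least 1 / (22 * Re
  s), a quarter of which enters the exponent: 1 / 88. The perturbation by z is at most 12 * (t + 8)
  * |u| / Re s, and 2112 = 12 * 176 limits it to half of that saving.\<close>

theorem hookF_minor:
  assumes t: "t > 0" and u: "norm u \<le> 1 / (2112 * real (t + 8))"
    and s: "0 < Re s" "Re s \<le> 1 / 2" "Re s \<le> \<bar>Im s\<bar>" "\<bar>Im s\<bar> \<le> pi"
  shows "norm (hookF t (exp u) (exp (- s))) \<le> 4 * exp 6 * exp ((pi\<^sup>2 / 12 - 1 / 176) / Re s)"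
proof -
  define q p \<sigma> where "q = exp (- s)" and "p = norm q" and "\<sigma> = Re s"
  have \<sigma>: "0 < \<sigma>" "\<sigma> \<le> 1 / 2" using s by (auto simp: \<sigma>_def)
  have pe: "p = exp (- \<sigma>)" by (simp add: p_def q_def \<sigma>_def)
  have "1 - \<sigma> \<le> p" unfolding pe using exp_ge_add_one_self[of "- \<sigma>"] by simp
  then have p: "p \<ge> 1 / 2" "1 - p \<le> \<sigma>" "p < 1" using \<sigma> by (auto simp: pe)
  have p2: "\<sigma> / 2 \<le> 1 - p"
  proof -
    have "1 + \<sigma> \<le> exp \<sigma>" by (rule exp_ge_add_one_self)
    then have "p \<le> 1 / (1 + \<sigma>)" unfolding pe exp_minus using \<sigma> by (simp add: field_simps)
    also have "\<dots> \<le> 1 - \<sigma> / 2" using \<sigma> by (simp add: field_simps)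
    finally show ?thesis by simp
  qed
  have q: "q \<noteq> 0" "norm q < 1" using p by (auto simp: p_def q_def)
  have u200: "norm u \<le> 1 / 200"
  proof -
    have "1 / (2112 * real (t + 8)) \<le> 1 / 200" by (intro divide_left_mono) auto
    then show ?thesis using u by linarith
  qed
  have xz: "norm (exp u - 1) \<le> 1 / 2" "norm ((exp u)\<^sup>2 - 1) \<le> 6 * norm u"
  proof -
    show "norm (exp u - 1) \<le> 1 / 2" using exp_near_0_bounds(1)[OF u200] by simp
    have "norm (exp (2 * u) - 1) \<le> 3 * norm (2 * u)" using u200 by (intro norm_exp_minus_1_le) (simp add: norm_mult)
    then show "norm ((exp u)\<^sup>2 - 1) \<le> 6 * norm u" by (simp add: exp_double norm_mult)
  qed
  have A: "real (t + 8) * (norm ((exp u)\<^sup>2 - 1) / (1 - p)) \<le> 1 / 176 / \<sigma>"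
  proof -
    have "norm ((exp u)\<^sup>2 - 1) / (1 - p) \<le> (6 * norm u) / (\<sigma> / 2)" using xz p p2 \<sigma> by (intro frac_le) auto
    then have "real (t + 8) * (norm ((exp u)\<^sup>2 - 1) / (1 - p)) \<le> real (t + 8) * ((6 * norm u) / (\<sigma> / 2))"
      by (intro mult_left_mono) auto
    also have "\<dots> = 12 / \<sigma> * (real (t + 8) * norm u)" using \<sigma> by (simp add: field_simps)
    also have "\<dots> \<le> 12 / \<sigma> * (1 / 2112)"
    proof (rule mult_left_mono)
      have "real (t + 8) * norm u \<le> real (t + 8) * (1 / (2112 * real (t + 8)))" using u by (intro mult_left_mono) auto
      also have "\<dots> = 1 / 2112" by (simp del: of_nat_add)
      finally show "real (t + 8) * norm u \<le> 1 / 2112" .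
    qed (use \<sigma> in auto)
    finally show ?thesis using \<sigma> by (simp add: field_simps)
  qed
  have D: "p / (1 - p) - Re (q / (1 - q)) \<ge> 1 / (22 * \<sigma>)"
  proof -
    have "(norm (1 - q))\<^sup>2 = (1 - p)\<^sup>2 + 2 * p * (1 - cos (Im s))"
    proof -
      have "Re q = p * cos (Im s)" "Im q = - (p * sin (Im s))" by (simp_all add: q_def pe \<sigma>_def Re_exp Im_exp)
      then have "(norm (1 - q))\<^sup>2 = (1 - p * cos (Im s))\<^sup>2 + (p * sin (Im s))\<^sup>2" by (simp add: cmod_power2)
      also have "\<dots> = 1 - 2 * p * cos (Im s) + (p\<^sup>2 * (cos (Im s))\<^sup>2 + p\<^sup>2 * (sin (Im s))\<^sup>2)"
        by (simp add: power2_eq_square algebra_simps)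
      also have "p\<^sup>2 * (cos (Im s))\<^sup>2 + p\<^sup>2 * (sin (Im s))\<^sup>2 = p\<^sup>2 * ((cos (Im s))\<^sup>2 + (sin (Im s))\<^sup>2)"
        by (simp only: distrib_left)
      also have "1 - 2 * p * cos (Im s) + p\<^sup>2 * ((cos (Im s))\<^sup>2 + (sin (Im s))\<^sup>2) = (1 - p)\<^sup>2 + 2 * p * (1 - cos (Im s))"
        unfolding sin_cos_squared_add2 by (simp add: power2_eq_square algebra_simps)
      finally show ?thesis .
    qed
    moreover have "1 - cos (Im s) \<ge> \<sigma>\<^sup>2 / 4"
    proof -
      have "cos \<bar>Im s\<bar> \<le> cos \<sigma>" using s \<sigma> by (intro cos_monotone_0_pi_le) (auto simp: \<sigma>_def)
      then show ?thesis using one_minus_cos_ge[of \<sigma>] \<sigma> by simp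
    qed
    then have "2 * (1 / 2) * (\<sigma>\<^sup>2 / 4) \<le> 2 * p * (1 - cos (Im s))" using p by (intro mult_mono) auto
    moreover have "(1 - p)\<^sup>2 \<le> \<sigma>\<^sup>2" using p by (intro power_mono) auto
    ultimately have "(norm (1 - q))\<^sup>2 \<ge> 5 / 4 * (1 - p)\<^sup>2" by simp
    also have "5 / 4 * (1 - p)\<^sup>2 \<ge> (11 / 10 * (1 - p))\<^sup>2"
      unfolding power_mult_distrib by (rule mult_right_mono) (auto simp: power2_eq_square)
    finally have n: "11 / 10 * (1 - p) \<le> norm (1 - q)" by (rule power2_le_imp_le) auto
    have "Re (q / (1 - q)) \<le> norm (q / (1 - q))" by (rule complex_Re_le_cmod)
    also have "\<dots> = p / norm (1 - q)" by (simp add: norm_divide p_def)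
    also have "\<dots> \<le> p / (11 / 10 * (1 - p))" using n p by (intro divide_left_mono mult_pos_pos) auto
    finally have "p / (1 - p) - Re (q / (1 - q)) \<ge> p / (1 - p) - p / (11 / 10 * (1 - p))" by simp
    also have "p / (1 - p) - p / (11 / 10 * (1 - p)) = p / (11 * (1 - p))"
    proof -
      have key: "p / m - p / (11 / 10 * m) = p / (11 * m)" if "m \<noteq> 0" for m using that by (simp add: field_simps)
      show ?thesis by (rule key) (use p in auto)
    qed
    also have "p / (11 * (1 - p)) \<ge> (1 / 2) / (11 * \<sigma>)" using p \<sigma> by (intro frac_le) auto
    finally show ?thesis by simp
  qed
  have R: "norm (qf 0 (of_real p) (of_real p)) \<le> exp (pi\<^sup>2 / 12 / \<sigma> + 6)"
  proof -
    have "of_real \<sigma> \<in> sector" "norm (of_real \<sigma> :: complex) \<le> 1" using \<sigma> by (auto simp: sector_def)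
    then obtain e where e: "norm e \<le> 6 * norm (of_real \<sigma> :: complex)"
      "qf 0 (exp (- of_real \<sigma>)) (exp (- of_real \<sigma>)) = exp (of_real (pi\<^sup>2 / 12) / of_real \<sigma> - Ln 2 / 2 + e)"
      using qf0_exp_asymptotics[of "of_real \<sigma>" 1] by (auto simp: altdilog_1)
    have "exp (- of_real \<sigma>) = (of_real p :: complex)" unfolding pe by (metis exp_of_real of_real_minus)
    then have "norm (qf 0 (of_real p) (of_real p)) = exp (Re (of_real (pi\<^sup>2 / 12) / of_real \<sigma> - Ln 2 / 2 + e))"
      using e(2) by simp
    also have "Re (of_real (pi\<^sup>2 / 12) / of_real \<sigma> - Ln 2 / 2 + e) = pi\<^sup>2 / 12 / \<sigma> - ln 2 / 2 + Re e"
      using Ln_of_real[of 2] by (simp flip: of_real_divide)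
    also have "\<dots> \<le> pi\<^sup>2 / 12 / \<sigma> + 6"
    proof -
      have "Re e \<le> 6 * \<sigma>" using complex_Re_le_cmod[of e] e(1) \<sigma> by simp
      then show ?thesis using \<sigma> ln_gt_zero[of "2::real"] by linarith
    qed
    finally show ?thesis by simp
  qed
  have "norm (hookF t (exp u) q) \<le> 4 * norm (qf 0 (of_real p) (of_real p)) *
    exp (- (p / (1 - p) - Re (q / (1 - q))) / 4 + real (t + 8) * (norm ((exp u)\<^sup>2 - 1) / (1 - p)))"
    unfolding p_def by (rule hookF_norm_le[OF q t xz(1)])
  also have "\<dots> \<le> 4 * exp (pi\<^sup>2 / 12 / \<sigma> + 6) * exp (- (1 / (22 * \<sigma>)) / 4 + 1 / 176 / \<sigma>)"
  proof (intro mult_mono)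
    have "- (p / (1 - p) - Re (q / (1 - q))) / 4 + real (t + 8) * (norm ((exp u)\<^sup>2 - 1) / (1 - p)) \<le>
        - (1 / (22 * \<sigma>)) / 4 + 1 / 176 / \<sigma>"
      using A D by (intro add_mono divide_right_mono) auto
    then show "exp (- (p / (1 - p) - Re (q / (1 - q))) / 4 + real (t + 8) * (norm ((exp u)\<^sup>2 - 1) / (1 - p))) \<le>
        exp (- (1 / (22 * \<sigma>)) / 4 + 1 / 176 / \<sigma>)"
      by (simp only: exp_le_cancel_iff)
  qed (use R in auto)
  also have "\<dots> = 4 * exp 6 * exp (pi\<^sup>2 / 12 / \<sigma> - 1 / 176 / \<sigma>)"
    using \<sigma> by (simp add: exp_add[symmetric] field_simps)
  finally show ?thesis by (simp add: q_def \<sigma>_def diff_divide_distrib)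
qed

section \<open>The saddle point integral\<close>

text \<open>For the lower bound, t^2 >= X * t beyond X, so the tail is at most the integral of exp
  (- X * t), which is exp (- X^2) / X.\<close>

lemma integral_gauss_le:
  "0 \<le> X \<Longrightarrow> integral {-X..X} (\<lambda>t. exp (- t\<^sup>2)) \<le> sqrt pi"
  and integral_gauss_ge:
  "0 < X \<Longrightarrow> sqrt pi - 2 * exp (- X\<^sup>2) / X \<le> integral {-X..X} (\<lambda>t::real. exp (- t\<^sup>2))"
proof -
  define f where "f = (\<lambda>t::real. exp (- t\<^sup>2))"
  define G where "G = (\<lambda>X. integral {0..X} f)"
  have int: "f integrable_on {a..b}" for a b
    unfolding f_def by (intro integrable_continuous_interval continuous_intros)
  have double: "integral {-X..X} f = 2 * G X" if "0 \<le> X" for X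
  proof -
    have "(\<lambda>x. f (- x)) = f" by (simp add: f_def)
    then have r: "integral {-X..0} f = integral {0..X} f"
      using Henstock_Kurzweil_Integration.integral_reflect_real[where f = f and a = 0 and b = X] by simp
    have "integral {-X..X} f = integral {-X..0} f + integral {0..X} f"
      using that by (intro Henstock_Kurzweil_Integration.integral_combine[symmetric] int) auto
    then show ?thesis unfolding r by (simp add: G_def)
  qed
  have lim: "(G \<longlongrightarrow> sqrt pi / 2) at_top"
  proof -
    define g where "g = (\<lambda>x::real. indicator {0..} x *\<^sub>R exp (- x\<^sup>2) :: real)"
    have g: "has_bochner_integral lborel g (sqrt pi / 2)" unfolding g_def by (rule gaussian_moment_0)
    have "((\<lambda>y. LINT x|lborel. indicator {.. y} x *\<^sub>R g x) \<longlongrightarrow> (LINT x|lborel. g x)) at_top"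
      using g by (intro tendsto_integral_at_top) (auto simp: has_bochner_integral_iff)
    moreover have "(LINT x|lborel. indicator {.. y} x *\<^sub>R g x) = G y" for y
    proof -
      have "(LINT x|lborel. indicator {.. y} x *\<^sub>R g x) = (LINT x:{0..y}|lborel. f x)"
        unfolding set_lebesgue_integral_def by (intro Bochner_Integration.integral_cong) (auto simp: g_def f_def indicator_def)
      also have "\<dots> = G y"
      proof -
        have "set_integrable lborel {0..y} f"
          by (intro borel_integrable_atLeastAtMost') (auto simp: f_def intro!: continuous_intros)
        then show ?thesis unfolding G_def by (rule set_borel_integral_eq_integral)
      qed
      finally show ?thesis .
    qed
    moreover have "(LINT x|lborel. g x) = sqrt pi / 2" using g by (rule has_bochner_integral_integral_eq)
    ultimately show ?thesis by (simp only:)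
  qed
  have mono: "G X \<le> G Y" if "0 \<le> X" "X \<le> Y" for X Y
    unfolding G_def using that by (intro integral_subset_le int) (auto simp: f_def)
  have up: "G X \<le> sqrt pi / 2" if "0 \<le> X" for X
  proof (rule tendsto_lowerbound[OF lim])
    show "eventually (\<lambda>Y. G X \<le> G Y) at_top" using eventually_ge_at_top[of X] by eventually_elim (use mono that in auto)
  qed simp
  show "integral {-X..X} (\<lambda>t. exp (- t\<^sup>2)) \<le> sqrt pi" if "0 \<le> X"
    using double[OF that] up[OF that] by (simp add: f_def)
  show "sqrt pi - 2 * exp (- X\<^sup>2) / X \<le> integral {-X..X} (\<lambda>t::real. exp (- t\<^sup>2))" if X: "0 < X"
  proof -
    have "G Y \<le> G X + exp (- X\<^sup>2) / X" if "X \<le> Y" for Y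
    proof -
      have "G Y = G X + integral {X..Y} f"
        unfolding G_def using X that by (intro Henstock_Kurzweil_Integration.integral_combine[symmetric] int) auto
      also have "integral {X..Y} f \<le> integral {X..Y} (\<lambda>t. exp (- X * t))"
      proof (intro integral_le int integrable_continuous_interval continuous_intros)
        fix t assume "t \<in> {X..Y}"
        then have "X * t \<le> t * t" using X by (intro mult_right_mono) auto
        then show "f t \<le> exp (- X * t)" by (simp add: f_def power2_eq_square)
      qed
      also have "integral {X..Y} (\<lambda>t. exp (- X * t)) = (- exp (- X * Y) / X) - (- exp (- X * X) / X)"
        using X that by (intro integral_unique fundamental_theorem_of_calculus)
          (auto intro!: derivative_eq_intros simp flip: has_real_derivative_iff_has_vector_derivative)
      also have "\<dots> \<le> exp (- X\<^sup>2) / X" using X by (simp add: power2_eq_square)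
      finally show ?thesis by simp
    qed
    then have "sqrt pi / 2 \<le> G X + exp (- X\<^sup>2) / X"
      by (intro tendsto_upperbound[OF lim]) (auto intro: eventually_mono[OF eventually_ge_at_top[of X]])
    then show ?thesis using double[of X] X by (simp add: f_def)
  qed
qed

text \<open>An entire primitive of the Gaussian reduces a complex variance to a real one.\<close>

lemma integral_complex_gauss:
  fixes w :: complex and K :: real
  assumes K: "K > 0" and w: "Re w > 0"
  shows "norm (w * integral {-K..K} (\<lambda>t. exp (- (w * of_real t)\<^sup>2)) - of_real (sqrt pi)) \<le>
    2 * \<bar>K * Im w\<bar> * exp (- K\<^sup>2 * Re (w\<^sup>2)) + 2 * exp (- (K * Re w)\<^sup>2) / (K * Re w)"
proof -
  have hol: "(\<lambda>v::complex. exp (- v\<^sup>2)) holomorphic_on UNIV" by (intro holomorphic_intros)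
  obtain P :: "complex \<Rightarrow> complex" where P': "\<And>v. v \<in> UNIV \<Longrightarrow> (P has_field_derivative exp (- v\<^sup>2)) (at v within UNIV)"
    using holomorphic_convex_primitive'[OF convex_UNIV open_UNIV hol] by blast
  then have P: "(P has_field_derivative exp (- v\<^sup>2)) (at v)" for v by simp
  have ftc: "((\<lambda>t. v * exp (- (v * of_real t)\<^sup>2)) has_integral (P (v * of_real X) - P (v * of_real (- X)))) {-X..X}" if "X \<ge> 0" for v X
  proof (rule fundamental_theorem_of_calculus)
    fix t assume "t \<in> {-X..X}"
    have "((\<lambda>u. P (v * u)) has_field_derivative (v * exp (- (v * of_real t)\<^sup>2))) (at (of_real t))"
      by (rule DERIV_cong[OF DERIV_chain2[OF P]]) (auto intro!: derivative_eq_intros)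
    then have "((\<lambda>t. P (v * of_real t)) has_vector_derivative (v * exp (- (v * of_real t)\<^sup>2))) (at t)"
      by (rule has_vector_derivative_real_field)
    then show "((\<lambda>t. P (v * of_real t)) has_vector_derivative (v * exp (- (v * of_real t)\<^sup>2))) (at t within {-X..X})"
      by (rule has_vector_derivative_at_within)
  qed (use that in auto)
  define x where "x = K * Re w"
  define W where "W = w * of_real K"
  have x: "x > 0" using K w by (simp add: x_def)
  have "w * integral {-K..K} (\<lambda>t. exp (- (w * of_real t)\<^sup>2)) = integral {-K..K} (\<lambda>t. w * exp (- (w * of_real t)\<^sup>2))"
    by simp
  also have "\<dots> = P W - P (- W)" using integral_unique[OF ftc[of K w]] K unfolding W_def by (simp only: of_real_minus mult_minus_right less_imp_le)
  finally have 1: "w * integral {-K..K} (\<lambda>t. exp (- (w * of_real t)\<^sup>2)) = P W - P (- W)" .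
  have "P (of_real x) - P (- of_real x) = integral {-x..x} (\<lambda>t. of_real (exp (- t\<^sup>2)))"
    using ftc[of x 1] x by (simp add: integral_unique exp_of_real[symmetric])
  also have "\<dots> = of_real (integral {-x..x} (\<lambda>t. exp (- t\<^sup>2)))"
    by (intro integral_unique has_integral_of_real integrable_integral integrable_continuous_interval continuous_intros)
  finally have 2: "P (of_real x) - P (- of_real x) = of_real (integral {-x..x} (\<lambda>t. exp (- t\<^sup>2)))" .
  have ReW: "Re W = x" "Im W = K * Im w" "Re (W\<^sup>2) = K\<^sup>2 * Re (w\<^sup>2)"
    by (simp_all add: W_def x_def power2_eq_square algebra_simps)
  \<comment> \<open>Along the vertical segment Re (y^2) is smallest at the end v, because |Im y| is
    largest there.\<close>
  have seg: "norm (P v - P (of_real (Re v))) \<le> exp (- Re (v\<^sup>2)) * \<bar>Im v\<bar>" for v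
  proof -
    have "norm (P v - P (of_real (Re v))) \<le> exp (- Re (v\<^sup>2)) * norm (v - of_real (Re v))"
    proof (rule field_differentiable_bound[of "closed_segment (of_real (Re v)) v"])
      fix y assume "y \<in> closed_segment (of_real (Re v)) v"
      then obtain r where r: "0 \<le> r" "r \<le> 1" "y = (1 - r) *\<^sub>R of_real (Re v) + r *\<^sub>R v"
        by (auto simp: in_segment)
      have "Re y = Re v" "Im y = r * Im v" unfolding r(3) by (simp_all add: left_diff_distrib)
      moreover have "(r * Im v)\<^sup>2 \<le> (1 * Im v)\<^sup>2"
        unfolding power_mult_distrib using r by (intro mult_right_mono power_mono) auto
      ultimately show "norm (exp (- y\<^sup>2)) \<le> exp (- Re (v\<^sup>2))" by (simp add: power2_eq_square)
      show "(P has_field_derivative exp (- y\<^sup>2)) (at y within closed_segment (of_real (Re v)) v)"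
        using P has_field_derivative_at_within by blast
    qed auto
    also have "norm (v - of_real (Re v)) = \<bar>Im v\<bar>" by (simp add: cmod_def)
    finally show ?thesis .
  qed
  have "norm ((P W - P (- W)) - (P (of_real x) - P (- of_real x))) \<le> 2 * (exp (- Re (W\<^sup>2)) * \<bar>Im W\<bar>)"
    using seg[of W] seg[of "- W"] norm_triangle_ineq4[of "P W - P (of_real x)" "P (- W) - P (- of_real x)"]
    unfolding ReW(1)[symmetric] by (simp add: algebra_simps)
  moreover have "norm (of_real (integral {-x..x} (\<lambda>t. exp (- t\<^sup>2))) - of_real (sqrt pi) :: complex) \<le> 2 * exp (- x\<^sup>2) / x"
    unfolding of_real_diff[symmetric] norm_of_real using integral_gauss_le[of x] integral_gauss_ge[of x] x by simp
  ultimately show ?thesis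
    unfolding 1 2 ReW x_def[symmetric] 
    using dist_triangle[of "P W - P (- W)" "of_real (sqrt pi)" "of_real (integral {-x..x} (\<lambda>t. exp (- t\<^sup>2)))"]
    by (simp add: dist_norm mult_ac)
qed

lemma integral_gauss_scaled_le:
  assumes "b > 0" "K > 0"
  shows "integral {-K..K} (\<lambda>t::real. exp (- b * t\<^sup>2)) \<le> sqrt (pi / b)"
proof -
  define r where "r = sqrt b"
  have r: "r > 0" "r\<^sup>2 = b" using assms by (auto simp: r_def)
  have "((\<lambda>t. exp (- t\<^sup>2)) has_integral integral {-(r * K)..r * K} (\<lambda>t. exp (- t\<^sup>2))) (cbox (- (r * K)) (r * K))"
    by (simp add: integrable_integral integrable_continuous_interval continuous_intros)
  from has_integral_affinity[OF this, of r 0] r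
  have "((\<lambda>t. exp (- (r * t)\<^sup>2)) has_integral (1 / r * integral {-(r * K)..r * K} (\<lambda>t. exp (- t\<^sup>2)))) ((\<lambda>x. x / r) ` {-(r * K)..r * K})"
    by (simp add: divide_inverse mult.commute)
  also have "(\<lambda>x. x / r) ` {-(r * K)..r * K} = {-K..K}"
    using r by (simp add: image_divide_atLeastAtMost)
  finally have "integral {-K..K} (\<lambda>t. exp (- (r * t)\<^sup>2)) = 1 / r * integral {-(r * K)..r * K} (\<lambda>t. exp (- t\<^sup>2))"
    by (rule integral_unique)
  also have "\<dots> \<le> 1 / r * sqrt pi"
    using r assms by (intro mult_left_mono integral_gauss_le) auto
  also have "\<dots> = sqrt (pi / b)" by (simp add: r_def real_sqrt_divide)
  finally show ?thesis using r by (simp add: power_mult_distrib)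
qed

text \<open>The factor is max 1 (exp (Re D)) and not exp |D|, because in
  \<open>inner_vs_gauss\<close> the decay of g and of g * exp D is known separately.\<close>

lemma norm_exp_remainder_2:
  fixes D :: complex
  shows "norm (exp D - 1 - D) \<le> max 1 (exp (Re D)) * norm D ^ 2"
proof -
  have "norm (exp D - (\<Sum>i\<le>1. exp 0 * (D - 0) ^ i / fact i)) \<le> max 1 (exp (Re D)) * norm (D - 0) ^ Suc 1 / fact 1"
  proof (rule complex_Taylor[of "closed_segment 0 D" 1 "\<lambda>_. exp" _])
    fix y assume "y \<in> closed_segment 0 D"
    then obtain r where r: "0 \<le> r" "r \<le> 1" "y = r *\<^sub>R D" by (auto simp: in_segment)
    have "Re y \<le> max 0 (Re D)"
    proof (cases "Re D \<ge> 0")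
      case True
      then show ?thesis using r by (simp add: mult_left_le_one_le)
    next
      case False
      then show ?thesis using r by (simp add: mult_nonneg_nonpos)
    qed
    then have "exp (Re y) \<le> exp (max 0 (Re D))" by simp
    then show "norm (exp y) \<le> max 1 (exp (Re D))" by (auto simp: max_def split: if_splits)
  qed (auto intro: DERIV_exp has_field_derivative_at_within)
  then show ?thesis by (simp add: numeral_2_eq_2 diff_diff_eq)
qed

text \<open>Expanding (1 + v / 15)^3 <= exp (v / 5) produces v^3 / 3375 and v^2 / 75; 20000 exceeds
  4 * 3375 and 2 * 75.\<close>

lemma cubic_le_exp:
  fixes v :: real
  assumes "v \<ge> 0"
  shows "4 * v ^ 3 + 2 * v\<^sup>2 \<le> 20000 * exp (v / 5)"
proof -
  have y: "1 + v / 15 \<le> exp (v / 15)" by (rule exp_ge_add_one_self)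
  have "(1 + v / 15) ^ 3 \<le> exp (v / 15) ^ 3" using y assms by (intro power_mono) auto
  also have "\<dots> = exp (v / 5)" by (simp add: exp_of_nat_mult[symmetric])
  finally have e: "(1 + v / 15) ^ 3 \<le> exp (v / 5)" .
  have "(1 + v / 15) ^ 3 = 1 + v / 5 + v\<^sup>2 / 75 + v ^ 3 / 3375" by (simp add: power3_eq_cube power2_eq_square field_simps)
  then show ?thesis using e assms zero_le_power[of v 3] zero_le_power2[of v] by linarith
qed

section \<open>Cauchy's coefficient formula on a vertical segment\<close>

lemma has_integral_exp_frequency:
  fixes k :: complex and n m :: nat
  assumes R: "R > 0"
  shows "((\<lambda>\<xi>. exp ((of_nat n - of_nat m) * ((k + \<i> * of_real \<xi>) / of_real R))) has_integral
     (if m = n then of_real (2 * pi * R) else 0)) {- (pi * R)..pi * R}"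
proof (cases "m = n")
  case True
  then show ?thesis using has_integral_const_real[of "1::complex" "- (pi * R)" "pi * R"] R
    by (simp add: scaleR_conv_of_real mult_ac)
next
  case False
  define d where "d = (of_nat n - of_nat m :: complex)"
  have d: "d \<noteq> 0" using False by (simp add: d_def)
  define A where "A = (\<lambda>v::complex. exp (d * ((k + \<i> * v) / of_real R)) * (of_real R / (\<i> * d)))"
  have "((\<lambda>\<xi>. exp (d * ((k + \<i> * of_real \<xi>) / of_real R))) has_integral (A (of_real (pi * R)) - A (of_real (- (pi * R))))) {- (pi * R)..pi * R}"
  proof (rule fundamental_theorem_of_calculus)
    fix \<xi> assume "\<xi> \<in> {- (pi * R)..pi * R}"
    have "(A has_field_derivative exp (d * ((k + \<i> * of_real \<xi>) / of_real R))) (at (of_real \<xi>))"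
      unfolding A_def using R d by (auto intro!: derivative_eq_intros)
    then have "((\<lambda>\<xi>. A (of_real \<xi>)) has_vector_derivative exp (d * ((k + \<i> * of_real \<xi>) / of_real R))) (at \<xi>)"
      by (rule has_vector_derivative_real_field)
    then show "((\<lambda>\<xi>. A (of_real \<xi>)) has_vector_derivative exp (d * ((k + \<i> * of_real \<xi>) / of_real R))) (at \<xi> within {- (pi * R)..pi * R})"
      by (rule has_vector_derivative_at_within)
  qed (use R in auto)
  moreover have "A (of_real (pi * R)) = A (of_real (- (pi * R)))"
  proof -
    have "d * ((k + \<i> * of_real (pi * R)) / of_real R) = d * ((k + \<i> * of_real (- (pi * R))) / of_real R) + (of_int (int n - int m) * (of_real (2 * pi) * \<i>))"
      using R by (simp add: d_def field_simps)
    moreover have "exp (of_int (int n - int m) * (of_real (2 * pi) * \<i>)) = 1"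
      using exp_integer_2pi[of "of_int (int n - int m)"] by (simp only: Ints_of_int of_real_mult of_real_numeral mult_ac) simp
    ultimately have "exp (d * ((k + \<i> * of_real (pi * R)) / of_real R)) = exp (d * ((k + \<i> * of_real (- (pi * R))) / of_real R))"
      by (simp only: exp_add mult_1_right)
    then show ?thesis by (simp add: A_def)
  qed
  ultimately show ?thesis using False by (simp add: d_def)
qed

text \<open>The segment has length 2 * pi in s, one full period of exp (- s), so a complex k only
  shifts it within the period. Absolute convergence on the line, inherited from a point with half
  the real part, permits integrating the series termwise.\<close>

lemma has_integral_coefficient:
  fixes c :: "nat \<Rightarrow> complex" and k :: complex
  assumes sums: "\<And>s. Re s > 0 \<Longrightarrow> (\<lambda>m. c m * exp (- s) ^ m) sums F s" and R: "R > 0" and k: "Re k > 0"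
  shows "((\<lambda>\<xi>. F ((k + \<i> * of_real \<xi>) / of_real R) * exp (of_nat n * ((k + \<i> * of_real \<xi>) / of_real R))) has_integral
     (of_real (2 * pi * R) * c n)) {- (pi * R)..pi * R}"
proof -
  define s where "s = (\<lambda>\<xi>. (k + \<i> * of_real \<xi>) / of_real R)"
  have Res: "Re (s \<xi>) = Re k / R" for \<xi> using R by (simp add: s_def Re_divide_of_real)
  have Rpos: "Re k / R > 0" using R k by simp
  have e: "exp (- s \<xi>) ^ m * exp (of_nat n * s \<xi>) = exp ((of_nat n - of_nat m) * s \<xi>)" for \<xi> m
    by (simp add: exp_of_nat_mult[symmetric] exp_add[symmetric] algebra_simps)
  define f where "f = (\<lambda>N \<xi>. \<Sum>m<N. c m * exp ((of_nat n - of_nat m) * s \<xi>))"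
  define g where "g = (\<lambda>\<xi>. F (s \<xi>) * exp (of_nat n * s \<xi>))"
  have "uniform_limit {- (pi * R)..pi * R} (\<lambda>N \<xi>. \<Sum>m<N. c m * exp ((of_nat n - of_nat m) * s \<xi>)) (\<lambda>\<xi>. \<Sum>m. c m * exp ((of_nat n - of_nat m) * s \<xi>)) sequentially"
  proof (rule Weierstrass_m_test)
    define x where "x = complex_of_real (exp (- (Re k / R / 2)))"
    define y where "y = complex_of_real (exp (- (Re k / R)))"
    have "summable (\<lambda>m. c m * x ^ m)"
      using sums[of "of_real (Re k / R / 2)"] Rpos unfolding x_def by (simp add: sums_iff exp_of_real[symmetric])
    moreover have "norm y < norm x" using Rpos by (simp add: x_def y_def)
    ultimately have "summable (\<lambda>m. norm (c m * y ^ m))" by (rule powser_insidea)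
    then show "summable (\<lambda>m. norm (c m * y ^ m) * exp (real n * (Re k / R)))" by (rule summable_mult2)
    fix m \<xi>
    have "norm (c m * exp ((of_nat n - of_nat m) * s \<xi>)) = norm (c m) * (norm (exp (- s \<xi>)) ^ m * norm (exp (of_nat n * s \<xi>)))"
      unfolding e[symmetric] by (simp add: norm_mult norm_power)
    also have "\<dots> = norm (c m * y ^ m) * exp (real n * (Re k / R))"
      by (simp add: norm_mult norm_power y_def Res)
    finally show "norm (c m * exp ((of_nat n - of_nat m) * s \<xi>)) \<le> norm (c m * y ^ m) * exp (real n * (Re k / R))" by simp
  qed
  moreover have "(\<Sum>m. c m * exp ((of_nat n - of_nat m) * s \<xi>)) = g \<xi>" for \<xi>
  proof -
    have "(\<lambda>m. c m * exp (- s \<xi>) ^ m * exp (of_nat n * s \<xi>)) sums g \<xi>"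
      unfolding g_def using Rpos by (intro sums_mult2 sums) (simp add: Res)
    then show ?thesis by (simp add: mult.assoc e sums_iff)
  qed
  ultimately have ul: "uniform_limit {- (pi * R)..pi * R} f g sequentially" by (simp add: f_def)
  have fi: "(f N has_integral (\<Sum>m<N. c m * (if m = n then of_real (2 * pi * R) else 0))) {- (pi * R)..pi * R}" for N
    unfolding f_def s_def by (intro has_integral_sum has_integral_mult_right has_integral_exp_frequency R) auto
  have cont: "continuous_on {- (pi * R)..pi * R} (f N)" for N
    unfolding f_def s_def using R by (intro continuous_intros) auto
  obtain I J where IJ: "\<And>N. (f N has_integral I N) {- (pi * R)..pi * R}" "(g has_integral J) {- (pi * R)..pi * R}" "I \<longlonglongrightarrow> J"
    using uniform_limit_integral[OF ul cont] by auto
  have "I N = of_real (2 * pi * R) * c n" if "N > n" for N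
  proof -
    have "I N = (\<Sum>m<N. c m * (if m = n then of_real (2 * pi * R) else 0))"
      using has_integral_unique[OF IJ(1) fi] .
    also have "\<dots> = (\<Sum>m<N. if m = n then c m * of_real (2 * pi * R) else 0)" by (intro sum.cong) auto
    also have "\<dots> = of_real (2 * pi * R) * c n" using that by (simp add: mult_ac)
    finally show ?thesis .
  qed
  then have "eventually (\<lambda>N. I N = of_real (2 * pi * R) * c n) sequentially"
    by (intro eventually_mono[OF eventually_gt_at_top[of n]])
  then have "I \<longlonglongrightarrow> of_real (2 * pi * R) * c n" by (rule tendsto_eventually)
  then have "J = of_real (2 * pi * R) * c n" using IJ(3) LIMSEQ_unique by blast
  then show ?thesis using IJ(2) by (simp add: g_def s_def)
qed

lemma cube_exp_bound: "x * exp (- d * x) \<le> 27 / d ^ 3 / x ^ 2" if "x > 0" "d > 0" for x d :: real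
proof -
  have "(1 + d * x / 3) ^ 3 \<le> exp (d * x / 3) ^ 3" using that exp_ge_add_one_self[of "d * x / 3"] by (intro power_mono) auto
  also have "\<dots> = exp (d * x)" by (simp add: exp_of_nat_mult[symmetric])
  finally have "(1 + d * x / 3) ^ 3 \<le> exp (d * x)" .
  moreover have "(d * x / 3) ^ 3 \<le> (1 + d * x / 3) ^ 3" using that by (intro power_mono) auto
  ultimately have "(d * x / 3) ^ 3 \<le> exp (d * x)" by linarith
  then show ?thesis using that by (simp add: field_simps exp_minus power3_eq_cube power2_eq_square)
qed

text \<open>k^2 / s + n * s has its saddle point at s = k / sqrt n, so the path s = (k + i * \<xi>)
  / R with R = sqrt n runs vertically through it even for complex k. Divided by Re k, the condition
  \<open>gap\<close> says that the minor arc bound stays below the saddle value by a factor exp (-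
  \<eta> / 8 * R).\<close>

locale saddle =
  fixes c :: "nat \<Rightarrow> complex" and F :: "complex \<Rightarrow> complex" and k l :: complex and C1 C2 C3 a0 \<eta> s0 :: real
  assumes sums: "\<And>s. Re s > 0 \<Longrightarrow> (\<lambda>m. c m * exp (- s) ^ m) sums F s"
    and k: "4 / 5 \<le> Re k" "Re k \<le> 11 / 10" "\<bar>Im k\<bar> \<le> 1 / 10"
    and gap: "a0 - \<eta> \<le> (Re k)\<^sup>2 - \<eta> / 8 * Re k"
    and major_arc: "\<And>s. s \<in> sector \<Longrightarrow> norm s \<le> s0 \<Longrightarrow>
      norm (F s / (exp (k\<^sup>2 / s + l) / of_real (sqrt 2)) - 1) \<le> C1 * norm s"
    and minor_arc: "\<And>s. 0 < Re s \<Longrightarrow> Re s \<le> s0 \<Longrightarrow> Re s \<le> \<bar>Im s\<bar> \<Longrightarrow> \<bar>Im s\<bar> \<le> 4 \<Longrightarrow>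
      norm (F s) \<le> C2 * exp ((a0 - \<eta>) / Re s)"
    and l: "norm l \<le> C3" and cpos: "0 < \<eta>" "\<eta> \<le> 4 / 5" "0 < s0" "0 \<le> C1" "0 \<le> C2"
begin

abbreviation p :: "real \<Rightarrow> complex" where "p \<xi> \<equiv> k + \<i> * of_real \<xi>"

lemma p_nz: "norm (p \<xi>) \<ge> 4 / 5" "p \<xi> \<noteq> 0" "norm k \<ge> 4 / 5" "k \<noteq> 0"
proof -
  show 1: "norm (p \<xi>) \<ge> 4 / 5" using complex_Re_le_cmod[of "p \<xi>"] k by simp
  then show "p \<xi> \<noteq> 0" by auto
  show 2: "norm k \<ge> 4 / 5" using complex_Re_le_cmod[of k] k by simp
  then show "k \<noteq> 0" by auto
qed

lemma Re_inverse_p: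
  assumes "\<bar>Im k + \<xi>\<bar> \<le> Re k"
  shows "Re (1 / p \<xi>) \<ge> 2 / 5"
proof -
  have "(Im k + \<xi>)\<^sup>2 \<le> (Re k)\<^sup>2" using assms by (subst abs_le_square_iff[symmetric]) simp
  then have "(Re k)\<^sup>2 + (Im k + \<xi>)\<^sup>2 \<le> 2 * (Re k)\<^sup>2" by simp
  moreover have "(Re k)\<^sup>2 + (Im k + \<xi>)\<^sup>2 > 0" using k by (intro add_pos_nonneg) auto
  ultimately have "Re k / ((Re k)\<^sup>2 + (Im k + \<xi>)\<^sup>2) \<ge> Re k / (2 * (Re k)\<^sup>2)"
    using k by (intro divide_left_mono mult_pos_pos) auto
  also have "Re k / (2 * (Re k)\<^sup>2) = 1 / (2 * Re k)" using k by (simp add: power2_eq_square)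
  also have "1 / (2 * Re k) \<ge> 2 / 5" using k by (simp add: field_simps)
  finally show ?thesis by (simp add: Re_divide)
qed

lemma Re_inverse_k: "Re (1 / k) \<ge> 3 / 5"
proof -
  have "(Re k)\<^sup>2 \<le> (11 / 10)\<^sup>2" using k by (intro power_mono) auto
  moreover have "(Im k)\<^sup>2 \<le> (1 / 10)\<^sup>2" using k by (subst abs_le_square_iff[symmetric]) simp
  ultimately have "(Re k)\<^sup>2 + (Im k)\<^sup>2 \<le> 122 / 100" by (simp add: power2_eq_square)
  moreover have "(Re k)\<^sup>2 + (Im k)\<^sup>2 > 0" using k by (intro add_pos_nonneg) auto
  ultimately have "Re k / ((Re k)\<^sup>2 + (Im k)\<^sup>2) \<ge> (4 / 5) / (122 / 100)"
    using k by (intro frac_le) auto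
  then show ?thesis by (simp add: Re_divide)
qed

text \<open>As p - k is purely imaginary, (p - k)^2 = - \<xi>^2. This makes the exponent exact, so a
  Taylor expansion is avoided; only 1 / p still varies.\<close>

lemma exponent_identity:
  assumes "R > 0"
  shows "k\<^sup>2 / (p \<xi> / of_real R) + of_real (R\<^sup>2) * (p \<xi> / of_real R) = 2 * k * of_real R - of_real (R * \<xi>\<^sup>2) * (1 / p \<xi>)"
proof -
  have gen: "k\<^sup>2 / (P / r) + r\<^sup>2 * (P / r) = 2 * k * r - r * y\<^sup>2 * (1 / P)"
    if "P \<noteq> 0" "r \<noteq> 0" "P\<^sup>2 + k\<^sup>2 = 2 * k * P - y\<^sup>2" for P r y :: complex
  proof -
    have "k\<^sup>2 / (P / r) + r\<^sup>2 * (P / r) = r * (P\<^sup>2 + k\<^sup>2) / P"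
      using that by (simp add: field_simps power2_eq_square)
    also have "\<dots> = 2 * k * r - r * y\<^sup>2 * (1 / P)"
      unfolding that(3) using that(1) by (simp add: field_simps)
    finally show ?thesis .
  qed
  have "(p \<xi>)\<^sup>2 + k\<^sup>2 = 2 * k * p \<xi> - (of_real \<xi>)\<^sup>2"
    by (simp add: power2_eq_square algebra_simps)
  from gen[OF p_nz(2) _ this, of "of_real R"] assms show ?thesis by simp
qed

context
  fixes R :: real and n :: nat
  assumes R: "R \<ge> 1" "2 / R \<le> s0" "2 * s0 \<ge> 0" and n: "real n = R\<^sup>2"
begin

definition I :: "real \<Rightarrow> complex" where
  "I \<xi> = F (p \<xi> / of_real R) * exp (of_nat n * (p \<xi> / of_real R))"

definition V :: complex where "V = exp (2 * k * of_real R + l)"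

lemma V_nz: "V \<noteq> 0" by (simp add: V_def)

lemma nR: "(of_nat n :: complex) = of_real (R\<^sup>2)"
  using n by (metis of_real_of_nat_eq)

lemma I_major:
  assumes \<xi>: "\<bar>Im k + \<xi>\<bar> \<le> Re k"
  obtains E where "norm E \<le> C1 * (2 / R)" "I \<xi> = V / of_real (sqrt 2) * exp (- (of_real (R * \<xi>\<^sup>2) * (1 / p \<xi>))) * (1 + E)"
proof -
  define s where "s = p \<xi> / of_real R"
  have s: "s \<in> sector" using R k \<xi> by (auto simp: sector_def s_def Re_divide_of_real Im_divide_of_real abs_divide divide_right_mono)
  have "norm (p \<xi>) \<le> \<bar>Re k\<bar> + \<bar>Im k + \<xi>\<bar>" using cmod_le[of "p \<xi>"] by simp
  then have "norm (p \<xi>) \<le> 22 / 10" using k \<xi> by linarith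
  moreover have "norm (p \<xi>) \<le> 3 / 2 * Re k" 
    using norm_le_Re_sector[of "p \<xi>"] k \<xi> by (auto simp: sector_def)
  ultimately have "norm (p \<xi>) \<le> 2" using k by linarith
  then have ns: "norm s \<le> 2 / R" using R by (auto simp: s_def norm_divide divide_right_mono)
  define E where "E = F s / (exp (k\<^sup>2 / s + l) / of_real (sqrt 2)) - 1"
  have "norm E \<le> C1 * norm s" unfolding E_def using ns R by (intro major_arc s) auto
  also have "\<dots> \<le> C1 * (2 / R)" using ns cpos by (intro mult_left_mono) auto
  finally have E: "norm E \<le> C1 * (2 / R)" .
  have "F s = exp (k\<^sup>2 / s + l) / of_real (sqrt 2) * (1 + E)" by (simp add: E_def)
  then have "I \<xi> = exp (k\<^sup>2 / s + l) * exp (of_nat n * s) / of_real (sqrt 2) * (1 + E)" by (simp add: I_def s_def)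
  also have "exp (k\<^sup>2 / s + l) * exp (of_nat n * s) = exp (l + (k\<^sup>2 / s + of_real (R\<^sup>2) * s))"
    unfolding nR exp_add[symmetric] by (simp add: algebra_simps)
  also have "\<dots> = exp (2 * k * of_real R + l + - (of_real (R * \<xi>\<^sup>2) * (1 / p \<xi>)))"
    unfolding s_def using R by (subst exponent_identity) (auto simp: algebra_simps)
  also have "\<dots> = V * exp (- (of_real (R * \<xi>\<^sup>2) * (1 / p \<xi>)))" unfolding V_def exp_add ..
  finally show ?thesis using that[OF E] by simp
qed

lemma norm_exp_p_le:
  assumes "\<bar>Im k + \<xi>\<bar> \<le> Re k"
  shows "norm (exp (- (of_real (R * \<xi>\<^sup>2) * (1 / p \<xi>)))) \<le> exp (- (2 / 5 * R) * \<xi>\<^sup>2)"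
proof -
  have "R * \<xi>\<^sup>2 * (2 / 5) \<le> R * \<xi>\<^sup>2 * Re (1 / p \<xi>)" using R by (intro mult_left_mono Re_inverse_p assms) auto
  moreover have "Re (of_real (R * \<xi>\<^sup>2) * (1 / p \<xi>)) = R * \<xi>\<^sup>2 * Re (1 / p \<xi>)" by (simp only: Re_complex_of_real Im_complex_of_real times_complex.sel mult_zero_left diff_zero)
  ultimately show ?thesis by (simp add: algebra_simps)
qed

text \<open>Inside the sector the Gaussian factor at |\<xi>| >= 1 / 2 is at most exp (- R / 10), and
  \<eta> <= 4 / 5 makes this suffice. Outside, the minor arc bound and \<open>gap\<close> apply;
  passing from exp (2 * Re k * R) to |V| costs at most exp C3.\<close>

lemma I_outer:
  assumes \<xi>: "1 / 2 \<le> \<bar>\<xi>\<bar>" "\<bar>\<xi>\<bar> \<le> pi * R"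
  shows "norm (I \<xi>) \<le> (1 + 2 * C1 + C2 * exp C3) * norm V * exp (- (\<eta> / 8 * R))"
proof (cases "\<bar>Im k + \<xi>\<bar> \<le> Re k")
  case True
  obtain E where E: "norm E \<le> C1 * (2 / R)" "I \<xi> = V / of_real (sqrt 2) * exp (- (of_real (R * \<xi>\<^sup>2) * (1 / p \<xi>))) * (1 + E)"
    using I_major[OF True] by blast
  have "C1 * (2 / R) \<le> C1 * 2" using R cpos by (intro mult_left_mono) (auto simp: divide_le_eq)
  then have nE: "norm (1 + E) \<le> 1 + 2 * C1" using norm_triangle_ineq[of 1 E] E(1) by simp
  have "1 / 4 \<le> \<xi>\<^sup>2" using \<xi> abs_le_square_iff[of "1 / 2" \<xi>] by (simp add: power2_eq_square)
  then have "(2 / 5 * R) * (1 / 4) \<le> (2 / 5 * R) * \<xi>\<^sup>2" using R by (intro mult_left_mono) auto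
  moreover have "\<eta> / 8 * R \<le> 1 / 10 * R" using cpos R by (intro mult_right_mono) auto
  ultimately have "exp (- (2 / 5 * R) * \<xi>\<^sup>2) \<le> exp (- (\<eta> / 8 * R))" by (simp add: mult_ac)
  then have e: "norm (exp (- (of_real (R * \<xi>\<^sup>2) * (1 / p \<xi>)))) \<le> exp (- (\<eta> / 8 * R))"
    using norm_exp_p_le[OF True] by linarith
  have "norm (V / of_real (sqrt 2)) \<le> norm V" by (simp add: norm_divide divide_le_eq mult_le_cancel_left1)
  then have "norm (I \<xi>) \<le> norm V * exp (- (\<eta> / 8 * R)) * (1 + 2 * C1)"
    unfolding E(2) norm_mult using e nE by (intro mult_mono) auto
  also have "\<dots> \<le> norm V * exp (- (\<eta> / 8 * R)) * (1 + 2 * C1 + C2 * exp C3)"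
    using cpos by (intro mult_left_mono) auto
  finally show ?thesis by (simp add: mult_ac)
next
  case False
  define s where "s = p \<xi> / of_real R"
  have Res: "Re s = Re k / R" "Im s = (Im k + \<xi>) / R" by (simp_all add: s_def Re_divide_of_real Im_divide_of_real)
  have "norm (F s) \<le> C2 * exp ((a0 - \<eta>) / Re s)"
  proof (rule minor_arc)
    show "0 < Re s" using k R by (simp add: Res)
    have "Re k / R \<le> 2 / R" using k R by (intro divide_right_mono) auto
    then show "Re s \<le> s0" using R by (simp add: Res)
    show "Re s \<le> \<bar>Im s\<bar>" unfolding Res abs_divide using False R by (simp add: divide_right_mono)
    have "\<bar>Im k + \<xi>\<bar> \<le> 1 / 10 * R + pi * R" using \<xi> k R by linarith
    also have "1 / 10 * R + pi * R = (1 / 10 + pi) * R" by (simp only: distrib_right)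
    also have "\<dots> \<le> 4 * R" using R pi_approx by (intro mult_right_mono) auto
    finally show "\<bar>Im s\<bar> \<le> 4" unfolding Res abs_divide using R by (simp add: divide_le_eq)
  qed
  then have "norm (I \<xi>) \<le> C2 * exp ((a0 - \<eta>) / Re s) * norm (exp (of_nat n * s))"
    unfolding I_def s_def[symmetric] norm_mult by (rule mult_right_mono) simp
  also have "\<dots> = C2 * exp ((a0 - \<eta>) / Re k * R + Re k * R)"
  proof -
    have "Re (of_nat n * s) = R\<^sup>2 * Re s" unfolding nR by (simp only: Re_complex_of_real Im_complex_of_real times_complex.sel mult_zero_left diff_zero)
    also have "\<dots> = Re k * R" using R by (simp add: Res power2_eq_square)
    finally have 1: "norm (exp (of_nat n * s)) = exp (Re k * R)" by simp
    have 2: "(a0 - \<eta>) / Re s = (a0 - \<eta>) / Re k * R" by (simp add: Res)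
    show ?thesis unfolding 1 2 by (simp add: exp_add)
  qed
  also have "C2 * exp ((a0 - \<eta>) / Re k * R + Re k * R) \<le> C2 * exp (2 * Re k * R - \<eta> / 8 * R)"
  proof -
    have "(a0 - \<eta>) / Re k \<le> ((Re k)\<^sup>2 - \<eta> / 8 * Re k) / Re k" using gap k by (intro divide_right_mono) auto
    also have "\<dots> = Re k - \<eta> / 8" using k by (simp add: field_simps power2_eq_square)
    finally have "(a0 - \<eta>) / Re k * R \<le> (Re k - \<eta> / 8) * R" using R by (intro mult_right_mono) auto
    then show ?thesis using cpos by (intro mult_left_mono) (auto simp: algebra_simps)
  qed
  also have "C2 * exp (2 * Re k * R - \<eta> / 8 * R) = C2 * exp (- Re l) * norm V * exp (- (\<eta> / 8 * R))"
    by (simp add: V_def exp_add[symmetric])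
  also have "\<dots> \<le> (1 + 2 * C1 + C2 * exp C3) * norm V * exp (- (\<eta> / 8 * R))"
  proof (intro mult_right_mono)
    have "exp (- Re l) \<le> exp C3" using abs_Re_le_cmod[of l] l by simp
    then have "C2 * exp (- Re l) \<le> C2 * exp C3" using cpos by (intro mult_left_mono) auto
    then show "C2 * exp (- Re l) \<le> 1 + 2 * C1 + C2 * exp C3" using cpos by linarith
  qed auto
  finally show ?thesis using cpos by simp
qed

lemma inner_near: "\<bar>\<xi>\<bar> \<le> 1 / 2 \<Longrightarrow> \<bar>Im k + \<xi>\<bar> \<le> Re k"
  using k by linarith

lemma cont_inner: "continuous_on A (\<lambda>\<xi>. exp (- (of_real (R * \<xi>\<^sup>2) * (1 / p \<xi>))))"
  using p_nz(2) by (intro continuous_intros) auto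

text \<open>Replacing 1 / p by 1 / k changes the integrand to first order by an odd function, whose
  integral vanishes. What is left has order (v^3 + v^2) / R with v = R * \<xi>^2, so the relative
  error is O(1 / R) instead of O(1 / sqrt R).\<close>

lemma inner_vs_gauss:
  "norm (integral {-(1/2)..1/2} (\<lambda>\<xi>. exp (- (of_real (R * \<xi>\<^sup>2) * (1 / p \<xi>)))) - integral {-(1/2)..1/2} (\<lambda>\<xi>. exp (- (of_real (R * \<xi>\<^sup>2) * (1 / k)))))
     \<le> 20000 / R * sqrt (5 * pi / R)"
proof -
  define f where "f = (\<lambda>\<xi>. exp (- (of_real (R * \<xi>\<^sup>2) * (1 / p \<xi>))))"
  define g where "g = (\<lambda>\<xi>::real. exp (- (of_real (R * \<xi>\<^sup>2) * (1 / k))))"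
  define od where "od = (\<lambda>\<xi>::real. g \<xi> * (\<i> * of_real (R * \<xi> ^ 3) / k\<^sup>2))"
  have cg: "continuous_on A g" for A unfolding g_def by (intro continuous_intros)
  have co: "continuous_on A od" for A unfolding od_def using p_nz by (intro continuous_intros cg) auto
  have cf: "continuous_on A f" for A unfolding f_def by (rule cont_inner)
  have odd: "integral {-(1/2)..1/2} od = 0"
  proof -
    have "integral {-(1/2)..1/2} (\<lambda>x. od (- x)) = integral {-(1/2)..1/2} od"
      using Henstock_Kurzweil_Integration.integral_reflect_real[where f = od and a = "-(1/2)" and b = "1/2"] by simp
    moreover have "(\<lambda>x. od (- x)) = (\<lambda>x. - od x)" by (auto simp: od_def g_def)
    ultimately show ?thesis by simp
  qed
  have pt: "norm (f \<xi> - g \<xi> - od \<xi>) \<le> 20000 / R * exp (- (1 / 5 * R) * \<xi>\<^sup>2)" if "\<xi> \<in> {-(1/2)..1/2}" for \<xi>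
  proof -
    have a: "\<bar>Im k + \<xi>\<bar> \<le> Re k" using that by (intro inner_near) auto
    define v where "v = R * \<xi>\<^sup>2"
    have v: "v \<ge> 0" using R by (simp add: v_def)
    \<comment> \<open>D is the difference of the exponents; its leading part is the odd cubic term
      of \<open>od\<close>, and T is the quartic rest.\<close>
    define D where "D = \<i> * of_real (R * \<xi> ^ 3) / (k * p \<xi>)"
    define T where "T = of_real (R * \<xi> ^ 4) / (k * k * p \<xi>)"
    have nz: "k \<noteq> 0" "p \<xi> \<noteq> 0" using p_nz by auto
    have fg: "f \<xi> = g \<xi> * exp D"
    proof -
      have "- (of_real (R * \<xi>\<^sup>2) * (1 / p \<xi>)) = - (of_real (R * \<xi>\<^sup>2) * (1 / k)) + D"
      proof -
        have "1 / k - 1 / P = (P - k) / (k * P)" if "P \<noteq> 0" for P using nz that by (simp add: field_simps)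
        from this[OF nz(2)] have "1 / k - 1 / p \<xi> = \<i> * of_real \<xi> / (k * p \<xi>)" by simp
        moreover have "D = of_real (R * \<xi>\<^sup>2) * (\<i> * of_real \<xi> / (k * p \<xi>))"
          by (simp add: D_def power2_eq_square power3_eq_cube mult_ac)
        ultimately have "D = of_real (R * \<xi>\<^sup>2) * (1 / k - 1 / p \<xi>)" by simp
        then show ?thesis by (simp only: right_diff_distrib) simp
      qed
      then show ?thesis by (simp only: f_def g_def exp_add)
    qed
    have DT: "D = \<i> * of_real (R * \<xi> ^ 3) / k\<^sup>2 + T"
    proof -
      have "\<i> * of_real (R * \<xi> ^ 3) * k = \<i> * of_real (R * \<xi> ^ 3) * p \<xi> + of_real (R * \<xi> ^ 4)"
        by (simp add: algebra_simps power3_eq_cube power4_eq_xxxx)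
      moreover have "D = \<i> * of_real (R * \<xi> ^ 3) * k / (k * k * p \<xi>)" using nz by (simp add: D_def)
      moreover have "\<i> * of_real (R * \<xi> ^ 3) / k\<^sup>2 = \<i> * of_real (R * \<xi> ^ 3) * p \<xi> / (k * k * p \<xi>)" using nz by (simp add: power2_eq_square)
      ultimately show ?thesis by (simp only: T_def add_divide_distrib)
    qed
    have gb: "norm (g \<xi>) \<le> exp (- (2 / 5) * v)"
    proof -
      have "v * (2 / 5) \<le> v * Re (1 / k)" using Re_inverse_k v by (intro mult_left_mono) auto
      moreover have "Re (of_real v * (1 / k)) = v * Re (1 / k)" by (simp only: Re_complex_of_real Im_complex_of_real times_complex.sel mult_zero_left diff_zero)
      ultimately show ?thesis by (simp add: g_def v_def[symmetric] del: of_real_mult)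
    qed
    \<comment> \<open>The left side is |f|, whose decay is known directly; so D may have a positive
      real part.\<close>
    have fb: "norm (g \<xi>) * exp (Re D) \<le> exp (- (2 / 5) * v)"
    proof -
      have "norm (f \<xi>) \<le> exp (- (2 / 5 * R) * \<xi>\<^sup>2)" unfolding f_def by (rule norm_exp_p_le[OF a])
      moreover have "norm (f \<xi>) = norm (g \<xi>) * exp (Re D)" by (simp only: fg norm_mult norm_exp_eq_Re)
      moreover have "- (2 / 5) * v = - (2 / 5 * R) * \<xi>\<^sup>2" by (simp add: v_def)
      ultimately show ?thesis by (simp only:)
    qed
    have kp: "norm (k * p \<xi>) \<ge> 16 / 25" "norm (k * k * p \<xi>) \<ge> 64 / 125"
      using mult_mono[OF p_nz(3) p_nz(1)[of \<xi>]] mult_mono[OF mult_mono[OF p_nz(3) p_nz(3)] p_nz(1)[of \<xi>]] by (auto simp: norm_mult)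
    have Dn: "norm D ^ 2 \<le> 4 * v ^ 3 / R"
    proof -
      have "norm D = R * \<bar>\<xi>\<bar> ^ 3 / norm (k * p \<xi>)" using R by (simp add: D_def norm_divide norm_mult norm_power)
      also have "\<dots> \<le> R * \<bar>\<xi>\<bar> ^ 3 / (16 / 25)" using kp R by (intro divide_left_mono mult_pos_pos) (auto simp: p_nz norm_mult)
      finally have "norm D ^ 2 \<le> (R * \<bar>\<xi>\<bar> ^ 3 / (16 / 25)) ^ 2" by (intro power_mono) auto
      also have "\<dots> = (25 / 16)\<^sup>2 * (R\<^sup>2 * (\<xi>\<^sup>2) ^ 3)" 
        by (simp add: power_mult_distrib power_divide power_mult[symmetric] power_even_abs)
      also have "\<dots> \<le> 4 * (R\<^sup>2 * (\<xi>\<^sup>2) ^ 3)" by (intro mult_right_mono) (auto simp: power2_eq_square)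
      also have "\<dots> = 4 * v ^ 3 / R" using R by (simp add: v_def power_mult_distrib power3_eq_cube power2_eq_square)
      finally show ?thesis .
    qed
    have Tn: "norm T \<le> 2 * v\<^sup>2 / R"
    proof -
      have "norm T = R * \<xi> ^ 4 / norm (k * k * p \<xi>)" using R by (simp add: T_def norm_divide norm_mult norm_power)
      also have "\<dots> \<le> R * \<xi> ^ 4 / (64 / 125)" using kp R by (intro divide_left_mono mult_pos_pos) (auto simp: p_nz norm_mult)
      also have "\<dots> \<le> 2 * (R * \<xi> ^ 4)" using R by (simp add: field_simps)
      also have "\<dots> = 2 * v\<^sup>2 / R" using R by (simp add: v_def power_mult_distrib power2_eq_square power4_eq_xxxx)
      finally show ?thesis .
    qed
    have "f \<xi> - g \<xi> - od \<xi> = g \<xi> * (exp D - 1 - D) + g \<xi> * T"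
      unfolding fg od_def by (subst (3) DT) (simp add: algebra_simps)
    then have "norm (f \<xi> - g \<xi> - od \<xi>) \<le> norm (g \<xi>) * norm (exp D - 1 - D) + norm (g \<xi>) * norm T"
      by (metis norm_mult norm_triangle_ineq)
    also have "\<dots> \<le> norm (g \<xi>) * (max 1 (exp (Re D)) * norm D ^ 2) + norm (g \<xi>) * norm T"
      by (intro add_right_mono mult_left_mono norm_exp_remainder_2) auto
    also have "\<dots> = max (norm (g \<xi>)) (norm (g \<xi>) * exp (Re D)) * norm D ^ 2 + norm (g \<xi>) * norm T"
      by (simp add: max_mult_distrib_left mult.assoc[symmetric])
    also have "\<dots> \<le> exp (- (2 / 5) * v) * (4 * v ^ 3 / R) + exp (- (2 / 5) * v) * (2 * v\<^sup>2 / R)"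
      using gb fb Dn Tn v R by (intro add_mono mult_mono) auto
    also have "\<dots> = exp (- (2 / 5) * v) * (4 * v ^ 3 + 2 * v\<^sup>2) / R" by (simp add: distrib_left add_divide_distrib mult_ac)
    also have "\<dots> \<le> exp (- (2 / 5) * v) * (20000 * exp (v / 5)) / R"
      using R by (intro divide_right_mono mult_left_mono cubic_le_exp v) auto
    also have "\<dots> = 20000 / R * exp (- (2 / 5) * v + v / 5)" unfolding exp_add by simp
    also have "- (2 / 5) * v + v / 5 = - (1 / 5 * R) * \<xi>\<^sup>2" by (simp add: v_def)
    finally show ?thesis .
  qed
  have "integral {-(1/2)..1/2} f - integral {-(1/2)..1/2} g = integral {-(1/2)..1/2} (\<lambda>\<xi>. f \<xi> - g \<xi> - od \<xi>)"
    by (simp add: Henstock_Kurzweil_Integration.integral_diff integrable_diff integrable_continuous_interval cf cg co odd)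
  also have "norm \<dots> \<le> integral {-(1/2)..1/2} (\<lambda>\<xi>. 20000 / R * exp (- (1 / 5 * R) * \<xi>\<^sup>2))"
    by (intro integral_norm_bound_integral integrable_continuous_interval continuous_intros cf cg co pt)
  also have "\<dots> = 20000 / R * integral {-(1/2)..1/2} (\<lambda>\<xi>. exp (- (1 / 5 * R) * \<xi>\<^sup>2))" by simp
  also have "\<dots> \<le> 20000 / R * sqrt (pi / (1 / 5 * R))"
    using R by (intro mult_left_mono integral_gauss_scaled_le) auto
  finally show ?thesis by (simp add: f_def g_def mult.commute)
qed


text \<open>Apply \<open>integral_complex_gauss\<close> with w = sqrt R / csqrt k and K = 1 / 2. The
  error decays like exp (- 3 / 20 * R), where 3 / 20 = (1 / 2)^2 * 3 / 5 uses
  \<open>Re_inverse_k\<close>.\<close>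

lemma gauss_main:
  "norm (of_real (sqrt R) / csqrt k * integral {-(1/2)..1/2} (\<lambda>\<xi>. exp (- (of_real (R * \<xi>\<^sup>2) * (1 / k)))) - of_real (sqrt pi)) \<le> 80000 / R"
proof -
  define w where "w = of_real (sqrt R) / csqrt k"
  have w2: "w\<^sup>2 = of_real R * (1 / k)"
    using R by (simp add: w_def power_divide of_real_power[symmetric] del: of_real_power)
  have Re2: "Re (w\<^sup>2) \<ge> 3 / 5 * R"
  proof -
    have "Re (of_real R * (1 / k)) = R * Re (1 / k)" by (simp only: Re_complex_of_real Im_complex_of_real times_complex.sel mult_zero_left diff_zero)
    moreover have "R * (3 / 5) \<le> R * Re (1 / k)" using Re_inverse_k R by (intro mult_left_mono) auto
    ultimately show ?thesis unfolding w2 by simp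
  qed
  have Re1: "(Re w)\<^sup>2 \<ge> 3 / 5 * R"
  proof -
    have "Re (w\<^sup>2) = (Re w)\<^sup>2 - (Im w)\<^sup>2" by (simp add: power2_eq_square)
    then show ?thesis using Re2 zero_le_power2[of "Im w"] by linarith
  qed
  have "Re w \<ge> 0"
  proof -
    have "Re w = sqrt R * Re (csqrt k) / ((Re (csqrt k))\<^sup>2 + (Im (csqrt k))\<^sup>2)"
      by (simp add: w_def Re_divide)
    moreover have "Re (csqrt k) \<ge> 0" by (rule Re_csqrt)
    ultimately show ?thesis using R by (auto intro!: divide_nonneg_nonneg mult_nonneg_nonneg)
  qed
  moreover have "(1 / 2)\<^sup>2 \<le> (Re w)\<^sup>2" using Re1 R by (simp add: power2_eq_square)
  ultimately have Rew: "Re w \<ge> 1 / 2" by (rule power2_le_imp_le[rotated])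
  have nw: "norm w \<le> 2 * R"
  proof -
    have "norm w ^ 2 = norm (of_real R * (1 / k))" unfolding w2[symmetric] by (simp add: norm_power)
    also have "\<dots> = R * norm (1 / k)" using R by (simp add: norm_mult norm_divide)
    also have "\<dots> \<le> R * (5 / 4)" using p_nz(3) p_nz(4) R by (intro mult_left_mono) (auto simp: norm_divide field_simps)
    also have "\<dots> \<le> (2 * R)\<^sup>2" using R by (simp add: power2_eq_square)
    finally show ?thesis by (rule power2_le_imp_le) (use R in auto)
  qed
  have "norm (w * integral {-(1/2)..1/2} (\<lambda>t. exp (- (w * of_real t)\<^sup>2)) - of_real (sqrt pi)) \<le>
    2 * \<bar>1 / 2 * Im w\<bar> * exp (- (1 / 2)\<^sup>2 * Re (w\<^sup>2)) + 2 * exp (- (1 / 2 * Re w)\<^sup>2) / (1 / 2 * Re w)"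
    using Rew by (intro integral_complex_gauss) auto
  also have "(\<lambda>t. exp (- (w * of_real t)\<^sup>2)) = (\<lambda>\<xi>. exp (- (of_real (R * \<xi>\<^sup>2) * (1 / k))))"
    by (simp add: power_mult_distrib w2 mult_ac)
  also have "2 * \<bar>1 / 2 * Im w\<bar> * exp (- (1 / 2)\<^sup>2 * Re (w\<^sup>2)) + 2 * exp (- (1 / 2 * Re w)\<^sup>2) / (1 / 2 * Re w) \<le>
     2 * R * exp (- (3 / 20) * R) + 8 * exp (- (3 / 20) * R)"
  proof (rule add_mono[OF mult_mono])
    show "2 * \<bar>1 / 2 * Im w\<bar> \<le> 2 * R" using abs_Im_le_cmod[of w] nw by simp
    show "exp (- (1 / 2)\<^sup>2 * Re (w\<^sup>2)) \<le> exp (- (3 / 20) * R)" using Re2 by (simp add: power2_eq_square)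
    have "2 * exp (- (1 / 2 * Re w)\<^sup>2) / (1 / 2 * Re w) \<le> 2 * exp (- (3 / 20) * R) / (1 / 4)"
    proof (intro frac_le mult_left_mono)
      show "exp (- (1 / 2 * Re w)\<^sup>2) \<le> exp (- (3 / 20) * R)" using Re1 by (simp add: power_mult_distrib power_divide)
    qed (use Rew in auto)
    then show "2 * exp (- (1 / 2 * Re w)\<^sup>2) / (1 / 2 * Re w) \<le> 8 * exp (- (3 / 20) * R)" by simp
  qed (use R in auto)
  also have "\<dots> \<le> 10 * (R * exp (- (3 / 20) * R))"
  proof -
    have "1 * exp (- (3 / 20) * R) \<le> R * exp (- (3 / 20) * R)" using R by (intro mult_right_mono) auto
    then show ?thesis by simp
  qed
  also have "\<dots> \<le> 80000 / R"
  proof -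
    have "R * exp (- (3 / 20) * R) \<le> 27 / (3 / 20) ^ 3 / R ^ 2" using R by (intro cube_exp_bound) auto
    also have "27 / (3 / 20) ^ 3 / R ^ 2 = 8000 / R ^ 2" by (simp add: power3_eq_cube)
    finally have "10 * (R * exp (- (3 / 20) * R)) \<le> 80000 / R\<^sup>2" by simp
    moreover
    have "80000 / R\<^sup>2 \<le> 80000 / R" using R by (intro divide_left_mono) (auto simp: power2_eq_square)
    ultimately show ?thesis by linarith
  qed
  finally show ?thesis by (simp add: w_def)
qed

text \<open>Four errors after normalizing the main term to 1: 1 / p against 1 / k (2 * 20000 * 5),
  the major arc approximation (2 * 2 * C1 * 3), the Gaussian integral (80000), and the outer parts,
  whose exponential decay beats the growth of the normalization.\<close>

lemma saddle_estimate:
  "norm (of_real (2 * pi * R) * c n * (of_real (sqrt 2) * (of_real (sqrt R) / csqrt k) / (V * of_real (sqrt pi))) - 1)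
    \<le> (280000 + 12 * C1 + 24 * (1 + 2 * C1 + C2 * exp C3) * (27 / (\<eta> / 8) ^ 3)) / R"
proof -
  define w where "w = of_real (sqrt R) / csqrt k"
  define J where "J = integral {-(1/2)..1/2} (\<lambda>\<xi>. exp (- (of_real (R * \<xi>\<^sup>2) * (1 / p \<xi>))))"
  define h where "h = integral {-(1/2)..1/2} (\<lambda>\<xi>::real. exp (- (of_real (R * \<xi>\<^sup>2) * (1 / k))))"
  define CB where "CB = 1 + 2 * C1 + C2 * exp C3"
  define W where "W = of_real (sqrt 2) * w / (V * of_real (sqrt pi))"
  have CB0: "CB \<ge> 0" using cpos by (simp add: CB_def)
  have sp: "sqrt pi \<ge> 1" "sqrt pi \<le> 2" using pi_gt3 pi_less_4 real_sqrt_le_mono[of pi 4] by auto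
  have sR: "sqrt R > 0" "sqrt R * sqrt R = R" using R by auto
  have nw: "norm w \<le> 2 * sqrt R"
  proof -
    have "norm (csqrt k) ^ 2 = norm k" by (metis norm_power power2_csqrt)
    then have "norm (csqrt k) ^ 2 \<ge> (1 / 2) ^ 2" using p_nz(3) by (simp add: power2_eq_square)
    then have "norm (csqrt k) \<ge> 1 / 2" by (rule power2_le_imp_le) simp
    then have "norm w \<le> sqrt R / (1 / 2)" unfolding w_def norm_divide using R by (intro frac_le) auto
    then show ?thesis by simp
  qed
  have tot: "(I has_integral (of_real (2 * pi * R) * c n)) {- (pi * R)..pi * R}"
    unfolding I_def using sums R k by (intro has_integral_coefficient) auto
  have piR: "1 / 2 \<le> pi * R"
  proof -
    have "3 * 1 \<le> pi * R" using pi_gt3 R by (intro mult_mono) auto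
    then show ?thesis by simp
  qed
  have int: "I integrable_on {a..b}" if "- (pi * R) \<le> a" "b \<le> pi * R" for a b
    using integrable_subinterval_real[of I "- (pi * R)" "pi * R" a b] tot that by (auto simp: has_integral_integrable)
  have split: "of_real (2 * pi * R) * c n = integral {- (pi * R)..-(1/2)} I + integral {-(1/2)..1/2} I + integral {1/2..pi * R} I"
  proof -
    have "of_real (2 * pi * R) * c n = integral {- (pi * R)..pi * R} I" using tot by (simp add: integral_unique)
    also have "\<dots> = integral {- (pi * R)..-(1/2)} I + integral {-(1/2)..pi * R} I"
      using piR by (intro Henstock_Kurzweil_Integration.integral_combine[symmetric] int) auto
    also have "integral {-(1/2)..pi * R} I = integral {-(1/2)..1/2} I + integral {1/2..pi * R} I"
      using piR by (intro Henstock_Kurzweil_Integration.integral_combine[symmetric] int) auto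
    finally show ?thesis by (simp add: add.assoc)
  qed
  define B where "B = CB * norm V * exp (- (\<eta> / 8 * R))"
  have B0: "B \<ge> 0" using CB0 by (simp add: B_def)
  have outer: "norm (integral {a..b} I) \<le> pi * R * B" if ab: "- (pi * R) \<le> a" "b \<le> pi * R" "a \<le> b" "b - a \<le> pi * R" "\<And>\<xi>. \<xi> \<in> {a..b} \<Longrightarrow> 1 / 2 \<le> \<bar>\<xi>\<bar>" for a b
  proof -
    have "norm (integral {a..b} I) \<le> integral {a..b} (\<lambda>_. B)"
    proof (rule integral_norm_bound_integral)
      fix \<xi> assume x: "\<xi> \<in> {a..b}"
      then have "\<bar>\<xi>\<bar> \<le> pi * R" using ab by auto
      then show "norm (I \<xi>) \<le> B" unfolding B_def CB_def using I_outer[OF ab(5)[OF x]] by simp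
    qed (use ab in \<open>auto intro!: int\<close>)
    also have "\<dots> = (b - a) * B" using ab by simp
    also have "\<dots> \<le> pi * R * B" using ab B0 by (intro mult_right_mono) auto
    finally show ?thesis .
  qed
  define e where "e = (\<lambda>\<xi>. exp (- (of_real (R * \<xi>\<^sup>2) * (1 / p \<xi>))))"
  define V2 where "V2 = V / of_real (sqrt 2)"
  have inner: "norm (integral {-(1/2)..1/2} I - V2 * J) \<le> norm V2 * (C1 * (2 / R)) * sqrt (pi / (2 / 5 * R))"
  proof -
    have ie: "(\<lambda>\<xi>. V2 * e \<xi>) integrable_on {-(1/2)..1/2}"
      unfolding e_def by (intro integrable_continuous_interval continuous_intros cont_inner)
    have "integral {-(1/2)..1/2} I - V2 * J = integral {-(1/2)..1/2} (\<lambda>\<xi>. I \<xi> - V2 * e \<xi>)"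
      using piR by (subst Henstock_Kurzweil_Integration.integral_diff[OF int ie]) (auto simp: J_def e_def)
    also have "norm \<dots> \<le> integral {-(1/2)..1/2} (\<lambda>\<xi>. norm V2 * (C1 * (2 / R)) * exp (- (2 / 5 * R) * \<xi>\<^sup>2))"
    proof (rule integral_norm_bound_integral)
      show "(\<lambda>\<xi>. I \<xi> - V2 * e \<xi>) integrable_on {-(1/2)..1/2}" using piR by (intro integrable_diff int ie) auto
      show "(\<lambda>\<xi>. norm V2 * (C1 * (2 / R)) * exp (- (2 / 5 * R) * \<xi>\<^sup>2)) integrable_on {-(1/2)..1/2}"
        by (intro integrable_continuous_interval continuous_intros)
      fix \<xi> :: real assume "\<xi> \<in> {-(1/2)..1/2}"
      then have near: "\<bar>Im k + \<xi>\<bar> \<le> Re k" by (intro inner_near) auto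
      obtain E where E: "norm E \<le> C1 * (2 / R)" "I \<xi> = V2 * e \<xi> * (1 + E)"
        using I_major[OF near] unfolding V2_def e_def by blast
      have "I \<xi> - V2 * e \<xi> = V2 * E * e \<xi>" unfolding E(2) by (simp add: algebra_simps)
      then have "norm (I \<xi> - V2 * e \<xi>) = norm V2 * norm E * norm (e \<xi>)" by (simp only: norm_mult)
      also have "\<dots> \<le> norm V2 * (C1 * (2 / R)) * exp (- (2 / 5 * R) * \<xi>\<^sup>2)"
        using E(1) norm_exp_p_le[OF near] cpos R unfolding e_def by (intro mult_mono) auto
      finally show "norm (I \<xi> - V2 * e \<xi>) \<le> norm V2 * (C1 * (2 / R)) * exp (- (2 / 5 * R) * \<xi>\<^sup>2)" .
    qed
    also have "\<dots> = norm V2 * (C1 * (2 / R)) * integral {-(1/2)..1/2} (\<lambda>\<xi>. exp (- (2 / 5 * R) * \<xi>\<^sup>2))" by simp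
    also have "\<dots> \<le> norm V2 * (C1 * (2 / R)) * sqrt (pi / (2 / 5 * R))"
      using R cpos by (intro mult_left_mono integral_gauss_scaled_le) auto
    finally show ?thesis .
  qed
  have WV: "W * V2 = w / of_real (sqrt pi)" using V_nz sp by (simp add: W_def V2_def)
  have nWV: "norm (W * V2) \<le> 2 * sqrt R"
  proof -
    have "norm w / sqrt pi \<le> norm w / 1" using sp by (intro divide_left_mono) auto
    then show ?thesis unfolding WV using nw sp by (simp add: norm_divide)
  qed
  have s5: "sqrt (5 * pi / R) \<le> 5 / sqrt R" "sqrt (pi / (2 / 5 * R)) \<le> 3 / sqrt R"
  proof -
    have "sqrt (5 * pi) \<le> sqrt (5\<^sup>2)" "sqrt (pi / (2 / 5)) \<le> sqrt (3\<^sup>2 + 2)"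
      using pi_less_4 by (intro real_sqrt_le_mono; simp add: power2_eq_square)+
    then show "sqrt (5 * pi / R) \<le> 5 / sqrt R" unfolding real_sqrt_divide using R by (simp add: divide_right_mono)
    have "pi / (2 / 5) \<le> 3\<^sup>2" using pi_approx by (simp add: power2_eq_square)
    then have "sqrt (pi / (2 / 5)) \<le> 3" by (metis abs_numeral real_sqrt_abs real_sqrt_le_mono)
    moreover have "sqrt (pi / (2 / 5 * R)) = sqrt (pi / (2 / 5)) / sqrt R" by (simp add: real_sqrt_divide real_sqrt_mult)
    ultimately show "sqrt (pi / (2 / 5 * R)) \<le> 3 / sqrt R" using R by (simp add: divide_right_mono)
  qed
  have cR: "2 * sqrt R * (x * (y / sqrt R)) = 2 * x * y" for x y using sR by simp
  have T1: "norm (W * V2 * (J - h)) \<le> 200000 / R"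
  proof -
    have "norm (W * V2 * (J - h)) \<le> 2 * sqrt R * (20000 / R * (5 / sqrt R))"
      unfolding norm_mult[of "W * V2"]
      by (intro mult_mono nWV order_trans[OF inner_vs_gauss[folded J_def h_def]] mult_left_mono s5) (use R in auto)
    then show ?thesis unfolding cR by simp
  qed
  have T2: "norm (W * (integral {-(1/2)..1/2} I - V2 * J)) \<le> 12 * C1 / R"
  proof -
    have "norm (W * (integral {-(1/2)..1/2} I - V2 * J)) \<le> norm W * (norm V2 * (C1 * (2 / R)) * (3 / sqrt R))"
      unfolding norm_mult using cpos R
      by (intro mult_left_mono order_trans[OF inner] s5) auto
    also have "\<dots> = norm (W * V2) * ((C1 * (2 / R)) * (3 / sqrt R))" by (simp add: norm_mult)
    also have "\<dots> \<le> 2 * sqrt R * ((C1 * (2 / R)) * (3 / sqrt R))"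
      using cpos R by (intro mult_right_mono nWV) auto
    finally show ?thesis unfolding cR by (simp add: mult_ac)
  qed
  have T3: "norm (W * V2 * h - 1) \<le> 80000 / R"
  proof -
    have "W * V2 * h - 1 = (w * h - of_real (sqrt pi)) / of_real (sqrt pi)"
      unfolding WV using sp by (simp add: field_simps)
    then have "norm (W * V2 * h - 1) = norm (w * h - of_real (sqrt pi)) / sqrt pi" using sp by (simp add: norm_divide)
    also have "\<dots> \<le> (80000 / R) / 1" using gauss_main sp R unfolding w_def h_def by (intro frac_le) auto
    finally show ?thesis by simp
  qed
  have T4: "norm (W * (integral {- (pi * R)..-(1/2)} I + integral {1/2..pi * R} I)) \<le> 24 * CB * (27 / (\<eta> / 8) ^ 3) / R"
  proof -
    have nW: "norm W \<le> 3 * R / norm V"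
    proof -
      have "norm W = sqrt 2 * norm w / (norm V * sqrt pi)" using sp by (simp add: W_def norm_divide norm_mult)
      also have "\<dots> \<le> sqrt 2 * (2 * sqrt R) / (norm V * 1)" using nw sp V_nz by (intro frac_le mult_left_mono mult_nonneg_nonneg mult_pos_pos) (use R in auto)
      also have "\<dots> \<le> 3 * R / norm V"
      proof -
        have "sqrt 2 \<le> 3 / 2" by (rule real_le_lsqrt) (auto simp: power2_eq_square)
        moreover have "sqrt R \<le> R" using R by (simp add: real_le_lsqrt power2_eq_square)
        ultimately have "sqrt 2 * (2 * sqrt R) \<le> 3 / 2 * (2 * R)" using R by (intro mult_mono) auto
        then show ?thesis by (simp add: divide_right_mono)
      qed
      finally show ?thesis .
    qed
    have "norm (integral {- (pi * R)..-(1/2)} I + integral {1/2..pi * R} I) \<le> pi * R * B + pi * R * B"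
      using piR by (intro norm_triangle_le add_mono outer) auto
    also have "\<dots> \<le> 8 * R * B"
    proof -
      have "pi * (R * B) \<le> 4 * (R * B)" using pi_less_4 R B0 by (intro mult_right_mono) auto
      then show ?thesis by (simp add: mult_ac)
    qed
    finally have "norm (W * (integral {- (pi * R)..-(1/2)} I + integral {1/2..pi * R} I)) \<le> 3 * R / norm V * (8 * R * B)"
      unfolding norm_mult using nW R B0 by (intro mult_mono) auto
    also have "\<dots> = 24 * CB * R * (R * exp (- (\<eta> / 8) * R))" using V_nz by (simp add: B_def mult_ac)
    also have "\<dots> \<le> 24 * CB * R * (27 / (\<eta> / 8) ^ 3 / R ^ 2)"
      using CB0 R cpos by (intro mult_left_mono cube_exp_bound) auto
    also have "\<dots> = 24 * CB * (27 / (\<eta> / 8) ^ 3) / R" using R by (simp add: power2_eq_square)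
    finally show ?thesis .
  qed
  have "of_real (2 * pi * R) * c n * W - 1 = W * V2 * (J - h) + W * (integral {-(1/2)..1/2} I - V2 * J) + (W * V2 * h - 1)
     + W * (integral {- (pi * R)..-(1/2)} I + integral {1/2..pi * R} I)"
    unfolding split by (simp add: algebra_simps)
  then have "norm (of_real (2 * pi * R) * c n * W - 1) \<le> 200000 / R + 12 * C1 / R + 80000 / R + 24 * CB * (27 / (\<eta> / 8) ^ 3) / R"
    unfolding split[symmetric] by (simp only:) (intro norm_triangle_le add_mono T1 T2 T3 T4)
  then show ?thesis unfolding W_def w_def CB_def by (simp add: add_divide_distrib)
qed

end

end

section \<open>Quasi-powers\<close>

text \<open>The factor \<open>B n\<close> is unrestricted apart from being nonzero: dividing by the
  value at u = 0 removes it, and the error \<delta> then vanishes at 0.\<close>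

locale quasi_powers =
  fixes A :: "nat \<Rightarrow> 'a set" and Y :: "'a \<Rightarrow> real" and h g h1 g1 :: "complex \<Rightarrow> complex"
    and B :: "nat \<Rightarrow> complex" and \<rho> C a1 a2 b1 b2 :: real and N0 :: nat
  assumes fin: "\<And>n. finite (A n)" and ne: "\<And>n. A n \<noteq> {}"
    and pos: "\<rho> > 0" "C > 0" "a2 > 0"
    and dh: "\<And>u. norm u < \<rho> \<Longrightarrow> (h has_field_derivative h1 u) (at u)"
    and dg: "\<And>u. norm u < \<rho> \<Longrightarrow> (g has_field_derivative g1 u) (at u)"
    and h1: "h1 0 = of_real a1" "(h1 has_field_derivative of_real a2) (at 0)"
    and g1: "g1 0 = of_real b1" "(g1 has_field_derivative of_real b2) (at 0)"
    and approx: "\<And>n u. n \<ge> N0 \<Longrightarrow> norm u < \<rho> \<Longrightarrow> B n \<noteq> 0 \<and>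
      norm ((\<Sum>x\<in>A n. exp (u * of_real (Y x))) / (B n * exp (of_real (sqrt n) * h u + g u)) - 1) \<le> C / sqrt n"
begin

definition P :: "nat \<Rightarrow> complex \<Rightarrow> complex" where
  "P n u = (\<Sum>x\<in>A n. exp (u * of_real (Y x)))"

definition mean :: "nat \<Rightarrow> real" where
  "mean n = measure_pmf.expectation (pmf_of_set (A n)) Y"

definition var :: "nat \<Rightarrow> real" where
  "var n = measure_pmf.variance (pmf_of_set (A n)) Y"

definition K :: "nat \<Rightarrow> complex \<Rightarrow> complex" where
  "K n u = of_real (sqrt n) * (h u - h 0) + (g u - g 0)"

definition \<delta> :: "nat \<Rightarrow> complex \<Rightarrow> complex" where
  "\<delta> n u = P n u / of_nat (card (A n)) * exp (- K n u) - 1"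

lemma card_pos: "card (A n) > 0"
  using fin ne by (simp add: card_gt_0_iff)

lemma expectation_eq:
  fixes f :: "'a \<Rightarrow> 'b :: {banach, second_countable_topology}"
  shows "measure_pmf.expectation (pmf_of_set (A n)) f = (1 / real (card (A n))) *\<^sub>R (\<Sum>x\<in>A n. f x)"
proof -
  have "measure_pmf.expectation (pmf_of_set (A n)) f = (\<Sum>x\<in>A n. pmf (pmf_of_set (A n)) x *\<^sub>R f x)"
    by (rule integral_measure_pmf[OF fin]) (use fin ne in auto)
  also have "\<dots> = (\<Sum>x\<in>A n. (1 / real (card (A n))) *\<^sub>R f x)"
    using fin ne by (intro sum.cong refl) (simp add: pmf_of_set)
  finally show ?thesis by (simp add: scaleR_sum_right)
qed

lemma P_0: "P n 0 = of_nat (card (A n))"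
  by (simp add: P_def)

lemma transform_eq: "P n u / of_nat (card (A n)) = exp (K n u) * (1 + \<delta> n u)"
  by (simp add: \<delta>_def exp_minus)

lemma \<delta>_0: "\<delta> n 0 = 0"
  using card_pos[of n] by (simp add: \<delta>_def P_0 K_def)

text \<open>Normalizing at 0 turns two errors of size C / sqrt n into their difference over a number
  of modulus at least 1 / 2, hence 4 * C.\<close>

lemma \<delta>_bound:
  assumes "n \<ge> N0" "C / sqrt n \<le> 1 / 2" "norm u < \<rho>"
  shows "norm (\<delta> n u) \<le> 4 * C / sqrt n"
proof -
  define \<epsilon> where "\<epsilon> = (\<lambda>u. P n u / (B n * exp (of_real (sqrt n) * h u + g u)) - 1)"
  have B: "B n \<noteq> 0" using approx[OF assms(1), of 0] pos by auto
  have e: "norm (\<epsilon> v) \<le> C / sqrt n" if "norm v < \<rho>" for v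
    using approx[OF assms(1) that] by (simp add: \<epsilon>_def P_def)
  have e0: "norm (1 + \<epsilon> 0) \<ge> 1 / 2"
  proof -
    have "norm (\<epsilon> 0) \<le> 1 / 2" using order_trans[OF e[of 0] assms(2)] pos(1) by simp
    then show ?thesis using norm_diff_ineq[of 1 "\<epsilon> 0"] by simp
  qed
  then have ne0: "1 + \<epsilon> 0 \<noteq> 0" by auto
  have Pv: "P n v = (1 + \<epsilon> v) * (B n * exp (of_real (sqrt n) * h v + g v))" for v
    using B by (simp add: \<epsilon>_def)
  have "exp (- K n u) * exp (of_real (sqrt n) * h u + g u) = exp (of_real (sqrt n) * h 0 + g 0)"
    unfolding exp_add[symmetric] by (simp add: K_def algebra_simps)
  then have "P n u * exp (- K n u) = (1 + \<epsilon> u) * (B n * exp (of_real (sqrt n) * h 0 + g 0))"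
    unfolding Pv[of u] by (simp add: mult_ac)
  moreover have "of_nat (card (A n)) = (1 + \<epsilon> 0) * (B n * exp (of_real (sqrt n) * h 0 + g 0))"
    using Pv[of 0] by (simp add: P_0)
  ultimately have "\<delta> n u = (1 + \<epsilon> u) / (1 + \<epsilon> 0) - 1"
    unfolding \<delta>_def using B ne0 by simp
  also have "\<dots> = (\<epsilon> u - \<epsilon> 0) / (1 + \<epsilon> 0)" using ne0 by (simp add: field_simps)
  finally have "norm (\<delta> n u) = norm (\<epsilon> u - \<epsilon> 0) / norm (1 + \<epsilon> 0)" by (simp add: norm_divide)
  also have "\<dots> \<le> (2 * (C / sqrt n)) / (1 / 2)"
    using e[OF assms(3)] e[of 0] pos e0 norm_triangle_ineq4[of "\<epsilon> u" "\<epsilon> 0"] by (intro frac_le) auto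
  finally show ?thesis by simp
qed

lemma dK: "norm u < \<rho> \<Longrightarrow> (K n has_field_derivative (of_real (sqrt n) * h1 u + g1 u)) (at u)"
  unfolding K_def[abs_def] by (auto intro!: derivative_eq_intros dh dg)

lemma dP: "(P n has_field_derivative (\<Sum>x\<in>A n. of_real (Y x) * exp (u * of_real (Y x)))) (at u)"
  unfolding P_def[abs_def] by (auto intro!: derivative_eq_intros sum.cong)

lemma \<delta>_holo: "\<delta> n holomorphic_on ball 0 \<rho>"
proof -
  have "K n holomorphic_on ball 0 \<rho>"
    using dK by (auto simp: holomorphic_on_open intro!: exI)
  moreover have "P n holomorphic_on ball 0 \<rho>" unfolding P_def[abs_def] by (intro holomorphic_intros)
  ultimately show ?thesis
    unfolding \<delta>_def[abs_def] using card_pos[of n] by (intro holomorphic_intros) auto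
qed

lemma \<delta>_deriv_bound:
  assumes "n \<ge> N0" "C / sqrt n \<le> 1 / 2" "n > 0"
  shows "norm (deriv (\<delta> n) 0) \<le> 16 * C / \<rho> / sqrt n"
    "norm (deriv (deriv (\<delta> n)) 0) \<le> 64 * C / \<rho>\<^sup>2 / sqrt n"
proof -
  have n0: "sqrt n > 0" using assms by simp
  \<comment> \<open>Cauchy's estimate on the disc of radius \<rho> / 2. It asks for values in an
    open ball, so 8 * C takes the place of 4 * C.\<close>
  have b: "norm ((deriv ^^ j) (\<delta> n) 0) \<le> fact j * (8 * C / sqrt n) / (\<rho> / 2) ^ j" if "0 < j" for j
  proof (rule Cauchy_higher_deriv_bound[of _ _ _ 0])
    have sub: "ball (0::complex) (\<rho> / 2) \<subseteq> ball 0 \<rho>" "cball (0::complex) (\<rho> / 2) \<subseteq> ball 0 \<rho>" using pos by auto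
    show "\<delta> n holomorphic_on ball 0 (\<rho> / 2)" using holomorphic_on_subset[OF \<delta>_holo sub(1)] .
    show "continuous_on (cball 0 (\<rho> / 2)) (\<delta> n)"
      using holomorphic_on_imp_continuous_on[OF holomorphic_on_subset[OF \<delta>_holo sub(2)]] .
    fix w :: complex assume "w \<in> ball 0 (\<rho> / 2)"
    then have "norm (\<delta> n w) \<le> 4 * C / sqrt n" using pos by (intro \<delta>_bound assms(1,2)) auto
    also have "\<dots> < 8 * C / sqrt n" using pos n0 by (simp add: divide_strict_right_mono)
    finally show "\<delta> n w \<in> ball 0 (8 * C / sqrt n)" by simp
  qed (use pos that in auto)
  show "norm (deriv (\<delta> n) 0) \<le> 16 * C / \<rho> / sqrt n"
    using b[of 1] pos by (simp add: field_simps)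
  show "norm (deriv (deriv (\<delta> n)) 0) \<le> 64 * C / \<rho>\<^sup>2 / sqrt n"
    using b[of 2] pos by (simp add: numeral_2_eq_2 field_simps)
qed

text \<open>Differentiate the moment generating function exp K * (1 + \<delta>) twice at 0, where K
  and \<delta> vanish. In the variance the squares and mixed products with K' cancel, leaving K'' +
  \<delta>'' - \<delta>'^2.\<close>

lemma moments:
  "of_real (mean n) = of_real (sqrt n * a1 + b1) + deriv (\<delta> n) 0"
  "of_real (var n) = of_real (sqrt n * a2 + b2) + deriv (deriv (\<delta> n)) 0 - (deriv (\<delta> n) 0)\<^sup>2"
proof -
  define k1 where "k1 = (\<lambda>u. of_real (sqrt n) * h1 u + g1 u)"
  define d1 where "d1 = deriv (\<delta> n)"
  define cn where "cn = (of_nat (card (A n)) :: complex)"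
  have cn: "cn \<noteq> 0" using card_pos[of n] by (simp add: cn_def)
  define m1 m2 where "m1 = (\<Sum>x\<in>A n. of_real (Y x)) / cn" and "m2 = (\<Sum>x\<in>A n. of_real ((Y x)\<^sup>2)) / cn"
  have dd: "(\<delta> n has_field_derivative d1 u) (at u)" if "norm u < \<rho>" for u
    unfolding d1_def using that \<delta>_holo by (intro holomorphic_derivI[of _ "ball 0 \<rho>"]) auto
  have dd1: "(d1 has_field_derivative deriv d1 u) (at u)" if "norm u < \<rho>" for u
    unfolding d1_def using that \<delta>_holo by (intro holomorphic_derivI[of _ "ball 0 \<rho>"] holomorphic_deriv) auto
  have dk1: "(k1 has_field_derivative of_real (sqrt n * a2 + b2)) (at 0)"
    unfolding k1_def by (auto intro!: derivative_eq_intros h1(2) g1(2))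
  have k10: "k1 0 = of_real (sqrt n * a1 + b1)" by (simp add: k1_def h1 g1)
  define M where "M = (\<lambda>u. P n u / cn)"
  define M1 where "M1 = (\<lambda>u. (\<Sum>x\<in>A n. of_real (Y x) * exp (u * of_real (Y x))) / cn)"
  have dM: "(M has_field_derivative M1 u) (at u)" for u
    unfolding M_def M1_def by (intro DERIV_cdivide dP)
  have dM1: "(M1 has_field_derivative m2) (at 0)"
    unfolding M1_def m2_def by (rule DERIV_cdivide)
      (auto intro!: derivative_eq_intros sum.cong simp: power2_eq_square)
  define E1 where "E1 = (\<lambda>u. exp (K n u) * (k1 u * (1 + \<delta> n u) + d1 u))"
  have MK: "M = (\<lambda>u. exp (K n u) * (1 + \<delta> n u))" by (simp add: M_def cn_def transform_eq)
  have dMK: "(M has_field_derivative E1 u) (at u)" if "norm u < \<rho>" for u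
    unfolding MK E1_def using that
    by (auto intro!: derivative_eq_intros dK dd simp: k1_def algebra_simps)
  have M1E: "M1 u = E1 u" if "norm u < \<rho>" for u
    using DERIV_unique[OF dM dMK[OF that]] .
  have K0: "K n 0 = 0" by (simp add: K_def)
  have dK0: "(K n has_field_derivative k1 0) (at 0)" using dK[of 0 n] pos by (simp add: k1_def)
  have dE1: "(E1 has_field_derivative (k1 0 * (k1 0 + d1 0) + (of_real (sqrt n * a2 + b2) + k1 0 * d1 0 + deriv d1 0))) (at 0)"
    unfolding E1_def using pos
    by (auto intro!: derivative_eq_intros dK0 dd[of 0] dd1[of 0] dk1 simp: K0 \<delta>_0 algebra_simps)
  have "(M1 has_field_derivative (k1 0 * (k1 0 + d1 0) + (of_real (sqrt n * a2 + b2) + k1 0 * d1 0 + deriv d1 0))) (at 0)"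
  proof (rule has_field_derivative_transform_within_open[OF dE1, of "ball 0 \<rho>"])
    show "E1 u = M1 u" if "u \<in> ball 0 \<rho>" for u using M1E[of u] that by simp
  qed (use pos in auto)
  then have m2: "m2 = k1 0 * (k1 0 + d1 0) + (of_real (sqrt n * a2 + b2) + k1 0 * d1 0 + deriv d1 0)"
    using DERIV_unique[OF dM1] by blast
  have m1: "m1 = k1 0 + d1 0"
    using M1E[of 0] pos by (simp add: M1_def E1_def m1_def K0 \<delta>_0)
  have mean: "of_real (mean n) = m1"
    by (simp add: mean_def expectation_eq m1_def cn_def scaleR_conv_of_real)
  then show "of_real (mean n) = of_real (sqrt n * a1 + b1) + deriv (\<delta> n) 0"
    by (simp add: m1 k10 d1_def)
  have "var n = measure_pmf.expectation (pmf_of_set (A n)) (\<lambda>x. (Y x)\<^sup>2) - (mean n)\<^sup>2"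
    unfolding var_def mean_def
    by (rule measure_pmf.variance_eq) (auto intro!: integrable_measure_pmf_finite simp: fin ne)
  also have "of_real \<dots> = m2 - m1\<^sup>2"
    by (simp add: mean m2_def cn_def expectation_eq scaleR_conv_of_real)
  finally show "of_real (var n) = of_real (sqrt n * a2 + b2) + deriv (deriv (\<delta> n)) 0 - (deriv (\<delta> n) 0)\<^sup>2"
    by (simp add: m1 m2 k10 d1_def power2_eq_square algebra_simps)
qed

lemma eventually_good: "eventually (\<lambda>n. n \<ge> N0 \<and> C / sqrt n \<le> 1 / 2 \<and> n > 0) sequentially"
proof -
  have "(\<lambda>n. C / sqrt (real n)) \<longlonglongrightarrow> 0" by real_asymp
  then have "eventually (\<lambda>n. C / sqrt (real n) < 1 / 2) sequentially" by (rule order_tendstoD) simp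
  then show ?thesis using eventually_ge_at_top[of N0] eventually_gt_at_top[of 0] by eventually_elim auto
qed

lemma mean_asymptotics: "(\<lambda>n. mean n - (sqrt n * a1 + b1)) \<in> O(\<lambda>n. 1 / sqrt (real n))"
proof (rule bigoI[of _ "16 * C / \<rho>"])
  show "\<forall>\<^sub>F n in sequentially. norm (mean n - (sqrt n * a1 + b1)) \<le> 16 * C / \<rho> * norm (1 / sqrt (real n))"
    using eventually_good
  proof eventually_elim
    case (elim n)
    have "of_real (mean n - (sqrt n * a1 + b1)) = deriv (\<delta> n) 0" using moments(1)[of n] by simp
    then have "norm (mean n - (sqrt n * a1 + b1)) = norm (deriv (\<delta> n) 0)" by (metis norm_of_real real_norm_def)
    moreover have "norm (deriv (\<delta> n) 0) \<le> 16 * C / \<rho> / sqrt n" using elim by (intro \<delta>_deriv_bound) auto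
    ultimately show ?case by simp
  qed
qed

lemma var_asymptotics: "(\<lambda>n. var n - (sqrt n * a2 + b2)) \<in> O(\<lambda>n. 1 / sqrt (real n))"
proof (rule bigoI[of _ "64 * C / \<rho>\<^sup>2 + (16 * C / \<rho>)\<^sup>2"])
  show "\<forall>\<^sub>F n in sequentially. norm (var n - (sqrt n * a2 + b2)) \<le> (64 * C / \<rho>\<^sup>2 + (16 * C / \<rho>)\<^sup>2) * norm (1 / sqrt (real n))"
    using eventually_good
  proof eventually_elim
    case (elim n)
    have s1: "1 \<le> sqrt (real n)" using elim by simp
    have "of_real (var n - (sqrt n * a2 + b2)) = deriv (deriv (\<delta> n)) 0 - (deriv (\<delta> n) 0)\<^sup>2" using moments(2)[of n] by simp
    then have "norm (var n - (sqrt n * a2 + b2)) = norm (deriv (deriv (\<delta> n)) 0 - (deriv (\<delta> n) 0)\<^sup>2)" by (metis norm_of_real real_norm_def)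
    also have "\<dots> \<le> norm (deriv (deriv (\<delta> n)) 0) + norm (deriv (\<delta> n) 0) ^ 2"
      using norm_triangle_ineq4 by (simp add: norm_power[symmetric])
    also have "norm (deriv (\<delta> n) 0) ^ 2 \<le> (16 * C / \<rho> / sqrt n) ^ 2"
      using elim by (intro power_mono \<delta>_deriv_bound) auto
    also have "\<dots> = (16 * C / \<rho>)\<^sup>2 / (sqrt n)\<^sup>2" by (rule power_divide)
    also have "\<dots> \<le> (16 * C / \<rho>)\<^sup>2 / sqrt n"
    proof (rule divide_left_mono)
      have "sqrt n * 1 \<le> sqrt n * sqrt n" using s1 by (intro mult_left_mono) auto
      then show "sqrt n \<le> (sqrt n)\<^sup>2" by (simp add: power2_eq_square)
    qed (use elim in auto)
    moreover have "norm (deriv (deriv (\<delta> n)) 0) \<le> 64 * C / \<rho>\<^sup>2 / sqrt n" using elim by (intro \<delta>_deriv_bound) auto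
    ultimately have "norm (var n - (sqrt n * a2 + b2)) \<le> 64 * C / \<rho>\<^sup>2 / sqrt n + (16 * C / \<rho>)\<^sup>2 / sqrt n" by linarith
    then show ?case by (simp add: add_divide_distrib)
  qed
qed

text \<open>Peano form: \<open>h1\<close> minus its linear part is o(u), and the mean value bound on
  the disc of radius |u| integrates this to o(u^2).\<close>

lemma h_remainder: "((\<lambda>u. (h u - h 0 - of_real a1 * u - of_real a2 / 2 * u\<^sup>2) / u\<^sup>2) \<longlongrightarrow> 0) (at 0)"
proof (rule tendstoI)
  fix e :: real assume e: "e > 0"
  define q where "q = (\<lambda>u. h u - h 0 - of_real a1 * u - of_real a2 / 2 * u\<^sup>2)"
  have "((\<lambda>u. (h1 u - h1 0 - of_real a2 * u) / u) \<longlongrightarrow> 0) (at 0)"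
  proof -
    have "((\<lambda>u. (h1 u - h1 0) / u - of_real a2) \<longlongrightarrow> of_real a2 - of_real a2) (at 0)"
      using h1(2) by (intro tendsto_diff) (auto simp: has_field_derivative_iff)
    moreover have "eventually (\<lambda>u. (h1 u - h1 0) / u - of_real a2 = (h1 u - h1 0 - of_real a2 * u) / u) (at 0)"
      by (auto simp: eventually_at_filter diff_divide_distrib)
    ultimately show ?thesis by (simp add: tendsto_cong)
  qed
  then have "eventually (\<lambda>u. dist ((h1 u - h1 0 - of_real a2 * u) / u) 0 < e / 2) (at 0)"
    using e by (intro tendstoD) auto
  then obtain d where d: "d > 0" "\<And>u. u \<noteq> 0 \<Longrightarrow> norm u < d \<Longrightarrow> norm ((h1 u - h1 0 - of_real a2 * u) / u) < e / 2"
    by (auto simp: eventually_at)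
  have dq: "(q has_field_derivative (h1 u - h1 0 - of_real a2 * u)) (at u)" if "norm u < \<rho>" for u
    unfolding q_def using that by (auto intro!: derivative_eq_intros dh simp: h1)
  have "norm (q u / u\<^sup>2) < e" if u: "u \<noteq> 0" "norm u < min d \<rho>" for u
  proof -
    have "norm (q u - q 0) \<le> (e / 2 * norm u) * norm (u - 0)"
    proof (rule field_differentiable_bound[of "cball 0 (norm u)"])
      fix v assume v: "v \<in> cball (0::complex) (norm u)"
      show "(q has_field_derivative (h1 v - h1 0 - of_real a2 * v)) (at v within cball 0 (norm u))"
        using v u by (intro has_field_derivative_at_within[OF dq]) auto
      show "norm (h1 v - h1 0 - of_real a2 * v) \<le> e / 2 * norm u"
      proof (cases "v = 0")
        case False
        then have "norm ((h1 v - h1 0 - of_real a2 * v) / v) < e / 2" using v u by (intro d(2)) auto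
        then have "norm (h1 v - h1 0 - of_real a2 * v) \<le> e / 2 * norm v" using False by (simp add: norm_divide field_simps)
        also have "\<dots> \<le> e / 2 * norm u" using v e by (intro mult_left_mono) auto
        finally show ?thesis .
      qed (use e in auto)
    qed auto
    then have "norm (q u) \<le> e / 2 * (norm u)\<^sup>2" by (simp add: q_def power2_eq_square)
    then have "norm (q u / u\<^sup>2) \<le> e / 2" using u by (simp add: norm_divide norm_power divide_le_eq)
    then show ?thesis using e by simp
  qed
  then have "\<forall>\<^sub>F u in at 0. norm (q u / u\<^sup>2) < e"
    using d(1) pos(1) unfolding eventually_at by (intro exI[of _ "min d \<rho>"]) auto
  then show "\<forall>\<^sub>F u in at 0. dist ((h u - h 0 - of_real a1 * u - of_real a2 / 2 * u\<^sup>2) / u\<^sup>2) 0 < e"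
    unfolding q_def by (simp only: dist_norm diff_0_right)
qed

lemma var_over_sqrt: "(\<lambda>n. var n / sqrt (real n)) \<longlonglongrightarrow> a2"
proof -
  have s: "(\<lambda>n. 1 / sqrt (real n)) \<in> o(\<lambda>n. 1 :: real)" by real_asymp
  have "(\<lambda>n. var n - (sqrt n * a2 + b2)) \<longlonglongrightarrow> 0"
    using smalloD_tendsto[OF landau_o.big_small_trans[OF var_asymptotics s]] by simp
  moreover have "(\<lambda>n. 1 / sqrt (real n)) \<longlonglongrightarrow> 0" by real_asymp
  ultimately have "(\<lambda>n. (var n - (sqrt n * a2 + b2)) * (1 / sqrt (real n)) + a2 + b2 * (1 / sqrt (real n))) \<longlonglongrightarrow> 0 * 0 + a2 + b2 * 0"
    by (intro tendsto_intros)
  moreover have "eventually (\<lambda>n. (var n - (sqrt n * a2 + b2)) * (1 / sqrt (real n)) + a2 + b2 * (1 / sqrt (real n)) = var n / sqrt n) sequentially"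
    using eventually_gt_at_top[of 0] by eventually_elim (simp add: field_simps)
  ultimately show ?thesis by (simp add: tendsto_cong)
qed

text \<open>The characteristic function at v is the transform at u = i * v / \<sigma>, centred at
  the mean. As \<sigma>^2 grows like a2 * sqrt n, sqrt n * u^2 tends to - v^2 / a2, and the
  quadratic term of h gives - v^2 / 2. The linear term cancels the mean up to a bounded amount times
  u, which vanishes.\<close>

theorem normal_limit:
  "weak_conv_m (\<lambda>n. distr (measure_pmf (pmf_of_set (A n))) borel (\<lambda>x. (Y x - mean n) / sqrt (var n))) std_normal_distribution"
proof (rule levy_continuity)
  show "real_distribution (distr (measure_pmf (pmf_of_set (A n))) borel (\<lambda>x. (Y x - mean n) / sqrt (var n)))" for n
    by (rule prob_space.real_distribution_distr[OF prob_space_measure_pmf]) simp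
  show "real_distribution std_normal_distribution" by (rule real_dist_normal_dist)
  fix v :: real
  define \<sigma> where "\<sigma> = (\<lambda>n. sqrt (var n))"
  define u where "u = (\<lambda>n. \<i> * of_real (v / \<sigma> n))"
  have char: "char (distr (measure_pmf (pmf_of_set (A n))) borel (\<lambda>x. (Y x - mean n) / sqrt (var n))) v =
     exp (K n (u n) - u n * of_real (mean n)) * (1 + \<delta> n (u n))" for n
  proof -
    have "char (distr (measure_pmf (pmf_of_set (A n))) borel (\<lambda>x. (Y x - mean n) / sqrt (var n))) v =
       measure_pmf.expectation (pmf_of_set (A n)) (\<lambda>x. iexp (v * ((Y x - mean n) / sqrt (var n))))"
      unfolding char_def by (subst integral_distr) auto
    also have "\<dots> = (1 / real (card (A n))) *\<^sub>R (\<Sum>x\<in>A n. iexp (v * ((Y x - mean n) / sqrt (var n))))"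
      by (rule expectation_eq)
    also have "(\<lambda>x. iexp (v * ((Y x - mean n) / sqrt (var n)))) = (\<lambda>x. exp (- u n * of_real (mean n)) * exp (u n * of_real (Y x)))"
      unfolding exp_add[symmetric] u_def \<sigma>_def by (auto simp: fun_eq_iff diff_divide_distrib algebra_simps)
    also have "(1 / real (card (A n))) *\<^sub>R (\<Sum>x\<in>A n. exp (- u n * of_real (mean n)) * exp (u n * of_real (Y x))) =
       exp (- u n * of_real (mean n)) * (P n (u n) / of_nat (card (A n)))"
      by (simp add: P_def sum_distrib_left[symmetric] scaleR_conv_of_real)
    also have "\<dots> = exp (- u n * of_real (mean n)) * exp (K n (u n)) * (1 + \<delta> n (u n))" unfolding transform_eq by simp
    also have "exp (- u n * of_real (mean n)) * exp (K n (u n)) = exp (K n (u n) - u n * of_real (mean n))"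
      unfolding exp_add[symmetric] by simp
    finally show ?thesis .
  qed
  have sq: "filterlim (\<lambda>n. sqrt (real n)) at_top sequentially" by real_asymp
  have vpos: "eventually (\<lambda>n. var n > 0 \<and> n > 0) sequentially"
    using order_tendstoD(1)[OF var_over_sqrt pos(3)] eventually_gt_at_top[of 0]
    by eventually_elim (auto simp: zero_less_divide_iff)
  have inv: "(\<lambda>n. sqrt (real n) / var n) \<longlonglongrightarrow> 1 / a2"
    using tendsto_divide[OF tendsto_const[of 1] var_over_sqrt] pos by simp
  have u2: "(\<lambda>n. of_real (sqrt n) * (u n)\<^sup>2) \<longlonglongrightarrow> of_real (- (v\<^sup>2) / a2)"
  proof -
    have "(\<lambda>n. of_real (- (v\<^sup>2) * (sqrt (real n) / var n)) :: complex) \<longlonglongrightarrow> of_real (- (v\<^sup>2) * (1 / a2))"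
      by (intro tendsto_of_real tendsto_mult tendsto_const inv)
    moreover have "eventually (\<lambda>n. of_real (- (v\<^sup>2) * (sqrt (real n) / var n)) = of_real (sqrt n) * (u n)\<^sup>2) sequentially"
      using vpos by eventually_elim (simp add: u_def \<sigma>_def power_mult_distrib power_divide flip: of_real_power)
    ultimately show ?thesis by (simp add: tendsto_cong)
  qed
  have u0: "u \<longlonglongrightarrow> 0"
  proof -
    have "(\<lambda>n. sqrt (real n) / var n * (1 / sqrt (real n))) \<longlonglongrightarrow> 1 / a2 * 0"
      by (intro tendsto_mult inv) real_asymp
    moreover have "eventually (\<lambda>n. sqrt (real n) / var n * (1 / sqrt (real n)) = 1 / var n) sequentially"
      using vpos by eventually_elim simp
    ultimately have "(\<lambda>n. 1 / var n) \<longlonglongrightarrow> 0" by (simp add: tendsto_cong)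
    then have "(\<lambda>n. sqrt (1 / var n)) \<longlonglongrightarrow> sqrt 0" by (rule tendsto_real_sqrt)
    then have "(\<lambda>n. \<i> * of_real (v * sqrt (1 / var n))) \<longlonglongrightarrow> \<i> * of_real (v * 0)"
      by (intro tendsto_intros) simp
    then show ?thesis by (simp add: u_def \<sigma>_def real_sqrt_divide)
  qed
  have q0: "(\<lambda>n. of_real (sqrt n) * (h (u n) - h 0 - of_real a1 * u n - of_real a2 / 2 * (u n)\<^sup>2)) \<longlonglongrightarrow> 0"
  proof -
    define q where "q = (\<lambda>u. if u = 0 then 0 else (h u - h 0 - of_real a1 * u - of_real a2 / 2 * u\<^sup>2) / u\<^sup>2)"
    have "(q \<longlongrightarrow> q 0) (at 0)"
      using h_remainder unfolding q_def by (auto intro: Lim_transform_eventually simp: eventually_at_filter)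
    then have "isCont q 0" by (simp add: isCont_def)
    then have "(\<lambda>n. q (u n)) \<longlonglongrightarrow> q 0" using u0 by (rule isCont_tendsto_compose)
    then have "(\<lambda>n. of_real (sqrt n) * (u n)\<^sup>2 * q (u n)) \<longlonglongrightarrow> of_real (- (v\<^sup>2) / a2) * q 0"
      by (intro tendsto_mult u2)
    moreover have eq: "of_real (sqrt n) * (u n)\<^sup>2 * q (u n) = of_real (sqrt n) * (h (u n) - h 0 - of_real a1 * u n - of_real a2 / 2 * (u n)\<^sup>2)" for n
      by (simp add: q_def)
    moreover have "q 0 = 0" by (simp add: q_def)
    ultimately show ?thesis by (simp only: eq mult_zero_right)
  qed
  have gl: "(\<lambda>n. g (u n) - g 0) \<longlonglongrightarrow> 0"
  proof -
    have "isCont g 0" using dg[of 0] pos by (auto intro: DERIV_isCont)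
    then have "(\<lambda>n. g (u n)) \<longlonglongrightarrow> g 0" using u0 by (rule isCont_tendsto_compose)
    then show ?thesis by (simp add: LIM_zero)
  qed
  have ml: "(\<lambda>n. u n * of_real (mean n - sqrt n * a1)) \<longlonglongrightarrow> 0"
  proof -
    have s: "(\<lambda>n. 1 / sqrt (real n)) \<in> o(\<lambda>n. 1 :: real)" by real_asymp
    have "(\<lambda>n. mean n - (sqrt n * a1 + b1)) \<longlonglongrightarrow> 0"
      using smalloD_tendsto[OF landau_o.big_small_trans[OF mean_asymptotics s]] by simp
    then have "(\<lambda>n. u n * of_real ((mean n - (sqrt n * a1 + b1)) + b1)) \<longlonglongrightarrow> 0 * of_real (0 + b1)"
      by (intro tendsto_intros u0)
    then show ?thesis by (simp add: algebra_simps)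
  qed
  have dl: "(\<lambda>n. \<delta> n (u n)) \<longlonglongrightarrow> 0"
  proof (rule Lim_null_comparison)
    have "eventually (\<lambda>n. norm (u n) < \<rho>) sequentially"
      using order_tendstoD(2)[OF tendsto_norm_zero[OF u0] pos(1)] .
    then show "\<forall>\<^sub>F n in sequentially. norm (\<delta> n (u n)) \<le> 4 * C / sqrt n"
      using eventually_good by eventually_elim (intro \<delta>_bound, auto)
    show "(\<lambda>n. 4 * C / sqrt (real n)) \<longlonglongrightarrow> 0" by real_asymp
  qed
  have L: "(\<lambda>n. of_real (sqrt n) * (h (u n) - h 0 - of_real a1 * u n - of_real a2 / 2 * (u n)\<^sup>2)
      + of_real a2 / 2 * (of_real (sqrt n) * (u n)\<^sup>2) + (g (u n) - g 0) - u n * of_real (mean n - sqrt n * a1)) \<longlonglongrightarrow>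
      0 + of_real a2 / 2 * of_real (- (v\<^sup>2) / a2) + 0 - 0"
    by (intro tendsto_add tendsto_diff tendsto_mult tendsto_const q0 u2 gl ml)
  have eqK: "of_real (sqrt n) * (h (u n) - h 0 - of_real a1 * u n - of_real a2 / 2 * (u n)\<^sup>2)
      + of_real a2 / 2 * (of_real (sqrt n) * (u n)\<^sup>2) + (g (u n) - g 0) - u n * of_real (mean n - sqrt n * a1) = K n (u n) - u n * of_real (mean n)" for n
    by (simp add: K_def algebra_simps)
  have val: "0 + of_real a2 / 2 * of_real (- (v\<^sup>2) / a2) + 0 - 0 = (of_real (- (v\<^sup>2) / 2) :: complex)"
    using pos by (simp add: field_simps)
  have "(\<lambda>n. exp (K n (u n) - u n * of_real (mean n)) * (1 + \<delta> n (u n))) \<longlonglongrightarrow> exp (of_real (- (v\<^sup>2) / 2)) * (1 + 0)"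
    by (intro tendsto_intros dl L[unfolded eqK val])
  also have "exp (of_real (- (v\<^sup>2) / 2)) * (1 + 0) = char std_normal_distribution v"
    unfolding char_std_normal_distribution exp_of_real[symmetric] by simp
  finally show "(\<lambda>n. char (distr (measure_pmf (pmf_of_set (A n))) borel (\<lambda>x. (Y x - mean n) / sqrt (var n))) v) \<longlonglongrightarrow> char std_normal_distribution v"
    unfolding char .
qed

end

section \<open>Hooks of doubled distinct partitions\<close>

lemma down_closed_eq_lessThan:
  fixes A :: "nat set"
  assumes "finite A" "\<And>a b. a \<in> A \<Longrightarrow> b \<le> a \<Longrightarrow> b \<in> A"
  shows "A = {..<card A}"
proof -
  obtain m where m: "A = {..<m}"
  proof (cases "A = {}")
    case True then show ?thesis using that[of 0] by simp
  next
    case False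
    then have "b \<in> A" if "b \<le> Max A" for b using assms(2)[OF Max_in[OF assms(1)] that] by simp
    then have "A = {..<Suc (Max A)}" using assms(1) by (auto simp: less_Suc_eq_le)
    then show ?thesis using that by blast
  qed
  then show ?thesis by simp
qed

lemma partition_of_diagram:
  assumes fin: "finite D" and down: "\<And>i j i' j'. (i, j) \<in> D \<Longrightarrow> i' \<le> i \<Longrightarrow> j' \<le> j \<Longrightarrow> (i', j') \<in> D"
  shows "\<exists>\<mu>. is_partition \<mu> \<and> young_diagram \<mu> = D"
proof -
  define row where "row = (\<lambda>i. card {j. (i, j) \<in> D})"
  define L where "L = card {i. (i, 0) \<in> D}"
  have f1: "finite {j. (i, j) \<in> D}" for i
    by (rule finite_subset[OF _ finite_imageI[OF fin, of snd]]) force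
  have f2: "finite {i. (i, 0) \<in> D}"
    by (rule finite_subset[OF _ finite_imageI[OF fin, of fst]]) force
  have r: "{j. (i, j) \<in> D} = {..<row i}" for i
    unfolding row_def by (rule down_closed_eq_lessThan[OF f1]) (use down in blast)
  have l: "{i. (i, 0) \<in> D} = {..<L}"
    unfolding L_def by (rule down_closed_eq_lessThan[OF f2]) (use down in blast)
  have mem: "(i, j) \<in> D \<longleftrightarrow> j < row i" for i j using r[of i] by blast
  have mem0: "0 < row i \<longleftrightarrow> i < L" for i using l mem[of i 0] by blast
  have anti: "row i' \<le> row i" if "i \<le> i'" for i i'
  proof (rule ccontr)
    assume "\<not> row i' \<le> row i"
    then have "(i', row i) \<in> D" by (simp add: mem)
    then have "(i, row i) \<in> D" using down that by blast
    then show False by (simp add: mem)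
  qed
  define \<mu> where "\<mu> = map row [0..<L]"
  have "is_partition \<mu>"
    unfolding is_partition_def \<mu>_def by (auto simp: sorted_wrt_iff_nth_less anti mem0)
  moreover have "young_diagram \<mu> = D"
  proof -
    have "i < L \<and> j < row i \<longleftrightarrow> (i, j) \<in> D" for i j
      using mem0[of i] by (auto simp: mem)
    moreover have "(i, j) \<in> young_diagram \<mu> \<longleftrightarrow> i < L \<and> j < row i" for i j
      by (auto simp: young_diagram_def \<mu>_def)
    ultimately show ?thesis by (intro set_eqI) (simp only: split_paired_all)
  qed
  ultimately show ?thesis by blast
qed

lemma young_diagram_inject:
  assumes "is_partition \<mu>" "is_partition \<mu>'" "young_diagram \<mu> = young_diagram \<mu>'"
  shows "\<mu> = \<mu>'"
proof (rule nth_equalityI)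
  have e: "i < length \<mu> \<and> j < \<mu> ! i \<longleftrightarrow> i < length \<mu>' \<and> j < \<mu>' ! i" for i j
    using assms(3) unfolding young_diagram_def by blast
  have p: "i < length \<mu> \<Longrightarrow> 0 < \<mu> ! i" "i < length \<mu>' \<Longrightarrow> 0 < \<mu>' ! i" for i
    using assms(1,2) by (auto simp: is_partition_def)
  have "i < length \<mu> \<longleftrightarrow> i < length \<mu>'" for i using e[of i 0] p[of i] by blast
  then show len: "length \<mu> = length \<mu>'" by (metis linorder_neqE_nat nat_neq_iff)
  fix i assume i: "i < length \<mu>"
  have "j < \<mu> ! i \<longleftrightarrow> j < \<mu>' ! i" for j using e[of i j] i len by simp
  then show "\<mu> ! i = \<mu>' ! i" by (metis nat_neq_iff)
qed

lemma card_young_diagram: "card (young_diagram \<mu>) = sum_list \<mu>"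
proof -
  have "young_diagram \<mu> = (SIGMA i:{..<length \<mu>}. {..<\<mu> ! i})" by (auto simp: young_diagram_def)
  then show ?thesis by (simp add: sum_list_sum_nth atLeast0LessThan)
qed

text \<open>In terms of the Maya diagram: the row numbers \<open>X i = row i - i - 1\<close> and the column numbers
  \<open>Y j = j - col j\<close> partition the integers, and the hook length of the box \<open>(i, j)\<close> is \<open>X i - Y j\<close>.\<close>

locale maya =
  fixes \<mu> :: "nat list" and row col :: "nat \<Rightarrow> nat"
  assumes row: "\<And>i j. (i, j) \<in> young_diagram \<mu> \<longleftrightarrow> j < row i"
    and col: "\<And>i j. (i, j) \<in> young_diagram \<mu> \<longleftrightarrow> i < col j"
begin

definition X :: "nat \<Rightarrow> int" where "X i = int (row i) - int i - 1"
definition Y :: "nat \<Rightarrow> int" where "Y j = int j - int (col j)"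

lemma rc: "j < row i \<longleftrightarrow> i < col j"
  using row col by blast

lemma box_iff: "(i, j) \<in> young_diagram \<mu> \<longleftrightarrow> Y j < X i" and XY: "X i \<noteq> Y j"
proof -
  have "Y j < X i" if "j < row i" using that rc[of j i] by (simp add: X_def Y_def)
  moreover have "X i < Y j" if "\<not> j < row i" using that rc[of j i] by (simp add: X_def Y_def)
  ultimately show "(i, j) \<in> young_diagram \<mu> \<longleftrightarrow> Y j < X i" "X i \<noteq> Y j"
    unfolding row by force+
qed

lemma row_mono: "i \<le> i' \<Longrightarrow> row i' \<le> row i"
  using rc by (meson le_less_trans linorder_not_le less_irrefl)

lemma col_mono: "j \<le> j' \<Longrightarrow> col j' \<le> col j"
  using rc by (meson le_less_trans linorder_not_le less_irrefl)

lemma inj_X: "inj X"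
proof (rule linorder_injI)
  show "X i \<noteq> X i'" if "i < i'" for i i' using row_mono[of i i'] that by (simp add: X_def)
qed

lemma inj_Y: "inj Y"
proof (rule linorder_injI)
  show "Y j \<noteq> Y j'" if "j < j'" for j j' using col_mono[of j j'] that by (simp add: Y_def)
qed

text \<open>Counting: the first N row numbers and the first N column numbers are 2 * N different
  integers in a window of 2 * N integers, which they therefore fill.\<close>

lemma XY_cover: "m \<in> range X \<or> m \<in> range Y"
proof -
  define N where "N = nat \<bar>m\<bar> + row 0 + col 0 + 1"
  have "X i \<in> {- int N..<int N}" if "i < N" for i
    using that row_mono[of 0 i] by (auto simp: X_def N_def)
  moreover have "Y j \<in> {- int N..<int N}" if "j < N" for j
    using that col_mono[of 0 j] by (auto simp: Y_def N_def)
  ultimately have sub: "X ` {..<N} \<union> Y ` {..<N} \<subseteq> {- int N..<int N}" by blast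
  have "card (X ` {..<N} \<union> Y ` {..<N}) = card (X ` {..<N}) + card (Y ` {..<N})"
    using XY by (intro card_Un_disjoint) auto
  also have "\<dots> = N + N"
    by (simp add: card_image inj_on_subset[OF inj_X] inj_on_subset[OF inj_Y])
  finally have "card (X ` {..<N} \<union> Y ` {..<N}) = card {- int N..<int N}" by simp
  then have "X ` {..<N} \<union> Y ` {..<N} = {- int N..<int N}" by (intro card_subset_eq sub) auto
  moreover have "m \<in> {- int N..<int N}" by (auto simp: N_def)
  ultimately show ?thesis by blast
qed

lemma card_hook:
  assumes "(i, j) \<in> young_diagram \<mu>"
  shows "int (card (hook \<mu> (i, j))) = X i - Y j"
proof -
  have ij: "j < row i" "i < col j" using assms row col by auto
  have "hook \<mu> (i, j) = {i} \<times> {j..<row i} \<union> {i<..<col j} \<times> {j}"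
    unfolding hook_def using row col ij by (auto simp: less_le)
  also have "card \<dots> = card ({i} \<times> {j..<row i}) + card ({i<..<col j} \<times> {j})"
    by (intro card_Un_disjoint) auto
  finally show ?thesis using ij by (simp add: card_cartesian_product X_def Y_def)
qed

text \<open>A box with hook length t is determined by its row number, since its column number is
  smaller by exactly t.\<close>

lemma n_hooks_eq:
  assumes "t > 0"
  shows "n_hooks t \<mu> = card {a \<in> range X. a - int t \<in> range Y}"
proof -
  have "bij_betw (\<lambda>(i, j). X i) {b \<in> young_diagram \<mu>. card (hook \<mu> b) = t} {a \<in> range X. a - int t \<in> range Y}"
  proof (rule bij_betwI')
    fix b b' assume b: "b \<in> {b \<in> young_diagram \<mu>. card (hook \<mu> b) = t}" "b' \<in> {b \<in> young_diagram \<mu>. card (hook \<mu> b) = t}"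
    obtain i j i' j' where [simp]: "b = (i, j)" "b' = (i', j')" by (metis surj_pair)
    have "X i - Y j = int t" "X i' - Y j' = int t" using b card_hook[of i j] card_hook[of i' j'] by auto
    then have "X i = X i' \<Longrightarrow> Y j = Y j'" by linarith
    then have "X i = X i' \<longleftrightarrow> i = i' \<and> j = j'" using injD[OF inj_X] injD[OF inj_Y] by blast
    then show "((case b of (i, j) \<Rightarrow> X i) = (case b' of (i, j) \<Rightarrow> X i)) = (b = b')" by simp
  next
    fix b assume b: "b \<in> {b \<in> young_diagram \<mu>. card (hook \<mu> b) = t}"
    obtain i j where [simp]: "b = (i, j)" by (metis surj_pair)
    have "X i - int t = Y j" using b card_hook[of i j] by auto
    then show "(case b of (i, j) \<Rightarrow> X i) \<in> {a \<in> range X. a - int t \<in> range Y}" by auto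
  next
    fix a assume "a \<in> {a \<in> range X. a - int t \<in> range Y}"
    then obtain i j where ij: "a = X i" "X i - int t = Y j" by auto
    then have box: "(i, j) \<in> young_diagram \<mu>" using box_iff assms by simp
    then have "int (card (hook \<mu> (i, j))) = int t" using card_hook ij by simp
    then show "\<exists>b\<in>{b \<in> young_diagram \<mu>. card (hook \<mu> b) = t}. a = (case b of (i, j) \<Rightarrow> X i)"
      using box ij by (intro bexI[of _ "(i, j)"]) auto
  qed
  then show ?thesis unfolding n_hooks_def by (rule bij_betw_same_card)
qed

text \<open>The hypotheses say that the Maya diagram is antisymmetric apart from 0, which is a
  column number. A move from a to a - t staying negative and one staying positive both give the
  first set of \<open>hookN\<close>, hence its factor 2; a move onto 0 gives t in S, and a move from
  some a >= 0 to a negative number pairs a with t - a.\<close>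

lemma n_hooks_eq_hookN:
  assumes t: "t > 0" and S: "finite S" "0 \<notin> S"
    and X: "\<And>a. int a \<in> range X \<longleftrightarrow> a \<in> S" and Y: "\<And>b. b > 0 \<Longrightarrow> - int b \<in> range Y \<longleftrightarrow> b \<in> S"
  shows "n_hooks t \<mu> = hookN t S"
proof -
  have XorY: "a \<in> range Y \<longleftrightarrow> a \<notin> range X" for a using XY XY_cover[of a] by auto
  define A1 where "A1 = {i. 1 \<le> i \<and> i \<notin> S \<and> i + t \<in> S}"
  define A2 where "A2 = {a \<in> S. a < t \<and> t - a \<in> S}"
  define T where "T = (if t \<in> S then {int t} else {})"
  have fin: "finite A1" "finite A2"
    unfolding A1_def A2_def using S finite_shift[OF S(1), of "\<lambda>i. 1 \<le> i \<and> i \<notin> S" t] by auto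
  have "{a \<in> range X. a - int t \<in> range Y} = (\<lambda>b. - int b) ` A1 \<union> ((\<lambda>b. int (b + t)) ` A1 \<union> (T \<union> int ` A2))"
  proof (rule set_eqI)
    fix a :: int
    consider b where "a = - int b" "b > 0" | c where "a = int c" "c < t" | c where "a = int c" "c = t" | c where "a = int (c + t)" "c > 0"
    proof (cases "a < 0")
      case True then show ?thesis using that(1)[of "nat (- a)"] by simp
    next
      case False
      then obtain c where c: "a = int c" by (metis nonneg_int_cases not_le)
      then show ?thesis using that(2)[of c] that(3)[of c] that(4)[of "c - t"] by (cases c t rule: linorder_cases) auto
    qed
    then show "a \<in> {a \<in> range X. a - int t \<in> range Y} \<longleftrightarrow> a \<in> (\<lambda>b. - int b) ` A1 \<union> ((\<lambda>b. int (b + t)) ` A1 \<union> (T \<union> int ` A2))"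
    proof cases
      case 1
      have "- int b \<in> range X \<longleftrightarrow> b \<notin> S" using XorY[of "- int b"] Y[OF 1(2)] by blast
      moreover have "- int b - int t \<in> range Y \<longleftrightarrow> b + t \<in> S"
        using Y[of "b + t"] 1(2) by (simp only: of_nat_add minus_add_distrib diff_conv_add_uminus add_pos_nonneg)
      ultimately have "a \<in> {a \<in> range X. a - int t \<in> range Y} \<longleftrightarrow> b \<in> A1"
        using 1 by (simp only: mem_Collect_eq A1_def) auto
      moreover have "- int b \<noteq> int (b' + t)" "- int b \<notin> T" "- int b \<notin> int ` A2" for b'
        using 1 t by (auto simp: T_def)
      then have "a \<in> (\<lambda>b. - int b) ` A1 \<union> ((\<lambda>b. int (b + t)) ` A1 \<union> (T \<union> int ` A2)) \<longleftrightarrow> b \<in> A1"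
        unfolding 1(1) by (simp only: Un_iff image_iff) auto
      ultimately show ?thesis by blast
    next
      case 2
      have "- int (t - c) = int c - int t" using 2 by simp
      then have "int c - int t \<in> range Y \<longleftrightarrow> t - c \<in> S" using Y[of "t - c"] 2(2) by simp
      then have "a \<in> {a \<in> range X. a - int t \<in> range Y} \<longleftrightarrow> c \<in> A2"
        unfolding 2(1) mem_Collect_eq X A2_def using 2(2) by blast
      moreover have "int c \<notin> (\<lambda>b. - int b) ` A1" "int c \<notin> (\<lambda>b. int (b + t)) ` A1" "int c \<notin> T"
        using 2(2) by (auto simp: A1_def T_def)
      ultimately show ?thesis unfolding 2(1) by (simp only: Un_iff image_iff) auto
    next
      case 3
      have "0 \<in> range Y" using XorY[of 0] X[of 0] S by simp
      then have "a \<in> {a \<in> range X. a - int t \<in> range Y} \<longleftrightarrow> t \<in> S"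
        unfolding 3 mem_Collect_eq X by simp
      moreover have "int t \<notin> (\<lambda>b. - int b) ` A1" "int t \<notin> (\<lambda>b. int (b + t)) ` A1" "int t \<notin> int ` A2"
        using t by (auto simp: A1_def A2_def)
      ultimately show ?thesis unfolding 3 by (auto simp: T_def)
    next
      case 4
      have "int (c + t) - int t = int c" by simp
      then have "a \<in> {a \<in> range X. a - int t \<in> range Y} \<longleftrightarrow> c + t \<in> S \<and> c \<notin> S"
        unfolding 4(1) mem_Collect_eq X using X[of c] XorY[of "int c"] by (simp only:)
      then have "a \<in> {a \<in> range X. a - int t \<in> range Y} \<longleftrightarrow> c \<in> A1"
        unfolding A1_def mem_Collect_eq using 4(2) by (simp only: Suc_le_eq One_nat_def) blast
      moreover have "int (c + t) \<notin> (\<lambda>b. - int b) ` A1" "int (c + t) \<notin> T" "int (c + t) \<notin> int ` A2"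
        using 4(2) t by (auto simp: A2_def T_def)
      ultimately show ?thesis unfolding 4(1) by (simp only: Un_iff image_iff) auto
    qed
  qed
  moreover have "card ((\<lambda>b. - int b) ` A1 \<union> ((\<lambda>b. int (b + t)) ` A1 \<union> (T \<union> int ` A2))) = card A1 + (card A1 + (card T + card A2))"
  proof -
    have c: "card ((\<lambda>b. - int b) ` A1) = card A1" "card ((\<lambda>b. int (b + t)) ` A1) = card A1" "card (int ` A2) = card A2"
      by (intro card_image; simp add: inj_on_def)+
    have "card (T \<union> int ` A2) = card T + card (int ` A2)"
      using fin by (intro card_Un_disjoint) (auto simp: T_def A2_def)
    moreover have "card ((\<lambda>b. int (b + t)) ` A1 \<union> (T \<union> int ` A2)) = card ((\<lambda>b. int (b + t)) ` A1) + card (T \<union> int ` A2)"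
      using fin by (intro card_Un_disjoint) (auto simp: T_def A2_def A1_def)
    moreover have "card ((\<lambda>b. - int b) ` A1 \<union> ((\<lambda>b. int (b + t)) ` A1 \<union> (T \<union> int ` A2))) = card ((\<lambda>b. - int b) ` A1) + card ((\<lambda>b. int (b + t)) ` A1 \<union> (T \<union> int ` A2))"
      using fin t by (intro card_Un_disjoint) (auto simp: T_def A2_def A1_def)
    ultimately show ?thesis by (simp only: c)
  qed
  ultimately show ?thesis
    unfolding n_hooks_eq[OF t] hookN_def A1_def[symmetric] A2_def[symmetric] by (simp add: T_def)
qed

end

section \<open>Rows and columns of the double of a strict partition\<close>

context
  fixes \<nu> :: "nat list"
  assumes strict: "is_strict_partition \<nu>"
begin

text \<open>Strictness enters the geometry only here: strictly decreasing parts make the row ends i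
  + \<nu> ! i weakly decreasing.\<close>

lemma strict_nth:
  "i < length \<nu> \<Longrightarrow> 0 < \<nu> ! i"
  "i \<le> j \<Longrightarrow> j < length \<nu> \<Longrightarrow> j + \<nu> ! j \<le> i + \<nu> ! i"
proof -
  show pos: "0 < \<nu> ! i" if "i < length \<nu>" for i
    using strict that by (auto simp: is_strict_partition_def is_partition_def)
  have dec: "\<nu> ! (Suc i) < \<nu> ! i" if "Suc i < length \<nu>" for i
  proof -
    have "\<nu> ! i \<ge> \<nu> ! (Suc i)" "\<nu> ! i \<noteq> \<nu> ! (Suc i)"
      using strict that by (auto simp: is_strict_partition_def is_partition_def sorted_wrt_iff_nth_less nth_eq_iff_index_eq)
    then show ?thesis by simp
  qed
  show "j + \<nu> ! j \<le> i + \<nu> ! i" if "i \<le> j" "j < length \<nu>" for i j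
    using that
  proof (induction j rule: dec_induct)
    case (step m)
    then show ?case using dec[of m] by simp
  qed simp
qed

text \<open>The two defining pieces give only one side of the diagonal each; monotone row ends fill
  in the rest, so rows and columns can be read off without case distinctions on the
  diagonal.\<close>

lemma doubling_diagram:
  "(i, j) \<in> shifted_diagram \<nu> \<union> added_boxes \<nu> \<longleftrightarrow>
     (i < length \<nu> \<and> j \<le> i + \<nu> ! i) \<or> (j < length \<nu> \<and> i < j + \<nu> ! j)"
proof
  assume "(i, j) \<in> shifted_diagram \<nu> \<union> added_boxes \<nu>"
  then show "(i < length \<nu> \<and> j \<le> i + \<nu> ! i) \<or> (j < length \<nu> \<and> i < j + \<nu> ! j)"
    by (auto simp: shifted_diagram_def added_boxes_def)
next
  assume "(i < length \<nu> \<and> j \<le> i + \<nu> ! i) \<or> (j < length \<nu> \<and> i < j + \<nu> ! j)"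
  then show "(i, j) \<in> shifted_diagram \<nu> \<union> added_boxes \<nu>"
  proof
    assume a: "i < length \<nu> \<and> j \<le> i + \<nu> ! i"
    show ?thesis
    proof (cases "i < j")
      case True then show ?thesis using a by (simp add: shifted_diagram_def)
    next
      case False
      then have "i + \<nu> ! i \<le> j + \<nu> ! j" "0 < \<nu> ! i" using strict_nth a by auto
      then show ?thesis using a False by (simp add: added_boxes_def)
    qed
  next
    assume a: "j < length \<nu> \<and> i < j + \<nu> ! j"
    show ?thesis
    proof (cases "i < j")
      case False then show ?thesis using a by (simp add: added_boxes_def)
    next
      case True
      then have "j + \<nu> ! j \<le> i + \<nu> ! i" "0 < \<nu> ! j" using strict_nth a by auto
      then show ?thesis using a True by (simp add: shifted_diagram_def)
    qed
  qed
qed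

lemma doubling_row:
  "i < length \<nu> \<Longrightarrow> (i, j) \<in> shifted_diagram \<nu> \<union> added_boxes \<nu> \<longleftrightarrow> j < i + \<nu> ! i + 1"
  unfolding doubling_diagram using strict_nth(2)[of i j] by fastforce

lemma doubling_col:
  "j < length \<nu> \<Longrightarrow> (i, j) \<in> shifted_diagram \<nu> \<union> added_boxes \<nu> \<longleftrightarrow> i < j + \<nu> ! j"
  unfolding doubling_diagram using strict_nth(1)[of i] strict_nth(2)[of j i] by fastforce

lemma doubling_diagonal: "(i, i) \<in> shifted_diagram \<nu> \<union> added_boxes \<nu> \<longleftrightarrow> i < length \<nu>"
  unfolding doubling_diagram using strict_nth(1)[of i] by auto

lemma card_doubling: "card (shifted_diagram \<nu> \<union> added_boxes \<nu>) = 2 * sum_list \<nu>"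
  and finite_doubling: "finite (shifted_diagram \<nu> \<union> added_boxes \<nu>)"
proof -
  have s: "shifted_diagram \<nu> = (SIGMA i:{..<length \<nu>}. {i + 1..i + \<nu> ! i})" by (auto simp: shifted_diagram_def)
  have a: "added_boxes \<nu> = prod.swap ` (SIGMA i:{..<length \<nu>}. {i..<i + \<nu> ! i})"
    by (auto simp: added_boxes_def image_iff)
  have "card (shifted_diagram \<nu>) = sum_list \<nu>" unfolding s by (simp add: sum_list_sum_nth atLeast0LessThan)
  moreover have "card (added_boxes \<nu>) = sum_list \<nu>"
    unfolding a by (subst card_image) (auto simp: sum_list_sum_nth atLeast0LessThan)
  moreover have fin: "finite (shifted_diagram \<nu>)" "finite (added_boxes \<nu>)" unfolding s a by auto
  moreover have "shifted_diagram \<nu> \<inter> added_boxes \<nu> = {}" by (auto simp: shifted_diagram_def added_boxes_def)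
  ultimately show "card (shifted_diagram \<nu> \<union> added_boxes \<nu>) = 2 * sum_list \<nu>" by (simp add: card_Un_disjoint)
  show "finite (shifted_diagram \<nu> \<union> added_boxes \<nu>)" using fin by simp
qed

lemma doubling_exists: "\<exists>\<mu>. is_doubling \<nu> \<mu>"
  unfolding is_doubling_def
proof (rule partition_of_diagram[OF finite_doubling])
  fix i j i' j' assume a: "(i, j) \<in> shifted_diagram \<nu> \<union> added_boxes \<nu>" "i' \<le> i" "j' \<le> j"
  from a(1) have "(i < length \<nu> \<and> j \<le> i + \<nu> ! i) \<or> (j < length \<nu> \<and> i < j + \<nu> ! j)"
    by (simp only: doubling_diagram)
  then show "(i', j') \<in> shifted_diagram \<nu> \<union> added_boxes \<nu>"
    unfolding doubling_diagram
  proof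
    assume "i < length \<nu> \<and> j \<le> i + \<nu> ! i"
    then have "i' < length \<nu> \<and> j' \<le> i' + \<nu> ! i'" using a strict_nth(2)[of i' i] by auto
    then show "(i' < length \<nu> \<and> j' \<le> i' + \<nu> ! i') \<or> (j' < length \<nu> \<and> i' < j' + \<nu> ! j')" ..
  next
    assume "j < length \<nu> \<and> i < j + \<nu> ! j"
    then have "j' < length \<nu> \<and> i' < j' + \<nu> ! j'" using a strict_nth(2)[of j' j] by auto
    then show "(i' < length \<nu> \<and> j' \<le> i' + \<nu> ! i') \<or> (j' < length \<nu> \<and> i' < j' + \<nu> ! j')" ..
  qed
qed

context
  fixes \<mu> :: "nat list"
  assumes doubling: "is_doubling \<nu> \<mu>"
begin

lemma diagram: "(i, j) \<in> young_diagram \<mu> \<longleftrightarrow> (i, j) \<in> shifted_diagram \<nu> \<union> added_boxes \<nu>"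
  using doubling by (simp add: is_doubling_def)

lemma sum_list_doubling: "sum_list \<mu> = 2 * sum_list \<nu>"
  using doubling card_doubling card_young_diagram[of \<mu>] by (simp add: is_doubling_def)

text \<open>Row i has length i + \<nu> ! i + 1 and column j has length j + \<nu> ! j, so the row
  numbers are the parts and the column numbers their negatives. Beyond the Durfee square row numbers
  are negative and column numbers nonnegative.\<close>

lemma n_hooks_doubling:
  assumes "t > 0"
  shows "n_hooks t \<mu> = hookN t (set \<nu>)"
proof -
  define row where "row = (\<lambda>i. if i < length \<mu> then \<mu> ! i else 0)"
  define col where "col = (\<lambda>j. card {i. (i, j) \<in> young_diagram \<mu>})"
  have mono: "\<mu> ! i' \<le> \<mu> ! i" if "i \<le> i'" "i' < length \<mu>" for i i'
    using doubling that by (cases "i = i'") (auto simp: is_doubling_def is_partition_def sorted_wrt_iff_nth_less)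
  have r: "(i, j) \<in> young_diagram \<mu> \<longleftrightarrow> j < row i" for i j by (simp add: young_diagram_def row_def)
  have c: "{i. (i, j) \<in> young_diagram \<mu>} = {..<col j}" for j
    unfolding col_def
  proof (rule down_closed_eq_lessThan)
    show "finite {i. (i, j) \<in> young_diagram \<mu>}"
      by (rule finite_subset[of _ "{..<length \<mu>}"]) (auto simp: young_diagram_def)
    show "i' \<in> {i. (i, j) \<in> young_diagram \<mu>}" if "i \<in> {i. (i, j) \<in> young_diagram \<mu>}" "i' \<le> i" for i i'
      using that mono[of i' i] by (auto simp: young_diagram_def)
  qed
  interpret maya \<mu> row col
    by unfold_locales (use r c in blast)+
  have row_small: "row i = i + \<nu> ! i + 1" if "i < length \<nu>" for i
  proof -
    have "j < row i \<longleftrightarrow> j < i + \<nu> ! i + 1" for j using r[of i j] diagram doubling_row[OF that] by blast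
    then show ?thesis by (metis nat_neq_iff)
  qed
  have col_small: "col j = j + \<nu> ! j" if "j < length \<nu>" for j
  proof -
    have "i < col j \<longleftrightarrow> i < j + \<nu> ! j" for i using col[of i j] diagram doubling_col[OF that] by blast
    then show ?thesis by (metis nat_neq_iff)
  qed
  have Xnn: "X i \<ge> 0 \<longleftrightarrow> i < length \<nu>" for i
    using r[of i i] diagram[of i i] doubling_diagonal[of i] by (auto simp: X_def)
  have Xs: "X i = int (\<nu> ! i)" if "i < length \<nu>" for i using row_small[OF that] by (simp add: X_def)
  have Ynn: "Y j < 0 \<longleftrightarrow> j < length \<nu>" for j
    using col[of j j] diagram[of j j] doubling_diagonal[of j] by (auto simp: Y_def)
  have Ys: "Y j = - int (\<nu> ! j)" if "j < length \<nu>" for j using col_small[OF that] by (simp add: Y_def)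
  show ?thesis
  proof (rule n_hooks_eq_hookN[OF assms])
    show "0 \<notin> set \<nu>" using strict by (auto simp: is_strict_partition_def is_partition_def)
    show "int a \<in> range X \<longleftrightarrow> a \<in> set \<nu>" for a
    proof
      assume "int a \<in> range X"
      then obtain i where i: "X i = int a" by auto
      then have "i < length \<nu>" using Xnn[of i] by simp
      then show "a \<in> set \<nu>" using i Xs[of i] by (auto simp: in_set_conv_nth)
    next
      assume "a \<in> set \<nu>"
      then obtain i where "i < length \<nu>" "\<nu> ! i = a" by (auto simp: in_set_conv_nth)
      then show "int a \<in> range X" using Xs[of i] by (metis rangeI)
    qed
    show "- int b \<in> range Y \<longleftrightarrow> b \<in> set \<nu>" if "b > 0" for b
    proof
      assume "- int b \<in> range Y"
      then obtain j where j: "Y j = - int b" by auto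
      then have "j < length \<nu>" using Ynn[of j] that by simp
      then show "b \<in> set \<nu>" using j Ys[of j] by (auto simp: in_set_conv_nth)
    next
      assume "b \<in> set \<nu>"
      then obtain j where "j < length \<nu>" "\<nu> ! j = b" by (auto simp: in_set_conv_nth)
      then show "- int b \<in> range Y" using Ys[of j] by (metis rangeI)
    qed
  qed simp
qed

end

end

section \<open>Strict partitions as finite sets of parts\<close>

lemma strict_partition_of_set:
  assumes "finite S" "0 \<notin> S"
  shows "is_strict_partition (rev (sorted_list_of_set S))" "set (rev (sorted_list_of_set S)) = S"
    "sum_list (rev (sorted_list_of_set S)) = \<Sum>S"
proof -
  show "set (rev (sorted_list_of_set S)) = S" using assms by simp
  have "sorted_wrt (\<ge>) (rev (sorted_list_of_set S))"
    by (simp add: sorted_wrt_rev)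
  then show "is_strict_partition (rev (sorted_list_of_set S))"
    using assms by (auto simp: is_strict_partition_def is_partition_def) (metis gr0I)
  show "sum_list (rev (sorted_list_of_set S)) = \<Sum>S"
    using assms by (metis distinct_sorted_list_of_set set_sorted_list_of_set sum_list_distinct_conv_sum_set sum_list_rev list.map_ident)
qed

lemma strict_partition_unique:
  assumes "is_strict_partition \<nu>" "is_strict_partition \<nu>'" "set \<nu> = set \<nu>'"
  shows "\<nu> = \<nu>'"
proof -
  have "sorted (rev \<nu>)" "sorted (rev \<nu>')" "distinct (rev \<nu>)" "distinct (rev \<nu>')"
    using assms(1,2) by (auto simp: is_strict_partition_def is_partition_def sorted_wrt_rev)
  then have "rev \<nu> = rev \<nu>'" using assms(3) by (intro sorted_distinct_set_unique) auto
  then show ?thesis by simp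
qed

text \<open>Doubling is injective: the diagonal of the diagram gives the number of parts, the row
  lengths give the parts.\<close>

lemma sum_doubled_distinct:
  fixes f :: "nat \<Rightarrow> 'a :: comm_monoid_add"
  assumes t: "t > 0"
  shows "(\<Sum>\<mu>\<in>doubled_distinct_of (2 * n). f (n_hooks t \<mu>)) = (\<Sum>S\<in>strict_sets n. f (hookN t S))"
proof -
  define \<nu>_of where "\<nu>_of = (\<lambda>S::nat set. rev (sorted_list_of_set S))"
  define M where "M = (\<lambda>S. SOME \<mu>. is_doubling (\<nu>_of S) \<mu>)"
  have st: "is_strict_partition (\<nu>_of S)" "set (\<nu>_of S) = S" "sum_list (\<nu>_of S) = n" if "S \<in> strict_sets n" for S
    using strict_partition_of_set[of S] that by (auto simp: \<nu>_of_def strict_sets_def)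
  have M: "is_doubling (\<nu>_of S) (M S)" if "S \<in> strict_sets n" for S
    unfolding M_def by (rule someI_ex[OF doubling_exists[OF st(1)[OF that]]])
  have "bij_betw M (strict_sets n) (doubled_distinct_of (2 * n))"
  proof (rule bij_betwI')
    fix S S' assume SS: "S \<in> strict_sets n" "S' \<in> strict_sets n"
    show "M S = M S' \<longleftrightarrow> S = S'"
    proof
      assume e: "M S = M S'"
      have D: "shifted_diagram (\<nu>_of S) \<union> added_boxes (\<nu>_of S) = shifted_diagram (\<nu>_of S') \<union> added_boxes (\<nu>_of S')"
        using M[OF SS(1)] M[OF SS(2)] e by (simp add: is_doubling_def)
      have len: "length (\<nu>_of S) = length (\<nu>_of S')"
      proof -
        have "i < length (\<nu>_of S) \<longleftrightarrow> i < length (\<nu>_of S')" for i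
          using doubling_diagonal[OF st(1)[OF SS(1)], of i, unfolded D] doubling_diagonal[OF st(1)[OF SS(2)], of i] by blast
        then show ?thesis by (metis nat_neq_iff)
      qed
      have "\<nu>_of S = \<nu>_of S'"
      proof (rule nth_equalityI[OF len])
        fix i assume i: "i < length (\<nu>_of S)"
        have "j < i + \<nu>_of S ! i + 1 \<longleftrightarrow> j < i + \<nu>_of S' ! i + 1" for j
          using doubling_row[OF st(1)[OF SS(1)] i, of j, unfolded D] doubling_row[OF st(1)[OF SS(2)], of i j] i len by simp
        then have "i + \<nu>_of S ! i + 1 = i + \<nu>_of S' ! i + 1" by (metis nat_neq_iff)
        then show "\<nu>_of S ! i = \<nu>_of S' ! i" by simp
      qed
      then show "S = S'" using st(2) SS by metis
    qed simp
  next
    fix S assume S: "S \<in> strict_sets n"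
    have "sum_list (M S) = 2 * n" using sum_list_doubling[OF st(1)[OF S] M[OF S]] st(3)[OF S] by simp
    then show "M S \<in> doubled_distinct_of (2 * n)"
      using M[OF S] st(1)[OF S] by (auto simp: doubled_distinct_of_def doubled_distinct_def)
  next
    fix \<mu> assume "\<mu> \<in> doubled_distinct_of (2 * n)"
    then obtain \<nu> where \<nu>: "is_strict_partition \<nu>" "is_doubling \<nu> \<mu>" "sum_list \<mu> = 2 * n"
      by (auto simp: doubled_distinct_of_def doubled_distinct_def)
    have "sum_list \<nu> = n" using sum_list_doubling[OF \<nu>(1,2)] \<nu>(3) by simp
    moreover have "sum_list \<nu> = \<Sum>(set \<nu>)" 
      using \<nu>(1) sum_list_distinct_conv_sum_set[of \<nu> "\<lambda>x. x"] by (simp add: is_strict_partition_def)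
    moreover have "0 \<notin> set \<nu>" using \<nu>(1) by (auto simp: is_strict_partition_def is_partition_def)
    ultimately have S: "set \<nu> \<in> strict_sets n" by (auto simp: strict_sets_def)
    have "\<nu>_of (set \<nu>) = \<nu>" using strict_partition_unique[OF st(1)[OF S] \<nu>(1)] st(2)[OF S] by simp
    then have "is_doubling \<nu> (M (set \<nu>))" using M[OF S] by simp
    then have "M (set \<nu>) = \<mu>" using \<nu>(2) by (intro young_diagram_inject) (auto simp: is_doubling_def)
    then show "\<exists>S\<in>strict_sets n. \<mu> = M S" using S by blast
  qed
  then have "(\<Sum>\<mu>\<in>doubled_distinct_of (2 * n). f (n_hooks t \<mu>)) = (\<Sum>S\<in>strict_sets n. f (n_hooks t (M S)))"
    by (rule sum.reindex_bij_betw[symmetric])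
  also have "\<dots> = (\<Sum>S\<in>strict_sets n. f (hookN t S))"
    using n_hooks_doubling[OF st(1) M t] st(2) by (intro sum.cong refl) simp
  finally show ?thesis .
qed

section \<open>The limit law\<close>

text \<open>The derivative as a series. The closed form Ln (1 + y) / y would evaluate to 0 at y = 0,
  exactly where the value 1 and the next derivative are wanted.\<close>

definition altdilog' :: "complex \<Rightarrow> complex" where
  "altdilog' y = (\<Sum>n. diffs (\<lambda>n. (-1) ^ Suc n / of_nat n ^ 2) n * y ^ n)"

lemma altdilog_derivatives:
  "norm y < 1 \<Longrightarrow> (altdilog has_field_derivative altdilog' y) (at y)"
  "altdilog' 0 = 1" "(altdilog' has_field_derivative (- 1 / 2)) (at 0)"
proof -
  define c where "c = (\<lambda>n. (-1) ^ Suc n / of_nat n ^ 2 :: complex)"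
  have sm: "summable (\<lambda>n. c n * 1 ^ n)"
    using summable_norm_cancel[OF summable_altdilog_coeffs] by (simp add: c_def)
  have ad: "altdilog = (\<lambda>y. \<Sum>n. c n * y ^ n)" "altdilog' = (\<lambda>y. \<Sum>n. diffs c n * y ^ n)"
    by (simp_all add: altdilog_def altdilog'_def c_def fun_eq_iff)
  show "norm y < 1 \<Longrightarrow> (altdilog has_field_derivative altdilog' y) (at y)"
    unfolding ad by (rule termdiffs_strong[OF sm]) simp
  show "altdilog' 0 = 1" unfolding ad powser_zero by (simp add: diffs_def c_def)
  have "summable (\<lambda>n. c n * y ^ n)" if "norm y < 1" for y
    using powser_inside[OF sm] that by simp
  then have "summable (\<lambda>n. diffs c n * (1 / 2) ^ n)" by (intro termdiff_converges[of "1 / 2" 1 c]) (simp_all add: norm_divide)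
  then have "((\<lambda>y. \<Sum>n. diffs c n * y ^ n) has_field_derivative (\<Sum>n. diffs (diffs c) n * 0 ^ n)) (at 0)"
    by (rule termdiffs_strong) (simp add: norm_divide)
  also have "(\<Sum>n. diffs (diffs c) n * 0 ^ n) = - 1 / 2"
    unfolding powser_zero by (simp add: diffs_def c_def)
  finally show "(altdilog' has_field_derivative (- 1 / 2)) (at 0)" unfolding ad .
qed

definition afun' :: "complex \<Rightarrow> complex" where
  "afun' u = altdilog' (exp (2 * u) - 1) * exp (2 * u)"

lemma afun_derivatives:
  "norm u \<le> 1 / 200 \<Longrightarrow> (afun has_field_derivative afun' u) (at u)"
  "afun 0 = of_real (pi\<^sup>2 / 12)" "afun' 0 = 1" "(afun' has_field_derivative 1) (at 0)"
proof -
  show "(afun has_field_derivative afun' u) (at u)" if "norm u \<le> 1 / 200"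
  proof -
    have "norm (exp (2 * u) - 1) < 1" using exp_near_0_bounds(2)[OF that] by simp
    then show ?thesis unfolding afun_def[abs_def] afun'_def
      by (auto intro!: derivative_eq_intros DERIV_chain2[OF altdilog_derivatives(1)])
  qed
  show "afun 0 = of_real (pi\<^sup>2 / 12)" "afun' 0 = 1" by (simp_all add: afun_def afun'_def altdilog_derivatives)
  have "((\<lambda>u. altdilog' (exp (2 * u) - 1)) has_field_derivative (- 1 / 2 * 2)) (at 0)"
    by (rule DERIV_chain2[of altdilog' _ "\<lambda>u. exp (2 * u) - 1"]) (auto intro!: derivative_eq_intros altdilog_derivatives(3)[simplified])
  then show "(afun' has_field_derivative 1) (at 0)"
    unfolding afun'_def[abs_def] by (auto intro!: derivative_eq_intros simp: altdilog_derivatives)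
qed

text \<open>The square root of \<open>afun\<close>; the saddle point of \<open>n * s + afun u / s\<close> is \<open>s = kfun u / sqrt n\<close>.\<close>

definition kfun :: "complex \<Rightarrow> complex" where "kfun u = exp (Ln (afun u) / 2)"

text \<open>The summand Ln (afun u) / 4 is the logarithm of \<open>csqrt (kfun u)\<close>, the width
  of the Gaussian at the saddle point.\<close>

definition gfun :: "nat \<Rightarrow> complex \<Rightarrow> complex" where "gfun t u = lfun t u + Ln (afun u) / 4"

definition gfun' :: "nat \<Rightarrow> complex \<Rightarrow> complex" where
  "gfun' t u = of_real ((1 - real t + delta_even t) / 2) - of_real (1 + delta_even t / 2) * (exp u / (1 + exp u))
    + afun' u / afun u / 4"

lemma kfun_squared: "afun u \<noteq> 0 \<Longrightarrow> (kfun u)\<^sup>2 = afun u"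
  unfolding kfun_def exp_double[symmetric] by simp

text \<open>Halving the imaginary part of a principal logarithm brings it strictly below pi, so no
  branch is crossed.\<close>

lemma csqrt_kfun:
  assumes "afun u \<noteq> 0"
  shows "csqrt (kfun u) = exp (Ln (afun u) / 4)"
proof -
  have "\<bar>Im (Ln (afun u))\<bar> \<le> pi" using mpi_less_Im_Ln[OF assms] Im_Ln_le_pi[OF assms] by simp
  moreover have "Im (Ln (afun u) / 2) = Im (Ln (afun u)) / 2" by simp
  ultimately have "\<bar>Im (Ln (afun u) / 2)\<bar> < pi" using pi_gt_zero by linarith
  then have L: "Ln (kfun u) = Ln (afun u) / 2" unfolding kfun_def by (simp add: Ln_exp)
  have "csqrt (kfun u) = exp (Ln (kfun u) / 2)" by (rule csqrt_exp_Ln) (simp add: kfun_def)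
  then show ?thesis unfolding L by simp
qed

lemma kfun_gfun_derivatives:
  assumes u: "norm u \<le> 1 / 200" "Re (afun u) > 0"
  shows "((\<lambda>u. 2 * kfun u) has_field_derivative (kfun u * (afun' u / afun u))) (at u)"
    "(gfun t has_field_derivative gfun' t u) (at u)"
proof -
  have a: "afun u \<notin> \<real>\<^sub>\<le>\<^sub>0" "afun u \<noteq> 0" using u(2) by (auto simp: complex_nonpos_Reals_iff)
  show "((\<lambda>u. 2 * kfun u) has_field_derivative (kfun u * (afun' u / afun u))) (at u)"
    unfolding kfun_def using a by (auto intro!: derivative_eq_intros afun_derivatives(1) u(1) simp: field_simps)
  have n1: "1 + exp u \<noteq> 0" using exp_near_0_bounds(5)[OF u(1)] by auto
  have "\<bar>Re (exp u - 1)\<bar> \<le> 1 / 8" using exp_near_0_bounds(1)[OF u(1)] abs_Re_le_cmod order_trans by blast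
  then have "\<bar>Re (exp u) - 1\<bar> \<le> 1 / 8" by simp
  then have "Re (exp u) > 0" by linarith
  then have e: "(1 + exp u) / 2 \<notin> \<real>\<^sub>\<le>\<^sub>0" by (auto simp: complex_nonpos_Reals_iff)
  have L: "((\<lambda>u. Ln ((1 + exp u) / 2)) has_field_derivative (exp u / (1 + exp u))) (at u)"
    using e n1 by (auto intro!: derivative_eq_intros simp: field_simps)
  have A: "((\<lambda>u. Ln (afun u)) has_field_derivative (afun' u / afun u)) (at u)"
    using a by (auto intro!: derivative_eq_intros afun_derivatives(1) u(1) simp: divide_inverse mult.commute)
  show "(gfun t has_field_derivative gfun' t u) (at u)"
    unfolding gfun_def[abs_def] gfun'_def lfun_def
    by (rule DERIV_cong[OF DERIV_add[OF DERIV_diff[OF DERIV_cmult[OF DERIV_ident] DERIV_cmult[OF L]] DERIV_cdivide[OF A]]]) simp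
qed

lemma kfun_0: "kfun 0 = of_real (sqrt (pi\<^sup>2 / 12))"
proof -
  have p: "pi\<^sup>2 / 12 > 0" by simp
  have "Ln (afun 0) = of_real (ln (pi\<^sup>2 / 12))" unfolding afun_derivatives(2) using Ln_of_real[OF p] by simp
  then have "kfun 0 = exp (of_real (ln (pi\<^sup>2 / 12) / 2))" by (simp add: kfun_def)
  also have "\<dots> = of_real (exp (ln (pi\<^sup>2 / 12) / 2))" by (rule exp_of_real)
  also have "exp (ln (pi\<^sup>2 / 12) / 2) = sqrt (pi\<^sup>2 / 12)"
  proof -
    have "(exp (ln (pi\<^sup>2 / 12) / 2))\<^sup>2 = pi\<^sup>2 / 12" using p by (simp add: exp_double[symmetric])
    then show ?thesis by (metis exp_ge_zero real_sqrt_unique)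
  qed
  finally show ?thesis .
qed

lemma pi_squared_bounds: "0.64 < pi\<^sup>2 / 12" "pi\<^sup>2 / 12 < 1"
proof -
  have "3.14\<^sup>2 < pi\<^sup>2" "pi\<^sup>2 < 3.15\<^sup>2" using pi_approx by (intro power_strict_mono; simp)+
  then show "0.64 < pi\<^sup>2 / 12" "pi\<^sup>2 / 12 < 1" by (simp_all add: power2_eq_square)
qed

text \<open>The coefficients of the theorem: derivatives of 2 * \<open>kfun\<close> and
  \<open>gfun\<close> at 0, evaluated from \<open>afun\<close> there being pi^2 / 12 with first and
  second derivative 1.\<close>

lemma second_derivatives:
  shows "((\<lambda>u. kfun u * (afun' u / afun u)) has_field_derivative of_real (2 * (pi\<^sup>2 - 6) / pi ^ 3 * sqrt 3)) (at 0)"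
    "kfun 0 * (afun' 0 / afun 0) = of_real (2 * sqrt 3 / pi)"
    "(gfun' t has_field_derivative of_real (- 36 / pi ^ 4 + 3 / pi ^ 2 - 1 / 4 - delta_even t / 8)) (at 0)"
    "gfun' t 0 = of_real (3 / pi ^ 2 - real t / 2 + delta_even t / 4)"
proof -
  define a0 where "a0 = complex_of_real (pi\<^sup>2 / 12)"
  define k0 where "k0 = sqrt (pi\<^sup>2 / 12)"
  have a: "afun 0 = a0" "a0 \<noteq> 0" by (auto simp: a0_def afun_derivatives)
  have Re0: "Re (afun 0) > 0" by (simp add: afun_derivatives)
  have k: "kfun 0 = of_real k0" by (simp add: k0_def kfun_0)
  have k0: "k0 = pi / (2 * sqrt 3)"
  proof -
    have "pi\<^sup>2 / 12 = (pi / (2 * sqrt 3))\<^sup>2" by (simp add: power_divide power_mult_distrib)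
    then show ?thesis by (simp add: k0_def)
  qed
  have dk: "(kfun has_field_derivative (of_real k0 * (1 / a0) / 2)) (at 0)"
    using DERIV_cmult[OF kfun_gfun_derivatives(1)[of 0], of "1 / 2"] Re0 by (simp add: k a afun_derivatives(3) mult.commute)
  have da: "(afun has_field_derivative 1) (at 0)" using afun_derivatives(1)[of 0] afun_derivatives(3) by simp
  have daa: "((\<lambda>u. afun' u / afun u) has_field_derivative ((a0 - 1) / a0\<^sup>2)) (at 0)"
    by (rule DERIV_cong[OF DERIV_divide[OF afun_derivatives(4) da]]) (simp_all add: a afun_derivatives(3) power2_eq_square)
  have "((\<lambda>u. kfun u * (afun' u / afun u)) has_field_derivative ((of_real k0 * (1 / a0) / 2) * (afun' 0 / afun 0) + ((a0 - 1) / a0\<^sup>2) * kfun 0)) (at 0)"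
    by (rule DERIV_mult[OF dk daa])
  also have "(of_real k0 * (1 / a0) / 2) * (afun' 0 / afun 0) + ((a0 - 1) / a0\<^sup>2) * kfun 0 = of_real (k0 * (1 / (pi\<^sup>2 / 12) - 1 / (2 * (pi\<^sup>2 / 12)\<^sup>2)))"
    using a(2) unfolding a k afun_derivatives(3) of_real_mult of_real_diff of_real_divide of_real_power a0_def[symmetric, unfolded of_real_divide of_real_power]
    by (simp add: a0_def field_simps power2_eq_square)
  also have "k0 * (1 / (pi\<^sup>2 / 12) - 1 / (2 * (pi\<^sup>2 / 12)\<^sup>2)) = 2 * (pi\<^sup>2 - 6) / pi ^ 3 * sqrt 3"
    unfolding k0 by (simp add: field_simps power2_eq_square power3_eq_cube)
  finally show "((\<lambda>u. kfun u * (afun' u / afun u)) has_field_derivative of_real (2 * (pi\<^sup>2 - 6) / pi ^ 3 * sqrt 3)) (at 0)" .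
  show "kfun 0 * (afun' 0 / afun 0) = of_real (2 * sqrt 3 / pi)"
  proof -
    have "kfun 0 * (afun' 0 / afun 0) = of_real (k0 * (1 / (pi\<^sup>2 / 12)))" by (simp add: k a a0_def afun_derivatives(3))
    also have "k0 * (1 / (pi\<^sup>2 / 12)) = 2 * sqrt 3 / pi" unfolding k0 by (simp add: field_simps power2_eq_square)
    finally show ?thesis .
  qed
  have "(gfun' t has_field_derivative (0 - of_real (1 + delta_even t / 2) * (1 / 4) + (a0 - 1) / a0\<^sup>2 / 4)) (at 0)"
  proof -
    have "((\<lambda>u. exp u / (1 + exp u)) has_field_derivative (1 / 4 :: complex)) (at 0)"
      by (auto intro!: derivative_eq_intros)
    then show ?thesis unfolding gfun'_def[abs_def]
      by (intro DERIV_add DERIV_diff DERIV_const DERIV_cmult DERIV_cdivide daa)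
  qed
  also have "0 - of_real (1 + delta_even t / 2) * (1 / 4) + (a0 - 1) / a0\<^sup>2 / 4 =
     of_real (- (1 + delta_even t / 2) * (1 / 4) + (pi\<^sup>2 / 12 - 1) / (pi\<^sup>2 / 12)\<^sup>2 / 4)"
    by (simp add: a0_def field_simps)
  also have "- (1 + delta_even t / 2) * (1 / 4) + (pi\<^sup>2 / 12 - 1) / (pi\<^sup>2 / 12)\<^sup>2 / 4 = - 36 / pi ^ 4 + 3 / pi ^ 2 - 1 / 4 - delta_even t / 8"
    by (simp add: field_simps power2_eq_square power4_eq_xxxx)
  finally show "(gfun' t has_field_derivative of_real (- 36 / pi ^ 4 + 3 / pi ^ 2 - 1 / 4 - delta_even t / 8)) (at 0)" .
  have "gfun' t 0 = of_real ((1 - real t + delta_even t) / 2 - (1 + delta_even t / 2) * (1 / 2) + 1 / (pi\<^sup>2 / 12) / 4)"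
    by (simp add: gfun'_def a a0_def afun_derivatives(3))
  also have "(1 - real t + delta_even t) / 2 - (1 + delta_even t / 2) * (1 / 2) + 1 / (pi\<^sup>2 / 12) / 4 = 3 / pi ^ 2 - real t / 2 + delta_even t / 4"
    by (simp add: field_simps)
  finally show "gfun' t 0 = of_real (3 / pi ^ 2 - real t / 2 + delta_even t / 4)" .
qed

text \<open>By continuity it suffices that the inequalities are strict at u = 0. There
  \<open>kfun\<close> squares to pi^2 / 12, which lies between (4 / 5)^2 and 1, so the gap condition
  reduces to kfun 0 / 8 < 1.\<close>

lemma good_neighbourhood:
  assumes "t > 0"
  obtains \<rho> where "\<rho> > 0"
    "\<And>u. norm u < \<rho> \<Longrightarrow> norm u \<le> 1 / 200 \<and> norm u \<le> 1 / (2112 * real (t + 8)) \<and> Re (afun u) > 0 \<and>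
       4 / 5 \<le> Re (kfun u) \<and> Re (kfun u) \<le> 11 / 10 \<and> \<bar>Im (kfun u)\<bar> \<le> 1 / 10 \<and>
       pi\<^sup>2 / 12 - 1 / 176 \<le> (Re (kfun u))\<^sup>2 - 1 / 176 / 8 * Re (kfun u) \<and> norm (lfun t u) \<le> 1"
proof -
  have Re0: "Re (afun 0) > 0" by (simp add: afun_derivatives)
  have ca: "isCont afun 0" using afun_derivatives(1)[of 0] by (auto intro: DERIV_isCont)
  have ck: "isCont kfun 0"
    using DERIV_isCont[OF DERIV_cmult[OF kfun_gfun_derivatives(1)[of 0], of "1 / 2"]] Re0 by simp
  have cl: "isCont (lfun t) 0"
    unfolding lfun_def[abs_def] by (intro continuous_intros) auto
  define k0 where "k0 = sqrt (pi\<^sup>2 / 12)"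
  have k0: "4 / 5 < k0" "k0 < 1" "k0\<^sup>2 = pi\<^sup>2 / 12"
  proof -
    have "sqrt ((4 / 5)\<^sup>2) < k0" unfolding k0_def using pi_squared_bounds by (intro real_sqrt_less_mono) (simp add: power2_eq_square)
    then show "4 / 5 < k0" by simp
    show "k0 < 1" unfolding k0_def using pi_squared_bounds by simp
    show "k0\<^sup>2 = pi\<^sup>2 / 12" by (simp add: k0_def)
  qed
  have k: "kfun 0 = of_real k0" by (simp add: k0_def kfun_0)
  have "eventually (\<lambda>u. Re (afun u) > 0) (nhds 0)"
    using ca Re0 by (intro order_tendstoD(1)[of _ "Re (afun 0)"] tendsto_intros) (auto simp: isCont_def tendsto_at_iff_tendsto_nhds)
  moreover have kt: "(kfun \<longlongrightarrow> of_real k0) (nhds 0)" using ck[unfolded isCont_def tendsto_at_iff_tendsto_nhds] unfolding k .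
  have "eventually (\<lambda>u. Re (kfun u) > 4 / 5) (nhds 0)" "eventually (\<lambda>u. Re (kfun u) < 11 / 10) (nhds 0)"
    using order_tendstoD(1)[OF tendsto_Re[OF kt], of "4 / 5"] order_tendstoD(2)[OF tendsto_Re[OF kt], of "11 / 10"] k0 by auto
  moreover have "eventually (\<lambda>u. \<bar>Im (kfun u)\<bar> < 1 / 10) (nhds 0)"
    using order_tendstoD(2)[OF tendsto_rabs[OF tendsto_Im[OF kt]], of "1 / 10"] by simp
  moreover have "eventually (\<lambda>u. pi\<^sup>2 / 12 - 1 / 176 < (Re (kfun u))\<^sup>2 - 1 / 176 / 8 * Re (kfun u)) (nhds 0)"
  proof (rule order_tendstoD(1))
    show "((\<lambda>u. (Re (kfun u))\<^sup>2 - 1 / 176 / 8 * Re (kfun u)) \<longlongrightarrow> (Re (of_real k0))\<^sup>2 - 1 / 176 / 8 * Re (of_real k0)) (nhds 0)"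
      by (intro tendsto_intros kt)
    show "pi\<^sup>2 / 12 - 1 / 176 < (Re (of_real k0))\<^sup>2 - 1 / 176 / 8 * Re (of_real k0)" using k0 by simp
  qed
  moreover have "eventually (\<lambda>u. norm (lfun t u) < 1) (nhds 0)"
    using order_tendstoD(2)[OF tendsto_norm[OF cl[unfolded isCont_def tendsto_at_iff_tendsto_nhds]], of 1] by (simp add: lfun_def)
  moreover have "eventually (\<lambda>u::complex. norm u < 1 / 200) (nhds 0)" "eventually (\<lambda>u::complex. norm u < 1 / (2112 * real (t + 8))) (nhds 0)"
    by (intro order_tendstoD(2)[of _ "norm (0::complex)"] tendsto_intros filterlim_ident; auto)+
  ultimately have "eventually (\<lambda>u. norm u \<le> 1 / 200 \<and> norm u \<le> 1 / (2112 * real (t + 8)) \<and> Re (afun u) > 0 \<and>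
       4 / 5 \<le> Re (kfun u) \<and> Re (kfun u) \<le> 11 / 10 \<and> \<bar>Im (kfun u)\<bar> \<le> 1 / 10 \<and>
       pi\<^sup>2 / 12 - 1 / 176 \<le> (Re (kfun u))\<^sup>2 - 1 / 176 / 8 * Re (kfun u) \<and> norm (lfun t u) \<le> 1) (nhds 0)"
    by eventually_elim auto
  then show ?thesis using that unfolding eventually_nhds_metric by auto
qed

text \<open>The integration path is shifted by the imaginary part of the saddle point and may leave
  the strip |Im s| <= pi slightly; a shift by 2 * pi * i returns to it.\<close>

lemma hookF_minor_wide:
  assumes t: "t > 0" and u: "norm u \<le> 1 / (2112 * real (t + 8))"
    and s: "0 < Re s" "Re s \<le> 1 / 2" "Re s \<le> \<bar>Im s\<bar>" "\<bar>Im s\<bar> \<le> 4"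
  shows "norm (hookF t (exp u) (exp (- s))) \<le> 4 * exp 6 * exp ((pi\<^sup>2 / 12 - 1 / 176) / Re s)"
proof (cases "\<bar>Im s\<bar> \<le> pi")
  case True
  then show ?thesis using hookF_minor[OF t u s(1-3)] by simp
next
  case False
  define s' where "s' = s - of_real (2 * pi * sgn (Im s)) * \<i>"
  have "exp (- s') = exp (- s)"
  proof (cases "Im s > 0")
    case True
    then show ?thesis by (simp add: s'_def exp_diff exp_minus exp_add inverse_eq_divide)
  next
    case F: False
    then have "sgn (Im s) = -1" using False pi_gt_zero by (auto simp: sgn_if)
    then show ?thesis by (simp add: s'_def exp_diff exp_minus exp_add inverse_eq_divide)
  qed
  moreover have "Re s' = Re s" by (simp add: s'_def)
  moreover have "\<bar>Im s'\<bar> = 2 * pi - \<bar>Im s\<bar>"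
    using False s(4) pi_gt3 by (cases "Im s > 0") (auto simp: s'_def sgn_if)
  moreover have "2 * pi - \<bar>Im s\<bar> \<le> pi" "Re s \<le> 2 * pi - \<bar>Im s\<bar>" using False s pi_gt3 by auto
  ultimately show ?thesis using hookF_minor[OF t u, of s'] s by simp
qed

theorem hookpoly_asymptotics:
  assumes t: "t > 0"
  obtains \<rho> C N0 where "\<rho> > 0" "C > 0"
    "\<And>u. norm u < \<rho> \<Longrightarrow> norm u \<le> 1 / 200 \<and> Re (afun u) > 0"
    "\<And>n u. n \<ge> N0 \<Longrightarrow> norm u < \<rho> \<Longrightarrow>
      of_real (sqrt pi / (2 * pi * sqrt n * sqrt 2 * sqrt (sqrt n))) \<noteq> (0 :: complex) \<and>
      norm (hookpoly t n (exp u) / (of_real (sqrt pi / (2 * pi * sqrt n * sqrt 2 * sqrt (sqrt n)))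
        * exp (of_real (sqrt n) * (2 * kfun u) + gfun t u)) - 1) \<le> C / sqrt n"
proof -
  obtain \<rho> where \<rho>: "\<rho> > 0"
    "\<And>u. norm u < \<rho> \<Longrightarrow> norm u \<le> 1 / 200 \<and> norm u \<le> 1 / (2112 * real (t + 8)) \<and> Re (afun u) > 0 \<and>
       4 / 5 \<le> Re (kfun u) \<and> Re (kfun u) \<le> 11 / 10 \<and> \<bar>Im (kfun u)\<bar> \<le> 1 / 10 \<and>
       pi\<^sup>2 / 12 - 1 / 176 \<le> (Re (kfun u))\<^sup>2 - 1 / 176 / 8 * Re (kfun u) \<and> norm (lfun t u) \<le> 1"
    using good_neighbourhood[OF t] by blast
  define C1 s0 C2 where "C1 = 20000 * (real t)\<^sup>2" and "s0 = 1 / (40000 * (real t)\<^sup>2)" and "C2 = 4 * exp (6 :: real)"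
  define C where "C = 280000 + 12 * C1 + 24 * (1 + 2 * C1 + C2 * exp 1) * (27 / (1 / 176 / 8) ^ 3)"
  have t2: "(real t)\<^sup>2 \<ge> 1" using t by simp
  have "s0 \<le> 1 / 40000" unfolding s0_def using t t2 by (intro divide_left_mono) auto
  moreover have "s0 > 0" using t by (simp add: s0_def)
  ultimately have s0: "s0 > 0" "s0 \<le> 1 / 2" by simp_all
  have Cpos: "C > 0" unfolding C_def C1_def C2_def by (intro add_pos_nonneg add_nonneg_nonneg mult_nonneg_nonneg) auto
  \<comment> \<open>Ensures both R >= 1 and 2 / R <= s0, so that the part of the path in the sector
    lies in the range of the major arc estimate.\<close>
  define N0 where "N0 = nat \<lceil>(1 + 2 / s0)\<^sup>2\<rceil>"
  have main: "of_real (sqrt pi / (2 * pi * sqrt n * sqrt 2 * sqrt (sqrt n))) \<noteq> (0 :: complex) \<and>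
      norm (hookpoly t n (exp u) / (of_real (sqrt pi / (2 * pi * sqrt n * sqrt 2 * sqrt (sqrt n)))
        * exp (of_real (sqrt n) * (2 * kfun u) + gfun t u)) - 1) \<le> C / sqrt n" if n: "n \<ge> N0" and u: "norm u < \<rho>" for n u
  proof -
    note g = \<rho>(2)[OF u]
    have a0: "afun u \<noteq> 0" using g by auto
    define R where "R = sqrt (real n)"
    have "(1 + 2 / s0)\<^sup>2 \<le> real n" using n unfolding N0_def by linarith
    then have "1 + 2 / s0 \<le> R" unfolding R_def by (rule real_le_rsqrt)
    then have R: "R \<ge> 1" "2 / s0 \<le> R" using s0 by (auto intro: order_trans[rotated])
    have R2: "2 / R \<le> s0" using R s0 by (simp add: field_simps)
    interpret saddle "\<lambda>m. hookpoly t m (exp u)" "\<lambda>s. hookF t (exp u) (exp (- s))" "kfun u" "lfun t u" C1 C2 1 "pi\<^sup>2 / 12" "1 / 176" s0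
    proof unfold_locales
      show "(\<lambda>m. hookpoly t m (exp u) * exp (- s) ^ m) sums hookF t (exp u) (exp (- s))" if "0 < Re s" for s
        using that by (intro hookpoly_sums_hookF t) auto
      show "norm (hookF t (exp u) (exp (- s)) / (exp ((kfun u)\<^sup>2 / s + lfun t u) / of_real (sqrt 2)) - 1) \<le> C1 * norm s"
        if "s \<in> sector" "norm s \<le> s0" for s
      proof -
        have "40000 * (real t)\<^sup>2 * norm s \<le> 1" using that(2) t pos_le_divide_eq[of "40000 * (real t)\<^sup>2" "norm s" 1] by (simp add: s0_def mult.commute)
        then show ?thesis
          using hookF_major[OF that(1) t, of u] g unfolding major_def kfun_squared[OF a0] C1_def by simp
      qed
      show "norm (hookF t (exp u) (exp (- s))) \<le> C2 * exp ((pi\<^sup>2 / 12 - 1 / 176) / Re s)"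
        if "0 < Re s" "Re s \<le> s0" "Re s \<le> \<bar>Im s\<bar>" "\<bar>Im s\<bar> \<le> 4" for s
      proof -
        have "Re s \<le> 1 / 2" using that(2) s0(2) by linarith
        then show ?thesis unfolding C2_def using that g hookF_minor_wide[OF t] by blast
      qed
      show "0 \<le> C1" "0 \<le> C2" by (simp_all add: C1_def C2_def)
      show "4 / 5 \<le> Re (kfun u)" "Re (kfun u) \<le> 11 / 10" "\<bar>Im (kfun u)\<bar> \<le> 1 / 10" "norm (lfun t u) \<le> 1"
        "pi\<^sup>2 / 12 - 1 / 176 \<le> (Re (kfun u))\<^sup>2 - 1 / 176 / 8 * Re (kfun u)" using g by blast+
      show "0 < s0" by (rule s0)
    qed simp_all
    have RP: "1 \<le> R" "2 / R \<le> s0" "0 \<le> 2 * s0" "real n = R\<^sup>2" using R R2 s0 by (simp_all add: R_def)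
    have est: "norm (of_real (2 * pi * R) * hookpoly t n (exp u) * (of_real (sqrt 2) * (of_real (sqrt R) / csqrt (kfun u)) / (V R * of_real (sqrt pi))) - 1) \<le> C / R"
      unfolding C_def by (rule saddle_estimate[OF RP])
    have Vg: "exp (of_real R * (2 * kfun u) + gfun t u) = V R * csqrt (kfun u)"
      unfolding V_def[OF RP] csqrt_kfun[OF a0] gfun_def exp_add[symmetric] by (simp add: algebra_simps)
    \<comment> \<open>The part of the normalization in \<open>saddle_estimate\<close> that is
      independent of u; the remaining factor \<open>csqrt (kfun u)\<close> is already inside
      \<open>gfun\<close>.\<close>
    define b where "b = sqrt pi / (2 * pi * R * sqrt 2 * sqrt R)"
    have b: "b \<noteq> 0" using R by (simp add: b_def)
    have ck: "csqrt (kfun u) \<noteq> 0" "V R \<noteq> 0" by (simp_all add: csqrt_kfun[OF a0] V_def[OF RP])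
    have "hookpoly t n (exp u) / (of_real b * (V R * csqrt (kfun u))) = of_real (2 * pi * R) * hookpoly t n (exp u) * (of_real (sqrt 2) * (of_real (sqrt R) / csqrt (kfun u)) / (V R * of_real (sqrt pi)))"
      using R ck by (simp add: b_def field_simps)
    then have "norm (hookpoly t n (exp u) / (of_real b * exp (of_real R * (2 * kfun u) + gfun t u)) - 1) \<le> C / R"
      unfolding Vg using est by simp
    then show ?thesis using b unfolding b_def R_def by simp
  qed
  show ?thesis
    by (rule that[OF \<rho>(1) Cpos _ main]) (use \<rho>(2) in blast)
qed

theorem theorem1p3:
  fixes t :: nat
  assumes "t > 0"
  shows "(\<lambda>n. mean_DD t n -
            (2 * sqrt (3 * real n) / pi + 3 / pi ^ 2 - real t / 2 + delta_even t / 4))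
           \<in> O(\<lambda>n. real n powr (- (1 / 2))) \<and>
         (\<lambda>n. var_DD t n -
            (2 * (pi ^ 2 - 6) / pi ^ 3 * sqrt (3 * real n) - 36 / pi ^ 4 + 3 / pi ^ 2
              - 1 / 4 - delta_even t / 8))
           \<in> O(\<lambda>n. real n powr (- (1 / 2))) \<and>
         weak_conv_m
           (\<lambda>n. distr (measure_pmf (DD_pmf n)) borel
                  (\<lambda>\<mu>. (N_DD t \<mu> - mean_DD t n) / sqrt (var_DD t n)))
           std_normal_distribution"
proof -
  obtain \<rho> C N0 where H: "\<rho> > 0" "C > 0"
    "\<And>u. norm u < \<rho> \<Longrightarrow> norm u \<le> 1 / 200 \<and> Re (afun u) > 0"
    "\<And>n u. n \<ge> N0 \<Longrightarrow> norm u < \<rho> \<Longrightarrow>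
      of_real (sqrt pi / (2 * pi * sqrt n * sqrt 2 * sqrt (sqrt n))) \<noteq> (0 :: complex) \<and>
      norm (hookpoly t n (exp u) / (of_real (sqrt pi / (2 * pi * sqrt n * sqrt 2 * sqrt (sqrt n)))
        * exp (of_real (sqrt n) * (2 * kfun u) + gfun t u)) - 1) \<le> C / sqrt n"
    using hookpoly_asymptotics[OF assms] by blast
  define a1 a2 b1 b2 where "a1 = 2 * sqrt 3 / pi" and "a2 = 2 * (pi\<^sup>2 - 6) / pi ^ 3 * sqrt 3"
    and "b1 = 3 / pi ^ 2 - real t / 2 + delta_even t / 4" and "b2 = - 36 / pi ^ 4 + 3 / pi ^ 2 - 1 / 4 - delta_even t / 8"
  have gf: "(\<Sum>\<mu>\<in>doubled_distinct_of (2 * n). exp (u * of_real (N_DD t \<mu>))) = hookpoly t n (exp u)" for n and u :: complex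
  proof -
    have "exp (u * of_real (N_DD t \<mu>)) = exp u ^ n_hooks t \<mu>" for \<mu>
      by (simp add: N_DD_def exp_of_nat2_mult)
    then show ?thesis
      using sum_doubled_distinct[OF assms, of "\<lambda>m. exp u ^ m" n] by (simp add: hookpoly_def)
  qed
  interpret quasi_powers "\<lambda>n. doubled_distinct_of (2 * n)" "N_DD t" "\<lambda>u. 2 * kfun u" "gfun t"
    "\<lambda>u. kfun u * (afun' u / afun u)" "gfun' t" "\<lambda>n. of_real (sqrt pi / (2 * pi * sqrt n * sqrt 2 * sqrt (sqrt n)))" \<rho> C a1 a2 b1 b2 N0
  proof unfold_locales
    show "finite (doubled_distinct_of (2 * n))" for n by (rule finite_doubled_distinct_of)
    show "doubled_distinct_of (2 * n) \<noteq> {}" for n by (rule doubled_distinct_of_nonempty)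
    have "3\<^sup>2 < pi\<^sup>2" using pi_gt3 by (intro power_strict_mono) auto
    then show "0 < a2" by (simp add: a2_def)
    show "((\<lambda>u. 2 * kfun u) has_field_derivative kfun u * (afun' u / afun u)) (at u)" if "norm u < \<rho>" for u
      using H(3)[OF that] by (intro kfun_gfun_derivatives) auto
    show "(gfun t has_field_derivative gfun' t u) (at u)" if "norm u < \<rho>" for u
      using H(3)[OF that] by (intro kfun_gfun_derivatives) auto
    show "kfun 0 * (afun' 0 / afun 0) = of_real a1" "((\<lambda>u. kfun u * (afun' u / afun u)) has_field_derivative of_real a2) (at 0)"
      "gfun' t 0 = of_real b1" "(gfun' t has_field_derivative of_real b2) (at 0)"
      unfolding a1_def a2_def b1_def b2_def by (rule second_derivatives)+
  qed (use H gf in auto)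
  have mean: "mean n = mean_DD t n" for n
    unfolding mean_def mean_DD_def DD_pmf_def by (rule refl)
  have var: "var n = var_DD t n" for n
    unfolding var_def var_DD_def DD_pmf_def by (rule refl)
  have O: "f \<in> O(\<lambda>n. real n powr (- (1 / 2)))" if "f \<in> O(\<lambda>n. 1 / sqrt (real n))" for f :: "nat \<Rightarrow> real"
  proof -
    have "1 / sqrt (real n) = real n powr (- (1 / 2))" for n
      by (simp only: powr_minus_divide powr_half_sqrt of_nat_0_le_iff)
    then show ?thesis using that by simp
  qed
  have "sqrt n * a1 + b1 = 2 * sqrt (3 * real n) / pi + 3 / pi ^ 2 - real t / 2 + delta_even t / 4" for n
    by (simp add: a1_def b1_def real_sqrt_mult)
  moreover have "sqrt n * a2 + b2 = 2 * (pi ^ 2 - 6) / pi ^ 3 * sqrt (3 * real n) - 36 / pi ^ 4 + 3 / pi ^ 2 - 1 / 4 - delta_even t / 8" for n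
    by (simp add: a2_def b2_def real_sqrt_mult)
  ultimately show ?thesis
    using O[OF mean_asymptotics] O[OF var_asymptotics] normal_limit
    unfolding mean var DD_pmf_def by (simp only:)
qed

end
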